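(* Let $M$ be a connected smooth manifold, let $(\mathcal{A},[\cdot,\cdot]_{\mathcal{A}},\rho)$ be a transitive Lie algebroid over $M$ with adjoint bundle $L=\mathrm{Ker}(\rho)$, and let $\mathfrak{L}:\mathcal{A}\to \mathcal{CDO}(F)$ be a representation of $\mathcal{A}$ on a vector bundle $F\to M$. Let $p:\widetilde{M}\to M$ be a universal covering, let $\widetilde{\mathcal{A}}=p^!\mathcal{A}$ and $\widetilde{F}=p^!F$ be the pull-back Lie algebroid and the pull-back vector bundle with the induced representation $\widetilde{\mathfrak{L}}$ of $\widetilde{\mathcal{A}}$ on $\widetilde F$, let $p^{1*}:H^1(\mathcal{A},F)\to H^1(\widetilde{\mathcal{A}},\widetilde{F})$ be the pull-back morphism, and let $\Upsilon^1_x:H^1(\mathcal{A},F)\to H^1(L_x,F_x)$ be the localization map at a point $x\in M$. Then for every $x\in M$ $$\mathrm{Ker}(\Upsilon_x^1)=\mathrm{Ker}(p^{1*}).$$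
   Context: A Lie algebroid $(\mathcal{A},[\cdot,\cdot]_{\mathcal{A}},\rho)$ over $M$ is a real vector bundle $\mathcal{A}\to M$ with a bundle map $\rho:\mathcal{A}\to TM$ (the anchor) and a real Lie bracket $[\cdot,\cdot]_{\mathcal{A}}$ on $\Gamma(\mathcal{A})$ such that $\rho:\Gamma(\mathcal{A})\to\mathcal{X}(M)$ is a Lie algebra morphism and $[A,fB]_{\mathcal{A}}=f[A,B]_{\mathcal{A}}+(\rho(A)f)B$ for $f\in C^\infty(M)$. It is transitive if $\rho$ is surjective; then $L=\mathrm{Ker}(\rho)$ is a bundle of Lie algebras, called the adjoint bundle. $\mathcal{CDO}(F)$ is the bundle of covariant differential operators of the vector bundle $F$: an element of $\mathcal{CDO}(F)_x$ is a linear operator $D_x:\Gamma(F)\to F_x$ for which there is a (unique) $X=\sigma(D_x)\in T_xM$ with $D_x(f\mu)=X(f)\mu(x)+f(x)D_x\mu$. It is a transitive Lie algebroid with anchor $\sigma$ and the commutator bracket. A representation of $\mathcal{A}$ on $F$ is a bundle map $\mathfrak{L}:\mathcal{A}\to\mathcal{CDO}(F)$, $A\mapsto \mathfrak{L}_A$, with $\sigma\circ\mathfrak{L}=\rho$ and $\mathfrak{L}_{[A,B]_{\mathcal{A}}}=\mathfrak{L}_A\circ\mathfrak{L}_B-\mathfrak{L}_B\circ\mathfrak{L}_A$ for $A,B\in\Gamma(\mathcal{A})$. $C^k(\mathcal{A},F)$ is the space of bundle maps $\wedge^k\mathcal{A}\to F$ ($C^0=\Gamma(F)$), with the usual Chevalley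 (Chevalley–Eilenberg) coboundary operator $\mathfrak{D}$ defined by $\mathfrak{L}$; $H^k(\mathcal{A},F)$ is its cohomology. In particular a 1-cocycle is a bundle map $\Omega:\mathcal{A}\to F$ with $\Omega([A,B]_{\mathcal{A}})=\mathfrak{L}_A(\Omega(B))-\mathfrak{L}_B(\Omega(A))$, and it is a coboundary if $\Omega=\mathfrak{D}\mu$, i.e. $\Omega(A)=\mathfrak{L}_A\mu$, for some $\mu\in\Gamma(F)$. For $x\in M$ the Lie algebra $L_x$ acts on $F_x$ by $\underline{\mathfrak{L}}_u(\mu)=\mathfrak{L}_u(\overline{\mu})$, where $\overline\mu$ is any local smooth extension of $\mu\in F_x$; $H^k(L_x,F_x)$ is the Lie algebra cohomology. The localization map $\Upsilon^k_x:H^k(\mathcal{A},F)\to H^k(L_x,F_x)$ is $[\Omega]\mapsto[\Omega|_{\wedge^kL_x}]$. For a covering map $p:\widetilde M\to M$, the pull-back bundle $\widetilde{\mathcal{A}}=p^!\mathcal{A}$ is a Lie algebroid over $\widetilde M$: its anchor sends $(z,A)$, with $A\in\mathcal{A}_{p(z)}$, to the unique $Z\in T_z\widetilde M$ with $p_*Z=\rho(A)$, and the bracket of pull-back sections is the pull-back of the bracket, extended by the Leibniz rule. The induced representation $\widetilde{\mathfrak{L}}$ on $\widetilde F=p^!F$ is determined by $\widetilde{\mathfrak{L}}_{(z,A)}(p^!\mu)=(z,\mathfrak{L}_A\mu)$ for $\mu\in\Gamma(F)$. The morphism $p^{k*}:H^k(\mathcal{A},F)\to H^k(\widetilde{\mathcal{A}},\widetilde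 F)$ is induced by pulling back cochains: $(p^{k*}\Omega)((z,A_1),\dots,(z,A_k))=(z,\Omega(A_1,\dots,A_k))$. *)

theory Defs
  imports "HOL-Analysis.Analysis" "HOL-Algebra.Coset"
begin

section \<open>Smooth maps and manifolds\<close>

text \<open>On an open subset \<open>S\<close> of a finite-dimensional space, \<open>Ck_on S f k\<close> says that \<open>f\<close> is of
  class \<open>C^k\<close>: all iterated directional derivatives of order at most \<open>k\<close> exist and are
  continuous.\<close>

primrec Ck_on ::
  "'e::real_normed_vector set \<Rightarrow> ('e \<Rightarrow> 'b::real_normed_vector) \<Rightarrow> nat \<Rightarrow> bool" where
  "Ck_on S f 0 \<longleftrightarrow> continuous_on S f"
| "Ck_on S f (Suc k) \<longleftrightarrow> (\<forall>x\<in>S. f differentiable (at x)) \<and>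
     (\<forall>v. Ck_on S (\<lambda>x. frechet_derivative f (at x) v) k)"

definition smooth_on ::
  "'e::real_normed_vector set \<Rightarrow> ('e \<Rightarrow> 'b::real_normed_vector) \<Rightarrow> bool" where
  "smooth_on S f \<longleftrightarrow> (\<forall>k. Ck_on S f k)"

text \<open>A chart is a pair of a domain and a coordinate map.  The points of the manifold are all
  elements of the type \<open>'m\<close> (Hausdorff and second countable in the theorem).  The model space
  is any finite-dimensional inner product space; \<open>euclidean_space\<close> is not used because it
  excludes dimension \<open>0\<close>.  The atlas need not be maximal.\<close>

type_synonym ('m, 'e) atlas = "('m set \<times> ('m \<Rightarrow> 'e)) set"

definition smooth_manifold ::
  "('m::{t2_space, second_countable_topology}, 'e::real_inner) atlas \<Rightarrow> bool" where
  "smooth_manifold M \<longleftrightarrow>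
     (\<exists>B :: 'e set. finite B \<and> span B = UNIV) \<and>
     (\<forall>(U, \<phi>)\<in>M. open U \<and> open (\<phi> ` U) \<and> homeomorphism U (\<phi> ` U) \<phi> (inv_into U \<phi>)) \<and>
     (\<Union>(U, \<phi>)\<in>M. U) = UNIV \<and>
     (\<forall>(U, \<phi>)\<in>M. \<forall>(V, \<psi>)\<in>M. smooth_on (\<phi> ` (U \<inter> V)) (\<psi> \<circ> inv_into U \<phi>))"

text \<open>The sets \<open>W\<close> below are meant to be open.\<close>

definition smooth_fun_on ::
  "('m, 'e::real_normed_vector) atlas \<Rightarrow> 'm set \<Rightarrow> ('m \<Rightarrow> real) \<Rightarrow> bool" where
  "smooth_fun_on M W f \<longleftrightarrow> (\<forall>(U, \<phi>)\<in>M. smooth_on (\<phi> ` (U \<inter> W)) (f \<circ> inv_into U \<phi>))"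

definition C_inf :: "('m, 'e::real_normed_vector) atlas \<Rightarrow> ('m \<Rightarrow> real) set" where
  "C_inf M = {f. smooth_fun_on M UNIV f}"

definition smooth_map_on ::
  "('m::topological_space, 'e::real_normed_vector) atlas \<Rightarrow>
   ('n::topological_space, 'd::real_normed_vector) atlas \<Rightarrow> 'm set \<Rightarrow> ('m \<Rightarrow> 'n) \<Rightarrow> bool" where
  "smooth_map_on M N W f \<longleftrightarrow> continuous_on W f \<and>
     (\<forall>(U, \<phi>)\<in>M. \<forall>(V, \<psi>)\<in>N.
        smooth_on (\<phi> ` (U \<inter> W \<inter> f -` V)) (\<psi> \<circ> f \<circ> inv_into U \<phi>))"

definition local_diffeomorphism ::
  "('m::topological_space, 'e::real_normed_vector) atlas \<Rightarrow>
   ('n::topological_space, 'd::real_normed_vector) atlas \<Rightarrow> ('m \<Rightarrow> 'n) \<Rightarrow> bool" where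
  "local_diffeomorphism M N f \<longleftrightarrow>
     (\<forall>z. \<exists>W g. z \<in> W \<and> open W \<and> open (f ` W) \<and> homeomorphism W (f ` W) f g \<and>
        smooth_map_on M N W f \<and> smooth_map_on N M (f ` W) g)"

definition universal_covering ::
  "('n::topological_space, 'd::real_normed_vector) atlas \<Rightarrow>
   ('m::topological_space, 'e::real_normed_vector) atlas \<Rightarrow> ('n \<Rightarrow> 'm) \<Rightarrow> bool" where
  "universal_covering N M p \<longleftrightarrow>
     covering_space UNIV p UNIV \<and> local_diffeomorphism N M p \<and> simply_connected (UNIV :: 'n set)"

text \<open>Tangent vectors at \<open>x\<close> are the derivations of \<open>C_inf M\<close> at \<open>x\<close>.  Operators on a space of
  functions or sections are functions on the whole type; they are normalised to vanish off
  that space, so that equality of operators is equality of functions.\<close>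

definition tangent_space ::
  "('m, 'e::real_normed_vector) atlas \<Rightarrow> 'm \<Rightarrow> (('m \<Rightarrow> real) \<Rightarrow> real) set" where
  "tangent_space M x = {X.
     (\<forall>f. f \<notin> C_inf M \<longrightarrow> X f = 0) \<and>
     (\<forall>f\<in>C_inf M. \<forall>g\<in>C_inf M. X (\<lambda>y. f y + g y) = X f + X g) \<and>
     (\<forall>c. \<forall>f\<in>C_inf M. X (\<lambda>y. c * f y) = c * X f) \<and>
     (\<forall>f\<in>C_inf M. \<forall>g\<in>C_inf M. X (\<lambda>y. f y * g y) = X f * g x + f x * X g)}"

definition push_forward ::
  "('m, 'e::real_normed_vector) atlas \<Rightarrow> ('n \<Rightarrow> 'm) \<Rightarrow>
   (('n \<Rightarrow> real) \<Rightarrow> real) \<Rightarrow> ('m \<Rightarrow> real) \<Rightarrow> real" where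
  "push_forward M p Z = (\<lambda>f. if f \<in> C_inf M then Z (f \<circ> p) else 0)"


section \<open>Vector bundles\<close>

text \<open>The fibre over \<open>x\<close> is a linear subspace of the real vector space \<open>'f\<close>.  This only serves to
  have all fibres in one type: no relation between different fibres is assumed, and any family
  of real vector spaces of dimension \<open>r\<close> can be presented in this way.  The total space is
  \<open>Sigma UNIV (fibre E)\<close>.  The smooth structure is given by local frames \<open>(U, e)\<close>,
  where \<open>e 0, \<dots>, e (r - 1)\<close> restrict to a basis of every fibre over \<open>U\<close>; equivalently, by local
  trivialisations over \<open>U\<close>.\<close>

record ('m, 'f) vector_bundle =
  fibre :: "'m \<Rightarrow> 'f set"
  bundle_rank :: nat
  local_frames :: "('m set \<times> (nat \<Rightarrow> 'm \<Rightarrow> 'f)) set"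

definition is_vector_bundle ::
  "('m::topological_space, 'e::real_normed_vector) atlas \<Rightarrow>
   ('m, 'f::real_vector, 'z) vector_bundle_scheme \<Rightarrow> bool" where
  "is_vector_bundle M E \<longleftrightarrow>
     (\<forall>x. subspace (fibre E x)) \<and>
     (\<Union>(U, e)\<in>local_frames E. U) = UNIV \<and>
     (\<forall>(U, e)\<in>local_frames E. open U \<and>
        (\<forall>x\<in>U. inj_on (\<lambda>i. e i x) {..<bundle_rank E} \<and>
           independent ((\<lambda>i. e i x) ` {..<bundle_rank E}) \<and>
           span ((\<lambda>i. e i x) ` {..<bundle_rank E}) = fibre E x)) \<and>
     (\<forall>(U, e)\<in>local_frames E. \<forall>(V, e')\<in>local_frames E. \<exists>g.
        (\<forall>i<bundle_rank E. \<forall>j<bundle_rank E. smooth_fun_on M (U \<inter> V) (g i j)) \<and>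
        (\<forall>x\<in>U \<inter> V. \<forall>i<bundle_rank E.
           e' i x = (\<Sum>j<bundle_rank E. g i j x *\<^sub>R e j x)))"

text \<open>The space of smooth sections.\<close>

definition sections ::
  "('m, 'e::real_normed_vector) atlas \<Rightarrow>
   ('m, 'f::real_vector, 'z) vector_bundle_scheme \<Rightarrow> ('m \<Rightarrow> 'f) set" where
  "sections M E = {s. (\<forall>x. s x \<in> fibre E x) \<and>
     (\<forall>(U, e)\<in>local_frames E. \<exists>c. (\<forall>i<bundle_rank E. smooth_fun_on M U (c i)) \<and>
        (\<forall>x\<in>U. s x = (\<Sum>i<bundle_rank E. c i x *\<^sub>R e i x)))}"

definition linear_between ::
  "'a::real_vector set \<Rightarrow> 'b::real_vector set \<Rightarrow> ('a \<Rightarrow> 'b) \<Rightarrow> bool" where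
  "linear_between V W h \<longleftrightarrow> (\<forall>u\<in>V. h u \<in> W) \<and>
     (\<forall>u\<in>V. \<forall>v\<in>V. h (u + v) = h u + h v) \<and> (\<forall>c. \<forall>u\<in>V. h (c *\<^sub>R u) = c *\<^sub>R h u)"


section \<open>Transitive Lie algebroids\<close>

record ('m, 'a) lie_algebroid = "('m, 'a) vector_bundle" +
  anchor :: "'m \<Rightarrow> 'a \<Rightarrow> ('m \<Rightarrow> real) \<Rightarrow> real"
  bracket :: "('m \<Rightarrow> 'a) \<Rightarrow> ('m \<Rightarrow> 'a) \<Rightarrow> 'm \<Rightarrow> 'a"

text \<open>\<open>is_anchor\<close>: a smooth bundle map into the tangent bundle, where smooth vector fields are those
  that map smooth functions to smooth functions.\<close>

definition is_anchor ::
  "('m, 'e::real_normed_vector) atlas \<Rightarrow> ('m, 'a::real_vector) lie_algebroid \<Rightarrow> bool" where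
  "is_anchor M A \<longleftrightarrow>
     (\<forall>x. \<forall>a\<in>fibre A x. anchor A x a \<in> tangent_space M x) \<and>
     (\<forall>x. \<forall>a\<in>fibre A x. \<forall>b\<in>fibre A x.
        anchor A x (a + b) = (\<lambda>f. anchor A x a f + anchor A x b f)) \<and>
     (\<forall>x c. \<forall>a\<in>fibre A x. anchor A x (c *\<^sub>R a) = (\<lambda>f. c * anchor A x a f)) \<and>
     (\<forall>s\<in>sections M A. \<forall>f\<in>C_inf M. (\<lambda>x. anchor A x (s x) f) \<in> C_inf M)"

definition is_lie_bracket ::
  "('m \<Rightarrow> 'a::real_vector) set \<Rightarrow> (('m \<Rightarrow> 'a) \<Rightarrow> ('m \<Rightarrow> 'a) \<Rightarrow> 'm \<Rightarrow> 'a) \<Rightarrow> bool" where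
  "is_lie_bracket S br \<longleftrightarrow>
     (\<forall>s\<in>S. \<forall>t\<in>S. br s t \<in> S) \<and>
     (\<forall>s\<in>S. \<forall>s'\<in>S. \<forall>t\<in>S. br (\<lambda>x. s x + s' x) t = (\<lambda>x. br s t x + br s' t x)) \<and>
     (\<forall>c. \<forall>s\<in>S. \<forall>t\<in>S. br (\<lambda>x. c *\<^sub>R s x) t = (\<lambda>x. c *\<^sub>R br s t x)) \<and>
     (\<forall>s\<in>S. \<forall>t\<in>S. br s t = (\<lambda>x. - br t s x)) \<and>
     (\<forall>s\<in>S. \<forall>t\<in>S. \<forall>u\<in>S. \<forall>x. br s (br t u) x + br t (br u s) x + br u (br s t) x = 0)"

definition is_lie_algebroid ::
  "('m::topological_space, 'e::real_normed_vector) atlas \<Rightarrow>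
   ('m, 'a::real_vector) lie_algebroid \<Rightarrow> bool" where
  "is_lie_algebroid M A \<longleftrightarrow>
     is_vector_bundle M A \<and> is_anchor M A \<and> is_lie_bracket (sections M A) (bracket A) \<and>
     (\<forall>s\<in>sections M A. \<forall>t\<in>sections M A. \<forall>f\<in>C_inf M. \<forall>x.
        anchor A x (bracket A s t x) f =
          anchor A x (s x) (\<lambda>y. anchor A y (t y) f) - anchor A x (t x) (\<lambda>y. anchor A y (s y) f)) \<and>
     (\<forall>s\<in>sections M A. \<forall>t\<in>sections M A. \<forall>f\<in>C_inf M. \<forall>x.
        bracket A s (\<lambda>y. f y *\<^sub>R t y) x =
          f x *\<^sub>R bracket A s t x + anchor A x (s x) f *\<^sub>R t x)"

definition transitive ::
  "('m, 'e::real_normed_vector) atlas \<Rightarrow> ('m, 'a) lie_algebroid \<Rightarrow> bool" where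
  "transitive M A \<longleftrightarrow> (\<forall>x. anchor A x ` fibre A x = tangent_space M x)"

text \<open>The adjoint bundle \<open>L = Ker \<rho>\<close>, fibrewise, with the bracket of the Lie algebra \<open>L\<^sub>x\<close> computed
  from arbitrary extensions to smooth sections.\<close>

definition adjoint_fibre :: "('m, 'a) lie_algebroid \<Rightarrow> 'm \<Rightarrow> 'a set" where
  "adjoint_fibre A x = {u \<in> fibre A x. anchor A x u = (\<lambda>f. 0)}"

definition adjoint_bracket ::
  "('m, 'e::real_normed_vector) atlas \<Rightarrow> ('m, 'a::real_vector) lie_algebroid \<Rightarrow>
   'm \<Rightarrow> 'a \<Rightarrow> 'a \<Rightarrow> 'a" where
  "adjoint_bracket M A x u v =
     (THE w. \<exists>s\<in>sections M A. \<exists>t\<in>sections M A. s x = u \<and> t x = v \<and> w = bracket A s t x)"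


section \<open>Covariant differential operators and representations\<close>

text \<open>\<open>D\<close> has symbol \<open>X\<close>.  This is a relation rather than a function of \<open>D\<close> because in rank \<open>0\<close>
  the symbol is not determined by \<open>D\<close>.\<close>

definition has_symbol ::
  "('m, 'e::real_normed_vector) atlas \<Rightarrow> ('m, 'f::real_vector) vector_bundle \<Rightarrow> 'm \<Rightarrow>
   (('m \<Rightarrow> 'f) \<Rightarrow> 'f) \<Rightarrow> (('m \<Rightarrow> real) \<Rightarrow> real) \<Rightarrow> bool" where
  "has_symbol M F x D X \<longleftrightarrow> X \<in> tangent_space M x \<and>
     (\<forall>f\<in>C_inf M. \<forall>\<mu>\<in>sections M F. D (\<lambda>y. f y *\<^sub>R \<mu> y) = X f *\<^sub>R \<mu> x + f x *\<^sub>R D \<mu>)"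

definition CDO ::
  "('m, 'e::real_normed_vector) atlas \<Rightarrow> ('m, 'f::real_vector) vector_bundle \<Rightarrow> 'm \<Rightarrow>
   (('m \<Rightarrow> 'f) \<Rightarrow> 'f) set" where
  "CDO M F x = {D.
     (\<forall>\<mu>. \<mu> \<notin> sections M F \<longrightarrow> D \<mu> = 0) \<and>
     (\<forall>\<mu>\<in>sections M F. D \<mu> \<in> fibre F x) \<and>
     (\<forall>\<mu>\<in>sections M F. \<forall>\<nu>\<in>sections M F. D (\<lambda>y. \<mu> y + \<nu> y) = D \<mu> + D \<nu>) \<and>
     (\<forall>c. \<forall>\<mu>\<in>sections M F. D (\<lambda>y. c *\<^sub>R \<mu> y) = c *\<^sub>R D \<mu>) \<and>
     (\<exists>X. has_symbol M F x D X)}"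

text \<open>\<open>L x a\<close> is the operator \<open>\<LL>\<^sub>a \<in> CDO(F)\<^sub>x\<close> for \<open>a\<close> in the fibre of \<open>A\<close> over \<open>x\<close>.  Smoothness of the
  bundle map is preservation of smooth sections, the smooth sections of \<open>CDO(F)\<close> being the
  covariant differential operators on \<open>\<Gamma>(F)\<close>.\<close>

definition is_representation ::
  "('m, 'e::real_normed_vector) atlas \<Rightarrow> ('m, 'a::real_vector) lie_algebroid \<Rightarrow>
   ('m, 'f::real_vector) vector_bundle \<Rightarrow> ('m \<Rightarrow> 'a \<Rightarrow> ('m \<Rightarrow> 'f) \<Rightarrow> 'f) \<Rightarrow> bool" where
  "is_representation M A F L \<longleftrightarrow>
     (\<forall>x. \<forall>a\<in>fibre A x. L x a \<in> CDO M F x \<and> has_symbol M F x (L x a) (anchor A x a)) \<and>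
     (\<forall>x. \<forall>a\<in>fibre A x. \<forall>b\<in>fibre A x. L x (a + b) = (\<lambda>\<mu>. L x a \<mu> + L x b \<mu>)) \<and>
     (\<forall>x c. \<forall>a\<in>fibre A x. L x (c *\<^sub>R a) = (\<lambda>\<mu>. c *\<^sub>R L x a \<mu>)) \<and>
     (\<forall>s\<in>sections M A. \<forall>\<mu>\<in>sections M F. (\<lambda>x. L x (s x) \<mu>) \<in> sections M F) \<and>
     (\<forall>s\<in>sections M A. \<forall>t\<in>sections M A. \<forall>\<mu>\<in>sections M F. \<forall>x.
        L x (bracket A s t x) \<mu> =
          L x (s x) (\<lambda>y. L y (t y) \<mu>) - L x (t x) (\<lambda>y. L y (s y) \<mu>))"

definition adjoint_action ::
  "('m, 'e::real_normed_vector) atlas \<Rightarrow> ('m, 'f::real_vector) vector_bundle \<Rightarrow>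
   ('m \<Rightarrow> 'a \<Rightarrow> ('m \<Rightarrow> 'f) \<Rightarrow> 'f) \<Rightarrow> 'm \<Rightarrow> 'a \<Rightarrow> 'f \<Rightarrow> 'f" where
  "adjoint_action M F L x u m = (THE w. \<exists>\<mu>\<in>sections M F. \<mu> x = m \<and> w = L x u \<mu>)"


section \<open>First cohomology\<close>

text \<open>Cochains are normalised to vanish outside the fibres of \<open>A\<close>.  Cohomology spaces are
  quotients of additive groups; their elements are cosets of the group of coboundaries.\<close>

definition cochains1 ::
  "('m, 'e::real_normed_vector) atlas \<Rightarrow> ('m, 'a::real_vector) lie_algebroid \<Rightarrow>
   ('m, 'f::real_vector) vector_bundle \<Rightarrow> ('m \<Rightarrow> 'a \<Rightarrow> 'f) set" where
  "cochains1 M A F = {\<Omega>.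
     (\<forall>x. linear_between (fibre A x) (fibre F x) (\<Omega> x)) \<and>
     (\<forall>x a. a \<notin> fibre A x \<longrightarrow> \<Omega> x a = 0) \<and>
     (\<forall>s\<in>sections M A. (\<lambda>x. \<Omega> x (s x)) \<in> sections M F)}"

definition cocycles1 ::
  "('m, 'e::real_normed_vector) atlas \<Rightarrow> ('m, 'a::real_vector) lie_algebroid \<Rightarrow>
   ('m, 'f::real_vector) vector_bundle \<Rightarrow> ('m \<Rightarrow> 'a \<Rightarrow> ('m \<Rightarrow> 'f) \<Rightarrow> 'f) \<Rightarrow>
   ('m \<Rightarrow> 'a \<Rightarrow> 'f) set" where
  "cocycles1 M A F L = {\<Omega> \<in> cochains1 M A F.
     \<forall>s\<in>sections M A. \<forall>t\<in>sections M A. \<forall>x.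
       \<Omega> x (bracket A s t x) = L x (s x) (\<lambda>y. \<Omega> y (t y)) - L x (t x) (\<lambda>y. \<Omega> y (s y))}"

definition coboundaries1 ::
  "('m, 'e::real_normed_vector) atlas \<Rightarrow> ('m, 'a) lie_algebroid \<Rightarrow>
   ('m, 'f::real_vector) vector_bundle \<Rightarrow> ('m \<Rightarrow> 'a \<Rightarrow> ('m \<Rightarrow> 'f) \<Rightarrow> 'f) \<Rightarrow>
   ('m \<Rightarrow> 'a \<Rightarrow> 'f) set" where
  "coboundaries1 M A F L =
     (\<lambda>\<mu> x a. if a \<in> fibre A x then L x a \<mu> else 0) ` sections M F"

definition cocycle_group ::
  "('m, 'e::real_normed_vector) atlas \<Rightarrow> ('m, 'a::real_vector) lie_algebroid \<Rightarrow>
   ('m, 'f::real_vector) vector_bundle \<Rightarrow> ('m \<Rightarrow> 'a \<Rightarrow> ('m \<Rightarrow> 'f) \<Rightarrow> 'f) \<Rightarrow>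
   ('m \<Rightarrow> 'a \<Rightarrow> 'f) monoid" where
  "cocycle_group M A F L = \<lparr>carrier = cocycles1 M A F L,
     mult = (\<lambda>\<Omega> \<Omega>' x a. \<Omega> x a + \<Omega>' x a), one = (\<lambda>x a. 0)\<rparr>"

definition cohomology1 ::
  "('m, 'e::real_normed_vector) atlas \<Rightarrow> ('m, 'a::real_vector) lie_algebroid \<Rightarrow>
   ('m, 'f::real_vector) vector_bundle \<Rightarrow> ('m \<Rightarrow> 'a \<Rightarrow> ('m \<Rightarrow> 'f) \<Rightarrow> 'f) \<Rightarrow>
   ('m \<Rightarrow> 'a \<Rightarrow> 'f) set monoid" where
  "cohomology1 M A F L = cocycle_group M A F L Mod coboundaries1 M A F L"

definition cohomology_class ::
  "('m, 'e::real_normed_vector) atlas \<Rightarrow> ('m, 'a::real_vector) lie_algebroid \<Rightarrow>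
   ('m, 'f::real_vector) vector_bundle \<Rightarrow> ('m \<Rightarrow> 'a \<Rightarrow> ('m \<Rightarrow> 'f) \<Rightarrow> 'f) \<Rightarrow>
   ('m \<Rightarrow> 'a \<Rightarrow> 'f) \<Rightarrow> ('m \<Rightarrow> 'a \<Rightarrow> 'f) set" where
  "cohomology_class M A F L \<Omega> = coboundaries1 M A F L #>\<^bsub>cocycle_group M A F L\<^esub> \<Omega>"

text \<open>Cohomology of a Lie algebra \<open>(\<gg>, br)\<close> with values in the module \<open>(V, act)\<close>.\<close>

definition lie_cocycle_group ::
  "'g::real_vector set \<Rightarrow> ('g \<Rightarrow> 'g \<Rightarrow> 'g) \<Rightarrow> 'v::real_vector set \<Rightarrow> ('g \<Rightarrow> 'v \<Rightarrow> 'v) \<Rightarrow>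
   ('g \<Rightarrow> 'v) monoid" where
  "lie_cocycle_group \<gg> br V act =
     \<lparr>carrier = {\<omega>. linear_between \<gg> V \<omega> \<and> (\<forall>u. u \<notin> \<gg> \<longrightarrow> \<omega> u = 0) \<and>
        (\<forall>u\<in>\<gg>. \<forall>v\<in>\<gg>. \<omega> (br u v) = act u (\<omega> v) - act v (\<omega> u))},
      mult = (\<lambda>\<omega> \<omega>' u. \<omega> u + \<omega>' u), one = (\<lambda>u. 0)\<rparr>"

definition lie_coboundaries1 ::
  "'g set \<Rightarrow> 'v::real_vector set \<Rightarrow> ('g \<Rightarrow> 'v \<Rightarrow> 'v) \<Rightarrow> ('g \<Rightarrow> 'v) set" where
  "lie_coboundaries1 \<gg> V act = (\<lambda>m u. if u \<in> \<gg> then act u m else 0) ` V"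

definition lie_cohomology1 ::
  "'g::real_vector set \<Rightarrow> ('g \<Rightarrow> 'g \<Rightarrow> 'g) \<Rightarrow> 'v::real_vector set \<Rightarrow> ('g \<Rightarrow> 'v \<Rightarrow> 'v) \<Rightarrow>
   ('g \<Rightarrow> 'v) set monoid" where
  "lie_cohomology1 \<gg> br V act = lie_cocycle_group \<gg> br V act Mod lie_coboundaries1 \<gg> V act"

definition lie_cohomology_class ::
  "'g::real_vector set \<Rightarrow> ('g \<Rightarrow> 'g \<Rightarrow> 'g) \<Rightarrow> 'v::real_vector set \<Rightarrow> ('g \<Rightarrow> 'v \<Rightarrow> 'v) \<Rightarrow>
   ('g \<Rightarrow> 'v) \<Rightarrow> ('g \<Rightarrow> 'v) set" where
  "lie_cohomology_class \<gg> br V act \<omega> =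
     lie_coboundaries1 \<gg> V act #>\<^bsub>lie_cocycle_group \<gg> br V act\<^esub> \<omega>"

text \<open>\<open>H\<^sup>1(L\<^sub>x, F\<^sub>x)\<close> and the localization map \<open>\<Upsilon>\<^sup>1\<^sub>x\<close>.  The union over the representatives \<open>\<Omega>\<close> of a class
  is a union of equal sets, namely the class of any restriction.\<close>

definition adjoint_cohomology1 ::
  "('m, 'e::real_normed_vector) atlas \<Rightarrow> ('m, 'a::real_vector) lie_algebroid \<Rightarrow>
   ('m, 'f::real_vector) vector_bundle \<Rightarrow> ('m \<Rightarrow> 'a \<Rightarrow> ('m \<Rightarrow> 'f) \<Rightarrow> 'f) \<Rightarrow> 'm \<Rightarrow>
   ('a \<Rightarrow> 'f) set monoid" where
  "adjoint_cohomology1 M A F L x = lie_cohomology1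
     (adjoint_fibre A x) (adjoint_bracket M A x) (fibre F x) (adjoint_action M F L x)"

definition restrict_cochain ::
  "('m, 'a) lie_algebroid \<Rightarrow> 'm \<Rightarrow> ('m \<Rightarrow> 'a \<Rightarrow> 'f::real_vector) \<Rightarrow> 'a \<Rightarrow> 'f" where
  "restrict_cochain A x \<Omega> = (\<lambda>u. if u \<in> adjoint_fibre A x then \<Omega> x u else 0)"

definition localization1 ::
  "('m, 'e::real_normed_vector) atlas \<Rightarrow> ('m, 'a::real_vector) lie_algebroid \<Rightarrow>
   ('m, 'f::real_vector) vector_bundle \<Rightarrow> ('m \<Rightarrow> 'a \<Rightarrow> ('m \<Rightarrow> 'f) \<Rightarrow> 'f) \<Rightarrow> 'm \<Rightarrow>
   ('m \<Rightarrow> 'a \<Rightarrow> 'f) set \<Rightarrow> ('a \<Rightarrow> 'f) set" where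
  "localization1 M A F L x c = (\<Union>\<Omega>\<in>c. lie_cohomology_class
     (adjoint_fibre A x) (adjoint_bracket M A x) (fibre F x) (adjoint_action M F L x)
     (restrict_cochain A x \<Omega>))"


section \<open>Pull-back along a covering\<close>

text \<open>In all pull-backs along \<open>p\<close>, the point \<open>(z, a)\<close> of the pull-back bundle, with \<open>a\<close> in the
  fibre over \<open>p z\<close>, is represented by \<open>a\<close> in the fibre over \<open>z\<close>; the pull-back of a section \<open>s\<close>
  is \<open>s \<circ> p\<close>.\<close>

definition pullback_bundle ::
  "('n \<Rightarrow> 'm) \<Rightarrow> ('m, 'f) vector_bundle \<Rightarrow> ('n, 'f) vector_bundle" where
  "pullback_bundle p E =
     \<lparr>fibre = (\<lambda>z. fibre E (p z)), bundle_rank = bundle_rank E,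
      local_frames = (\<lambda>(U, e). (p -` U, \<lambda>i. e i \<circ> p)) ` local_frames E\<rparr>"

definition pullback_anchor ::
  "('n, 'd::real_normed_vector) atlas \<Rightarrow> ('m, 'e::real_normed_vector) atlas \<Rightarrow> ('n \<Rightarrow> 'm) \<Rightarrow>
   ('m, 'a) lie_algebroid \<Rightarrow> 'n \<Rightarrow> 'a \<Rightarrow> ('n \<Rightarrow> real) \<Rightarrow> real" where
  "pullback_anchor N M p A z a =
     (THE Z. Z \<in> tangent_space N z \<and> push_forward M p Z = anchor A (p z) a)"

definition pullback_with_bracket ::
  "('n, 'd::real_normed_vector) atlas \<Rightarrow> ('m, 'e::real_normed_vector) atlas \<Rightarrow> ('n \<Rightarrow> 'm) \<Rightarrow>
   ('m, 'a) lie_algebroid \<Rightarrow> (('n \<Rightarrow> 'a) \<Rightarrow> ('n \<Rightarrow> 'a) \<Rightarrow> 'n \<Rightarrow> 'a) \<Rightarrow>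
   ('n, 'a) lie_algebroid" where
  "pullback_with_bracket N M p A br =
     vector_bundle.extend (pullback_bundle p (vector_bundle.truncate A))
       \<lparr>anchor = pullback_anchor N M p A, bracket = br\<rparr>"

text \<open>The bracket on the pull-back is the one that satisfies the Lie algebroid axioms (in
  particular the Leibniz rule) and extends the bracket of pull-back sections.  It is normalised
  to vanish outside the smooth sections.\<close>

definition pullback_bracket ::
  "('n::topological_space, 'd::real_normed_vector) atlas \<Rightarrow>
   ('m, 'e::real_normed_vector) atlas \<Rightarrow> ('n \<Rightarrow> 'm) \<Rightarrow>
   ('m, 'a::real_vector) lie_algebroid \<Rightarrow> ('n \<Rightarrow> 'a) \<Rightarrow> ('n \<Rightarrow> 'a) \<Rightarrow> 'n \<Rightarrow> 'a" where
  "pullback_bracket N M p A = (THE br.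
     is_lie_algebroid N (pullback_with_bracket N M p A br) \<and>
     (\<forall>s\<in>sections M A. \<forall>t\<in>sections M A. br (s \<circ> p) (t \<circ> p) = bracket A s t \<circ> p) \<and>
     (\<forall>s t. s \<notin> sections N (pullback_with_bracket N M p A br) \<or>
            t \<notin> sections N (pullback_with_bracket N M p A br) \<longrightarrow> br s t = (\<lambda>z. 0)))"

definition pullback_algebroid ::
  "('n::topological_space, 'd::real_normed_vector) atlas \<Rightarrow>
   ('m, 'e::real_normed_vector) atlas \<Rightarrow> ('n \<Rightarrow> 'm) \<Rightarrow>
   ('m, 'a::real_vector) lie_algebroid \<Rightarrow> ('n, 'a) lie_algebroid" where
  "pullback_algebroid N M p A = pullback_with_bracket N M p A (pullback_bracket N M p A)"

definition pullback_representation ::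
  "('n, 'd::real_normed_vector) atlas \<Rightarrow> ('m, 'e::real_normed_vector) atlas \<Rightarrow> ('n \<Rightarrow> 'm) \<Rightarrow>
   ('m, 'a) lie_algebroid \<Rightarrow> ('m, 'f::real_vector) vector_bundle \<Rightarrow>
   ('m \<Rightarrow> 'a \<Rightarrow> ('m \<Rightarrow> 'f) \<Rightarrow> 'f) \<Rightarrow> 'n \<Rightarrow> 'a \<Rightarrow> ('n \<Rightarrow> 'f) \<Rightarrow> 'f" where
  "pullback_representation N M p A F L z a = (THE D.
     D \<in> CDO N (pullback_bundle p F) z \<and>
     has_symbol N (pullback_bundle p F) z D (pullback_anchor N M p A z a) \<and>
     (\<forall>\<mu>\<in>sections M F. D (\<mu> \<circ> p) = L (p z) a \<mu>))"

definition pullback_cochain :: "('n \<Rightarrow> 'm) \<Rightarrow> ('m \<Rightarrow> 'a \<Rightarrow> 'f) \<Rightarrow> 'n \<Rightarrow> 'a \<Rightarrow> 'f" where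
  "pullback_cochain p \<Omega> = (\<lambda>z a. \<Omega> (p z) a)"

definition pullback_cohomology1 ::
  "('n::topological_space, 'd::real_normed_vector) atlas \<Rightarrow>
   ('m, 'e::real_normed_vector) atlas \<Rightarrow> ('n \<Rightarrow> 'm) \<Rightarrow>
   ('m, 'a::real_vector) lie_algebroid \<Rightarrow> ('m, 'f::real_vector) vector_bundle \<Rightarrow>
   ('m \<Rightarrow> 'a \<Rightarrow> ('m \<Rightarrow> 'f) \<Rightarrow> 'f) \<Rightarrow> ('m \<Rightarrow> 'a \<Rightarrow> 'f) set \<Rightarrow> ('n \<Rightarrow> 'a \<Rightarrow> 'f) set" where
  "pullback_cohomology1 N M p A F L c = (\<Union>\<Omega>\<in>c. cohomology_class N
     (pullback_algebroid N M p A) (pullback_bundle p F) (pullback_representation N M p A F L)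
     (pullback_cochain p \<Omega>))"

end

theory Submission imports Defs begin

text \<open>Solutions \<open>\<mu>\<close> of \<open>L\<^sub>a \<mu> = \<Omega>(a)\<close> form a local system whose possible values at \<open>x\<close>
  are exactly the primitives of \<open>\<Omega>\<close> restricted to the isotropy algebra at \<open>x\<close>. To extend such a
  primitive \<open>m\<close> to a solution near \<open>x\<close>, let \<open>r\<close> be a section of the algebroid lifting the radial
  vector field at \<open>x\<close> and solve \<open>L\<^sub>r \<mu> = \<Omega>(r)\<close>, \<open>\<mu>(x) = m\<close>, which is a linear differential
  equation along the rays. The cocycle \<open>\<Psi>(a) = L\<^sub>a \<mu> - \<Omega>(a)\<close> is killed by \<open>r\<close> and by the isotropy
  algebra at \<open>x\<close>, and the cocycle identity \<open>L\<^sub>r (\<Psi>(a)) = \<Psi>([r, a])\<close> is a homogeneous linear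
  equation along the rays that forces \<open>\<Psi> = 0\<close>. The same uniqueness argument shows that solutions
  agreeing at one point agree nearby. Pulled back to the simply connected covering, the local system
  is trivial, so \<open>m\<close> extends to a global primitive of the pulled back cocycle. Conversely the value
  at a point over \<open>x\<close> of a global primitive upstairs is a primitive on the isotropy algebra, since
  an operator with vanishing symbol acts on the fibre.\<close>

section \<open>Calculus of \<open>C\<^sup>k\<close> maps\<close>

text \<open>The radial section vanishes at its centre, so along a ray with parameter
  \<open>t\<close> every equation has leading term \<open>t * d/dt\<close>, singular at 0. For
  values on the adjoint bundle the right-hand side also carries a factor \<open>t\<close>, which
  cancels. For a lift \<open>s\<close> of a coordinate field the bracket with the radial section is
  \<open>- s\<close> plus a field in the adjoint bundle, so a term \<open>- y\<close> remains;
  passing to \<open>t * y\<close> absorbs it. Hence the exponent \<open>m\<close> in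
  \<open>radial_vanish\<close>, and hence the adjoint bundle is treated before the lifts. A local
  system needs neighbourhoods over which solutions extend from each of their points, so the centre
  ranges over a whole ball and the estimates are uniform in it. Smooth dependence of a solution on
  the end point of the ray comes from functional analysis: the integral equation lives in a Banach
  space of bounded continuous functions, its solution operator is a resolvent, and resolvents
  inherit smoothness. Fibres carry no topology, so all analysis is done on coefficients in local
  frames; cut-offs make frames and coefficients global, because derivations and operators act on
  global objects.\<close>

lemma frechet_derivative_cong_open:
  assumes "open S" "x \<in> S" "\<And>y. y \<in> S \<Longrightarrow> f y = g y"
  shows "frechet_derivative f (at x) = frechet_derivative g (at x)"
proof -
  have "(f has_derivative D) (at x) \<longleftrightarrow> (g has_derivative D) (at x)" for D
    using assms has_derivative_transform_within_open by metis
  then show ?thesis unfolding frechet_derivative_def by simp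
qed

lemma Ck_on_cong:
  assumes "open S" "\<And>y. y \<in> S \<Longrightarrow> f y = g y"
  shows "Ck_on S f k \<longleftrightarrow> Ck_on S g k"
  using assms(2)
proof (induction k arbitrary: f g)
  case 0
  then show ?case using continuous_on_cong by auto
next
  case (Suc k)
  have "f differentiable (at x) \<longleftrightarrow> g differentiable (at x)" if "x \<in> S" for x
    unfolding differentiable_def
    using that assms(1) Suc.prems has_derivative_transform_within_open by metis
  moreover have "Ck_on S (\<lambda>x. frechet_derivative f (at x) v) k \<longleftrightarrow>
      Ck_on S (\<lambda>x. frechet_derivative g (at x) v) k" for v
    by (rule Suc.IH) (metis assms(1) Suc.prems frechet_derivative_cong_open)
  ultimately show ?case by simp
qed

lemma Ck_on_subset: "Ck_on S f k \<Longrightarrow> T \<subseteq> S \<Longrightarrow> Ck_on T f k"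
  by (induction k arbitrary: f) (auto intro: continuous_on_subset)

lemma Ck_on_SucD: "Ck_on S f (Suc k) \<Longrightarrow> Ck_on S f k"
proof (induction k arbitrary: f)
  case 0
  then show ?case
    by (auto intro!: differentiable_imp_continuous_on simp: differentiable_on_def
        differentiable_at_withinI)
qed auto

lemma Ck_on_continuous: "Ck_on S f k \<Longrightarrow> continuous_on S f"
proof (induction k)
  case (Suc k)
  then show ?case by (blast dest: Ck_on_SucD)
qed simp

lemma Ck_on_local:
  assumes "\<And>x. x \<in> S \<Longrightarrow> \<exists>T. open T \<and> x \<in> T \<and> Ck_on T f k"
  shows "Ck_on S f k"
  using assms
proof (induction k arbitrary: f)
  case 0
  then have "\<forall>x\<in>S. isCont f x"
    by (metis Ck_on.simps(1) continuous_on_eq_continuous_at)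
  then show ?case by (simp add: continuous_at_imp_continuous_on)
next
  case (Suc k)
  have "f differentiable (at x)" if "x \<in> S" for x
    using Suc.prems[OF that] by auto
  moreover have "Ck_on S (\<lambda>x. frechet_derivative f (at x) v) k" for v
  proof (rule Suc.IH)
    fix x assume "x \<in> S"
    from Suc.prems[OF this] show "\<exists>T. open T \<and> x \<in> T \<and> Ck_on T (\<lambda>x. frechet_derivative f (at x) v) k"
      by auto
  qed
  ultimately show ?case by simp
qed

text \<open>The recursion of \<open>Ck_on\<close> runs through \<open>frechet_derivative\<close>.
  Together with \<open>Ck_on_SucE\<close> this rule lets inductions on the order use any convenient
  family of derivatives; openness of \<open>S\<close> makes it the canonical one.\<close>

lemma Ck_on_SucI:
  assumes "open S" "\<And>x. x \<in> S \<Longrightarrow> (f has_derivative f' x) (at x)"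
    "\<And>v. Ck_on S (\<lambda>x. f' x v) k"
  shows "Ck_on S f (Suc k)"
proof -
  have "frechet_derivative f (at x) = f' x" if "x \<in> S" for x
    using assms(2)[OF that] frechet_derivative_at by metis
  then have "Ck_on S (\<lambda>x. frechet_derivative f (at x) v) k" for v
    using assms(1,3) Ck_on_cong[of S "\<lambda>x. frechet_derivative f (at x) v" "\<lambda>x. f' x v"] by simp
  then show ?thesis using assms(2) by (auto simp: differentiable_def)
qed

lemma Ck_on_SucE:
  assumes "Ck_on S f (Suc k)"
  obtains f' where "\<And>x. x \<in> S \<Longrightarrow> (f has_derivative f' x) (at x)"
    "\<And>v. Ck_on S (\<lambda>x. f' x v) k"
  using that[of "\<lambda>x. frechet_derivative f (at x)"] assms
  by (simp add: frechet_derivative_works)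

lemma Ck_on_const: "open S \<Longrightarrow> Ck_on S (\<lambda>x. c) k"
proof (induction k arbitrary: c)
  case (Suc k)
  show ?case
    by (rule Ck_on_SucI[where f' = "\<lambda>x v. 0"]) (use Suc in auto)
qed simp

lemma Ck_on_bounded_linear:
  assumes "open S" "bounded_linear h"
  shows "Ck_on S f k \<Longrightarrow> Ck_on S (\<lambda>x. h (f x)) k"
proof (induction k arbitrary: f)
  case 0
  then show ?case using bounded_linear.continuous_on[OF assms(2)] by simp
next
  case (Suc k)
  from Suc.prems obtain f' where f': "\<And>x. x \<in> S \<Longrightarrow> (f has_derivative f' x) (at x)"
    "\<And>v. Ck_on S (\<lambda>x. f' x v) k" by (rule Ck_on_SucE) blast
  show ?case
    by (rule Ck_on_SucI[OF assms(1), where f' = "\<lambda>x v. h (f' x v)"])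
      (use f' Suc.IH in \<open>auto intro!: bounded_linear.has_derivative[OF assms(2)]\<close>)
qed

lemma Ck_on_ident: "open S \<Longrightarrow> Ck_on S (\<lambda>x. x) k"
  by (cases k) (auto intro!: Ck_on_SucI Ck_on_const)

lemma Ck_on_add:
  assumes "open S"
  shows "Ck_on S f k \<Longrightarrow> Ck_on S g k \<Longrightarrow> Ck_on S (\<lambda>x. f x + g x) k"
proof (induction k arbitrary: f g)
  case 0
  then show ?case by (auto intro: continuous_on_add)
next
  case (Suc k)
  from Suc.prems obtain f' g' where f': "\<And>x. x \<in> S \<Longrightarrow> (f has_derivative f' x) (at x)"
    "\<And>v. Ck_on S (\<lambda>x. f' x v) k" and g': "\<And>x. x \<in> S \<Longrightarrow> (g has_derivative g' x) (at x)"
    "\<And>v. Ck_on S (\<lambda>x. g' x v) k" by (metis Ck_on_SucE)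
  show ?case
    by (rule Ck_on_SucI[OF assms, where f' = "\<lambda>x v. f' x v + g' x v"])
      (use f' g' Suc.IH in \<open>auto intro: has_derivative_add\<close>)
qed

lemma Ck_on_sum:
  assumes "open S" "finite I" "\<And>i. i \<in> I \<Longrightarrow> Ck_on S (f i) k"
  shows "Ck_on S (\<lambda>x. \<Sum>i\<in>I. f i x) k"
  using assms(2,3) by (induction I) (auto intro: Ck_on_add Ck_on_const assms(1))

lemma Ck_on_bilinear:
  assumes "open S" "bounded_bilinear h"
  shows "Ck_on S f k \<Longrightarrow> Ck_on S g k \<Longrightarrow> Ck_on S (\<lambda>x. h (f x) (g x)) k"
proof (induction k arbitrary: f g)
  case 0
  then show ?case using bounded_bilinear.continuous_on[OF assms(2)] by auto
next
  case (Suc k)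
  from Suc.prems obtain f' g' where f': "\<And>x. x \<in> S \<Longrightarrow> (f has_derivative f' x) (at x)"
    "\<And>v. Ck_on S (\<lambda>x. f' x v) k" and g': "\<And>x. x \<in> S \<Longrightarrow> (g has_derivative g' x) (at x)"
    "\<And>v. Ck_on S (\<lambda>x. g' x v) k" by (metis Ck_on_SucE)
  show ?case
    by (rule Ck_on_SucI[OF assms(1), where f' = "\<lambda>x v. h (f x) (g' x v) + h (f' x v) (g x)"])
      (use f' g' Suc.IH Suc.prems in \<open>auto intro!: Ck_on_add assms(1)
          bounded_bilinear.FDERIV[OF assms(2)] simp del: Ck_on.simps dest: Ck_on_SucD\<close>)
qed

lemmas Ck_on_mult = Ck_on_bilinear[OF _ bounded_bilinear_mult]
  and Ck_on_scaleR = Ck_on_bilinear[OF _ bounded_bilinear_scaleR]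

text \<open>The model space is only known to have a finite spanning set; an orthonormal family
  \<open>b 0, \<dots>, b (n - 1)\<close> spanning it plays the role of \<open>Basis\<close>.\<close>

locale orthonormal_frame =
  fixes b :: "nat \<Rightarrow> 'e::real_inner" and n :: nat
  assumes inner_b: "i < n \<Longrightarrow> j < n \<Longrightarrow> b i \<bullet> b j = (if i = j then 1 else 0)"
    and expand: "x = (\<Sum>i<n. (x \<bullet> b i) *\<^sub>R b i)"
begin

lemma norm_b: "i < n \<Longrightarrow> norm (b i) = 1"
  using inner_b[of i i] by (simp add: norm_eq_sqrt_inner)

lemma abs_coord_le: "i < n \<Longrightarrow> \<bar>x \<bullet> b i\<bar> \<le> norm x"
  using Cauchy_Schwarz_ineq2[of x "b i"] norm_b by simp

lemma linear_expand:
  assumes "linear h" shows "h x = (\<Sum>i<n. (x \<bullet> b i) *\<^sub>R h (b i))"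
  by (subst expand[of x]) (simp add: linear_sum[OF assms] linear_scale[OF assms])

text \<open>The induction hypothesis speaks of directional derivatives in fixed directions, whereas
  the chain rule differentiates \<open>g\<close> in the moving direction \<open>f' x v\<close>.
  Expanding that vector in the frame gives a finite sum of scalar functions times derivatives of
  \<open>g\<close> in the directions \<open>b i\<close>.\<close>

lemma Ck_on_compose:
  fixes f :: "'d::real_normed_vector \<Rightarrow> 'e"
  assumes "open S" "open T"
  shows "f ` S \<subseteq> T \<Longrightarrow> Ck_on S f k \<Longrightarrow> Ck_on T g k \<Longrightarrow> Ck_on S (\<lambda>x. g (f x)) k"
proof (induction k arbitrary: g)
  case 0
  then show ?case by (auto intro: continuous_on_compose2)
next
  case (Suc k)
  from Suc.prems obtain f' g' where f': "\<And>x. x \<in> S \<Longrightarrow> (f has_derivative f' x) (at x)"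
    "\<And>v. Ck_on S (\<lambda>x. f' x v) k" and g': "\<And>x. x \<in> T \<Longrightarrow> (g has_derivative g' x) (at x)"
    "\<And>v. Ck_on T (\<lambda>x. g' x v) k" by (metis Ck_on_SucE)
  let ?D = "\<lambda>x v. \<Sum>i<n. (f' x v \<bullet> b i) *\<^sub>R g' (f x) (b i)"
  have "((\<lambda>x. g (f x)) has_derivative ?D x) (at x)" if "x \<in> S" for x
  proof -
    have g'x: "(g has_derivative g' (f x)) (at (f x))" using g' that Suc.prems by auto
    have "((\<lambda>x. g (f x)) has_derivative (\<lambda>v. g' (f x) (f' x v))) (at x)"
      using has_derivative_compose[OF f'(1)[OF that] g'x] .
    moreover have "(\<lambda>v. g' (f x) (f' x v)) = ?D x"
      by (rule ext) (rule linear_expand[OF has_derivative_linear[OF g'x]])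
    ultimately show ?thesis by simp
  qed
  moreover have "Ck_on S (\<lambda>x. ?D x v) k" for v
  proof (rule Ck_on_sum[OF assms(1) finite_lessThan])
    fix i
    have "Ck_on S (\<lambda>x. g' (f x) (b i)) k"
      using Suc.prems(1) Ck_on_SucD[OF Suc.prems(2)] g'(2) by (rule Suc.IH)
    then show "Ck_on S (\<lambda>x. (f' x v \<bullet> b i) *\<^sub>R g' (f x) (b i)) k"
      by (rule Ck_on_scaleR[OF assms(1) Ck_on_bounded_linear[OF assms(1) bounded_linear_inner_left f'(2)]])
  qed
  ultimately show ?case by (rule Ck_on_SucI[OF assms(1)])
qed

end

text \<open>Orthogonalise a finite spanning set and normalise it. The orthogonal set may contain 0,
  which is removed in \<open>?C\<close>; in dimension zero the frame is empty and
  \<open>n = 0\<close>.\<close>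

lemma orthonormal_frame_exists:
  assumes "finite B" "span B = (UNIV :: 'e::real_inner set)"
  obtains b n where "orthonormal_frame (b :: nat \<Rightarrow> 'e) n"
proof -
  obtain C where C: "finite C" "span C = (UNIV::'e set)" "pairwise orthogonal C"
    using basis_orthogonal[OF assms(1)] assms(2) by metis
  let ?C = "C - {0}"
  have fin: "finite ?C" using C(1) by simp
  obtain c where c: "bij_betw c {..<card ?C} ?C"
    using ex_bij_betw_nat_finite[OF fin] by (auto simp: atLeast0LessThan)
  define b where "b i = c i /\<^sub>R norm (c i)" for i
  let ?n = "card ?C"
  have cin: "c i \<in> ?C" if "i < ?n" for i using c that bij_betwE by blast
  have inner: "b i \<bullet> b j = (if i = j then 1 else 0)" if "i < ?n" "j < ?n" for i j
  proof (cases "i = j")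
    case True
    then show ?thesis using cin[OF that(1)]
      by (simp add: b_def power2_norm_eq_inner[symmetric] power2_eq_square)
  next
    case False
    then have "c i \<noteq> c j" using c that by (metis bij_betw_imp_inj_on inj_on_eq_iff lessThan_iff)
    then show ?thesis using C(3) cin that False
      by (simp add: b_def pairwise_def orthogonal_def)
  qed
  have "span (b ` {..<?n}) = UNIV"
  proof -
    have "y \<in> span (b ` {..<?n})" if "y \<in> C" for y
    proof (cases "y = 0")
      case False
      with that have "y \<in> c ` {..<?n}" using c by (auto simp: bij_betw_def)
    then obtain i where i: "i < ?n" "y = c i" by blast
      then have "y = norm (c i) *\<^sub>R b i" using cin by (auto simp: b_def)
      moreover have "b i \<in> span (b ` {..<?n})" using i by (simp add: span_base)
    ultimately show ?thesis using span_scale i(2) by metis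
    qed (simp add: span_zero)
    then have "C \<subseteq> span (b ` {..<?n})" by auto
    then show ?thesis using C(2) span_minimal[OF _ subspace_span] by blast
  qed
  moreover have "x = (\<Sum>i<?n. (x \<bullet> b i) *\<^sub>R b i)" if "x \<in> span (b ` {..<?n})" for x
    using that
  proof (induction rule: span_induct_alt)
    case base then show ?case by simp
  next
    case (step a x y)
    then obtain j where j: "j < ?n" "x = b j" by auto
    have "(\<Sum>i<?n. (b j \<bullet> b i) *\<^sub>R b i) = (\<Sum>i<?n. if i = j then b i else 0)"
      using inner j(1) by (intro sum.cong) auto
    then have "(\<Sum>i<?n. (b j \<bullet> b i) *\<^sub>R b i) = b j" using j(1) by simp
    moreover have "(\<Sum>i<?n. ((a *\<^sub>R x + y) \<bullet> b i) *\<^sub>R b i) =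
        a *\<^sub>R (\<Sum>i<?n. (x \<bullet> b i) *\<^sub>R b i) + (\<Sum>i<?n. (y \<bullet> b i) *\<^sub>R b i)"
      by (simp add: inner_add_left scaleR_add_left sum.distrib scaleR_sum_right)
    ultimately show ?case using step.IH j(2) by simp
  qed
  ultimately have "orthonormal_frame b ?n"
    using inner by unfold_locales auto
  then show thesis by (rule that)
qed

section \<open>Smooth maps\<close>

lemma smooth_on_Ck: "smooth_on S f \<Longrightarrow> Ck_on S f k"
  by (simp add: smooth_on_def)

lemma smooth_on_cong:
  "open S \<Longrightarrow> (\<And>y. y \<in> S \<Longrightarrow> f y = g y) \<Longrightarrow> smooth_on S f \<longleftrightarrow> smooth_on S g"
  unfolding smooth_on_def using Ck_on_cong by blast

lemma smooth_on_subset: "smooth_on S f \<Longrightarrow> T \<subseteq> S \<Longrightarrow> smooth_on T f"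
  unfolding smooth_on_def using Ck_on_subset by blast

lemma smooth_on_local:
  "(\<And>x. x \<in> S \<Longrightarrow> \<exists>T. open T \<and> x \<in> T \<and> smooth_on T f) \<Longrightarrow> smooth_on S f"
  unfolding smooth_on_def using Ck_on_local by metis

lemma smooth_on_continuous: "smooth_on S f \<Longrightarrow> continuous_on S f"
  unfolding smooth_on_def using Ck_on_continuous by blast

lemma smooth_on_const: "open S \<Longrightarrow> smooth_on S (\<lambda>x. c)"
  by (simp add: smooth_on_def Ck_on_const)

lemma smooth_on_ident: "open S \<Longrightarrow> smooth_on S (\<lambda>x. x)"
  by (simp add: smooth_on_def Ck_on_ident)

lemma smooth_on_add:
  "open S \<Longrightarrow> smooth_on S f \<Longrightarrow> smooth_on S g \<Longrightarrow> smooth_on S (\<lambda>x. f x + g x)"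
  by (simp add: smooth_on_def Ck_on_add)

lemma smooth_on_sum:
  "open S \<Longrightarrow> finite I \<Longrightarrow> (\<And>i. i \<in> I \<Longrightarrow> smooth_on S (f i)) \<Longrightarrow> smooth_on S (\<lambda>x. \<Sum>i\<in>I. f i x)"
  by (simp add: smooth_on_def Ck_on_sum)

lemma smooth_on_bounded_linear:
  "open S \<Longrightarrow> bounded_linear h \<Longrightarrow> smooth_on S f \<Longrightarrow> smooth_on S (\<lambda>x. h (f x))"
  by (simp add: smooth_on_def Ck_on_bounded_linear)

lemma smooth_on_mult:
  fixes f g :: "_ \<Rightarrow> real"
  shows "open S \<Longrightarrow> smooth_on S f \<Longrightarrow> smooth_on S g \<Longrightarrow> smooth_on S (\<lambda>x. f x * g x)"
  by (simp add: smooth_on_def Ck_on_mult)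

lemma smooth_on_scaleR:
  "open S \<Longrightarrow> smooth_on S f \<Longrightarrow> smooth_on S g \<Longrightarrow> smooth_on S (\<lambda>x. f x *\<^sub>R g x)"
  by (simp add: smooth_on_def Ck_on_scaleR)

lemma smooth_on_diff:
  assumes "open S" "smooth_on S f" "smooth_on S g"
  shows "smooth_on S (\<lambda>x. f x - g x)"
  using smooth_on_add[OF assms(1,2) smooth_on_bounded_linear[OF assms(1) bounded_linear_minus
        [OF bounded_linear_ident] assms(3)]] by simp

lemma smooth_on_frechet: "smooth_on S f \<Longrightarrow> smooth_on S (\<lambda>x. frechet_derivative f (at x) v)"
  unfolding smooth_on_def by (metis Ck_on.simps(2))

lemma smooth_on_has_derivative:
  "smooth_on S f \<Longrightarrow> x \<in> S \<Longrightarrow> (f has_derivative frechet_derivative f (at x)) (at x)"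
  unfolding smooth_on_def by (metis Ck_on.simps(2) frechet_derivative_works)

lemma (in orthonormal_frame) smooth_on_compose:
  fixes f :: "'d::real_normed_vector \<Rightarrow> 'e"
  assumes "open S" "open T" "f ` S \<subseteq> T" "smooth_on S f" "smooth_on T g"
  shows "smooth_on S (\<lambda>x. g (f x))"
  using assms unfolding smooth_on_def by (blast intro: Ck_on_compose)

lemma orthonormal_frame_real: "orthonormal_frame (\<lambda>_. 1::real) 1"
  by unfold_locales auto

lemmas smooth_on_compose_real = orthonormal_frame.smooth_on_compose[OF orthonormal_frame_real]

subsection \<open>Cut-off functions\<close>

text \<open>The functions \<open>t\<^sup>-\<^sup>k exp (-1/t)\<close>, extended by \<open>0\<close>, are stable under differentiation up to
  linear combinations.\<close>

definition flat_exp :: "nat \<Rightarrow> real \<Rightarrow> real" where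
  "flat_exp k t = (if t \<le> 0 then 0 else exp (- (1 / t)) / t ^ k)"

text \<open>Substituting \<open>1/t\<close> for \<open>t\<close> turns the limit from the right into
  the decay of \<open>t^k / exp t\<close> at infinity.\<close>

lemma flat_exp_tendsto: "(flat_exp k \<longlongrightarrow> 0) (at 0)"
proof -
  have "((\<lambda>t::real. t ^ k / exp t) \<longlongrightarrow> 0) at_top"
    by (rule tendsto_power_div_exp_0)
  then have "((\<lambda>t::real. (1/t) ^ k / exp (1/t)) \<longlongrightarrow> 0) (at_right 0)"
    using filterlim_compose[OF _ filterlim_inverse_at_top_right] by (auto simp: inverse_eq_divide)
  moreover have "\<forall>\<^sub>F t in at_right 0. (1/t) ^ k / exp (1/t) = flat_exp k t"
    by (rule eventually_at_rightI[of 0 1]) (auto simp: flat_exp_def exp_minus field_simps)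
  ultimately have "(flat_exp k \<longlongrightarrow> 0) (at_right 0)"
    using tendsto_cong by force
  moreover have "(flat_exp k \<longlongrightarrow> 0) (at_left 0)"
    by (rule tendsto_eventually, rule eventually_at_leftI[of "-1"]) (auto simp: flat_exp_def)
  ultimately show ?thesis using filterlim_at_split by blast
qed

lemma flat_exp_deriv:
  "(flat_exp k has_real_derivative (flat_exp (k + 2) t - k * flat_exp (k + 1) t)) (at t)"
proof -
  consider "t < 0" | "t = 0" | "t > 0" by linarith
  then show ?thesis
  proof cases
    case less: 1
    then have "(flat_exp k has_real_derivative 0) (at t)"
      using has_field_derivative_transform_within_open[OF DERIV_const[of 0], of "{..<0}" t "flat_exp k"]
      by (auto simp: flat_exp_def)
    then show ?thesis using less by (simp add: flat_exp_def)
  next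
    case equal: 2
    \<comment> \<open>The difference quotient of \<open>flat_exp k\<close> at 0 is
      \<open>flat_exp (Suc k)\<close>, whose limit is known.\<close>
    have "((\<lambda>h. flat_exp k h / h) \<longlongrightarrow> 0) (at 0)"
    proof (rule Lim_transform_eventually[OF flat_exp_tendsto[of "Suc k"]])
      show "\<forall>\<^sub>F x in at 0. flat_exp (Suc k) x = flat_exp k x / x"
        by (rule always_eventually) (auto simp: flat_exp_def)
    qed
    then show ?thesis using equal by (simp add: DERIV_def flat_exp_def)
  next
    case greater: 3
    have eq: "(exp (- (1 / t)) * (1 / t\<^sup>2) * t ^ k - exp (- (1 / t)) * (k * t ^ (k - 1))) / (t ^ k)\<^sup>2 =
        exp (- (1 / t)) / t ^ (k + 2) - k * (exp (- (1 / t)) / t ^ (k + 1))"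
      using greater by (cases k) (simp_all add: field_simps power2_eq_square)
    have "((\<lambda>t. exp (- (1 / t))) has_real_derivative exp (- (1 / t)) * (1 / t\<^sup>2)) (at t)"
      using greater by (auto intro!: derivative_eq_intros simp: power2_eq_square)
    from DERIV_divide[OF this DERIV_pow[of k t]]
    have "((\<lambda>t. exp (- (1 / t)) / t ^ k) has_real_derivative
        (flat_exp (k + 2) t - k * flat_exp (k + 1) t)) (at t)"
      using greater eq by (simp add: flat_exp_def power2_eq_square)
    then show ?thesis
      by (rule has_field_derivative_transform_within_open[where S = "{0<..}"])
        (use greater in \<open>auto simp: flat_exp_def\<close>)
  qed
qed

lemma flat_exp_Ck: "Ck_on UNIV (flat_exp k) j"
proof (induction j arbitrary: k)
  case 0
  show ?case using DERIV_isCont[OF flat_exp_deriv]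
    by (simp add: continuous_at_imp_continuous_on)
next
  case (Suc j)
  have s: "Ck_on UNIV (\<lambda>t. flat_exp (Suc (Suc k)) t - real k * flat_exp (Suc k) t) j"
    using Ck_on_add[OF _ Suc Ck_on_mult[OF _ Ck_on_const[of _ "- real k"] Suc]] by simp
  show ?case
  proof (rule Ck_on_SucI)
    show "(flat_exp k has_derivative (\<lambda>v. (flat_exp (Suc (Suc k)) t - real k * flat_exp (Suc k) t) * v)) (at t)" for t
      using flat_exp_deriv[of k t] by (simp add: has_field_derivative_def)
    show "Ck_on UNIV (\<lambda>t. (flat_exp (Suc (Suc k)) t - real k * flat_exp (Suc k) t) * v) j" for v
      by (rule Ck_on_mult[OF _ s Ck_on_const]) auto
  qed simp
qed

lemma Ck_on_inverse:
  fixes f :: "_ \<Rightarrow> real"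
  assumes "open S" "\<And>x. x \<in> S \<Longrightarrow> f x \<noteq> 0"
  shows "Ck_on S f k \<Longrightarrow> Ck_on S (\<lambda>x. inverse (f x)) k"
proof (induction k)
  case 0
  then show ?case using assms(2) by (auto intro!: continuous_on_inverse)
next
  case (Suc k)
  from Suc.prems obtain f' where f': "\<And>x. x \<in> S \<Longrightarrow> (f has_derivative f' x) (at x)"
    "\<And>v. Ck_on S (\<lambda>x. f' x v) k" by (rule Ck_on_SucE) blast
  have i: "Ck_on S (\<lambda>x. inverse (f x)) k" using Suc by (simp add: Ck_on_SucD del: Ck_on.simps)
  have "Ck_on S (\<lambda>x. (-1) * (inverse (f x) * f' x v * inverse (f x))) k" for v
    by (rule Ck_on_mult[OF assms(1) Ck_on_const Ck_on_mult[OF assms(1) Ck_on_mult[OF assms(1) i f'(2)] i]])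
      (rule assms(1))
  then have "Ck_on S (\<lambda>x. - (inverse (f x) * f' x v * inverse (f x))) k" for v by simp
  with assms(1) Deriv.has_derivative_inverse[OF assms(2) f'(1)]
  show ?case by (rule Ck_on_SucI)
qed

text \<open>The quotient of \<open>e t\<close> by \<open>e t + e (1 - t)\<close> with
  \<open>e = flat_exp 0\<close>. The denominator is positive because \<open>t\<close> and
  \<open>1 - t\<close> are never both nonpositive, and for \<open>t \<ge> 1\<close> its second
  summand is 0.\<close>

lemma bump_function_real:
  "\<exists>\<beta> :: real \<Rightarrow> real. smooth_on UNIV \<beta> \<and> (\<forall>t\<le>0. \<beta> t = 0) \<and> (\<forall>t\<ge>1. \<beta> t = 1)"
proof -
  let ?e = "flat_exp 0"
  let ?\<beta> = "\<lambda>t. ?e t * inverse (?e t + ?e (1 - t))"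
  have e: "smooth_on UNIV ?e" by (simp add: smooth_on_def flat_exp_Ck)
  have s: "smooth_on UNIV (\<lambda>t. ?e t + ?e (1 - t))"
    by (rule smooth_on_add[OF open_UNIV e smooth_on_compose_real[OF _ open_UNIV _
            smooth_on_diff[OF _ smooth_on_const smooth_on_ident] e]]) auto
  have "?e t + ?e (1 - t) \<noteq> 0" for t by (auto simp: flat_exp_def add_pos_pos less_imp_neq[symmetric])
  with s have "smooth_on UNIV (\<lambda>t. inverse (?e t + ?e (1 - t)))"
    by (simp add: smooth_on_def Ck_on_inverse)
  from smooth_on_mult[OF open_UNIV e this] have "smooth_on UNIV ?\<beta>" .
  moreover have "?e t = 0" if "t \<le> 0" for t using that by (simp add: flat_exp_def)
  moreover have "?e t \<noteq> 0" if "0 < t" for t using that by (simp add: flat_exp_def)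
  ultimately show ?thesis by (intro exI[of _ ?\<beta>]) auto
qed

lemma bump_function:
  fixes c :: "'e::real_inner"
  assumes "\<epsilon> > 0"
  obtains \<kappa> :: "'e \<Rightarrow> real" where "smooth_on UNIV \<kappa>" "\<And>x. dist c x \<le> \<epsilon> \<Longrightarrow> \<kappa> x = 1"
    "\<And>x. dist c x \<ge> 2 * \<epsilon> \<Longrightarrow> \<kappa> x = 0"
proof -
  obtain \<beta> :: "real \<Rightarrow> real" where \<beta>: "smooth_on UNIV \<beta>" "\<And>t. t \<le> 0 \<Longrightarrow> \<beta> t = 0" "\<And>t. 1 \<le> t \<Longrightarrow> \<beta> t = 1"
    using bump_function_real by blast
  \<comment> \<open>The affine function of the squared distance with value 1 at distance
    \<open>\<epsilon>\<close> and 0 at distance \<open>2 * \<epsilon>\<close>. The square keeps it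
    smooth at \<open>c\<close>.\<close>
  let ?q = "\<lambda>x::'e. (4 - ((x - c) \<bullet> (x - c)) *\<^sub>R (1 / \<epsilon>\<^sup>2)) *\<^sub>R (1/3::real)"
  have q: "?q x = (4 - (dist c x)\<^sup>2 / \<epsilon>\<^sup>2) / 3" for x
    by (simp add: dist_norm power2_norm_eq_inner[symmetric] norm_minus_commute)
  have "smooth_on UNIV (\<lambda>x::'e. x - c)"
    by (rule smooth_on_diff[OF open_UNIV smooth_on_ident smooth_on_const]) auto
  then have "smooth_on UNIV (\<lambda>x::'e. (x - c) \<bullet> (x - c))"
    using Ck_on_bilinear[OF open_UNIV bounded_bilinear_inner] unfolding smooth_on_def by blast
  from smooth_on_scaleR[OF _ smooth_on_diff[OF _ smooth_on_const smooth_on_scaleR[OF _ this smooth_on_const]] smooth_on_const]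
  have "smooth_on UNIV ?q" by blast
  from smooth_on_compose_real[OF _ _ _ this \<beta>(1)]
  have "smooth_on UNIV (\<lambda>x. \<beta> (?q x))" by blast
  then show thesis
  proof (rule that)
    fix x assume "dist c x \<le> \<epsilon>"
    then have "(dist c x)\<^sup>2 \<le> \<epsilon>\<^sup>2" by (simp add: power_mono)
    then show "\<beta> (?q x) = 1" unfolding q using assms by (intro \<beta>(3)) (simp add: field_simps)
  next
    fix x assume "2 * \<epsilon> \<le> dist c x"
    then have "(2 * \<epsilon>)\<^sup>2 \<le> (dist c x)\<^sup>2" using assms by (intro power_mono) auto
    then show "\<beta> (?q x) = 0" unfolding q using assms by (intro \<beta>(2)) (simp add: field_simps)
  qed
qed

section \<open>Linear equations depending on parameters\<close>

subsection \<open>Resolvents\<close>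

text \<open>A product rule in which \<open>f\<close> is merely continuous: as \<open>g\<close>
  vanishes at \<open>x\<close>, the increment of \<open>f\<close> is multiplied by a quantity of
  first order. It is made for the resolvent, whose differentiability is still to be shown when the
  rule is applied.\<close>

lemma has_derivative_bilinear_vanishing:
  assumes h: "bounded_bilinear h" and f: "isCont f x" and g: "(g has_derivative g') (at x)"
    and 0: "g x = 0"
  shows "((\<lambda>y. h (f y) (g y)) has_derivative (\<lambda>v. h (f x) (g' v))) (at x)"
proof -
  interpret h: bounded_bilinear h by fact
  obtain K where K: "\<And>a b. norm (h a b) \<le> norm a * norm b * K" "0 < K" using h.pos_bounded by blast
  have lin: "bounded_linear g'" using g by (rule has_derivative_bounded_linear)
  then obtain C where C: "\<And>v. norm (g' v) \<le> norm v * C" using bounded_linear.bounded by blast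
  let ?q = "\<lambda>y. norm (g y - g x - g' (y - x)) / norm (y - x)"
  have q: "(?q \<longlongrightarrow> 0) (at x)" using g has_derivative_iff_norm by blast
  have fx: "((\<lambda>y. norm (f y - f x)) \<longlongrightarrow> 0) (at x)"
    using f by (simp add: isCont_def LIM_zero_iff tendsto_norm_zero_iff)
  have "((\<lambda>y. norm (f y - f x) * (?q y + C) * K) \<longlongrightarrow> 0 * (0 + C) * K) (at x)"
    by (intro tendsto_intros fx q)
  then have lim: "((\<lambda>y. norm (f y - f x) * (?q y + C) * K) \<longlongrightarrow> 0) (at x)" by simp
  have bnd: "norm (norm (h (f y - f x) (g y)) / norm (y - x)) \<le> norm (f y - f x) * (?q y + C) * K"
    if "y \<noteq> x" for y
  proof -
    have "norm (g y) \<le> norm (g y - g x - g' (y - x)) + norm (g' (y - x))"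
      using norm_triangle_ineq[of "g y - g x - g' (y - x)" "g' (y - x)"] 0 by simp
    also have "\<dots> \<le> (?q y + C) * norm (y - x)"
      using C[of "y - x"] that by (simp add: distrib_left mult.commute)
    finally have "norm (h (f y - f x) (g y)) \<le> norm (f y - f x) * ((?q y + C) * norm (y - x)) * K"
      using K by (meson mult_left_mono mult_right_mono norm_ge_zero order_trans less_imp_le)
    then have "norm (h (f y - f x) (g y)) / norm (y - x) \<le> norm (f y - f x) * (?q y + C) * K"
      using that by (simp add: pos_divide_le_eq mult_ac)
    then show ?thesis by simp
  qed
  have "((\<lambda>y. norm (h (f y - f x) (g y)) / norm (y - x)) \<longlongrightarrow> 0) (at x)"
    using lim by (rule Lim_null_comparison[rotated]) (use bnd in \<open>auto simp: eventually_at_filter\<close>)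
  then have "((\<lambda>y. h (f y - f x) (g y)) has_derivative (\<lambda>v. 0)) (at x)"
    by (simp add: has_derivative_iff_norm 0 h.zero_right)
  moreover have "((\<lambda>y. h (f x) (g y)) has_derivative (\<lambda>v. h (f x) (g' v))) (at x)"
    using g by (rule bounded_linear.has_derivative[OF h.bounded_linear_right])
  ultimately have "((\<lambda>y. h (f y - f x) (g y) + h (f x) (g y)) has_derivative (\<lambda>v. 0 + h (f x) (g' v))) (at x)"
    by (rule has_derivative_add)
  then show ?thesis by (simp add: h.diff_left)
qed

text \<open>Solving \<open>v = c + K v\<close> is a fixed point problem for a contraction.
  Uniqueness of the fixed point gives linearity in \<open>c\<close>, and the triangle inequality
  gives the norm bound.\<close>

lemma neumann_inverse:
  fixes K :: "'v::{real_normed_vector,complete_space} \<Rightarrow>\<^sub>L 'v"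
  assumes "norm K \<le> q" "q < 1"
  shows "\<exists>R. R o\<^sub>L (id_blinfun - K) = id_blinfun \<and> (id_blinfun - K) o\<^sub>L R = id_blinfun \<and>
    norm R \<le> 1 / (1 - q)"
proof -
  have q0: "0 \<le> q" using assms(1) norm_ge_zero order_trans by blast
  have Kle: "norm (K v) \<le> q * norm v" for v
    using norm_blinfun[of K v] assms(1) by (meson mult_right_mono norm_ge_zero order_trans)
  have "\<exists>!v. c + K v = v" for c
    by (rule banach_fix_type[OF q0 assms(2)]) (use Kle in \<open>auto simp: dist_norm blinfun.diff_right[symmetric]\<close>)
  then obtain r where r: "\<And>c. c + K (r c) = r c" and uniq: "\<And>c v. c + K v = v \<Longrightarrow> v = r c"
    by metis
  have rn: "norm (r c) \<le> norm c * (1 / (1 - q))" for c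
  proof -
    have "norm (r c) \<le> norm c + q * norm (r c)"
      using norm_triangle_ineq[of c "K (r c)"] Kle[of "r c"] r[of c] by simp
    then have "norm (r c) * (1 - q) \<le> norm c" by (simp add: algebra_simps)
    then show ?thesis using assms(2) by (simp add: field_simps)
  qed
  have lin: "bounded_linear r"
  proof (rule bounded_linear_intro[OF _ _ rn])
    fix c d s
    have "(c + d) + K (r c + r d) = (c + K (r c)) + (d + K (r d))"
      by (simp add: blinfun.add_right)
    then show "r (c + d) = r c + r d" using uniq[of "c + d" "r c + r d"] r by simp
    have "s *\<^sub>R c + K (s *\<^sub>R r c) = s *\<^sub>R (c + K (r c))"
      by (simp add: blinfun.scaleR_right scaleR_add_right)
    then show "r (s *\<^sub>R c) = s *\<^sub>R r c" using uniq[of "s *\<^sub>R c" "s *\<^sub>R r c"] r by simp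
  qed
  let ?R = "Blinfun r"
  have app: "?R c = r c" for c using lin by (simp add: bounded_linear_Blinfun_apply)
  have "norm ?R \<le> 1 / (1 - q)"
    by (rule norm_blinfun_bound) (use assms(2) rn app in \<open>auto simp: mult.commute\<close>)
  moreover have "r (v - K v) = v" for v using uniq[of "v - K v" v] by simp
  moreover have "r v - K (r v) = v" for v using r[of v] by (simp add: diff_eq_eq add.commute)
  ultimately show ?thesis
    by (intro exI[of _ ?R]) (auto intro!: blinfun_eqI simp: app blinfun.diff_left)
qed

text \<open>Subtract \<open>R' = R (1 - K) R'\<close> from \<open>R = R (1 - K') R'\<close>.\<close>

lemma resolvent_identity:
  fixes K K' R R' :: "'v::real_normed_vector \<Rightarrow>\<^sub>L 'v"
  assumes "R o\<^sub>L (id_blinfun - K) = id_blinfun" "(id_blinfun - K') o\<^sub>L R' = id_blinfun"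
  shows "R - R' = R o\<^sub>L (K - K') o\<^sub>L R'"
proof (rule blinfun_eqI)
  fix v
  have "R (w - K w) = w" for w using arg_cong[OF assms(1), of "\<lambda>A. A w"] by (simp add: blinfun.diff_left)
  then have 1: "R w - R (K w) = w" for w by (simp add: blinfun.diff_right)
  have 2: "R' v - K' (R' v) = v" using arg_cong[OF assms(2), of "\<lambda>A. A v"] by (simp add: blinfun.diff_left)
  have "(R - R') v = R (R' v - K' (R' v)) - (R (R' v) - R (K (R' v)))"
    unfolding 1 2 by (simp add: blinfun.diff_left)
  then show "(R - R') v = (R o\<^sub>L (K - K') o\<^sub>L R') v"
    by (simp add: blinfun.diff_left blinfun.diff_right)
qed

text \<open>By the resolvent identity the increment of \<open>R\<close> is
  \<open>R y (K y - K x) R x\<close>. The uniform bound \<open>C\<close> turns this into continuity,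
  and then into differentiability with derivative \<open>R K' R\<close>, an expression in
  \<open>R\<close> and \<open>K'\<close> of the order handled by the induction hypothesis.\<close>

lemma Ck_on_resolvent:
  fixes K R :: "'d::real_normed_vector \<Rightarrow> ('v::real_normed_vector \<Rightarrow>\<^sub>L 'v)"
  assumes "open S" and R: "\<And>x. x \<in> S \<Longrightarrow> norm (R x) \<le> C"
    and inv: "\<And>x. x \<in> S \<Longrightarrow> R x o\<^sub>L (id_blinfun - K x) = id_blinfun"
      "\<And>x. x \<in> S \<Longrightarrow> (id_blinfun - K x) o\<^sub>L R x = id_blinfun"
  shows "Ck_on S K k \<Longrightarrow> Ck_on S R k"
proof (induction k)
  case 0
  then have K: "isCont K x" if "x \<in> S" for x
    using that assms(1) by (simp add: continuous_on_eq_continuous_at)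
  have "isCont R x" if x: "x \<in> S" for x
  proof -
    have "((\<lambda>y. norm (K y - K x)) \<longlongrightarrow> 0) (at x)"
      using K[OF x] by (simp add: isCont_def LIM_zero_iff tendsto_norm_zero_iff)
    then have "((\<lambda>y. C * norm (K y - K x) * C) \<longlongrightarrow> C * 0 * C) (at x)"
      by (intro tendsto_intros)
    then have lim: "((\<lambda>y. C * norm (K y - K x) * C) \<longlongrightarrow> 0) (at x)" by simp
    have "norm (R y - R x) \<le> C * norm (K y - K x) * C" if y: "y \<in> S" for y
    proof -
      have C0: "0 \<le> C" using R[OF x] norm_ge_zero order_trans by blast
      have "norm (R y - R x) \<le> norm (R y o\<^sub>L (K y - K x)) * norm (R x)"
        unfolding resolvent_identity[OF inv(1)[OF y] inv(2)[OF x]] by (rule norm_blinfun_compose)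
      also have "\<dots> \<le> (norm (R y) * norm (K y - K x)) * norm (R x)"
        by (intro mult_right_mono norm_blinfun_compose) simp
      also have "\<dots> \<le> C * norm (K y - K x) * C"
        using R x y C0 by (intro mult_mono) auto
      finally show ?thesis .
    qed
    then have "\<forall>\<^sub>F y in at x. norm (R y - R x) \<le> C * norm (K y - K x) * C"
      using eventually_at_topological x assms(1) by fast
    with lim have "((\<lambda>y. R y - R x) \<longlongrightarrow> 0) (at x)" by (rule Lim_null_comparison[rotated])
    then show ?thesis by (simp add: isCont_def LIM_zero_iff)
  qed
  then show ?case by (simp add: continuous_at_imp_continuous_on)
next
  case (Suc k)
  then have Rk: "Ck_on S R k" using Ck_on_SucD by blast
  from Suc.prems obtain K' where K': "\<And>x. x \<in> S \<Longrightarrow> (K has_derivative K' x) (at x)"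
    "\<And>v. Ck_on S (\<lambda>x. K' x v) k" by (rule Ck_on_SucE) blast
  have "(R has_derivative (\<lambda>v. R x o\<^sub>L (K' x v o\<^sub>L R x))) (at x)" if x: "x \<in> S" for x
  proof -
    have "isCont R x" using Ck_on_continuous[OF Rk] x assms(1)
      by (simp add: continuous_on_eq_continuous_at)
    moreover have "((\<lambda>y. (K y - K x) o\<^sub>L R x) has_derivative (\<lambda>v. K' x v o\<^sub>L R x)) (at x)"
      using has_derivative_diff[OF K'(1)[OF x] has_derivative_const[of "K x"]]
      by (intro bounded_linear.has_derivative[OF bounded_bilinear.bounded_linear_left
            [OF bounded_bilinear_blinfun_compose]]) simp
    ultimately have "((\<lambda>y. R y o\<^sub>L ((K y - K x) o\<^sub>L R x)) has_derivative (\<lambda>v. R x o\<^sub>L (K' x v o\<^sub>L R x))) (at x)"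
      by (rule has_derivative_bilinear_vanishing[OF bounded_bilinear_blinfun_compose])
        (simp add: blinfun_compose_zero)
    then have "((\<lambda>y. R x + (R y o\<^sub>L ((K y - K x) o\<^sub>L R x))) has_derivative (\<lambda>v. 0 + (R x o\<^sub>L (K' x v o\<^sub>L R x)))) (at x)"
      by (rule has_derivative_add[OF has_derivative_const])
    then have "((\<lambda>y. R x + (R y o\<^sub>L ((K y - K x) o\<^sub>L R x))) has_derivative (\<lambda>v. R x o\<^sub>L (K' x v o\<^sub>L R x))) (at x)"
      by simp
    moreover have "R x + (R y o\<^sub>L ((K y - K x) o\<^sub>L R x)) = R y" if y: "y \<in> S" for y
    proof -
      have "R y - R x = R y o\<^sub>L (K y - K x) o\<^sub>L R x"
        by (rule resolvent_identity[OF inv(1)[OF y] inv(2)[OF x]])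
      moreover have "R y o\<^sub>L (K y - K x) o\<^sub>L R x = R y o\<^sub>L ((K y - K x) o\<^sub>L R x)"
        by (rule blinfun_eqI) simp
      ultimately show ?thesis by (simp add: algebra_simps)
    qed
    ultimately show ?thesis
      using has_derivative_transform_within_open[OF _ assms(1) x] by blast
  qed
  then show ?case
  proof (rule Ck_on_SucI[OF assms(1)])
    fix v
    show "Ck_on S (\<lambda>x. R x o\<^sub>L (K' x v o\<^sub>L R x)) k"
      by (rule Ck_on_bilinear[OF assms(1) bounded_bilinear_blinfun_compose Rk
          Ck_on_bilinear[OF assms(1) bounded_bilinear_blinfun_compose K'(2) Rk]])
  qed
qed

subsection \<open>Functions along the rays from a point\<close>

text \<open>Precomposition with the clamp turns a continuous function on the unit interval into a
  bounded continuous function on the line, hence into a point of a Banach space.\<close>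

definition clamp01 :: "real \<Rightarrow> real" where "clamp01 t = max 0 (min 1 t)"

lemma clamp01_id: "0 \<le> t \<Longrightarrow> t \<le> 1 \<Longrightarrow> clamp01 t = t"
  and clamp01_ge: "0 \<le> clamp01 t" and clamp01_le: "clamp01 t \<le> 1"
  and clamp01_clamp01: "clamp01 (clamp01 t) = clamp01 t"
  by (auto simp: clamp01_def)

lemma continuous_on_clamp01: "continuous_on T clamp01"
  unfolding clamp01_def by (intro continuous_intros)

lemma bcontfun_clamp01:
  assumes "continuous_on {0..1} (g::real \<Rightarrow> real)"
  shows "(\<lambda>t. g (clamp01 t)) \<in> bcontfun"
proof -
  have "continuous_on UNIV (\<lambda>t. g (clamp01 t))"
    by (rule continuous_on_compose2[OF assms continuous_on_clamp01]) (auto simp: clamp01_ge clamp01_le)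
  moreover have "bounded (g ` {0..1})"
    using compact_continuous_image[OF assms] compact_imp_bounded by blast
  then have "bounded (range (\<lambda>t. g (clamp01 t)))"
    by (rule bounded_subset) (auto simp: clamp01_ge clamp01_le)
  ultimately show ?thesis by (simp add: bcontfun_def)
qed

text \<open>The restriction of \<open>f\<close> to the segment from \<open>c\<close> to
  \<open>x\<close>, as a vector depending on \<open>x\<close>. Differentiation in \<open>x\<close>
  produces a factor \<open>t\<close> by the chain rule; the weight \<open>t^j\<close> makes the
  family stable under differentiation.\<close>

definition along :: "'e::real_normed_vector \<Rightarrow> nat \<Rightarrow> ('e \<Rightarrow> real) \<Rightarrow> 'e \<Rightarrow> real \<Rightarrow>\<^sub>C real" where
  "along c j f x = Bcontfun (\<lambda>t. clamp01 t ^ j * f (c + clamp01 t *\<^sub>R (x - c)))"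

lemma ray_in_convex:
  assumes "convex S" "c \<in> S" "x \<in> S" "0 \<le> t" "t \<le> 1"
  shows "c + t *\<^sub>R (x - c) \<in> S"
proof -
  have "c + t *\<^sub>R (x - c) = (1 - t) *\<^sub>R c + t *\<^sub>R x" by (simp add: algebra_simps)
  then show ?thesis using assms by (simp add: convexD_alt)
qed

lemma apply_along:
  assumes "convex S" "c \<in> S" "x \<in> S" "continuous_on S f"
  shows "along c j f x t = clamp01 t ^ j * f (c + clamp01 t *\<^sub>R (x - c))"
proof -
  have "continuous_on {0..1} (\<lambda>t. t ^ j * f (c + t *\<^sub>R (x - c)))"
    by (intro continuous_intros continuous_on_compose2[OF assms(4)])
      (use ray_in_convex[OF assms(1-3)] in auto)
  from bcontfun_clamp01[OF this] show ?thesis by (simp add: along_def Bcontfun_inverse)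
qed

text \<open>Differentiation passes from \<open>f\<close> to its partial derivatives and raises
  \<open>j\<close> by one, so the induction generalises over both. The content is that derivatives
  formed separately for each \<open>t\<close> are derivatives in the sup norm.\<close>

lemma (in orthonormal_frame) Ck_on_along:
  fixes f :: "'e \<Rightarrow> real"
  assumes "open S" "convex S" "c \<in> S"
  shows "Ck_on S f k \<Longrightarrow> Ck_on S (along c j f) k"
proof (induction k arbitrary: f j)
  case (0 f)
  then have f: "continuous_on S f" by simp
  have "\<exists>d>0. \<forall>y\<in>S. dist y x < d \<longrightarrow> dist (along c j f y) (along c j f x) < e" if x: "x \<in> S" and e: "e > 0" for x e
  proof -
    \<comment> \<open>Joint continuity and compactness of the unit interval give continuity in
      \<open>y\<close> uniformly in \<open>t\<close>, that is, in the sup norm.\<close>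
    let ?F = "\<lambda>(y, t). t ^ j * f (c + t *\<^sub>R (y - c))"
    have "continuous_on (S \<times> {0..1}) ?F"
      unfolding split_def
      by (intro continuous_intros continuous_on_compose2[OF f])
        (use ray_in_convex[OF assms(2,3)] in auto)
    from continuous_on_prod_compactE[OF this compact_Icc x, of "e/2"] e obtain X0 where
      X0: "x \<in> X0" "open X0" "\<forall>y\<in>X0 \<inter> S. \<forall>t\<in>{0..1}. dist (?F (y, t)) (?F (x, t)) \<le> e/2"
      by auto
    from X0(1,2) obtain d where d: "d > 0" "ball x d \<subseteq> X0" using openE by blast
    have "dist (along c j f y) (along c j f x) < e" if y: "y \<in> S" "dist y x < d" for y
    proof -
      have "y \<in> X0 \<inter> S" using y d by (auto simp: dist_commute)
      then have "dist (?F (y, clamp01 t)) (?F (x, clamp01 t)) \<le> e/2" for t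
        using X0(3) by (auto simp: clamp01_ge clamp01_le)
      then have "dist (along c j f y) (along c j f x) \<le> e/2"
        by (intro dist_bound) (simp add: apply_along[OF assms(2,3) _ f] x y)
      then show ?thesis using e by simp
    qed
    then show ?thesis using d(1) by blast
  qed
  then show ?case by (simp add: continuous_on_iff)
next
  case (Suc k)
  from Suc.prems obtain f' where f': "\<And>x. x \<in> S \<Longrightarrow> (f has_derivative f' x) (at x)"
    "\<And>v. Ck_on S (\<lambda>x. f' x v) k" by (rule Ck_on_SucE) blast
  have f: "continuous_on S f" using Suc.prems by (rule Ck_on_continuous)
  let ?D = "\<lambda>i. along c (Suc j) (\<lambda>x. f' x (b i))"
  have Dk: "Ck_on S (?D i) k" for i by (rule Suc.IH[OF f'(2)])
  have apD: "?D i x t = clamp01 t ^ Suc j * f' (c + clamp01 t *\<^sub>R (x - c)) (b i)" if "x \<in> S" for i x t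
    by (rule apply_along[OF assms(2,3) that Ck_on_continuous[OF f'(2)]])
  have "(along c j f has_derivative (\<lambda>v. \<Sum>i<n. (v \<bullet> b i) *\<^sub>R ?D i x)) (at x)" if x: "x \<in> S" for x
    unfolding has_derivative_at_alt
  proof (intro conjI allI impI)
    show "bounded_linear (\<lambda>v. \<Sum>i<n. (v \<bullet> b i) *\<^sub>R ?D i x)"
      by (rule bounded_linear_sum)
        (rule bounded_linear_compose[OF bounded_linear_scaleR_left bounded_linear_inner_left])
    fix e :: real assume e: "e > 0"
    let ?s = "\<lambda>y. \<Sum>i<n. norm (?D i y - ?D i x)"
    have "continuous_on S ?s" using Ck_on_continuous[OF Dk] by (auto intro!: continuous_intros)
    from this x e have "\<exists>d>0. \<forall>y\<in>S. dist y x < d \<longrightarrow> dist (?s y) (?s x) < e"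
      unfolding continuous_on_iff by blast
    then obtain d1 where d1: "d1 > 0" "\<And>y. y \<in> S \<Longrightarrow> dist y x < d1 \<Longrightarrow> dist (?s y) (?s x) < e"
      by blast
    from assms(1) x obtain d2 where d2: "d2 > 0" "ball x d2 \<subseteq> S" using openE by blast
    define d where "d = min d1 d2"
    have dS: "ball x d \<subseteq> S" using d2(2) by (auto simp: d_def)
    have s: "?s y \<le> e" if "y \<in> ball x d" for y
    proof -
      have "dist (?s y) (?s x) < e" using d1(2)[of y] that dS by (auto simp: d_def dist_commute)
      then show ?thesis by (simp add: dist_real_def)
    qed
    \<comment> \<open>For each \<open>t\<close> the mean value inequality applies. Its constant is
      \<open>e\<close> for all \<open>t\<close> at once, because the vectors \<open>?D i z\<close>
      are close to \<open>?D i x\<close> in the sup norm.\<close>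
    have "norm (along c j f y - along c j f x - (\<Sum>i<n. ((y - x) \<bullet> b i) *\<^sub>R ?D i x)) \<le> e * norm (y - x)"
      if y: "norm (y - x) < d" for y
    proof (rule norm_bound)
      fix t
      let ?u = "clamp01 t"
      let ?F = "\<lambda>z. ?u ^ j * f (c + ?u *\<^sub>R (z - c))"
      let ?F' = "\<lambda>z v. \<Sum>i<n. (v \<bullet> b i) * ?D i z t"
      have "norm (?F y - ?F x - ?F' x (y - x)) \<le> norm (y - x) * e"
      proof (rule differentiable_bound_linearization[of x y "ball x d"])
        fix s :: real assume s: "s \<in> {0..1}"
        have "norm (s *\<^sub>R (y - x)) \<le> 1 * norm (y - x)"
          using s by (simp add: mult_left_le_one_le)
        then show "x + s *\<^sub>R (y - x) \<in> ball x d" using y by (simp add: dist_norm)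
      next
        fix z assume z: "z \<in> ball x d"
        then have zS: "c + ?u *\<^sub>R (z - c) \<in> S"
          using dS assms by (intro ray_in_convex) (auto simp: clamp01_ge clamp01_le)
        have "((\<lambda>z. c + ?u *\<^sub>R (z - c)) has_derivative (\<lambda>v. ?u *\<^sub>R v)) (at z)"
          by (auto intro!: derivative_eq_intros)
        from has_derivative_compose[OF this f'(1)[OF zS]]
        have "(?F has_derivative (\<lambda>v. ?u ^ j * f' (c + ?u *\<^sub>R (z - c)) (?u *\<^sub>R v))) (at z)"
          by (rule has_derivative_mult_right)
        moreover have "?u ^ j * f' (c + ?u *\<^sub>R (z - c)) (?u *\<^sub>R v) = ?F' z v" for v
        proof -
          have "f' (c + ?u *\<^sub>R (z - c)) (?u *\<^sub>R v) = ?u * f' (c + ?u *\<^sub>R (z - c)) v"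
            using linear_scale[OF has_derivative_linear[OF f'(1)[OF zS]]] by simp
          also have "f' (c + ?u *\<^sub>R (z - c)) v = (\<Sum>i<n. (v \<bullet> b i) *\<^sub>R f' (c + ?u *\<^sub>R (z - c)) (b i))"
            by (rule linear_expand[OF has_derivative_linear[OF f'(1)[OF zS]]])
          finally show ?thesis using z dS by (auto simp: apD subset_iff sum_distrib_left mult_ac intro!: sum.cong)
        qed
        ultimately have "(?F has_derivative ?F' z) (at z)" by simp
        then show "(?F has_derivative ?F' z) (at z within ball x d)" by (rule has_derivative_at_withinI)
        show "onorm (?F' z - ?F' x) \<le> e"
        proof (rule onorm_bound)
          show "0 \<le> e" using e by simp
          fix v
          have "norm ((?F' z - ?F' x) v) = \<bar>\<Sum>i<n. (v \<bullet> b i) * (?D i z - ?D i x) t\<bar>"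
            by (simp add: sum_subtractf[symmetric] right_diff_distrib)
          also have "\<dots> \<le> (\<Sum>i<n. \<bar>v \<bullet> b i\<bar> * \<bar>(?D i z - ?D i x) t\<bar>)"
            using sum_abs[of "\<lambda>i. (v \<bullet> b i) * (?D i z - ?D i x) t"] by (simp add: abs_mult)
          also have "\<dots> \<le> (\<Sum>i<n. norm v * norm (?D i z - ?D i x))"
            using norm_bounded[of "?D _ z - ?D _ x" t]
            by (intro sum_mono mult_mono) (auto simp: abs_coord_le simp del: minus_bcontfun.rep_eq)
          also have "\<dots> = norm v * ?s z" by (simp add: sum_distrib_left)
          also have "\<dots> \<le> e * norm v"
            by (subst mult.commute) (rule mult_right_mono[OF s[OF z] norm_ge_zero])
          finally show "norm ((?F' z - ?F' x) v) \<le> e * norm v" .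
        qed
      next
        show "x \<in> ball x d" using d1(1) d2(1) by (simp add: d_def)
      qed
      moreover have "y \<in> S" using y dS by (auto simp: dist_norm norm_minus_commute)
      moreover have "(\<Sum>i<n. ((y - x) \<bullet> b i) *\<^sub>R ?D i x) t = ?F' x (y - x)"
        by (induction n) auto
      ultimately show "norm ((along c j f y - along c j f x - (\<Sum>i<n. ((y - x) \<bullet> b i) *\<^sub>R ?D i x)) t) \<le> e * norm (y - x)"
        using x by (simp add: apply_along[OF assms(2,3) _ f] mult.commute)
    qed
    then show "\<exists>d>0. \<forall>y. norm (y - x) < d \<longrightarrow>
        norm (along c j f y - along c j f x - (\<Sum>i<n. ((y - x) \<bullet> b i) *\<^sub>R ?D i x)) \<le> e * norm (y - x)"
      using d1(1) d2(1) by (intro exI[of _ d]) (auto simp: d_def)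
  qed
  then show ?case
  proof (rule Ck_on_SucI[OF assms(1)])
    fix v
    show "Ck_on S (\<lambda>x. \<Sum>i<n. (v \<bullet> b i) *\<^sub>R ?D i x) k"
      by (rule Ck_on_sum[OF assms(1) finite_lessThan Ck_on_bounded_linear[OF assms(1) bounded_linear_scaleR_right Dk]])
  qed
qed

lemma (in orthonormal_frame) smooth_on_along:
  fixes f :: "'e \<Rightarrow> real"
  assumes "open S" "convex S" "c \<in> S" "smooth_on S f"
  shows "smooth_on S (along c j f)"
  using assms Ck_on_along unfolding smooth_on_def by blast

section \<open>Antiderivatives and the Hadamard lemma\<close>

definition integral01 :: "(real \<Rightarrow>\<^sub>C real) \<Rightarrow> real \<Rightarrow> real" where
  "integral01 g t = integral {0..clamp01 t} (apply_bcontfun g)"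

lemma abs_bcontfun_le: "\<bar>apply_bcontfun (g::_ \<Rightarrow>\<^sub>C real) x\<bar> \<le> norm g"
  using norm_bounded[of g x] by simp

lemma integrable_bcontfun: "(apply_bcontfun g :: real \<Rightarrow> real) integrable_on {a..b}"
  by (rule integrable_continuous_interval) simp

lemma abs_integral01_le: "\<bar>integral01 g t\<bar> \<le> norm g"
proof -
  have "norm (integral {0..clamp01 t} (apply_bcontfun g)) \<le> norm g * (clamp01 t - 0)"
    by (rule integral_bound) (use norm_bounded[of g] in \<open>auto simp: clamp01_ge\<close>)
  also have "\<dots> \<le> norm g * 1" by (intro mult_left_mono) (auto simp: clamp01_le)
  finally show ?thesis by (simp add: integral01_def)
qed

lemma integral01_add: "integral01 (g + h) t = integral01 g t + integral01 h t"
  unfolding integral01_def plus_bcontfun.rep_eq by (rule integral_add) (rule integrable_bcontfun)+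

lemma integral01_scaleR: "integral01 (a *\<^sub>R g) t = a * integral01 g t"
  unfolding integral01_def scaleR_bcontfun.rep_eq by simp

lemma bounded_linear_integral01: "bounded_linear (\<lambda>g. integral01 g t)"
  by (rule bounded_linear_intro[of _ 1])
    (auto simp: integral01_add integral01_scaleR abs_integral01_le)

lemma has_derivative_integral01:
  assumes "t \<in> {0..1}"
  shows "(integral01 g has_real_derivative g t) (at t within {0..1})"
proof -
  have "((\<lambda>u. integral {0..u} (apply_bcontfun g)) has_real_derivative g t) (at t within {0..1})"
    by (rule integral_has_real_derivative) (use assms in auto)
  then show ?thesis
    by (rule has_field_derivative_transform_within[of _ _ _ _ 1])
      (use assms in \<open>auto simp: integral01_def clamp01_id\<close>)
qed

text \<open>Take \<open>g i x\<close> to be the mean of the partial derivative of \<open>f\<close>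
  in direction \<open>b i\<close> over the segment from \<open>c\<close> to \<open>x\<close>, and
  apply the fundamental theorem of calculus along it. Smoothness of \<open>g i\<close> is that of
  \<open>along\<close>, followed by a bounded linear functional.\<close>

lemma (in orthonormal_frame) hadamard:
  fixes f :: "'e \<Rightarrow> real"
  assumes S: "open S" "convex S" "c \<in> S" and f: "smooth_on S f"
  obtains g where "\<And>i. smooth_on S (g i)" "\<And>i. g i c = frechet_derivative f (at c) (b i)"
    "\<And>x. x \<in> S \<Longrightarrow> f x = f c + (\<Sum>i<n. ((x - c) \<bullet> b i) * g i x)"
proof
  let ?d = "\<lambda>i x. frechet_derivative f (at x) (b i)"
  have d: "smooth_on S (?d i)" for i using f by (rule smooth_on_frechet)
  let ?g = "\<lambda>i x. integral01 (along c 0 (?d i) x) 1"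
  show "smooth_on S (?g i)" for i
    by (rule smooth_on_bounded_linear[OF S(1) bounded_linear_integral01 smooth_on_along[OF S d]])
  have ap: "along c 0 (?d i) x t = ?d i (c + clamp01 t *\<^sub>R (x - c))" if "x \<in> S" for i x t
    using apply_along[OF S(2,3) that smooth_on_continuous[OF d], of 0] by simp
  have int: "?g i x = integral {0..1} (\<lambda>t. ?d i (c + t *\<^sub>R (x - c)))" if "x \<in> S" for i x
  proof -
    have "?g i x = integral {0..1} (apply_bcontfun (along c 0 (?d i) x))"
      by (simp add: integral01_def clamp01_id)
    also have "\<dots> = integral {0..1} (\<lambda>t. ?d i (c + t *\<^sub>R (x - c)))"
      by (rule integral_cong) (simp add: ap[OF that] clamp01_id)
    finally show ?thesis .
  qed
  show "?g i c = ?d i c" for i using int[OF S(3)] by simp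
  fix x assume x: "x \<in> S"
  have "((\<lambda>t. \<Sum>i<n. ((x - c) \<bullet> b i) * ?d i (c + t *\<^sub>R (x - c))) has_integral
      f (c + 1 *\<^sub>R (x - c)) - f (c + 0 *\<^sub>R (x - c))) {0..1}"
  proof (rule fundamental_theorem_of_calculus)
    fix t :: real assume t: "t \<in> {0..1}"
    then have "c + t *\<^sub>R (x - c) \<in> S" using S x by (auto intro: ray_in_convex)
    then have fd: "(f has_derivative frechet_derivative f (at (c + t *\<^sub>R (x - c)))) (at (c + t *\<^sub>R (x - c)))"
      by (rule smooth_on_has_derivative[OF f])
    have "((\<lambda>t. c + t *\<^sub>R (x - c)) has_derivative (\<lambda>s. s *\<^sub>R (x - c))) (at t within {0..1})"
      by (auto intro!: derivative_eq_intros)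
    from has_derivative_compose[OF this fd]
    have "((\<lambda>t. f (c + t *\<^sub>R (x - c))) has_derivative
        (\<lambda>s. frechet_derivative f (at (c + t *\<^sub>R (x - c))) (s *\<^sub>R (x - c)))) (at t within {0..1})" .
    moreover have "frechet_derivative f (at (c + t *\<^sub>R (x - c))) (s *\<^sub>R (x - c)) =
        s *\<^sub>R (\<Sum>i<n. ((x - c) \<bullet> b i) * ?d i (c + t *\<^sub>R (x - c)))" for s
      using linear_scale[OF has_derivative_linear[OF fd]]
        linear_expand[OF has_derivative_linear[OF fd], of "x - c"] by simp
    ultimately show "((\<lambda>t. f (c + t *\<^sub>R (x - c))) has_vector_derivative
        (\<Sum>i<n. ((x - c) \<bullet> b i) * ?d i (c + t *\<^sub>R (x - c)))) (at t within {0..1})"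
      by (simp add: has_vector_derivative_def)
  qed simp
  then have "f x - f c = integral {0..1} (\<lambda>t. \<Sum>i<n. ((x - c) \<bullet> b i) * ?d i (c + t *\<^sub>R (x - c)))"
    by (simp add: integral_unique)
  also have "\<dots> = (\<Sum>i<n. integral {0..1} (\<lambda>t. ((x - c) \<bullet> b i) * ?d i (c + t *\<^sub>R (x - c))))"
  proof (rule integral_sum)
    fix i
    have "continuous_on {0..1} (\<lambda>t. ?d i (c + t *\<^sub>R (x - c)))"
      by (rule continuous_on_compose2[OF smooth_on_continuous[OF d]])
        (use ray_in_convex[OF S(2,3) x] in \<open>auto intro!: continuous_intros\<close>)
    then show "(\<lambda>t. ((x - c) \<bullet> b i) * ?d i (c + t *\<^sub>R (x - c))) integrable_on {0..1}"
      by (intro integrable_continuous_interval continuous_on_mult_left)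
  qed simp
  also have "\<dots> = (\<Sum>i<n. ((x - c) \<bullet> b i) * ?g i x)" by (simp add: int[OF x])
  finally show "f x = f c + (\<Sum>i<n. ((x - c) \<bullet> b i) * ?g i x)" by simp
qed

subsection \<open>Linear differential equations along rays\<close>

text \<open>A Gronwall argument for the sum of squares. The differential equation is asked for in
  the open interval only, so that equations divided by \<open>t\<close> qualify; the end points
  enter through continuity.\<close>

lemma linear_ode_zero:
  fixes w :: "'i \<Rightarrow> real \<Rightarrow> real"
  assumes "finite I" and d: "\<And>i t. i \<in> I \<Longrightarrow> t \<in> {0<..<1} \<Longrightarrow>
      (w i has_real_derivative (\<Sum>j\<in>I. a i j t * w j t)) (at t)"
    and cont: "\<And>i. i \<in> I \<Longrightarrow> continuous_on {0..1} (w i)"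
    and a: "\<And>i j t. i \<in> I \<Longrightarrow> j \<in> I \<Longrightarrow> t \<in> {0<..<1} \<Longrightarrow> \<bar>a i j t\<bar> \<le> C"
    and 0: "\<And>i. i \<in> I \<Longrightarrow> w i 0 = 0" and i: "i \<in> I" and t: "t \<in> {0..1}"
  shows "w i t = 0"
proof -
  let ?e = "\<lambda>t. \<Sum>i\<in>I. (w i t)\<^sup>2"
  \<comment> \<open>Each mixed term is at most \<open>C\<close> times the sum of two squares;
    summing over both indices counts every square \<open>2 * card I\<close> times.\<close>
  let ?c = "2 * C * card I"
  let ?e' = "\<lambda>t. \<Sum>i\<in>I. 2 * w i t * (\<Sum>j\<in>I. a i j t * w j t)"
  have e': "(?e has_real_derivative ?e' t) (at t)" if "t \<in> {0<..<1}" for t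
  proof (rule DERIV_sum)
    fix i assume "i \<in> I"
    from DERIV_power[OF d[OF this that], of 2]
    show "((\<lambda>t. (w i t)\<^sup>2) has_real_derivative 2 * w i t * (\<Sum>j\<in>I. a i j t * w j t)) (at t)"
      by (simp add: mult_ac)
  qed
  have le: "?e' t \<le> ?c * ?e t" if "t \<in> {0<..<1}" for t
  proof -
    have "2 * w i t * (a i j t * w j t) \<le> C * ((w i t)\<^sup>2 + (w j t)\<^sup>2)" if "i \<in> I" "j \<in> I" for i j
    proof -
      have "2 * w i t * (a i j t * w j t) \<le> \<bar>2 * w i t * (a i j t * w j t)\<bar>" by simp
      also have "\<dots> = \<bar>a i j t\<bar> * (2 * \<bar>w i t\<bar> * \<bar>w j t\<bar>)" by (simp add: abs_mult)
      also have "\<dots> \<le> \<bar>a i j t\<bar> * ((w i t)\<^sup>2 + (w j t)\<^sup>2)"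
        using sum_squares_bound[of "\<bar>w i t\<bar>" "\<bar>w j t\<bar>"] by (intro mult_left_mono) auto
      also have "\<dots> \<le> C * ((w i t)\<^sup>2 + (w j t)\<^sup>2)"
        using a[OF that \<open>t \<in> {0<..<1}\<close>] by (intro mult_right_mono) auto
      finally show ?thesis .
    qed
    then have "?e' t \<le> (\<Sum>i\<in>I. \<Sum>j\<in>I. C * ((w i t)\<^sup>2 + (w j t)\<^sup>2))"
      unfolding sum_distrib_left by (intro sum_mono) auto
    also have "\<dots> = ?c * ?e t"
      by (simp add: distrib_left sum.distrib sum_distrib_left[symmetric] algebra_simps)
    finally show ?thesis .
  qed
  let ?g = "\<lambda>t. ?e t * exp (- ?c * t)"
  have "?g t \<le> ?g 0"
  proof (cases "t = 0")
    case False
    then have "0 < t" using t by simp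
    moreover have "continuous_on {0..t} ?g"
      using continuous_on_subset[OF cont, of _ "{0..t}"] t by (auto intro!: continuous_intros)
    moreover have "(?g has_derivative (*) ((?e' s - ?c * ?e s) * exp (- ?c * s))) (at s)"
      if "0 < s" "s < t" for s
    proof -
      have s: "s \<in> {0<..<1}" using that t by auto
      have "((\<lambda>t. exp (- ?c * t)) has_real_derivative - ?c * exp (- ?c * s)) (at s)"
        by (auto intro!: derivative_eq_intros)
      from DERIV_mult[OF e'[OF s] this]
      show ?thesis unfolding has_field_derivative_def by (simp add: algebra_simps)
    qed
    ultimately obtain s where "s \<in> {0<..<t}" "?g t - ?g 0 = (?e' s - ?c * ?e s) * exp (- ?c * s) * (t - 0)"
      using mvt[of 0 t ?g "\<lambda>s. (*) ((?e' s - ?c * ?e s) * exp (- ?c * s))"] by auto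
    moreover from this le[of s] t have "(?e' s - ?c * ?e s) * exp (- ?c * s) * (t - 0) \<le> 0"
      by (intro mult_nonpos_nonneg) auto
    ultimately show ?thesis by linarith
  qed simp
  then have "?e t * exp (- ?c * t) \<le> 0" by (simp add: 0)
  then have "?e t \<le> 0" by (simp add: mult_le_0_iff)
  then have "?e t = 0" by (simp add: sum_nonneg antisym)
  then show ?thesis using i assms(1) by (simp add: sum_nonneg_eq_0_iff)
qed

text \<open>Vector-valued functions of varying length are realised in the single Banach space of bounded
  continuous functions on \<open>\<real> \<times> \<real>\<close>: the first argument carries the index, and \<open>peak i\<close> is a
  continuous substitute for the indicator of \<open>i\<close> among the natural numbers.\<close>

definition peak :: "nat \<Rightarrow> real \<Rightarrow> real" where
  "peak i l = max 0 (1 - \<bar>l - real i\<bar>)"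

lemma peak_of_nat: "peak i (real j) = (if j = i then 1 else 0)"
proof (cases "j = i")
  case False
  then have "1 \<le> \<bar>real j - real i\<bar>" by linarith
  then show ?thesis using False by (simp add: peak_def)
qed (simp add: peak_def)

lemma abs_peak_le: "\<bar>peak i l\<bar> \<le> 1"
  by (simp add: peak_def)

definition bmult :: "(real \<Rightarrow>\<^sub>C real) \<Rightarrow> (real \<Rightarrow>\<^sub>C real) \<Rightarrow> (real \<Rightarrow>\<^sub>C real)" where
  "bmult g h = Bcontfun (\<lambda>t. g t * h t)"

definition component :: "nat \<Rightarrow> ((real \<times> real) \<Rightarrow>\<^sub>C real) \<Rightarrow> (real \<Rightarrow>\<^sub>C real)" where
  "component j y = Bcontfun (\<lambda>t. y (real j, t))"

text \<open>Not just an embedding of slot \<open>i\<close>: the function is integrated from 0 as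
  well, so whatever is built from \<open>single\<close> is already the integrated form of an
  equation.\<close>

definition single :: "nat \<Rightarrow> (real \<Rightarrow>\<^sub>C real) \<Rightarrow> ((real \<times> real) \<Rightarrow>\<^sub>C real)" where
  "single i g = Bcontfun (\<lambda>p. peak i (fst p) * integral01 g (snd p))"

lemma apply_bmult: "bmult g h t = g t * h t"
proof -
  have "(\<lambda>t. g t * h t) \<in> bcontfun"
    by (rule bcontfun_normI[of _ "norm g * norm h"])
      (use norm_bounded[of g] norm_bounded[of h] in \<open>auto intro!: continuous_intros mult_mono simp: abs_mult\<close>)
  then show ?thesis by (simp add: bmult_def Bcontfun_inverse)
qed

lemma apply_component: "component j y t = y (real j, t)"
proof -
  have "continuous_on UNIV (\<lambda>t. y (real j, t))"
    by (rule continuous_on_compose2[OF continuous_on_apply_bcontfun[of UNIV y]])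
      (auto intro!: continuous_intros)
  then have "(\<lambda>t. y (real j, t)) \<in> bcontfun"
    by (rule bcontfun_normI[of _ "norm y"]) (rule norm_bounded)
  then show ?thesis by (simp add: component_def Bcontfun_inverse)
qed

lemma continuous_on_integral01: "continuous_on UNIV (integral01 g)"
proof -
  have "continuous_on {0..1} (\<lambda>u. integral {0..u} (apply_bcontfun g))"
    by (rule indefinite_integral_continuous_1[OF integrable_bcontfun])
  then show ?thesis
    unfolding integral01_def
    by (rule continuous_on_compose2[OF _ continuous_on_clamp01]) (auto simp: clamp01_ge clamp01_le)
qed

lemma continuous_on_single:
  fixes f :: "real \<Rightarrow> real"
  assumes "continuous_on UNIV f"
  shows "continuous_on UNIV (\<lambda>p. peak i (fst p) * f (snd p))"
  unfolding peak_def
  by (intro continuous_intros continuous_on_compose2[OF assms]) auto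

lemma apply_single: "single i g p = peak i (fst p) * integral01 g (snd p)"
proof -
  have "\<bar>peak i (fst p) * integral01 g (snd p)\<bar> \<le> 1 * norm g" for p :: "real \<times> real"
    unfolding abs_mult by (intro mult_mono abs_peak_le abs_integral01_le) auto
  then have "(\<lambda>p. peak i (fst p) * integral01 g (snd p)) \<in> bcontfun"
    using bcontfun_normI[OF continuous_on_single[OF continuous_on_integral01], where b = "norm g"] by simp
  then show ?thesis by (simp add: single_def Bcontfun_inverse)
qed

lemma bounded_bilinear_bmult: "bounded_bilinear bmult"
proof (rule bounded_bilinear.intro)
  show "\<exists>K. \<forall>a b. norm (bmult a b) \<le> norm a * norm b * K"
    by (rule exI[of _ 1])
      (auto intro!: norm_bound mult_mono abs_bcontfun_le simp: apply_bmult abs_mult)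
qed (auto intro!: bcontfun_eqI simp: apply_bmult algebra_simps)

lemma bounded_linear_component: "bounded_linear (component j)"
  by (rule bounded_linear_intro[of _ 1])
    (auto intro!: bcontfun_eqI norm_bound abs_bcontfun_le simp: apply_component)

lemma norm_single_le: "norm (single i g) \<le> norm g"
proof (rule norm_bound)
  fix p
  have "\<bar>peak i (fst p)\<bar> * \<bar>integral01 g (snd p)\<bar> \<le> 1 * norm g"
    by (intro mult_mono abs_peak_le abs_integral01_le) auto
  then show "norm (single i g p) \<le> norm g" by (simp add: apply_single abs_mult)
qed

lemma bounded_linear_single: "bounded_linear (single i)"
  by (rule bounded_linear_intro[of _ 1])
    (auto intro!: bcontfun_eqI simp: apply_single integral01_add integral01_scaleR norm_single_le distrib_left)

text \<open>The matrix entry \<open>(i, j)\<close> of a Volterra operator: multiply component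
  \<open>j\<close> by \<open>g\<close>, integrate, store in slot \<open>i\<close>. Being bounded
  linear in \<open>g\<close>, it transfers smooth dependence from coefficients to operators.\<close>

definition volterra :: "nat \<Rightarrow> nat \<Rightarrow> (real \<Rightarrow>\<^sub>C real) \<Rightarrow> ((real \<times> real) \<Rightarrow>\<^sub>C real) \<Rightarrow>\<^sub>L ((real \<times> real) \<Rightarrow>\<^sub>C real)" where
  "volterra i j g = Blinfun (\<lambda>y. single i (bmult g (component j y)))"

lemma apply_volterra: "volterra i j g y = single i (bmult g (component j y))"
  unfolding volterra_def
  by (subst bounded_linear_Blinfun_apply)
    (auto intro!: bounded_linear_compose[OF bounded_linear_single] bounded_linear_compose[OF
        bounded_bilinear.bounded_linear_right[OF bounded_bilinear_bmult]] bounded_linear_component)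

lemma norm_volterra_le: "norm (volterra i j g) \<le> norm g"
proof (rule norm_blinfun_bound)
  fix y
  have "norm (bmult g (component j y)) \<le> norm g * norm y"
    by (rule norm_bound) (auto simp: apply_bmult apply_component abs_mult intro!: mult_mono abs_bcontfun_le)
  then show "norm (volterra i j g y) \<le> norm g * norm y"
    unfolding apply_volterra using norm_single_le order_trans by blast
qed simp

lemma bounded_linear_volterra: "bounded_linear (volterra i j)"
proof (rule bounded_linear_intro[of _ 1])
  interpret m: bounded_bilinear bmult by (rule bounded_bilinear_bmult)
  interpret s: bounded_linear "single i" by (rule bounded_linear_single)
  fix g h :: "real \<Rightarrow>\<^sub>C real" and a :: real
  show "volterra i j (g + h) = volterra i j g + volterra i j h"
    by (rule blinfun_eqI) (simp add: apply_volterra m.add_left s.add blinfun.add_left)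
  show "volterra i j (a *\<^sub>R g) = a *\<^sub>R volterra i j g"
    by (rule blinfun_eqI) (simp add: apply_volterra m.scaleR_left s.scaleR blinfun.scaleR_left)
  show "norm (volterra i j g) \<le> norm g * 1" by (simp add: norm_volterra_le)
qed

lemma bounded_linear_apply_bcontfun: "bounded_linear (\<lambda>y. apply_bcontfun y p)"
  by (rule bounded_linear_intro[of _ 1]) (auto intro: norm_bounded)

lemma smooth_on_resolvent:
  fixes K R :: "'d::real_normed_vector \<Rightarrow> ('v::real_normed_vector \<Rightarrow>\<^sub>L 'v)"
  assumes "open S" "\<And>x. x \<in> S \<Longrightarrow> norm (R x) \<le> C"
    "\<And>x. x \<in> S \<Longrightarrow> R x o\<^sub>L (id_blinfun - K x) = id_blinfun"
    "\<And>x. x \<in> S \<Longrightarrow> (id_blinfun - K x) o\<^sub>L R x = id_blinfun" "smooth_on S K"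
  shows "smooth_on S R"
  unfolding smooth_on_def
proof
  fix k
  show "Ck_on S R k"
    by (rule Ck_on_resolvent[OF assms(1) assms(2) _ _ smooth_on_Ck[OF assms(5)]]) (use assms in auto)
qed

lemma smooth_on_blinfun_apply:
  assumes "open S" "smooth_on S A" "smooth_on S f"
  shows "smooth_on S (\<lambda>x. blinfun_apply (A x) (f x))"
  using assms Ck_on_bilinear[OF assms(1) bounded_bilinear_blinfun_apply] unfolding smooth_on_def
  by blast

lemma sum_apply_bcontfun: "apply_bcontfun (\<Sum>i\<in>I. f i) x = (\<Sum>i\<in>I. apply_bcontfun (f i) x)"
  by (induction I rule: infinite_finite_induct) auto

lemma sum_blinfun_apply: "blinfun_apply (\<Sum>i\<in>I. f i) x = (\<Sum>i\<in>I. blinfun_apply (f i) x)"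
  by (induction I rule: infinite_finite_induct) (auto simp: blinfun.add_left)

text \<open>Holds the initial value of component \<open>i\<close> in an integral equation, and
  serves as a basis vector when matrices are inverted.\<close>

definition const_single :: "nat \<Rightarrow> real \<Rightarrow> ((real \<times> real) \<Rightarrow>\<^sub>C real)" where
  "const_single i a = Bcontfun (\<lambda>p. peak i (fst p) * a)"

lemma apply_const_single: "const_single i a p = peak i (fst p) * a"
proof -
  have "\<bar>peak i (fst p) * a\<bar> \<le> 1 * \<bar>a\<bar>" for p :: "real \<times> real"
    unfolding abs_mult by (intro mult_mono abs_peak_le) auto
  then have "(\<lambda>p. peak i (fst p) * a) \<in> (bcontfun :: (real \<times> real \<Rightarrow> real) set)"
    by (intro bcontfun_normI[OF continuous_on_single[of "\<lambda>_. a"], where b = "\<bar>a\<bar>"]) auto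
  then show ?thesis by (simp add: const_single_def Bcontfun_inverse)
qed

context orthonormal_frame begin

text \<open>The one-form with coefficients \<open>f k\<close>, pulled back to the segment from
  \<open>c\<close> to \<open>x\<close>.\<close>

definition radial :: "'e \<Rightarrow> (nat \<Rightarrow> 'e \<Rightarrow> real) \<Rightarrow> 'e \<Rightarrow> real \<Rightarrow>\<^sub>C real" where
  "radial c f x = (\<Sum>k<n. ((x - c) \<bullet> b k) *\<^sub>R along c 0 (f k) x)"

lemma apply_radial:
  assumes "convex S" "c \<in> S" "x \<in> S" "\<And>k. k < n \<Longrightarrow> smooth_on S (f k)"
  shows "radial c f x t = (\<Sum>k<n. ((x - c) \<bullet> b k) * f k (c + clamp01 t *\<^sub>R (x - c)))"
  unfolding radial_def sum_apply_bcontfun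
  by (rule sum.cong) (auto simp: apply_along[OF assms(1-3) smooth_on_continuous[OF assms(4)]])

lemma smooth_on_coord:
  assumes "open S" shows "smooth_on S (\<lambda>x. (x - c) \<bullet> b k)"
  by (rule smooth_on_bounded_linear[OF assms bounded_linear_inner_left
        smooth_on_diff[OF assms smooth_on_ident[OF assms] smooth_on_const[OF assms]]])

lemma smooth_on_radial:
  assumes "open S" "convex S" "c \<in> S" "\<And>k. k < n \<Longrightarrow> smooth_on S (f k)"
  shows "smooth_on S (radial c f)"
  unfolding radial_def
proof (rule smooth_on_sum[OF assms(1) finite_lessThan])
  fix k assume "k \<in> {..<n}"
  then show "smooth_on S (\<lambda>x. ((x - c) \<bullet> b k) *\<^sub>R along c 0 (f k) x)"
    by (intro smooth_on_scaleR[OF assms(1) smooth_on_coord[OF assms(1)] smooth_on_along[OF assms(1-3)]])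
      (simp add: assms(4))
qed

text \<open>The segment to \<open>c + s *\<^sub>R (x - c)\<close> is the segment to \<open>x\<close>
  run at speed \<open>s\<close>, and one-forms are linear in the velocity.\<close>

lemma radial_scale:
  assumes S: "convex S" "c \<in> S" "x \<in> S" "\<And>k. k < n \<Longrightarrow> smooth_on S (f k)"
    and s: "s \<in> {0..1}" "t \<in> {0..1}"
  shows "radial c f (c + s *\<^sub>R (x - c)) t = s * radial c f x (s * t)"
proof -
  have st: "0 \<le> s * t" "s * t \<le> 1" using s by (auto simp: mult_le_one)
  have "c + s *\<^sub>R (x - c) \<in> S" using s S by (auto intro: ray_in_convex)
  from apply_radial[OF S(1,2) this S(4)] apply_radial[OF S] show ?thesis
    using s st by (simp add: clamp01_id sum_distrib_left mult.assoc mult.commute[of t])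
qed

text \<open>Along the ray to \<open>x\<close> this is an integral equation \<open>y = f\<^sub>x + K\<^sub>x y\<close>; smallness makes
  \<open>1 - K\<^sub>x\<close> invertible, and the inverse depends smoothly on the parameter \<open>x\<close>.\<close>

lemma radial_linear_ode:
  fixes \<Gamma> :: "nat \<Rightarrow> nat \<Rightarrow> nat \<Rightarrow> 'e \<Rightarrow> real" and \<omega> :: "nat \<Rightarrow> nat \<Rightarrow> 'e \<Rightarrow> real"
    and m :: "nat \<Rightarrow> real"
  assumes S: "open S" "convex S" "c \<in> S"
    and \<Gamma>: "\<And>i j k. i < r \<Longrightarrow> j < r \<Longrightarrow> k < n \<Longrightarrow> smooth_on S (\<Gamma> i j k)"
    and \<omega>: "\<And>i k. i < r \<Longrightarrow> k < n \<Longrightarrow> smooth_on S (\<omega> i k)"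
    and small: "\<And>i j x z. i < r \<Longrightarrow> j < r \<Longrightarrow> x \<in> S \<Longrightarrow> z \<in> S \<Longrightarrow>
      \<bar>\<Sum>k<n. ((x - c) \<bullet> b k) * \<Gamma> i j k z\<bar> \<le> \<epsilon>" "real (r * r) * \<epsilon> \<le> 1/2"
  obtains \<mu> where "\<And>i. i < r \<Longrightarrow> smooth_on S (\<mu> i)" "\<And>i. i < r \<Longrightarrow> \<mu> i c = m i"
    "\<And>i x. i < r \<Longrightarrow> x \<in> S \<Longrightarrow> frechet_derivative (\<mu> i) (at x) (x - c) =
      (\<Sum>k<n. ((x - c) \<bullet> b k) * (\<omega> i k x - (\<Sum>j<r. \<Gamma> i j k x * \<mu> j x)))"
proof -
  let ?\<beta> = "\<lambda>i j. radial c (\<Gamma> i j)"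
  let ?o = "\<lambda>i. radial c (\<omega> i)"
  have apb: "?\<beta> i j x t = (\<Sum>k<n. ((x - c) \<bullet> b k) * \<Gamma> i j k (c + clamp01 t *\<^sub>R (x - c)))"
    if "i < r" "j < r" "x \<in> S" for i j x t
    using that \<Gamma> by (intro apply_radial[OF S(2,3)]) auto
  have nb: "norm (?\<beta> i j x) \<le> \<epsilon>" if "i < r" "j < r" "x \<in> S" for i j x
    by (rule norm_bound)
      (use that S small(1) in \<open>auto simp: apb intro!: small(1) ray_in_convex clamp01_ge clamp01_le\<close>)
  \<comment> \<open>With this sign \<open>y = d + K y\<close> says that component \<open>i\<close>
    is its initial value plus the integral of \<open>?o i\<close> minus the sum of
    \<open>?\<beta> i j\<close> times component \<open>j\<close>.\<close>
  define K where "K x = - (\<Sum>i<r. \<Sum>j<r. volterra i j (?\<beta> i j x))" for x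
  have "norm (K x) \<le> 1/2" if x: "x \<in> S" for x
  proof -
    have "norm (K x) \<le> (\<Sum>i<r. \<Sum>j<r. norm (volterra i j (?\<beta> i j x)))"
      unfolding K_def norm_minus_cancel by (rule order_trans[OF norm_sum sum_mono[OF norm_sum]])
    also have "\<dots> \<le> (\<Sum>i<r. \<Sum>j<r. \<epsilon>)"
      by (intro sum_mono order_trans[OF norm_volterra_le nb]) (auto simp: x)
    finally show ?thesis using small(2) by simp
  qed
  then have "\<forall>x. \<exists>R. x \<in> S \<longrightarrow> R o\<^sub>L (id_blinfun - K x) = id_blinfun \<and>
      (id_blinfun - K x) o\<^sub>L R = id_blinfun \<and> norm R \<le> 1 / (1 - 1/2)"
    using neumann_inverse[of "K _" "1/2"] by force
  then obtain R where R: "\<And>x. x \<in> S \<Longrightarrow> R x o\<^sub>L (id_blinfun - K x) = id_blinfun"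
    "\<And>x. x \<in> S \<Longrightarrow> (id_blinfun - K x) o\<^sub>L R x = id_blinfun" "\<And>x. x \<in> S \<Longrightarrow> norm (R x) \<le> 1 / (1 - 1/2)"
    by metis
  have "smooth_on S (\<lambda>x. \<Sum>i<r. \<Sum>j<r. volterra i j (?\<beta> i j x))"
  proof (rule smooth_on_sum[OF S(1) finite_lessThan], rule smooth_on_sum[OF S(1) finite_lessThan])
    fix i j assume "i \<in> {..<r}" "j \<in> {..<r}"
    then have "smooth_on S (?\<beta> i j)" using \<Gamma> by (intro smooth_on_radial[OF S]) auto
    then show "smooth_on S (\<lambda>x. volterra i j (?\<beta> i j x))"
      by (rule smooth_on_bounded_linear[OF S(1) bounded_linear_volterra])
  qed
  from smooth_on_bounded_linear[OF S(1) bounded_linear_minus[OF bounded_linear_ident] this]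
  have "smooth_on S K" unfolding K_def .
  from smooth_on_resolvent[OF S(1) R(3,1,2) this] have Rs: "smooth_on S R" .
  define d where "d x = (\<Sum>i<r. single i (?o i x) + const_single i (m i))" for x
  have ds: "smooth_on S d"
    unfolding d_def
  proof (rule smooth_on_sum[OF S(1) finite_lessThan])
    fix i assume "i \<in> {..<r}"
    then have "smooth_on S (?o i)" using \<omega> by (intro smooth_on_radial[OF S]) auto
    from smooth_on_add[OF S(1) smooth_on_bounded_linear[OF S(1) bounded_linear_single this] smooth_on_const[OF S(1)]]
    show "smooth_on S (\<lambda>x. single i (?o i x) + const_single i (m i))" .
  qed
  define y where "y x = R x (d x)" for x
  have ys: "smooth_on S y" unfolding y_def by (rule smooth_on_blinfun_apply[OF S(1) Rs ds])
  define F where "F i x = ?o i x - (\<Sum>j<r. bmult (?\<beta> i j x) (component j (y x)))" for i x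
  have F: "F i x t = ?o i x t - (\<Sum>j<r. ?\<beta> i j x t * y x (real j, t))" for i x t
    by (simp add: F_def sum_apply_bcontfun apply_bmult apply_component)
  have yF: "y x (real i, t) = m i + integral01 (F i x) t" if x: "x \<in> S" and i: "i < r" for x i t
  proof -
    interpret I: bounded_linear "\<lambda>g. integral01 g t" by (rule bounded_linear_integral01)
    have "y x - K x (y x) = d x"
      using arg_cong[OF R(2)[OF x], of "\<lambda>A. A (d x)"] by (simp add: y_def blinfun.diff_left)
    then have "y x (real i, t) - K x (y x) (real i, t) = d x (real i, t)"
      by (metis minus_bcontfun.rep_eq)
    moreover have "K x (y x) (real i, t) = - (\<Sum>j<r. integral01 (bmult (?\<beta> i j x) (component j (y x))) t)"
    proof -
      let ?g = "\<lambda>l j. integral01 (bmult (?\<beta> l j x) (component j (y x))) t"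
      have "K x (y x) (real i, t) = - (\<Sum>l<r. \<Sum>j<r. peak l (real i) * ?g l j)"
        by (simp add: K_def blinfun.minus_left sum_blinfun_apply sum_apply_bcontfun apply_volterra apply_single)
      also have "(\<Sum>l<r. \<Sum>j<r. peak l (real i) * ?g l j) = (\<Sum>l<r. if i = l then \<Sum>j<r. ?g l j else 0)"
        by (intro sum.cong) (auto simp: peak_of_nat)
      finally show ?thesis using i by simp
    qed
    moreover have "d x (real i, t) = m i + integral01 (?o i x) t"
      using i by (simp add: d_def sum_apply_bcontfun sum.distrib apply_single apply_const_single peak_of_nat
          if_distrib[of "\<lambda>a. a * _"] cong: if_cong)
    ultimately show ?thesis by (simp add: F_def I.diff I.sum)
  qed
  have dy: "((\<lambda>t. y x (real i, t)) has_real_derivative F i x t) (at t within {0..1})"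
    if "x \<in> S" "i < r" "t \<in> {0..1}" for x i t
    using DERIV_add[OF DERIV_const has_derivative_integral01[OF that(3), of "F i x"], of "m i"]
    by (simp add: yF[OF that(1,2)])
  \<comment> \<open>Each end point has its own ray and its own integral equation. Uniqueness shows
    that these solutions fit together: the value at the end of a shorter ray is the intermediate
    value on the longer one.\<close>
  have scale: "y (c + s *\<^sub>R (x - c)) (real i, 1) = y x (real i, s)" if x: "x \<in> S" and s: "s \<in> {0..1}" and i: "i < r" for x s i
  proof -
    let ?x = "c + s *\<^sub>R (x - c)"
    let ?w = "\<lambda>i t. y ?x (real i, t) - y x (real i, s * t)"
    have x': "?x \<in> S" using s S x by (auto intro: ray_in_convex)
    have "?w i 1 = 0"
    proof (rule linear_ode_zero[of "{..<r}" ?w "\<lambda>i j t. - ?\<beta> i j ?x t" \<epsilon>])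
      fix i t assume i: "i \<in> {..<r}" and t': "t \<in> {0<..<1::real}"
      then have t: "t \<in> {0..1}" by simp
      have st: "s * t \<in> {0..1}" using s t by (auto simp: mult_le_one)
      have "((\<lambda>t. y x (real i, t)) has_real_derivative F i x (s * t)) (at (s * t) within (*) s ` {0..1})"
        by (rule DERIV_subset[OF dy[OF x _ st]]) (use i s in \<open>auto simp: mult_le_one\<close>)
      from DERIV_image_chain[OF this DERIV_cmult_Id]
      have "((\<lambda>t. y x (real i, s * t)) has_real_derivative F i x (s * t) * s) (at t within {0..1})"
        by (simp add: o_def)
      from DERIV_diff[OF dy[OF x' _ t, of i] this]
      have "(?w i has_real_derivative F i ?x t - F i x (s * t) * s) (at t within {0..1})" using i by simp
      moreover have "F i ?x t - F i x (s * t) * s = (\<Sum>j<r. - ?\<beta> i j ?x t * ?w j t)"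
      proof -
        have "?o i ?x t = s * ?o i x (s * t)" using \<omega> i by (intro radial_scale[OF S(2,3) x _ s t]) auto
        moreover have "?\<beta> i j ?x t = s * ?\<beta> i j x (s * t)" if "j < r" for j
          using \<Gamma> i that by (intro radial_scale[OF S(2,3) x _ s t]) auto
        ultimately show ?thesis
          unfolding F by (simp add: algebra_simps sum_distrib_left sum_subtractf sum_negf)
      qed
      ultimately show "(?w i has_real_derivative (\<Sum>j\<in>{..<r}. - ?\<beta> i j ?x t * ?w j t)) (at t)"
        using at_within_Icc_at[of 0 t 1] t' by simp
    next
      fix i
      have "continuous_on {0..1} (\<lambda>t. y z (real i, g t))" if "continuous_on {0..1} g" for z g
        by (rule continuous_on_compose2[OF continuous_on_apply_bcontfun[of UNIV]])
          (auto intro!: continuous_intros that)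
      from continuous_on_diff[OF this[OF continuous_on_id] this[OF continuous_on_mult_left[OF continuous_on_id]]]
      show "continuous_on {0..1} (?w i)" .
    next
      fix i j t assume "i \<in> {..<r}" "j \<in> {..<r}"
      then show "\<bar>- ?\<beta> i j ?x t\<bar> \<le> \<epsilon>" using abs_bcontfun_le[of "?\<beta> i j ?x" t] nb[OF _ _ x', of i j] by simp
    next
      fix i assume "i \<in> {..<r}"
      then show "?w i 0 = 0" using yF[OF x', of i 0] yF[OF x, of i 0]
        by (simp add: integral01_def clamp01_id)
    qed (use i in auto)
    then show ?thesis by simp
  qed
  \<comment> \<open>The function on \<open>S\<close> is read off at the end of each ray.\<close>
  let ?\<mu> = "\<lambda>i x. y x (real i, 1)"
  have ms: "smooth_on S (?\<mu> i)" for i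
    by (rule smooth_on_bounded_linear[OF S(1) bounded_linear_apply_bcontfun ys])
  show thesis
  proof (rule that[of ?\<mu>])
    show "smooth_on S (?\<mu> i)" for i by (rule ms)
    show "?\<mu> i c = m i" if "i < r" for i
      using scale[OF S(3), of 0 i] yF[OF S(3) that, of 0] that by (simp add: integral01_def clamp01_id)
    fix i x assume i: "i < r" and x: "x \<in> S"
    have D: "(?\<mu> i has_derivative frechet_derivative (?\<mu> i) (at x)) (at x)"
      by (rule smooth_on_has_derivative[OF ms x])
    have g: "((\<lambda>s. c + s *\<^sub>R (x - c)) has_derivative (\<lambda>s. s *\<^sub>R (x - c))) (at 1 within {0..1})"
      by (auto intro!: derivative_eq_intros)
    have "((\<lambda>s. ?\<mu> i (c + s *\<^sub>R (x - c))) has_derivative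
        (\<lambda>s. frechet_derivative (?\<mu> i) (at x) (s *\<^sub>R (x - c)))) (at 1 within {0..1})"
      by (rule has_derivative_compose[OF g]) (use D in simp)
    then have 1: "((\<lambda>s. ?\<mu> i (c + s *\<^sub>R (x - c))) has_vector_derivative
        frechet_derivative (?\<mu> i) (at x) (x - c)) (at 1 within {0..1})"
      using linear_scale[OF has_derivative_linear[OF D]] by (simp add: has_vector_derivative_def)
    \<comment> \<open>By \<open>scale\<close> this curve is the solution on the ray to
      \<open>x\<close>, so the differential equation gives its one-sided derivative at the end. The
      chain rule gave the same derivative above as a radial derivative of
      \<open>?\<mu> i\<close>.\<close>
    have "((\<lambda>s. ?\<mu> i (c + s *\<^sub>R (x - c))) has_real_derivative F i x 1) (at 1 within {0..1})"
      by (rule has_field_derivative_transform_within[OF dy[OF x i], of 1 1]) (use scale[OF x] i in auto)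
    then have 2: "((\<lambda>s. ?\<mu> i (c + s *\<^sub>R (x - c))) has_vector_derivative F i x 1) (at 1 within {0..1})"
      by (simp add: has_real_derivative_iff_has_vector_derivative)
    have "frechet_derivative (?\<mu> i) (at x) (x - c) = F i x 1"
      by (rule vector_derivative_unique_within[OF _ 1 2]) (simp add: trivial_limit_within)
    also have "\<dots> = (\<Sum>k<n. ((x - c) \<bullet> b k) * \<omega> i k x) - (\<Sum>j<r. (\<Sum>k<n. ((x - c) \<bullet> b k) * \<Gamma> i j k x) * y x (real j, 1))"
      unfolding F using i x \<omega> apb[OF i _ x] by (simp add: apply_radial[OF S(2,3) x] clamp01_id)
    also have "(\<Sum>j<r. (\<Sum>k<n. ((x - c) \<bullet> b k) * \<Gamma> i j k x) * y x (real j, 1)) =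
        (\<Sum>k<n. ((x - c) \<bullet> b k) * (\<Sum>j<r. \<Gamma> i j k x * y x (real j, 1)))"
      unfolding sum_distrib_left sum_distrib_right by (subst sum.swap) (simp add: mult.assoc)
    also have "(\<Sum>k<n. ((x - c) \<bullet> b k) * \<omega> i k x) - \<dots> =
        (\<Sum>k<n. ((x - c) \<bullet> b k) * (\<omega> i k x - (\<Sum>j<r. \<Gamma> i j k x * y x (real j, 1))))"
      by (simp add: right_diff_distrib sum_subtractf)
    finally show "frechet_derivative (?\<mu> i) (at x) (x - c) =
        (\<Sum>k<n. ((x - c) \<bullet> b k) * (\<omega> i k x - (\<Sum>j<r. \<Gamma> i j k x * ?\<mu> j x)))" .
  qed
qed

end

subsection \<open>Inverse matrices\<close>

text \<open>The matrix is realised as \<open>1 - K x\<close> on the function space, with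
  \<open>K p = 0\<close>. Near \<open>p\<close> the norm of \<open>K\<close> is at most one half, so
  the inverse is a resolvent and is smooth; its entries are read off on the vectors
  \<open>e l\<close>.\<close>

lemma smooth_matrix_inverse:
  fixes G :: "nat \<Rightarrow> nat \<Rightarrow> 'd::real_normed_vector \<Rightarrow> real"
  assumes S: "open S" "p \<in> S" and G: "\<And>k j. k < m \<Longrightarrow> j < m \<Longrightarrow> smooth_on S (G k j)"
    and 1: "\<And>k j. k < m \<Longrightarrow> j < m \<Longrightarrow> G k j p = (if k = j then 1 else 0)"
  obtains T H where "open T" "p \<in> T" "T \<subseteq> S" "\<And>k l. smooth_on T (H k l)"
    "\<And>x k j. x \<in> T \<Longrightarrow> k < m \<Longrightarrow> j < m \<Longrightarrow> (\<Sum>l<m. H k l x * G l j x) = (if k = j then 1 else 0)"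
proof -
  define e where "e k = const_single k 1" for k
  \<comment> \<open>Elementary matrices. The second argument of the functions is idle for matrices
    and is fixed at 0.\<close>
  define U where "U k j = Blinfun (\<lambda>y. apply_bcontfun y (real j, 0::real) *\<^sub>R e k)" for k j
  have U: "U k j y = y (real j, 0) *\<^sub>R e k" for k j y
    unfolding U_def
    by (rule bounded_linear_Blinfun_apply[THEN fun_cong])
      (rule bounded_linear_compose[OF bounded_linear_scaleR_left bounded_linear_apply_bcontfun])
  have e: "e l (real k, 0) = (if k = l then 1 else 0)" for k l
    by (simp add: e_def apply_const_single peak_of_nat)
  define d where "d k j x = (if k = j then 1 else 0) - G k j x" for k j x
  have ds: "smooth_on S (d k j)" if "k < m" "j < m" for k j
    unfolding d_def by (rule smooth_on_diff[OF S(1) smooth_on_const[OF S(1)] G[OF that]])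
  define K where "K x = (\<Sum>k<m. \<Sum>j<m. d k j x *\<^sub>R U k j)" for x
  have Ks: "smooth_on S K"
    unfolding K_def
  proof (rule smooth_on_sum[OF S(1) finite_lessThan], rule smooth_on_sum[OF S(1) finite_lessThan])
    fix k j assume "k \<in> {..<m}" "j \<in> {..<m}"
    then show "smooth_on S (\<lambda>x. d k j x *\<^sub>R U k j)"
      by (intro smooth_on_scaleR[OF S(1) ds smooth_on_const[OF S(1)]]) auto
  qed
  have "K p = 0" by (auto simp: K_def d_def 1 intro!: sum.neutral)
  moreover have "\<exists>\<delta>>0. \<forall>x\<in>S. dist x p < \<delta> \<longrightarrow> dist (K x) (K p) < 1/2"
    using smooth_on_continuous[OF Ks] S(2) unfolding continuous_on_iff by (metis half_gt_zero zero_less_one)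
  ultimately obtain \<delta> where \<delta>: "\<delta> > 0" "\<And>x. x \<in> S \<Longrightarrow> dist x p < \<delta> \<Longrightarrow> norm (K x) < 1/2"
    by auto
  define T where "T = S \<inter> ball p \<delta>"
  have T: "open T" "p \<in> T" "T \<subseteq> S" using S \<delta>(1) by (auto simp: T_def)
  have KT: "norm (K x) \<le> 1/2" if "x \<in> T" for x
    using \<delta>(2)[of x] that by (simp add: T_def dist_commute less_imp_le)
  then have "\<forall>x. \<exists>R. x \<in> T \<longrightarrow> R o\<^sub>L (id_blinfun - K x) = id_blinfun \<and>
      (id_blinfun - K x) o\<^sub>L R = id_blinfun \<and> norm R \<le> 1 / (1 - 1/2)"
    using neumann_inverse[of "K _" "1/2"] by force
  then obtain R where R: "\<And>x. x \<in> T \<Longrightarrow> R x o\<^sub>L (id_blinfun - K x) = id_blinfun"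
    "\<And>x. x \<in> T \<Longrightarrow> (id_blinfun - K x) o\<^sub>L R x = id_blinfun" "\<And>x. x \<in> T \<Longrightarrow> norm (R x) \<le> 1 / (1 - 1/2)"
    by metis
  have Rs: "smooth_on T R"
    by (rule smooth_on_resolvent[OF T(1) R(3,1,2) smooth_on_subset[OF Ks T(3)]])
  let ?H = "\<lambda>k l x. R x (e l) (real k, 0)"
  have "smooth_on T (?H k l)" for k l
    by (rule smooth_on_bounded_linear[OF T(1) bounded_linear_apply_bcontfun
          smooth_on_blinfun_apply[OF T(1) Rs smooth_on_const[OF T(1)]]])
  moreover have "(\<Sum>l<m. ?H k l x * G l j x) = (if k = j then 1 else 0)" if x: "x \<in> T" and k: "k < m" and j: "j < m" for x k j
  proof -
    have "K x (e j) = (\<Sum>k<m. d k j x *\<^sub>R e k)"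
    proof -
      have "K x (e j) = (\<Sum>k<m. \<Sum>i<m. if i = j then d k i x *\<^sub>R e k else 0)"
        unfolding K_def sum_blinfun_apply by (intro sum.cong) (auto simp: U e blinfun.scaleR_left)
      then show ?thesis using j by simp
    qed
    also have "\<dots> = (\<Sum>k<m. (if k = j then e k else 0) - G k j x *\<^sub>R e k)"
      by (intro sum.cong) (auto simp: d_def scaleR_diff_left)
    also have "\<dots> = e j - (\<Sum>k<m. G k j x *\<^sub>R e k)" using j by (simp add: sum_subtractf)
    finally have "e j - K x (e j) = (\<Sum>k<m. G k j x *\<^sub>R e k)" by simp
    moreover have "R x (e j - K x (e j)) = e j"
      using arg_cong[OF R(1)[OF x], of "\<lambda>A. A (e j)"] by (simp add: blinfun.diff_left)
    ultimately have "(\<Sum>l<m. G l j x *\<^sub>R R x (e l)) = e j"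
      by (simp add: blinfun.sum_right blinfun.scaleR_right)
    from arg_cong[OF this, of "\<lambda>y. y (real k, 0)"] show ?thesis
      by (simp add: sum_apply_bcontfun e mult.commute)
  qed
  ultimately show thesis using that[OF T, of ?H] by blast
qed

section \<open>Smooth functions and derivations on a manifold\<close>

text \<open>The ball is a closed subset of a cube spanned by the frame, and cubes are compact by
  induction on the number of edges, each step being an image of a product with an interval.\<close>

lemma (in orthonormal_frame) compact_cball: "compact (cball (c::'e) R)"
proof (cases "R \<ge> 0")
  case True
  have "compact {x. \<exists>t. (\<forall>i<k. \<bar>t i\<bar> \<le> R) \<and> x = (\<Sum>i<k. t i *\<^sub>R b i)}" (is "compact (?P k)") for k
  proof (induction k)
    case (Suc k)
    have "?P (Suc k) = (\<lambda>(x, s). x + s *\<^sub>R b k) ` (?P k \<times> {-R..R})" (is "?L = ?R")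
    proof (intro subset_antisym subsetI)
      fix x assume "x \<in> ?L"
      then obtain t where t: "\<forall>i<Suc k. \<bar>t i\<bar> \<le> R" "x = (\<Sum>i<Suc k. t i *\<^sub>R b i)" by blast
      have "(\<Sum>i<k. t i *\<^sub>R b i) \<in> ?P k" using t(1) by (intro CollectI exI[of _ t]) auto
      moreover have "t k \<in> {-R..R}" using t(1)[rule_format, of k] by (simp add: abs_le_iff)
      ultimately have "((\<Sum>i<k. t i *\<^sub>R b i), t k) \<in> ?P k \<times> {-R..R}" by blast
      then show "x \<in> ?R" using t(2) by (intro image_eqI[where x = "((\<Sum>i<k. t i *\<^sub>R b i), t k)"]) auto
    next
      fix x assume "x \<in> ?R"
      then obtain t s where t: "\<forall>i<k. \<bar>t i\<bar> \<le> R" "s \<in> {-R..R}" "x = (\<Sum>i<k. t i *\<^sub>R b i) + s *\<^sub>R b k"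
        by auto
      have "x = (\<Sum>i<Suc k. (t(k := s)) i *\<^sub>R b i)" using t(3) by simp
      moreover have "\<forall>i<Suc k. \<bar>(t(k := s)) i\<bar> \<le> R" using t by (auto simp: less_Suc_eq)
      ultimately show "x \<in> ?L" by blast
    qed
    moreover have "compact \<dots>"
      by (rule compact_continuous_image)
        (auto intro!: continuous_intros compact_Times Suc simp: split_def)
    ultimately show ?case by simp
  qed simp
  moreover have "cball 0 R \<subseteq> ?P n"
  proof
    fix x :: 'e assume "x \<in> cball 0 R"
    then have "\<bar>x \<bullet> b i\<bar> \<le> R" if "i < n" for i
      using abs_coord_le[OF that, of x] by simp
    then have "(\<forall>i<n. \<bar>x \<bullet> b i\<bar> \<le> R) \<and> x = (\<Sum>i<n. (x \<bullet> b i) *\<^sub>R b i)"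
      using expand by blast
    then show "x \<in> ?P n" by (intro CollectI exI[of _ "\<lambda>i. x \<bullet> b i"])
  qed
  ultimately have "compact (cball (0::'e) R)"
    using compact_Int_closed[of "?P n" "cball 0 R"] by (simp add: Int_absorb1)
  from compact_translation[OF this, of c] show ?thesis by (simp add: cball_translation)
qed simp

locale manifold = orthonormal_frame b n
  for b :: "nat \<Rightarrow> 'e::real_inner" and n :: nat +
  fixes M :: "('m::{t2_space, second_countable_topology}, 'e) atlas"
  assumes smooth_manifold: "smooth_manifold M"
begin

section \<open>Charts, smooth functions on open sets and cut-offs\<close>

lemma chart:
  assumes "(U, \<phi>) \<in> M"
  shows "open U" "open (\<phi> ` U)" "homeomorphism U (\<phi> ` U) \<phi> (inv_into U \<phi>)"
    and "\<And>x. x \<in> U \<Longrightarrow> inv_into U \<phi> (\<phi> x) = x"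
    and "continuous_on U \<phi>" "continuous_on (\<phi> ` U) (inv_into U \<phi>)"
  using smooth_manifold assms unfolding smooth_manifold_def by (auto simp: homeomorphism_def)

lemma chart_cover: obtains U \<phi> where "(U, \<phi>) \<in> M" "x \<in> U"
  using smooth_manifold unfolding smooth_manifold_def by blast

lemma chart_transition:
  "(U, \<phi>) \<in> M \<Longrightarrow> (V, \<psi>) \<in> M \<Longrightarrow> smooth_on (\<phi> ` (U \<inter> V)) (\<psi> \<circ> inv_into U \<phi>)"
  using smooth_manifold unfolding smooth_manifold_def by blast

lemma chart_open_image:
  assumes "(U, \<phi>) \<in> M" "open V" "V \<subseteq> U" shows "open (\<phi> ` V)"
proof -
  have "openin (top_of_set (\<phi> ` U)) (\<phi> ` V)"
    using homeomorphism_imp_open_map[OF chart(3)[OF assms(1)]] assms(2,3) chart(1)[OF assms(1)]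
    by (simp add: openin_open_eq)
  then show ?thesis using chart(2)[OF assms(1)] by (simp add: openin_open_eq)
qed

lemma chart_open_preimage:
  assumes "(U, \<phi>) \<in> M" "open B" shows "open (U \<inter> \<phi> -` B)"
  using continuous_open_preimage[OF chart(5)[OF assms(1)] chart(1)[OF assms(1)] assms(2)] .

lemma smooth_fun_onI:
  "(\<And>U \<phi>. (U, \<phi>) \<in> M \<Longrightarrow> smooth_on (\<phi> ` (U \<inter> W)) (f \<circ> inv_into U \<phi>)) \<Longrightarrow> smooth_fun_on M W f"
  unfolding smooth_fun_on_def by blast

lemma smooth_fun_onD:
  "smooth_fun_on M W f \<Longrightarrow> (U, \<phi>) \<in> M \<Longrightarrow> smooth_on (\<phi> ` (U \<inter> W)) (f \<circ> inv_into U \<phi>)"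
  by (auto simp: smooth_fun_on_def)

lemma smooth_fun_on_local:
  assumes "open W" "\<And>y. y \<in> W \<Longrightarrow> \<exists>V. open V \<and> y \<in> V \<and> smooth_fun_on M V f"
  shows "smooth_fun_on M W f"
  unfolding smooth_fun_on_def
proof safe
  fix U \<phi> assume c: "(U, \<phi>) \<in> M"
  show "smooth_on (\<phi> ` (U \<inter> W)) (f \<circ> inv_into U \<phi>)"
  proof (rule smooth_on_local)
    fix p assume "p \<in> \<phi> ` (U \<inter> W)"
    then obtain y where y: "y \<in> U" "y \<in> W" "p = \<phi> y" by auto
    then obtain V where V: "open V" "y \<in> V" "smooth_fun_on M V f" using assms by blast
    have "open (\<phi> ` (U \<inter> V))" using chart(1)[OF c] V by (intro chart_open_image[OF c]) auto
    then show "\<exists>T. open T \<and> p \<in> T \<and> smooth_on T (f \<circ> inv_into U \<phi>)"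
      using smooth_fun_onD[OF V(3) c] y V(2) by blast
  qed
qed

lemma smooth_fun_on_cong:
  assumes "open W" "\<And>y. y \<in> W \<Longrightarrow> f y = g y"
  shows "smooth_fun_on M W f \<longleftrightarrow> smooth_fun_on M W g"
proof -
  have "smooth_on (\<phi> ` (U \<inter> W)) (f \<circ> inv_into U \<phi>) \<longleftrightarrow> smooth_on (\<phi> ` (U \<inter> W)) (g \<circ> inv_into U \<phi>)"
    if c: "(U, \<phi>) \<in> M" for U \<phi>
    by (rule smooth_on_cong[OF chart_open_image[OF c]])
      (use assms chart[OF c] in auto)
  then show ?thesis unfolding smooth_fun_on_def by blast
qed

lemma smooth_fun_on_subset: "smooth_fun_on M W f \<Longrightarrow> V \<subseteq> W \<Longrightarrow> smooth_fun_on M V f"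
  by (rule smooth_fun_onI) (rule smooth_on_subset[OF smooth_fun_onD], auto)

lemma open_chart_image: "open W \<Longrightarrow> (U, \<phi>) \<in> M \<Longrightarrow> open (\<phi> ` (U \<inter> W))"
  using chart_open_image chart(1) by (metis Int_lower1 open_Int)

lemma smooth_fun_on_const: "open W \<Longrightarrow> smooth_fun_on M W (\<lambda>x. a)"
  by (rule smooth_fun_onI) (simp add: o_def smooth_on_const open_chart_image)

lemma smooth_fun_on_add:
  assumes "open W" "smooth_fun_on M W f" "smooth_fun_on M W g"
  shows "smooth_fun_on M W (\<lambda>x. f x + g x)"
proof (rule smooth_fun_onI)
  fix U \<phi> assume c: "(U, \<phi>) \<in> M"
  from smooth_on_add[OF open_chart_image[OF assms(1) c] smooth_fun_onD[OF assms(2) c] smooth_fun_onD[OF assms(3) c]]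
  show "smooth_on (\<phi> ` (U \<inter> W)) ((\<lambda>x. f x + g x) \<circ> inv_into U \<phi>)" by (simp add: o_def)
qed

lemma smooth_fun_on_mult:
  assumes "open W" "smooth_fun_on M W f" "smooth_fun_on M W g"
  shows "smooth_fun_on M W (\<lambda>x. f x * g x)"
proof (rule smooth_fun_onI)
  fix U \<phi> assume c: "(U, \<phi>) \<in> M"
  from smooth_on_mult[OF open_chart_image[OF assms(1) c] smooth_fun_onD[OF assms(2) c] smooth_fun_onD[OF assms(3) c]]
  show "smooth_on (\<phi> ` (U \<inter> W)) ((\<lambda>x. f x * g x) \<circ> inv_into U \<phi>)" by (simp add: o_def)
qed

lemma smooth_fun_on_sum:
  assumes "open W" "finite I" "\<And>i. i \<in> I \<Longrightarrow> smooth_fun_on M W (f i)"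
  shows "smooth_fun_on M W (\<lambda>x. \<Sum>i\<in>I. f i x)"
  using assms(2,3)
  by (induction I) (auto intro: smooth_fun_on_add smooth_fun_on_const assms(1))

lemma C_inf_const: "(\<lambda>x. a) \<in> C_inf M"
  and C_inf_add: "f \<in> C_inf M \<Longrightarrow> g \<in> C_inf M \<Longrightarrow> (\<lambda>x. f x + g x) \<in> C_inf M"
  and C_inf_mult: "f \<in> C_inf M \<Longrightarrow> g \<in> C_inf M \<Longrightarrow> (\<lambda>x. f x * g x) \<in> C_inf M"
  and C_inf_sum: "finite I \<Longrightarrow> (\<And>i. i \<in> I \<Longrightarrow> h i \<in> C_inf M) \<Longrightarrow> (\<lambda>x. \<Sum>i\<in>I. h i x) \<in> C_inf M"
  by (auto simp: C_inf_def intro: smooth_fun_on_const smooth_fun_on_add smooth_fun_on_mult smooth_fun_on_sum)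

lemma C_inf_cmult: "f \<in> C_inf M \<Longrightarrow> (\<lambda>x. a * f x) \<in> C_inf M"
  using C_inf_mult[OF C_inf_const] .

lemma C_inf_diff: "f \<in> C_inf M \<Longrightarrow> g \<in> C_inf M \<Longrightarrow> (\<lambda>x. f x - g x) \<in> C_inf M"
  using C_inf_add[of f "\<lambda>x. (-1) * g x"] C_inf_cmult[of g "-1"] by simp

lemma C_inf_smooth_on: "f \<in> C_inf M \<Longrightarrow> smooth_fun_on M W f"
  unfolding C_inf_def using smooth_fun_on_subset by blast

lemma C_infD: "f \<in> C_inf M \<Longrightarrow> (U, \<phi>) \<in> M \<Longrightarrow> smooth_on (\<phi> ` U) (f \<circ> inv_into U \<phi>)"
  using smooth_fun_onD[of UNIV f U \<phi>] by (simp add: C_inf_def)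

text \<open>One chart that contains \<open>W\<close> suffices, since the other charts are reached
  through smooth transition maps.\<close>

lemma smooth_fun_on_chartI:
  assumes c: "(U, \<phi>) \<in> M" and W: "open W" "W \<subseteq> U" and f: "smooth_on (\<phi> ` W) (f \<circ> inv_into U \<phi>)"
  shows "smooth_fun_on M W f"
  unfolding smooth_fun_on_def
proof safe
  fix V \<psi> assume d: "(V, \<psi>) \<in> M"
  have t: "smooth_on (\<psi> ` (V \<inter> W)) (\<phi> \<circ> inv_into V \<psi>)"
    by (rule smooth_on_subset[OF chart_transition[OF d c]]) (use W(2) in auto)
  have "smooth_on (\<psi> ` (V \<inter> W)) (\<lambda>p. (f \<circ> inv_into U \<phi>) ((\<phi> \<circ> inv_into V \<psi>) p))"
  proof (rule smooth_on_compose[OF open_chart_image[OF W(1) d] chart_open_image[OF c W] _ t f])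
    show "(\<phi> \<circ> inv_into V \<psi>) ` \<psi> ` (V \<inter> W) \<subseteq> \<phi> ` W" using chart(4)[OF d] by auto
  qed
  from _ this show "smooth_on (\<psi> ` (V \<inter> W)) (f \<circ> inv_into V \<psi>)"
  proof (rule smooth_on_cong[THEN iffD1, OF open_chart_image[OF W(1) d]])
    fix p assume "p \<in> \<psi> ` (V \<inter> W)"
    then show "(f \<circ> inv_into U \<phi>) ((\<phi> \<circ> inv_into V \<psi>) p) = (f \<circ> inv_into V \<psi>) p"
      using chart(4)[OF d] chart(4)[OF c] W(2) by auto
  qed
qed

lemma smooth_fun_on_chart_comp:
  assumes c: "(U, \<phi>) \<in> M" and W: "open W" "W \<subseteq> U" and g: "smooth_on (\<phi> ` W) g"
  shows "smooth_fun_on M W (\<lambda>x. g (\<phi> x))"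
proof (rule smooth_fun_on_chartI[OF c W])
  show "smooth_on (\<phi> ` W) ((\<lambda>x. g (\<phi> x)) \<circ> inv_into U \<phi>)"
    using g by (rule smooth_on_cong[THEN iffD2, rotated 2])
      (use chart_open_image[OF c W] chart(4)[OF c] W(2) in auto)
qed

text \<open>The open sets \<open>W\<close> and \<open>- C\<close> cover the manifold, and on the
  second one the function is zero. This is the device that makes local data global.\<close>

lemma C_inf_extend:
  assumes "open W" "closed C" "C \<subseteq> W" "\<kappa> \<in> C_inf M" "\<And>x. x \<notin> C \<Longrightarrow> \<kappa> x = 0" "smooth_fun_on M W f"
  shows "(\<lambda>x. if x \<in> W then \<kappa> x * f x else 0) \<in> C_inf M"
  unfolding C_inf_def mem_Collect_eq
proof (rule smooth_fun_on_local)
  fix x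
  show "\<exists>V. open V \<and> x \<in> V \<and> smooth_fun_on M V (\<lambda>x. if x \<in> W then \<kappa> x * f x else 0)"
  proof (cases "x \<in> W")
    case True
    have "smooth_fun_on M W (\<lambda>x. \<kappa> x * f x)"
      by (rule smooth_fun_on_mult[OF assms(1) C_inf_smooth_on[OF assms(4)] assms(6)])
    then have "smooth_fun_on M W (\<lambda>x. if x \<in> W then \<kappa> x * f x else 0)"
      by (subst smooth_fun_on_cong[OF assms(1)]) auto
    then show ?thesis using True assms(1) by blast
  next
    case False
    have "smooth_fun_on M (- C) (\<lambda>x. if x \<in> W then \<kappa> x * f x else 0)"
      using assms(2,5) by (subst smooth_fun_on_cong[where g = "\<lambda>_. 0"]) (auto intro: smooth_fun_on_const)
    then show ?thesis using False assms(2,3) by blast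
  qed
qed simp

text \<open>Supplies everything needed to localise at \<open>y\<close>: a coordinate ball
  \<open>W\<close>, and a cut-off that is 1 on \<open>W\<close> and vanishes off a closed set inside
  the prescribed neighbourhood.\<close>

lemma coordinate_ball_in_chart:
  assumes c: "(U, \<phi>) \<in> M" "y \<in> U" and "open O'" "y \<in> O'"
  obtains W \<epsilon> \<kappa> C where "\<epsilon> > 0" "open W" "y \<in> W" "W \<subseteq> U" "\<phi> ` W = ball (\<phi> y) \<epsilon>"
    "W \<subseteq> C" "closed C" "C \<subseteq> O'" "C \<subseteq> U" "\<kappa> \<in> C_inf M"
    "\<And>x. x \<in> W \<Longrightarrow> \<kappa> x = 1" "\<And>x. x \<notin> C \<Longrightarrow> \<kappa> x = (0::real)"
proof -
  have "open (\<phi> ` (U \<inter> O'))" using assms(3) c(1) by (rule open_chart_image)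
  moreover have "\<phi> y \<in> \<phi> ` (U \<inter> O')" using assms c by auto
  ultimately obtain \<delta> where \<delta>: "\<delta> > 0" "ball (\<phi> y) \<delta> \<subseteq> \<phi> ` (U \<inter> O')" using openE by blast
  \<comment> \<open>A third of the radius leaves room for the closed ball of radius
    \<open>2 * \<epsilon>\<close> outside which the cut-off vanishes.\<close>
  define \<epsilon> where "\<epsilon> = \<delta> / 3"
  have \<epsilon>: "\<epsilon> > 0" "cball (\<phi> y) (2 * \<epsilon>) \<subseteq> \<phi> ` (U \<inter> O')"
    using \<delta> by (auto simp: \<epsilon>_def subset_iff)
  obtain \<beta> :: "'e \<Rightarrow> real" where \<beta>: "smooth_on UNIV \<beta>" "\<And>x. dist (\<phi> y) x \<le> \<epsilon> \<Longrightarrow> \<beta> x = 1"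
    "\<And>x. dist (\<phi> y) x \<ge> 2 * \<epsilon> \<Longrightarrow> \<beta> x = 0"
    by (rule bump_function[OF \<epsilon>(1)]) blast
  define W where "W = U \<inter> \<phi> -` ball (\<phi> y) \<epsilon>"
  define C where "C = inv_into U \<phi> ` cball (\<phi> y) (2 * \<epsilon>)"
  have Csub: "C \<subseteq> U \<inter> O'" using \<epsilon>(2) chart(4)[OF c(1)] unfolding C_def by fastforce
  have "compact C" unfolding C_def
    by (rule compact_continuous_image[OF continuous_on_subset[OF chart(6)[OF c(1)]] compact_cball])
      (use \<epsilon>(2) in auto)
  \<comment> \<open>Closed in the whole manifold, by the Hausdorff property; hence
    \<open>- C\<close> is an open set on which the cut-off is zero.\<close>
  then have Ccl: "closed C" by (rule compact_imp_closed)
  have inC: "x \<in> C" if "x \<in> U" "dist (\<phi> y) (\<phi> x) \<le> 2 * \<epsilon>" for x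
    unfolding C_def using that chart(4)[OF c(1), of x] by (intro image_eqI[of _ _ "\<phi> x"]) auto
  define \<kappa> where "\<kappa> x = (if x \<in> U then \<beta> (\<phi> x) else 0)" for x
  have \<kappa>0: "\<kappa> x = 0" if "x \<notin> C" for x
    using that inC[of x] \<beta>(3)[of "\<phi> x"] by (cases "dist (\<phi> y) (\<phi> x) \<le> 2 * \<epsilon>") (auto simp: \<kappa>_def)
  have "\<kappa> \<in> C_inf M" unfolding C_inf_def mem_Collect_eq
  proof (rule smooth_fun_on_local)
    fix x
    show "\<exists>V. open V \<and> x \<in> V \<and> smooth_fun_on M V \<kappa>"
    proof (cases "x \<in> U")
      case True
      have "smooth_fun_on M U (\<lambda>x. \<beta> (\<phi> x))"
        by (rule smooth_fun_on_chart_comp[OF c(1) chart(1)[OF c(1)] order_refl smooth_on_subset[OF \<beta>(1)]]) simp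
      then have "smooth_fun_on M U \<kappa>"
        by (subst smooth_fun_on_cong[OF chart(1)[OF c(1)]]) (auto simp: \<kappa>_def)
      then show ?thesis using True chart(1)[OF c(1)] by blast
    next
      case False
      have "smooth_fun_on M (- C) \<kappa>"
        using Ccl \<kappa>0 by (subst smooth_fun_on_cong[where g = "\<lambda>_. 0"]) (auto intro: smooth_fun_on_const)
      then show ?thesis using False Csub Ccl by blast
    qed
  qed simp
  moreover have "\<phi> ` W = ball (\<phi> y) \<epsilon>"
  proof
    show "ball (\<phi> y) \<epsilon> \<subseteq> \<phi> ` W"
    proof
      fix q assume q: "q \<in> ball (\<phi> y) \<epsilon>"
      then have "q \<in> \<phi> ` (U \<inter> O')" using \<epsilon> by (auto simp: subset_iff)
      then show "q \<in> \<phi> ` W" using q unfolding W_def by auto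
    qed
  qed (auto simp: W_def)
  moreover have "open W" unfolding W_def by (rule chart_open_preimage[OF c(1)]) simp
  moreover have "W \<subseteq> C" using inC \<epsilon>(1) by (auto simp: W_def)
  moreover have "\<kappa> x = 1" if "x \<in> W" for x using that \<beta>(2) by (auto simp: W_def \<kappa>_def)
  moreover have "y \<in> W" using c(2) \<epsilon>(1) by (simp add: W_def)
  ultimately show thesis using that[of \<epsilon> W C \<kappa>] \<epsilon>(1) Ccl Csub \<kappa>0 by (auto simp: W_def)
qed

lemma coordinate_ball:
  assumes "open O'" "y \<in> O'"
  obtains U \<phi> W \<epsilon> \<kappa> C where "(U, \<phi>) \<in> M" "\<epsilon> > 0" "open W" "y \<in> W" "W \<subseteq> U" "\<phi> ` W = ball (\<phi> y) \<epsilon>"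
    "W \<subseteq> C" "closed C" "C \<subseteq> O'" "C \<subseteq> U" "\<kappa> \<in> C_inf M"
    "\<And>x. x \<in> W \<Longrightarrow> \<kappa> x = 1" "\<And>x. x \<notin> C \<Longrightarrow> \<kappa> x = (0::real)"
proof -
  obtain U \<phi> where c: "(U, \<phi>) \<in> M" "y \<in> U" by (rule chart_cover)
  show thesis by (rule coordinate_ball_in_chart[OF c assms]) (rule that[OF c(1)])
qed

subsection \<open>Derivations\<close>

lemma tangent_spaceD:
  assumes "X \<in> tangent_space M x"
  shows "f \<in> C_inf M \<Longrightarrow> g \<in> C_inf M \<Longrightarrow> X (\<lambda>y. f y + g y) = X f + X g"
    "f \<in> C_inf M \<Longrightarrow> X (\<lambda>y. a * f y) = a * X f"
    "f \<in> C_inf M \<Longrightarrow> g \<in> C_inf M \<Longrightarrow> X (\<lambda>y. f y * g y) = X f * g x + f x * X g"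
  using assms by (auto simp: tangent_space_def)

lemma tangent_const: assumes "X \<in> tangent_space M x" shows "X (\<lambda>y. a) = 0"
proof -
  have "X (\<lambda>y. 1 * 1) = X (\<lambda>y. 1) * 1 + 1 * X (\<lambda>y. 1)"
    by (rule tangent_spaceD(3)[OF assms C_inf_const C_inf_const])
  then have "X (\<lambda>y. 1) = 0" by simp
  then show ?thesis using tangent_spaceD(2)[OF assms C_inf_const[of 1], of a] by simp
qed

lemma tangent_diff:
  assumes "X \<in> tangent_space M x" "f \<in> C_inf M" "g \<in> C_inf M"
  shows "X (\<lambda>y. f y - g y) = X f - X g"
  using tangent_spaceD(1)[OF assms(1,2) C_inf_cmult[OF assms(3)], of "-1"]
    tangent_spaceD(2)[OF assms(1,3), of "-1"] by simp

text \<open>Apply the Leibniz rule to \<open>\<kappa> * (f - g)\<close>, which is identically zero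
  for a cut-off \<open>\<kappa>\<close> supported in \<open>W\<close>.\<close>

lemma tangent_local:
  assumes X: "X \<in> tangent_space M x" and "f \<in> C_inf M" "g \<in> C_inf M" "open W" "x \<in> W"
    "\<And>y. y \<in> W \<Longrightarrow> f y = g y"
  shows "X f = X g"
proof -
  obtain V C and \<kappa> :: "'m \<Rightarrow> real" where \<kappa>: "x \<in> V" "C \<subseteq> W" "\<kappa> \<in> C_inf M" "\<And>y. y \<in> V \<Longrightarrow> \<kappa> y = 1"
    "\<And>y. y \<notin> C \<Longrightarrow> \<kappa> y = 0"
    by (rule coordinate_ball[OF assms(4,5)]) blast
  let ?h = "\<lambda>y. f y - g y"
  have h: "?h \<in> C_inf M" by (rule C_inf_diff[OF assms(2,3)])
  have "(\<lambda>y. \<kappa> y * ?h y) = (\<lambda>y. 0)" using \<kappa>(2,5) assms(6) by fastforce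
  then have "X (\<lambda>y. \<kappa> y * ?h y) = 0" using tangent_const[OF X] by simp
  then have "X \<kappa> * ?h x + \<kappa> x * X ?h = 0" using tangent_spaceD(3)[OF X \<kappa>(3) h] by simp
  then have "X ?h = 0" using \<kappa>(1,4) assms(5,6) by simp
  then show ?thesis using tangent_diff[OF X assms(2,3)] by simp
qed

lemma tangent_sum:
  assumes X: "X \<in> tangent_space M x" and "finite I" "\<And>i. i \<in> I \<Longrightarrow> f i \<in> C_inf M"
  shows "X (\<lambda>y. \<Sum>i\<in>I. f i y) = (\<Sum>i\<in>I. X (f i))"
  using assms(2,3)
proof (induction I)
  case empty
  then show ?case using tangent_const[OF X] by simp
next
  case (insert i I)
  then show ?case using tangent_spaceD(1)[OF X, of "f i" "\<lambda>y. \<Sum>i\<in>I. f i y"] C_inf_sum[of I f] by simp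
qed

definition partial :: "'m set \<Rightarrow> ('m \<Rightarrow> 'e) \<Rightarrow> nat \<Rightarrow> ('m \<Rightarrow> real) \<Rightarrow> 'm \<Rightarrow> real" where
  "partial U \<phi> k f x = frechet_derivative (f \<circ> inv_into U \<phi>) (at (\<phi> x)) (b k)"

text \<open>A derivation applied to the Hadamard expansion retains only its values on the
  coordinates, because the factors \<open>\<xi> k - \<xi> k x\<close> vanish at \<open>x\<close>.
  The functions \<open>\<xi> k\<close> are global functions that agree with the coordinates on
  \<open>W\<close> only.\<close>

lemma tangent_expansion:
  assumes c: "(U, \<phi>) \<in> M" and W: "open W" "W \<subseteq> U" "convex (\<phi> ` W)" and x: "x \<in> W"
    and \<xi>: "\<And>k. k < n \<Longrightarrow> \<xi> k \<in> C_inf M" "\<And>k z. k < n \<Longrightarrow> z \<in> W \<Longrightarrow> \<xi> k z = \<phi> z \<bullet> b k"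
    and X: "X \<in> tangent_space M x" and f: "f \<in> C_inf M"
  shows "X f = (\<Sum>k<n. X (\<xi> k) * partial U \<phi> k f x)"
proof -
  let ?f = "f \<circ> inv_into U \<phi>"
  have oW: "open (\<phi> ` W)" by (rule chart_open_image[OF c W(1,2)])
  have fs: "smooth_on (\<phi> ` W) ?f" by (rule smooth_on_subset[OF C_infD[OF f c]]) (use W in auto)
  obtain g where g: "\<And>k. smooth_on (\<phi> ` W) (g k)"
    "\<And>k. g k (\<phi> x) = frechet_derivative ?f (at (\<phi> x)) (b k)"
    "\<And>p. p \<in> \<phi> ` W \<Longrightarrow> ?f p = ?f (\<phi> x) + (\<Sum>k<n. ((p - \<phi> x) \<bullet> b k) * g k p)"
    by (rule hadamard[OF oW W(3) imageI[OF x] fs]) blast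
  obtain V C and \<kappa> :: "'m \<Rightarrow> real" where \<kappa>: "open V" "x \<in> V" "V \<subseteq> C" "closed C" "C \<subseteq> W" "\<kappa> \<in> C_inf M"
    "\<And>y. y \<in> V \<Longrightarrow> \<kappa> y = 1" "\<And>y. y \<notin> C \<Longrightarrow> \<kappa> y = 0"
    by (rule coordinate_ball[OF W(1) x]) blast
  \<comment> \<open>Derivations act on global functions, so the Hadamard coefficients are cut off
    before \<open>X\<close> is applied.\<close>
  define G where "G k = (\<lambda>z. if z \<in> W then \<kappa> z * g k (\<phi> z) else 0)" for k
  have G: "G k \<in> C_inf M" for k
    unfolding G_def
    by (rule C_inf_extend[OF W(1) \<kappa>(4,5,6,8) smooth_fun_on_chart_comp[OF c W(1,2) g(1)]])
  let ?h = "\<lambda>z. f x + (\<Sum>k<n. (\<xi> k z - \<xi> k x) * G k z)"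
  have t: "(\<lambda>z. (\<xi> k z - \<xi> k x) * G k z) \<in> C_inf M" if "k < n" for k
    using that by (intro C_inf_mult C_inf_diff C_inf_const \<xi>(1) G)
  then have s: "(\<lambda>z. \<Sum>k<n. (\<xi> k z - \<xi> k x) * G k z) \<in> C_inf M" by (intro C_inf_sum) auto
  have eq: "f z = ?h z" if z: "z \<in> V" for z
  proof -
    have zW: "z \<in> W" using z \<kappa> by auto
    then have "f z = f x + (\<Sum>k<n. ((\<phi> z - \<phi> x) \<bullet> b k) * g k (\<phi> z))"
      using g(3)[OF imageI[OF zW]] chart(4)[OF c subsetD[OF W(2) x]] chart(4)[OF c subsetD[OF W(2) zW]] by simp
    then show ?thesis using z zW x \<kappa>(7) \<xi>(2) by (simp add: G_def inner_diff_left)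
  qed
  have "X f = X ?h"
    by (rule tangent_local[OF X f C_inf_add[OF C_inf_const s] \<kappa>(1,2) eq])
  also have "\<dots> = (\<Sum>k<n. X (\<lambda>z. (\<xi> k z - \<xi> k x) * G k z))"
    using tangent_spaceD(1)[OF X C_inf_const s] tangent_const[OF X]
      tangent_sum[OF X finite_lessThan, of n "\<lambda>k z. (\<xi> k z - \<xi> k x) * G k z"] t by simp
  also have "\<dots> = (\<Sum>k<n. X (\<xi> k) * partial U \<phi> k f x)"
  proof (rule sum.cong)
    fix k assume "k \<in> {..<n}"
    then have k: "k < n" by simp
    have "X (\<lambda>z. (\<xi> k z - \<xi> k x) * G k z) = X (\<lambda>z. \<xi> k z - \<xi> k x) * G k x + (\<xi> k x - \<xi> k x) * X (G k)"
      by (rule tangent_spaceD(3)[OF X C_inf_diff[OF \<xi>(1)[OF k] C_inf_const] G])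
    also have "\<dots> = X (\<xi> k) * partial U \<phi> k f x"
      using tangent_diff[OF X \<xi>(1)[OF k] C_inf_const] tangent_const[OF X] x \<kappa>(2,7)
      by (simp add: G_def g(2) partial_def)
    finally show "X (\<lambda>z. (\<xi> k z - \<xi> k x) * G k z) = X (\<xi> k) * partial U \<phi> k f x" .
  qed simp
  finally show ?thesis .
qed

text \<open>The value 0 off \<open>C_inf M\<close> is the normalisation of tangent vectors. In this
  form the coordinate derivations can be lifted through a surjective anchor.\<close>

lemma partial_tangent:
  assumes c: "(U, \<phi>) \<in> M" "x \<in> U"
  shows "(\<lambda>f. if f \<in> C_inf M then partial U \<phi> k f x else 0) \<in> tangent_space M x"
proof -
  have D: "((f \<circ> inv_into U \<phi>) has_derivative frechet_derivative (f \<circ> inv_into U \<phi>) (at (\<phi> x))) (at (\<phi> x))"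
    if "f \<in> C_inf M" for f
    by (rule smooth_on_has_derivative[OF C_infD[OF that c(1)] imageI[OF c(2)]])
  have eqI: "partial U \<phi> k h x = h' (b k)" if "((\<lambda>p. h (inv_into U \<phi> p)) has_derivative h') (at (\<phi> x))" for h h'
    unfolding partial_def using frechet_derivative_at[OF that] by (simp add: o_def)
  have "partial U \<phi> k (\<lambda>y. f y + g y) x = partial U \<phi> k f x + partial U \<phi> k g x"
    if "f \<in> C_inf M" "g \<in> C_inf M" for f g
    using has_derivative_add[OF D[OF that(1)] D[OF that(2)]] eqI[of "\<lambda>y. f y + g y"]
    by (simp add: o_def partial_def)
  moreover have "partial U \<phi> k (\<lambda>y. a * f y) x = a * partial U \<phi> k f x" if "f \<in> C_inf M" for f a
    using has_derivative_mult_right[OF D[OF that], of a] eqI[of "\<lambda>y. a * f y"]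
    by (simp add: o_def partial_def)
  moreover have "partial U \<phi> k (\<lambda>y. f y * g y) x = partial U \<phi> k f x * g x + f x * partial U \<phi> k g x"
    if "f \<in> C_inf M" "g \<in> C_inf M" for f g
    using has_derivative_mult[OF D[OF that(1)] D[OF that(2)]] eqI[of "\<lambda>y. f y * g y"] chart(4)[OF c]
    by (simp add: o_def partial_def)
  ultimately show ?thesis
    by (auto simp: tangent_space_def C_inf_add C_inf_mult C_inf_cmult)
qed

lemma partial_coord:
  assumes c: "(U, \<phi>) \<in> M" and W: "open W" "W \<subseteq> U" and x: "x \<in> W" and k: "k < n" "j < n"
    and \<xi>: "\<And>z. z \<in> W \<Longrightarrow> \<xi> z = \<phi> z \<bullet> b j"
  shows "partial U \<phi> k \<xi> x = (if k = j then 1 else 0)"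
proof -
  have "((\<lambda>p. p \<bullet> b j) has_derivative (\<lambda>v. v \<bullet> b j)) (at (\<phi> x))"
    by (rule bounded_linear_imp_has_derivative[OF bounded_linear_inner_left])
  then have "((\<xi> \<circ> inv_into U \<phi>) has_derivative (\<lambda>v. v \<bullet> b j)) (at (\<phi> x))"
    by (rule has_derivative_transform_within_open[OF _ chart_open_image[OF c W] imageI[OF x]])
      (use \<xi> chart(4)[OF c] W(2) in auto)
  then show ?thesis unfolding partial_def using frechet_derivative_at inner_b[OF k] by metis
qed

end

section \<open>Sections and covariant differential operators\<close>

locale smooth_bundle = manifold b n M
  for b :: "nat \<Rightarrow> 'e::real_inner" and n :: nat
    and M :: "('m::{t2_space, second_countable_topology}, 'e) atlas" +
  fixes E :: "('m, 'f::real_vector, 'z) vector_bundle_scheme"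
  assumes vector_bundle: "is_vector_bundle M E"
begin

abbreviation "rk \<equiv> bundle_rank E"

lemmas vector_bundle_unfolded = vector_bundle[unfolded is_vector_bundle_def]

lemma subspace_fibre: "subspace (fibre E x)"
  using conjunct1[OF vector_bundle_unfolded] by (rule spec)

lemma frame_cover: obtains U e where "(U, e) \<in> local_frames E" "x \<in> U"
proof -
  have "x \<in> (\<Union>(U, e)\<in>local_frames E. U)"
    using conjunct1[OF conjunct2[OF vector_bundle_unfolded]] by simp
  then show thesis using that by blast
qed

lemma frame_conditions:
  assumes "(U, e) \<in> local_frames E"
  shows "open U" "x \<in> U \<Longrightarrow> inj_on (\<lambda>i. e i x) {..<rk}"
    "x \<in> U \<Longrightarrow> independent ((\<lambda>i. e i x) ` {..<rk})"
    "x \<in> U \<Longrightarrow> span ((\<lambda>i. e i x) ` {..<rk}) = fibre E x"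
  using bspec[OF conjunct1[OF conjunct2[OF conjunct2[OF vector_bundle_unfolded]]] assms] by simp_all

lemmas frame_open = frame_conditions(1) and frame_basis = frame_conditions(2-4)

lemma frame_transition:
  assumes "(U, e) \<in> local_frames E" "(V, e') \<in> local_frames E"
  obtains g where "\<And>i j. i < rk \<Longrightarrow> j < rk \<Longrightarrow> smooth_fun_on M (U \<inter> V) (g i j)"
    "\<And>x i. x \<in> U \<inter> V \<Longrightarrow> i < rk \<Longrightarrow> e' i x = (\<Sum>j<rk. g i j x *\<^sub>R e j x)"
proof -
  have "\<exists>g. (\<forall>i<rk. \<forall>j<rk. smooth_fun_on M (U \<inter> V) (g i j)) \<and>
        (\<forall>x\<in>U \<inter> V. \<forall>i<rk. e' i x = (\<Sum>j<rk. g i j x *\<^sub>R e j x))"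
    using bspec[OF bspec[OF conjunct2[OF conjunct2[OF conjunct2[OF vector_bundle_unfolded]]] assms(1), simplified] assms(2)]
    by simp
  then show thesis using that by blast
qed

lemma frame_independent:
  assumes "(U, e) \<in> local_frames E" "x \<in> U" "(\<Sum>i<rk. c i *\<^sub>R e i x) = 0" "i < rk"
  shows "c i = 0"
proof -
  note inj = frame_basis(1)[OF assms(1,2)]
  let ?u = "c \<circ> the_inv_into {..<rk} (\<lambda>i. e i x)"
  have u: "?u (e i x) = c i" if "i < rk" for i
    using the_inv_into_f_f[OF inj, of i] that by simp
  have "(\<Sum>v\<in>(\<lambda>i. e i x) ` {..<rk}. ?u v *\<^sub>R v) = (\<Sum>i<rk. c i *\<^sub>R e i x)"
    unfolding sum.reindex[OF inj] by (rule sum.cong) (use u in auto)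
  then have "?u (e i x) = 0"
    by (intro independentD[OF frame_basis(2)[OF assms(1,2)]]) (use assms in auto)
  then show ?thesis using u assms(4) by simp
qed

lemma frame_unique:
  assumes "(U, e) \<in> local_frames E" "x \<in> U"
    "(\<Sum>i<rk. c i *\<^sub>R e i x) = (\<Sum>i<rk. d i *\<^sub>R e i x)" "i < rk"
  shows "c i = d i"
proof -
  have "(\<Sum>i<rk. (c i - d i) *\<^sub>R e i x) = 0"
    using assms(3) by (simp add: scaleR_diff_left sum_subtractf)
  from frame_independent[OF assms(1,2) this assms(4)] show ?thesis by simp
qed

lemma frame_spans:
  assumes "(U, e) \<in> local_frames E" "x \<in> U" "v \<in> fibre E x"
  obtains c where "v = (\<Sum>i<rk. c i *\<^sub>R e i x)"
proof -
  have "v \<in> range (\<lambda>u. \<Sum>w\<in>(\<lambda>i. e i x) ` {..<rk}. u w *\<^sub>R w)"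
    using assms(3) frame_basis(3)[OF assms(1,2)] span_finite[of "(\<lambda>i. e i x) ` {..<rk}"] by simp
  then obtain u where "v = (\<Sum>w\<in>(\<lambda>i. e i x) ` {..<rk}. u w *\<^sub>R w)" by blast
  then have "v = (\<Sum>i<rk. u (e i x) *\<^sub>R e i x)"
    unfolding sum.reindex[OF frame_basis(1)[OF assms(1,2)]] by simp
  then show thesis by (rule that)
qed

lemma frame_in_fibre:
  assumes "(U, e) \<in> local_frames E" "x \<in> U" "i < rk" shows "e i x \<in> fibre E x"
proof -
  have "e i x \<in> span ((\<lambda>i. e i x) ` {..<rk})" using assms(3) by (intro span_base) simp
  then show ?thesis using frame_basis(3)[OF assms(1,2)] by simp
qed

lemma section_fibre: "s \<in> sections M E \<Longrightarrow> s x \<in> fibre E x"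
  by (simp add: sections_def)

lemma section_coeff:
  assumes "s \<in> sections M E" "(U, e) \<in> local_frames E"
  obtains c where "\<And>i. i < rk \<Longrightarrow> smooth_fun_on M U (c i)" "\<And>x. x \<in> U \<Longrightarrow> s x = (\<Sum>i<rk. c i x *\<^sub>R e i x)"
proof -
  have "\<forall>(U, e)\<in>local_frames E. \<exists>c. (\<forall>i<rk. smooth_fun_on M U (c i)) \<and> (\<forall>x\<in>U. s x = (\<Sum>i<rk. c i x *\<^sub>R e i x))"
    using assms(1) by (simp add: sections_def)
  from bspec[OF this assms(2)] show thesis using that by auto
qed

lemma sectionI:
  assumes "\<And>x. s x \<in> fibre E x"
    "\<And>U e. (U, e) \<in> local_frames E \<Longrightarrow> \<exists>c. (\<forall>i<rk. smooth_fun_on M U (c i)) \<and> (\<forall>x\<in>U. s x = (\<Sum>i<rk. c i x *\<^sub>R e i x))"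
  shows "s \<in> sections M E"
  using assms by (auto simp: sections_def)

section \<open>The module of smooth sections\<close>

lemma section_add:
  assumes "s \<in> sections M E" "t \<in> sections M E" shows "(\<lambda>x. s x + t x) \<in> sections M E"
proof (rule sectionI)
  show "s x + t x \<in> fibre E x" for x
    by (rule subspace_add[OF subspace_fibre section_fibre[OF assms(1)] section_fibre[OF assms(2)]])
  fix U e assume f: "(U, e) \<in> local_frames E"
  obtain c where c: "\<And>i. i < rk \<Longrightarrow> smooth_fun_on M U (c i)" "\<And>x. x \<in> U \<Longrightarrow> s x = (\<Sum>i<rk. c i x *\<^sub>R e i x)"
    by (rule section_coeff[OF assms(1) f]) blast
  obtain d where d: "\<And>i. i < rk \<Longrightarrow> smooth_fun_on M U (d i)" "\<And>x. x \<in> U \<Longrightarrow> t x = (\<Sum>i<rk. d i x *\<^sub>R e i x)"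
    by (rule section_coeff[OF assms(2) f]) blast
  have "smooth_fun_on M U (\<lambda>x. c i x + d i x)" if "i < rk" for i
    by (rule smooth_fun_on_add[OF frame_open[OF f] c(1)[OF that] d(1)[OF that]])
  then show "\<exists>c. (\<forall>i<rk. smooth_fun_on M U (c i)) \<and> (\<forall>x\<in>U. s x + t x = (\<Sum>i<rk. c i x *\<^sub>R e i x))"
    by (intro exI[of _ "\<lambda>i x. c i x + d i x"]) (simp add: c(2) d(2) scaleR_add_left sum.distrib)
qed

lemma section_scale:
  assumes "f \<in> C_inf M" "s \<in> sections M E" shows "(\<lambda>x. f x *\<^sub>R s x) \<in> sections M E"
proof (rule sectionI)
  show "f x *\<^sub>R s x \<in> fibre E x" for x
    by (rule subspace_scale[OF subspace_fibre section_fibre[OF assms(2)]])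
  fix U e assume f: "(U, e) \<in> local_frames E"
  obtain c where c: "\<And>i. i < rk \<Longrightarrow> smooth_fun_on M U (c i)" "\<And>x. x \<in> U \<Longrightarrow> s x = (\<Sum>i<rk. c i x *\<^sub>R e i x)"
    by (rule section_coeff[OF assms(2) f]) blast
  have "smooth_fun_on M U (\<lambda>x. f x * c i x)" if "i < rk" for i
    by (rule smooth_fun_on_mult[OF frame_open[OF f] C_inf_smooth_on[OF assms(1)] c(1)[OF that]])
  then show "\<exists>c. (\<forall>i<rk. smooth_fun_on M U (c i)) \<and> (\<forall>x\<in>U. f x *\<^sub>R s x = (\<Sum>i<rk. c i x *\<^sub>R e i x))"
    by (intro exI[of _ "\<lambda>i x. f x * c i x"]) (simp add: c(2) scaleR_sum_right)
qed

lemma section_zero: "(\<lambda>x. 0) \<in> sections M E"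
proof (rule sectionI)
  show "0 \<in> fibre E x" for x by (rule subspace_0[OF subspace_fibre])
  fix U e assume f: "(U, e) \<in> local_frames E"
  show "\<exists>c. (\<forall>i<rk. smooth_fun_on M U (c i)) \<and> (\<forall>x\<in>U. 0 = (\<Sum>i<rk. c i x *\<^sub>R e i x))"
    by (rule exI[of _ "\<lambda>i x. 0"]) (simp add: smooth_fun_on_const[OF frame_open[OF f]])
qed

lemma section_cmult: "s \<in> sections M E \<Longrightarrow> (\<lambda>x. a *\<^sub>R s x) \<in> sections M E"
  using section_scale[OF C_inf_const] .

lemma section_diff:
  assumes "s \<in> sections M E" "t \<in> sections M E" shows "(\<lambda>x. s x - t x) \<in> sections M E"
  using section_add[OF assms(1) section_cmult[OF assms(2), of "-1"]] by simp

lemma section_sum: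
  assumes "finite I" "\<And>i. i \<in> I \<Longrightarrow> s i \<in> sections M E"
  shows "(\<lambda>x. \<Sum>i\<in>I. s i x) \<in> sections M E"
  using assms by (induction I) (auto intro: section_zero section_add)

text \<open>Coefficients in a frame are unique, so those of \<open>s\<close> coincide near each
  point with the smooth ones of the local model.\<close>

lemma section_local:
  assumes "\<And>x. \<exists>W t. open W \<and> x \<in> W \<and> t \<in> sections M E \<and> (\<forall>y\<in>W. s y = t y)"
  shows "s \<in> sections M E"
proof (rule sectionI)
  show fib: "s x \<in> fibre E x" for x using assms[of x] section_fibre by force
  fix U e assume f: "(U, e) \<in> local_frames E"
  have "\<exists>c. s x = (\<Sum>i<rk. c i *\<^sub>R e i x)" if "x \<in> U" for x
    by (rule frame_spans[OF f that fib[of x]]) blast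
  then obtain c where c: "\<And>x. x \<in> U \<Longrightarrow> s x = (\<Sum>i<rk. c x i *\<^sub>R e i x)" by metis
  have "smooth_fun_on M U (\<lambda>x. c x i)" if i: "i < rk" for i
  proof (rule smooth_fun_on_local[OF frame_open[OF f]])
    fix y assume y: "y \<in> U"
    obtain W t where W: "open W" "y \<in> W" "t \<in> sections M E" "\<And>z. z \<in> W \<Longrightarrow> s z = t z"
      using assms[of y] by blast
    obtain d where d: "\<And>i. i < rk \<Longrightarrow> smooth_fun_on M U (d i)" "\<And>x. x \<in> U \<Longrightarrow> t x = (\<Sum>i<rk. d i x *\<^sub>R e i x)"
      by (rule section_coeff[OF W(3) f]) blast
    have "smooth_fun_on M (U \<inter> W) (d i)" by (rule smooth_fun_on_subset[OF d(1)[OF i]]) auto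
    moreover have "c z i = d i z" if "z \<in> U \<inter> W" for z
    proof (rule frame_unique[OF f _ _ i])
      show "(\<Sum>i<rk. c z i *\<^sub>R e i z) = (\<Sum>i<rk. d i z *\<^sub>R e i z)"
        using that c[of z] d(2)[of z] W(4)[of z] by simp
    qed (use that in simp)
    ultimately have "smooth_fun_on M (U \<inter> W) (\<lambda>x. c x i)"
      by (subst smooth_fun_on_cong[of "U \<inter> W" _ "d i"]) (use W(1) frame_open[OF f] in auto)
    then show "\<exists>V. open V \<and> y \<in> V \<and> smooth_fun_on M V (\<lambda>x. c x i)"
      using y W frame_open[OF f] by (intro exI[of _ "U \<inter> W"]) auto
  qed
  then show "\<exists>c. (\<forall>i<rk. smooth_fun_on M U (c i)) \<and> (\<forall>x\<in>U. s x = (\<Sum>i<rk. c i x *\<^sub>R e i x))"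
    by (intro exI[of _ "\<lambda>i x. c x i"]) (use c in auto)
qed

text \<open>In any other frame the coefficients are the transition functions multiplied by the
  cut-off, extended by zero.\<close>

lemma section_extend_frame:
  assumes f: "(U, e) \<in> local_frames E" and C: "closed C" "C \<subseteq> U" and \<kappa>: "\<kappa> \<in> C_inf M" "\<And>x. x \<notin> C \<Longrightarrow> \<kappa> x = 0"
    and i: "i < rk"
  shows "(\<lambda>x. if x \<in> U then \<kappa> x *\<^sub>R e i x else 0) \<in> sections M E"
proof (rule sectionI)
  show "(if x \<in> U then \<kappa> x *\<^sub>R e i x else 0) \<in> fibre E x" for x
    using subspace_scale[OF subspace_fibre frame_in_fibre[OF f _ i], of x] subspace_0[OF subspace_fibre] by simp
  fix V e' assume g: "(V, e') \<in> local_frames E"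
  obtain h where h: "\<And>i j. i < rk \<Longrightarrow> j < rk \<Longrightarrow> smooth_fun_on M (V \<inter> U) (h i j)"
    "\<And>x i. x \<in> V \<inter> U \<Longrightarrow> i < rk \<Longrightarrow> e i x = (\<Sum>j<rk. h i j x *\<^sub>R e' j x)"
    by (rule frame_transition[OF g f]) blast
  let ?c = "\<lambda>j x. if x \<in> U then \<kappa> x * h i j x else 0"
  have "smooth_fun_on M V (?c j)" if j: "j < rk" for j
  proof (rule smooth_fun_on_local[OF frame_open[OF g]])
    fix y assume y: "y \<in> V"
    show "\<exists>W. open W \<and> y \<in> W \<and> smooth_fun_on M W (?c j)"
    proof (cases "y \<in> U")
      case True
      have o: "open (V \<inter> U)" using frame_open f g by blast
      have "smooth_fun_on M (V \<inter> U) (\<lambda>x. \<kappa> x * h i j x)"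
        by (rule smooth_fun_on_mult[OF o C_inf_smooth_on[OF \<kappa>(1)] h(1)[OF i j]])
      then have "smooth_fun_on M (V \<inter> U) (?c j)"
        by (subst smooth_fun_on_cong[OF o, of _ "\<lambda>x. \<kappa> x * h i j x"]) auto
      then show ?thesis using o y True by blast
    next
      case False
      have "smooth_fun_on M (- C) (?c j)"
        using C \<kappa>(2) by (subst smooth_fun_on_cong[where g = "\<lambda>_. 0"]) (auto intro: smooth_fun_on_const)
      then show ?thesis using False C by blast
    qed
  qed
  then show "\<exists>c. (\<forall>i<rk. smooth_fun_on M V (c i)) \<and>
      (\<forall>x\<in>V. (if x \<in> U then \<kappa> x *\<^sub>R e i x else 0) = (\<Sum>i<rk. c i x *\<^sub>R e' i x))"
    by (intro exI[of _ ?c]) (auto simp: h(2) i scaleR_sum_right)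
qed

text \<open>Multiplication by a cut-off turns a local frame into global sections which still form a
  frame near a point, with global smooth coefficient functions.\<close>

definition global_frame_on :: "'m set \<Rightarrow> (nat \<Rightarrow> 'm \<Rightarrow> 'f) \<Rightarrow> bool" where
  "global_frame_on W s \<longleftrightarrow> (\<forall>i<rk. s i \<in> sections M E) \<and>
     (\<forall>x\<in>W. \<forall>v\<in>fibre E x. \<exists>c. v = (\<Sum>i<rk. c i *\<^sub>R s i x)) \<and>
     (\<forall>x\<in>W. \<forall>c. (\<Sum>i<rk. c i *\<^sub>R s i x) = 0 \<longrightarrow> (\<forall>i<rk. c i = 0)) \<and>
     (\<forall>t\<in>sections M E. \<exists>c. (\<forall>i<rk. c i \<in> C_inf M) \<and> (\<forall>x\<in>W. t x = (\<Sum>i<rk. c i x *\<^sub>R s i x)))"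

lemma global_frame_onD:
  assumes "global_frame_on W s"
  shows "i < rk \<Longrightarrow> s i \<in> sections M E"
    "x \<in> W \<Longrightarrow> v \<in> fibre E x \<Longrightarrow> \<exists>c. v = (\<Sum>i<rk. c i *\<^sub>R s i x)"
    "x \<in> W \<Longrightarrow> (\<Sum>i<rk. c i *\<^sub>R s i x) = 0 \<Longrightarrow> i < rk \<Longrightarrow> c i = 0"
    "t \<in> sections M E \<Longrightarrow> \<exists>c. (\<forall>i<rk. c i \<in> C_inf M) \<and> (\<forall>x\<in>W. t x = (\<Sum>i<rk. c i x *\<^sub>R s i x))"
  using assms unfolding global_frame_on_def by simp_all

lemma global_frame:
  assumes f: "(U, e) \<in> local_frames E" and C: "closed C" "C \<subseteq> U" "W \<subseteq> C"
    and \<kappa>: "\<kappa> \<in> C_inf M" "\<And>x. x \<in> W \<Longrightarrow> \<kappa> x = 1" "\<And>x. x \<notin> C \<Longrightarrow> \<kappa> x = 0"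
  shows "global_frame_on W (\<lambda>i x. if x \<in> U then \<kappa> x *\<^sub>R e i x else 0)"
  unfolding global_frame_on_def
proof (intro conjI ballI allI impI)
  let ?s = "\<lambda>i x. if x \<in> U then \<kappa> x *\<^sub>R e i x else 0"
  show "?s i \<in> sections M E" if "i < rk" for i
    by (rule section_extend_frame[OF f C(1,2) \<kappa>(1,3) that])
  have s: "?s i x = e i x" if "x \<in> W" for i x using that C \<kappa>(2) by auto
  have WU: "x \<in> U" if "x \<in> W" for x using that C by auto
  show "\<exists>c. v = (\<Sum>i<rk. c i *\<^sub>R ?s i x)" if x: "x \<in> W" and v: "v \<in> fibre E x" for x v
    unfolding s[OF x] by (rule frame_spans[OF f WU[OF x] v]) blast
  show "c i = 0" if "x \<in> W" "(\<Sum>i<rk. c i *\<^sub>R ?s i x) = 0" "i < rk" for x i and c :: "nat \<Rightarrow> real"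
    using frame_independent[OF f WU[OF that(1)] that(2)[unfolded s[OF that(1)]] that(3)] .
  fix t assume t: "t \<in> sections M E"
  obtain d where d: "\<And>i. i < rk \<Longrightarrow> smooth_fun_on M U (d i)" "\<And>x. x \<in> U \<Longrightarrow> t x = (\<Sum>i<rk. d i x *\<^sub>R e i x)"
    by (rule section_coeff[OF t f]) blast
  have "(\<lambda>x. if x \<in> U then \<kappa> x * d i x else 0) \<in> C_inf M" if "i < rk" for i
    by (rule C_inf_extend[OF frame_open[OF f] C(1,2) \<kappa>(1,3) d(1)[OF that]])
  moreover have "t x = (\<Sum>i<rk. (if x \<in> U then \<kappa> x * d i x else 0) *\<^sub>R ?s i x)" if "x \<in> W" for x
    using d(2)[OF WU[OF that]] WU[OF that] \<kappa>(2)[OF that] by simp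
  ultimately show "\<exists>c. (\<forall>i<rk. c i \<in> C_inf M) \<and> (\<forall>x\<in>W. t x = (\<Sum>i<rk. c i x *\<^sub>R ?s i x))"
    by (intro exI[of _ "\<lambda>i x. if x \<in> U then \<kappa> x * d i x else 0"]) blast
qed

lemma section_through:
  assumes "v \<in> fibre E x" obtains s where "s \<in> sections M E" "s x = v"
proof -
  obtain U e where f: "(U, e) \<in> local_frames E" "x \<in> U" by (rule frame_cover)
  obtain W C and \<kappa> :: "'m \<Rightarrow> real" where \<kappa>: "x \<in> W" "W \<subseteq> C" "closed C" "C \<subseteq> U" "\<kappa> \<in> C_inf M" "\<And>x. x \<in> W \<Longrightarrow> \<kappa> x = 1"
    "\<And>x. x \<notin> C \<Longrightarrow> \<kappa> x = 0" by (rule coordinate_ball[OF frame_open[OF f(1)] f(2)]) blast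
  define s where "s = (\<lambda>i x. if x \<in> U then \<kappa> x *\<^sub>R e i x else 0)"
  have "global_frame_on W s" unfolding s_def by (rule global_frame[OF f(1) \<kappa>(3,4,2,5,6,7)])
  note s = global_frame_onD[OF this]
  obtain c where c: "v = (\<Sum>i<rk. c i *\<^sub>R s i x)" using s(2)[OF \<kappa>(1) assms] by blast
  have "(\<lambda>y. \<Sum>i<rk. c i *\<^sub>R s i y) \<in> sections M E"
    by (rule section_sum) (use section_cmult s(1) in auto)
  then show thesis using that c by blast
qed

end

locale cdo = smooth_bundle b n M F
  for b :: "nat \<Rightarrow> 'e::real_inner" and n :: nat
    and M :: "('m::{t2_space, second_countable_topology}, 'e) atlas"
    and F :: "('m, 'f::real_vector) vector_bundle" +
  fixes x :: 'm and D :: "('m \<Rightarrow> 'f) \<Rightarrow> 'f" and X :: "('m \<Rightarrow> real) \<Rightarrow> real"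
  assumes D: "D \<in> CDO M F x" and symbol: "has_symbol M F x D X"
begin

lemma X: "X \<in> tangent_space M x"
  and leibniz: "f \<in> C_inf M \<Longrightarrow> \<mu> \<in> sections M F \<Longrightarrow> D (\<lambda>y. f y *\<^sub>R \<mu> y) = X f *\<^sub>R \<mu> x + f x *\<^sub>R D \<mu>"
  using symbol by (auto simp: has_symbol_def)

lemma D_add: "\<mu> \<in> sections M F \<Longrightarrow> \<nu> \<in> sections M F \<Longrightarrow> D (\<lambda>y. \<mu> y + \<nu> y) = D \<mu> + D \<nu>"
  and D_scale: "\<mu> \<in> sections M F \<Longrightarrow> D (\<lambda>y. a *\<^sub>R \<mu> y) = a *\<^sub>R D \<mu>"
  and D_fibre: "\<mu> \<in> sections M F \<Longrightarrow> D \<mu> \<in> fibre F x"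
  using D by (auto simp: CDO_def)

lemma D_zero: "D (\<lambda>y. 0) = 0"
  using D_scale[OF section_zero, of 0] by simp

lemma D_diff: "\<mu> \<in> sections M F \<Longrightarrow> \<nu> \<in> sections M F \<Longrightarrow> D (\<lambda>y. \<mu> y - \<nu> y) = D \<mu> - D \<nu>"
  using D_add[OF _ section_cmult[of \<nu> "-1"], of \<mu>] D_scale[of \<nu> "-1"] by simp

lemma D_sum:
  assumes "finite I" "\<And>i. i \<in> I \<Longrightarrow> \<mu> i \<in> sections M F"
  shows "D (\<lambda>y. \<Sum>i\<in>I. \<mu> i y) = (\<Sum>i\<in>I. D (\<mu> i))"
  using assms
proof (induction I)
  case (insert i I)
  then show ?case using D_add[of "\<mu> i" "\<lambda>y. \<Sum>i\<in>I. \<mu> i y"] section_sum[of I \<mu>] by simp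
qed (simp add: D_zero)

text \<open>The cut-off argument of \<open>tangent_local\<close>, now with the Leibniz rule for
  operators.\<close>

lemma D_local:
  assumes "\<mu> \<in> sections M F" "\<nu> \<in> sections M F" "open W" "x \<in> W" "\<And>y. y \<in> W \<Longrightarrow> \<mu> y = \<nu> y"
  shows "D \<mu> = D \<nu>"
proof -
  obtain V C and \<kappa> :: "'m \<Rightarrow> real" where \<kappa>: "x \<in> V" "C \<subseteq> W" "\<kappa> \<in> C_inf M" "\<And>y. y \<in> V \<Longrightarrow> \<kappa> y = 1"
    "\<And>y. y \<notin> C \<Longrightarrow> \<kappa> y = 0"
    by (rule coordinate_ball[OF assms(3,4)]) blast
  let ?h = "\<lambda>y. \<mu> y - \<nu> y"
  have h: "?h \<in> sections M F" by (rule section_diff[OF assms(1,2)])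
  have "(\<lambda>y. \<kappa> y *\<^sub>R ?h y) = (\<lambda>y. 0)" using \<kappa>(2,5) assms(5) by fastforce
  then have "D (\<lambda>y. \<kappa> y *\<^sub>R ?h y) = 0" using D_zero by simp
  then have "D ?h = 0" using leibniz[OF \<kappa>(3) h] assms(4,5) \<kappa>(1,4) by simp
  then show ?thesis using D_diff[OF assms(1,2)] by simp
qed

lemma D_frame:
  fixes r :: nat
  assumes "open W" "x \<in> W" "\<And>i. i < r \<Longrightarrow> s i \<in> sections M F" "\<mu> \<in> sections M F"
    "\<And>i. i < r \<Longrightarrow> c i \<in> C_inf M" "\<And>y. y \<in> W \<Longrightarrow> \<mu> y = (\<Sum>i<r. c i y *\<^sub>R s i y)"
  shows "D \<mu> = (\<Sum>i<r. X (c i) *\<^sub>R s i x + c i x *\<^sub>R D (s i))"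
proof -
  have t: "(\<lambda>y. c i y *\<^sub>R s i y) \<in> sections M F" if "i < r" for i
    using that assms(3,5) by (intro section_scale) auto
  have "D \<mu> = D (\<lambda>y. \<Sum>i<r. c i y *\<^sub>R s i y)"
    by (rule D_local[OF assms(4) section_sum assms(1,2,6)]) (use t in auto)
  also have "\<dots> = (\<Sum>i<r. D (\<lambda>y. c i y *\<^sub>R s i y))"
    by (rule D_sum) (use t in auto)
  also have "\<dots> = (\<Sum>i<r. X (c i) *\<^sub>R s i x + c i x *\<^sub>R D (s i))"
    using leibniz assms(3,5) by simp
  finally show ?thesis .
qed

text \<open>Expand the difference in sections forming a frame near \<open>x\<close>. The
  coefficients vanish at \<open>x\<close>, and the zero symbol kills their derivatives, so nothing
  survives in the Leibniz rule.\<close>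

lemma D_tensorial:
  assumes "X = (\<lambda>f. 0)" "\<mu> \<in> sections M F" "\<nu> \<in> sections M F" "\<mu> x = \<nu> x"
  shows "D \<mu> = D \<nu>"
proof -
  obtain U e where f: "(U, e) \<in> local_frames F" "x \<in> U" by (rule frame_cover)
  obtain W C and \<kappa> :: "'m \<Rightarrow> real" where \<kappa>: "open W" "x \<in> W" "W \<subseteq> C" "closed C" "C \<subseteq> U" "\<kappa> \<in> C_inf M" "\<And>x. x \<in> W \<Longrightarrow> \<kappa> x = 1"
    "\<And>x. x \<notin> C \<Longrightarrow> \<kappa> x = 0" by (rule coordinate_ball[OF frame_open[OF f(1)] f(2)]) blast
  define s where "s = (\<lambda>i x. if x \<in> U then \<kappa> x *\<^sub>R e i x else 0)"
  have "global_frame_on W s" unfolding s_def by (rule global_frame[OF f(1) \<kappa>(4,5,3,6,7,8)])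
  note s = global_frame_onD[OF this]
  let ?h = "\<lambda>y. \<mu> y - \<nu> y"
  have h: "?h \<in> sections M F" by (rule section_diff[OF assms(2,3)])
  obtain c where c: "\<And>i. i < rk \<Longrightarrow> c i \<in> C_inf M" "\<And>y. y \<in> W \<Longrightarrow> ?h y = (\<Sum>i<rk. c i y *\<^sub>R s i y)"
    using s(4)[OF h] by blast
  have "c i x = 0" if "i < rk" for i
    using s(3)[OF \<kappa>(2) _ that, of "\<lambda>i. c i x"] c(2)[OF \<kappa>(2)] assms(4) by simp
  then have "D ?h = 0" using D_frame[OF \<kappa>(1,2) s(1) h c] assms(1) by simp
  then show ?thesis using D_diff[OF assms(2,3)] by simp
qed

end

section \<open>Representations of transitive Lie algebroids\<close>

locale algebroid_representation = manifold b n M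
  for b :: "nat \<Rightarrow> 'e::real_inner" and n :: nat
    and M :: "('m::{t2_space, second_countable_topology}, 'e) atlas" +
  fixes A :: "('m, 'a::real_vector) lie_algebroid" and F :: "('m, 'f::real_vector) vector_bundle"
    and L :: "'m \<Rightarrow> 'a \<Rightarrow> ('m \<Rightarrow> 'f) \<Rightarrow> 'f"
  assumes lie_algebroid: "is_lie_algebroid M A" and transitive: "transitive M A"
    and vector_bundle_F: "is_vector_bundle M F" and representation: "is_representation M A F L"
begin

lemmas algebroid_axioms = lie_algebroid[unfolded is_lie_algebroid_def is_anchor_def is_lie_bracket_def]

sublocale A: smooth_bundle b n M A
  by unfold_locales (rule algebroid_axioms[THEN conjunct1])

sublocale F: smooth_bundle b n M F
  by unfold_locales (rule vector_bundle_F)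

lemmas anchor_axioms = algebroid_axioms[THEN conjunct2, THEN conjunct1]
lemmas bracket_axioms = algebroid_axioms[THEN conjunct2, THEN conjunct2, THEN conjunct1]
lemmas anchor_tangent = anchor_axioms[THEN conjunct1, rule_format]
lemmas anchor_add = anchor_axioms[THEN conjunct2, THEN conjunct1, rule_format]
lemmas anchor_scale = anchor_axioms[THEN conjunct2, THEN conjunct2, THEN conjunct1, rule_format]
lemmas anchor_smooth = anchor_axioms[THEN conjunct2, THEN conjunct2, THEN conjunct2, rule_format]
lemmas bracket_section = bracket_axioms[THEN conjunct1, rule_format]
lemmas bracket_add = bracket_axioms[THEN conjunct2, THEN conjunct1, rule_format]
lemmas bracket_antisym =
  bracket_axioms[THEN conjunct2, THEN conjunct2, THEN conjunct2, THEN conjunct1, rule_format]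
lemmas anchor_bracket =
  algebroid_axioms[THEN conjunct2, THEN conjunct2, THEN conjunct2, THEN conjunct1, rule_format]
lemmas bracket_leibniz =
  algebroid_axioms[THEN conjunct2, THEN conjunct2, THEN conjunct2, THEN conjunct2, rule_format]

lemmas representation_axioms = representation[unfolded is_representation_def]
lemmas L_cdo = representation_axioms[THEN conjunct1, rule_format]
lemmas L_add = representation_axioms[THEN conjunct2, THEN conjunct1, rule_format]
lemmas L_scale = representation_axioms[THEN conjunct2, THEN conjunct2, THEN conjunct1, rule_format]
lemmas L_section =
  representation_axioms[THEN conjunct2, THEN conjunct2, THEN conjunct2, THEN conjunct1, rule_format]
lemmas L_bracket =
  representation_axioms[THEN conjunct2, THEN conjunct2, THEN conjunct2, THEN conjunct2, rule_format]

lemma cdo_L: "a \<in> fibre A x \<Longrightarrow> cdo b n M F x (L x a) (anchor A x a)"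
  by unfold_locales (use L_cdo in auto)

lemma lin_comb_fibre:
  assumes "finite I" "\<And>i. i \<in> I \<Longrightarrow> a i \<in> fibre A x"
  shows "(\<Sum>i\<in>I. c i *\<^sub>R a i) \<in> fibre A x"
  by (rule subspace_sum[OF A.subspace_fibre]) (rule subspace_scale[OF A.subspace_fibre assms(2)])

lemma anchor_lin_comb:
  assumes "finite I" "\<And>i. i \<in> I \<Longrightarrow> a i \<in> fibre A x"
  shows "anchor A x (\<Sum>i\<in>I. c i *\<^sub>R a i) f = (\<Sum>i\<in>I. c i * anchor A x (a i) f)"
  using assms
proof (induction I)
  case empty
  have "anchor A x (0 *\<^sub>R 0) = (\<lambda>f. 0 * anchor A x 0 f)"
    by (rule anchor_scale[OF subspace_0[OF A.subspace_fibre]])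
  then show ?case by simp
next
  case (insert i I)
  have "anchor A x (c i *\<^sub>R a i + (\<Sum>i\<in>I. c i *\<^sub>R a i)) =
      (\<lambda>f. anchor A x (c i *\<^sub>R a i) f + anchor A x (\<Sum>i\<in>I. c i *\<^sub>R a i) f)"
    by (rule anchor_add[OF subspace_scale[OF A.subspace_fibre] lin_comb_fibre]) (use insert in auto)
  then show ?case using insert anchor_scale[of "a i" x "c i"] by simp
qed

lemma L_lin_comb:
  assumes "finite I" "\<And>i. i \<in> I \<Longrightarrow> a i \<in> fibre A x"
  shows "L x (\<Sum>i\<in>I. c i *\<^sub>R a i) \<mu> = (\<Sum>i\<in>I. c i *\<^sub>R L x (a i) \<mu>)"
  using assms
proof (induction I)
  case empty
  have "L x (0 *\<^sub>R 0) = (\<lambda>\<mu>. 0 *\<^sub>R L x 0 \<mu>)"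
    by (rule L_scale[OF subspace_0[OF A.subspace_fibre]])
  then show ?case by simp
next
  case (insert i I)
  have "L x (c i *\<^sub>R a i + (\<Sum>i\<in>I. c i *\<^sub>R a i)) =
      (\<lambda>\<mu>. L x (c i *\<^sub>R a i) \<mu> + L x (\<Sum>i\<in>I. c i *\<^sub>R a i) \<mu>)"
    by (rule L_add[OF subspace_scale[OF A.subspace_fibre] lin_comb_fibre]) (use insert in auto)
  then show ?case using insert L_scale[of "a i" x "c i"] by simp
qed

lemma bracket_add_right:
  assumes "s \<in> sections M A" "t \<in> sections M A" "t' \<in> sections M A"
  shows "bracket A s (\<lambda>x. t x + t' x) x = bracket A s t x + bracket A s t' x"
proof -
  have "bracket A s (\<lambda>x. t x + t' x) x = - bracket A (\<lambda>x. t x + t' x) s x"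
    using bracket_antisym[OF assms(1) A.section_add[OF assms(2,3)]] by (rule fun_cong)
  also have "\<dots> = - (bracket A t s x + bracket A t' s x)"
    using fun_cong[OF bracket_add[OF assms(2,3,1)], of x] by simp
  also have "\<dots> = bracket A s t x + bracket A s t' x"
    using fun_cong[OF bracket_antisym[OF assms(1,2)], of x] fun_cong[OF bracket_antisym[OF assms(1,3)], of x]
    by simp
  finally show ?thesis .
qed

lemma bracket_sum_right:
  assumes s: "s \<in> sections M A" and "finite I" "\<And>i. i \<in> I \<Longrightarrow> t i \<in> sections M A"
  shows "bracket A s (\<lambda>x. \<Sum>i\<in>I. t i x) x = (\<Sum>i\<in>I. bracket A s (t i) x)"
  using assms(2,3)
proof (induction I)
  case empty
  \<comment> \<open>The bracket with the zero section is found from the Leibniz rule for the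
    constant function 0.\<close>
  have "bracket A s (\<lambda>y. 0 *\<^sub>R s y) x = 0 *\<^sub>R bracket A s s x + anchor A x (s x) (\<lambda>_. 0) *\<^sub>R s x"
    by (rule bracket_leibniz[OF s s C_inf_const])
  then show ?case using tangent_const[OF anchor_tangent[OF A.section_fibre[OF s]]] by simp
next
  case (insert i I)
  then show ?case using bracket_add_right[OF s, of "t i" "\<lambda>x. \<Sum>i\<in>I. t i x"] A.section_sum[of I t] by simp
qed

subsection \<open>Cochains and coboundaries\<close>

lemma cochainD:
  assumes "\<Omega> \<in> cochains1 M A F"
  shows "a \<in> fibre A x \<Longrightarrow> \<Omega> x a \<in> fibre F x"
    "a \<in> fibre A x \<Longrightarrow> a' \<in> fibre A x \<Longrightarrow> \<Omega> x (a + a') = \<Omega> x a + \<Omega> x a'"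
    "a \<in> fibre A x \<Longrightarrow> \<Omega> x (c *\<^sub>R a) = c *\<^sub>R \<Omega> x a"
    "a \<notin> fibre A x \<Longrightarrow> \<Omega> x a = 0"
    "s \<in> sections M A \<Longrightarrow> (\<lambda>x. \<Omega> x (s x)) \<in> sections M F"
  using assms by (auto simp: cochains1_def linear_between_def)

lemma cochain_lin_comb:
  assumes "\<Omega> \<in> cochains1 M A F" "finite I" "\<And>i. i \<in> I \<Longrightarrow> a i \<in> fibre A x"
  shows "\<Omega> x (\<Sum>i\<in>I. c i *\<^sub>R a i) = (\<Sum>i\<in>I. c i *\<^sub>R \<Omega> x (a i))"
  using assms(2,3)
proof (induction I)
  case empty
  show ?case using cochainD(3)[OF assms(1) subspace_0[OF A.subspace_fibre], of x 0] by simp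
next
  case (insert i I)
  have "\<Omega> x (c i *\<^sub>R a i + (\<Sum>i\<in>I. c i *\<^sub>R a i)) = \<Omega> x (c i *\<^sub>R a i) + \<Omega> x (\<Sum>i\<in>I. c i *\<^sub>R a i)"
    by (rule cochainD(2)[OF assms(1) subspace_scale[OF A.subspace_fibre] lin_comb_fibre]) (use insert in auto)
  then show ?case using insert cochainD(3)[OF assms(1), of "a i" x] by simp
qed

lemma cocycleD:
  assumes "\<Omega> \<in> cocycles1 M A F L"
  shows "\<Omega> \<in> cochains1 M A F"
    "s \<in> sections M A \<Longrightarrow> t \<in> sections M A \<Longrightarrow>
      \<Omega> x (bracket A s t x) = L x (s x) (\<lambda>y. \<Omega> y (t y)) - L x (t x) (\<lambda>y. \<Omega> y (s y))"
  using assms by (auto simp: cocycles1_def)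

definition coboundary :: "('m \<Rightarrow> 'f) \<Rightarrow> 'm \<Rightarrow> 'a \<Rightarrow> 'f" where
  "coboundary \<mu> = (\<lambda>x a. if a \<in> fibre A x then L x a \<mu> else 0)"

lemma coboundaries1_eq: "coboundaries1 M A F L = coboundary ` sections M F"
  by (simp add: coboundaries1_def coboundary_def[abs_def])

lemma coboundary_section: "s \<in> sections M A \<Longrightarrow> (\<lambda>x. coboundary \<mu> x (s x)) = (\<lambda>x. L x (s x) \<mu>)"
  by (simp add: coboundary_def A.section_fibre)

lemma coboundary_cocycle:
  assumes "\<mu> \<in> sections M F" shows "coboundary \<mu> \<in> cocycles1 M A F L"
proof -
  have "linear_between (fibre A x) (fibre F x) (coboundary \<mu> x)" for x
    using cdo.D_fibre[OF cdo_L assms] L_add[of _ x] L_scale[of _ x]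
    by (simp add: linear_between_def coboundary_def subspace_add[OF A.subspace_fibre]
        subspace_scale[OF A.subspace_fibre])
  moreover have "(\<lambda>x. coboundary \<mu> x (s x)) \<in> sections M F" if "s \<in> sections M A" for s
    unfolding coboundary_section[OF that] by (rule L_section[OF that assms])
  ultimately have "coboundary \<mu> \<in> cochains1 M A F"
    by (simp add: cochains1_def) (simp add: coboundary_def)
  moreover have "coboundary \<mu> x (bracket A s t x) =
      L x (s x) (\<lambda>y. coboundary \<mu> y (t y)) - L x (t x) (\<lambda>y. coboundary \<mu> y (s y))"
    if "s \<in> sections M A" "t \<in> sections M A" for s t x
    unfolding coboundary_section[OF that(1)] coboundary_section[OF that(2)]
    using L_bracket[OF that assms] A.section_fibre[OF bracket_section[OF that]]
    by (simp add: coboundary_def)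
  ultimately show ?thesis by (simp add: cocycles1_def)
qed

lemma cocycle_diff:
  assumes P: "\<Omega> \<in> cocycles1 M A F L" and Q: "\<Omega>' \<in> cocycles1 M A F L"
  shows "(\<lambda>x a. \<Omega> x a - \<Omega>' x a) \<in> cocycles1 M A F L"
proof -
  note P' = cochainD[OF cocycleD(1)[OF P]] and Q' = cochainD[OF cocycleD(1)[OF Q]]
  have "(\<lambda>x a. \<Omega> x a - \<Omega>' x a) \<in> cochains1 M A F"
    unfolding cochains1_def linear_between_def mem_Collect_eq
    using P' Q' by (auto intro: subspace_diff[OF F.subspace_fibre] F.section_diff simp: scaleR_diff_right)
  moreover have "\<Omega> x (bracket A s t x) - \<Omega>' x (bracket A s t x) =
      L x (s x) (\<lambda>y. \<Omega> y (t y) - \<Omega>' y (t y)) - L x (t x) (\<lambda>y. \<Omega> y (s y) - \<Omega>' y (s y))"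
    if st: "s \<in> sections M A" "t \<in> sections M A" for s t x
    using cdo.D_diff[OF cdo_L[OF A.section_fibre[OF st(1)]] P'(5)[OF st(2)] Q'(5)[OF st(2)], of x]
      cdo.D_diff[OF cdo_L[OF A.section_fibre[OF st(2)]] P'(5)[OF st(1)] Q'(5)[OF st(1)], of x]
      cocycleD(2)[OF P st] cocycleD(2)[OF Q st] by simp
  ultimately show ?thesis by (simp add: cocycles1_def)
qed

end

subsection \<open>Frames adapted to a coordinate ball\<close>

text \<open>In an adapted frame the sections \<open>s k\<close> lift the coordinate vector fields, and the
  sections \<open>u \<alpha>\<close> defined below span the adjoint bundle.\<close>

locale adapted_frame = algebroid_representation b n M A F L
  for b :: "nat \<Rightarrow> 'e::real_inner" and n :: nat
    and M :: "('m::{t2_space, second_countable_topology}, 'e) atlas"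
    and A :: "('m, 'a::real_vector) lie_algebroid" and F :: "('m, 'f::real_vector) vector_bundle"
    and L :: "'m \<Rightarrow> 'a \<Rightarrow> ('m \<Rightarrow> 'f) \<Rightarrow> 'f" +
  fixes U :: "'m set" and \<phi> :: "'m \<Rightarrow> 'e" and W :: "'m set" and \<xi> :: "nat \<Rightarrow> 'm \<Rightarrow> real"
    and E :: "nat \<Rightarrow> 'm \<Rightarrow> 'f" and S s :: "nat \<Rightarrow> 'm \<Rightarrow> 'a"
  assumes U: "(U, \<phi>) \<in> M" and W: "open W" "W \<subseteq> U" and convex_W: "convex (\<phi> ` W)"
    and \<xi>: "\<And>k. k < n \<Longrightarrow> \<xi> k \<in> C_inf M" "\<And>k z. k < n \<Longrightarrow> z \<in> W \<Longrightarrow> \<xi> k z = \<phi> z \<bullet> b k"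
    and E: "F.global_frame_on W E" and S: "A.global_frame_on W S"
    and s: "\<And>k. k < n \<Longrightarrow> s k \<in> sections M A"
      "\<And>z k j. z \<in> W \<Longrightarrow> k < n \<Longrightarrow> j < n \<Longrightarrow> anchor A z (s k z) (\<xi> j) = (if k = j then 1 else 0)"
begin

abbreviation "rF \<equiv> bundle_rank F"
abbreviation "rA \<equiv> bundle_rank A"

lemmas E_frame = F.global_frame_onD[OF E] and S_frame = A.global_frame_onD[OF S]

lemma anchor_expansion:
  "z \<in> W \<Longrightarrow> a \<in> fibre A z \<Longrightarrow> f \<in> C_inf M \<Longrightarrow>
    anchor A z a f = (\<Sum>k<n. anchor A z a (\<xi> k) * partial U \<phi> k f z)"
  by (rule tangent_expansion[OF U W convex_W _ \<xi> anchor_tangent])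

lemma anchor_eq_0I:
  assumes "z \<in> W" "a \<in> fibre A z" "\<And>k. k < n \<Longrightarrow> anchor A z a (\<xi> k) = 0"
  shows "anchor A z a = (\<lambda>f. 0)"
proof
  fix f show "anchor A z a f = 0"
  proof (cases "f \<in> C_inf M")
    case True
    then show ?thesis using anchor_expansion[OF assms(1,2)] assms(3) by simp
  next
    case False
    then show ?thesis using anchor_tangent[OF assms(2)] by (simp add: tangent_space_def)
  qed
qed

lemma s_fibre: "k < n \<Longrightarrow> s k z \<in> fibre A z"
  by (rule A.section_fibre[OF s(1)])

lemma anchor_s: "z \<in> W \<Longrightarrow> k < n \<Longrightarrow> f \<in> C_inf M \<Longrightarrow> anchor A z (s k z) f = partial U \<phi> k f z"
  using anchor_expansion[OF _ s_fibre] by (simp add: s(2) if_distrib[of "\<lambda>x. x * _"] cong: if_cong)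

text \<open>From \<open>S \<alpha>\<close> the lift of its own anchor is subtracted, which makes the
  anchor of the rest vanish over \<open>W\<close>.\<close>

definition u :: "nat \<Rightarrow> 'm \<Rightarrow> 'a" where
  "u \<alpha> z = S \<alpha> z - (\<Sum>k<n. anchor A z (S \<alpha> z) (\<xi> k) *\<^sub>R s k z)"

lemma u_section: assumes "\<alpha> < rA" shows "u \<alpha> \<in> sections M A"
proof -
  have "(\<lambda>z. \<Sum>k<n. anchor A z (S \<alpha> z) (\<xi> k) *\<^sub>R s k z) \<in> sections M A"
    by (rule A.section_sum, simp)
      (use A.section_scale[OF anchor_smooth[OF S_frame(1)[OF assms] \<xi>(1)] s(1)] in auto)
  from A.section_diff[OF S_frame(1)[OF assms] this] show ?thesis by (simp add: u_def[abs_def])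
qed

lemma anchor_u:
  assumes "\<alpha> < rA" "z \<in> W" shows "anchor A z (u \<alpha> z) = (\<lambda>f. 0)"
proof (rule anchor_eq_0I[OF assms(2) A.section_fibre[OF u_section[OF assms(1)]]])
  fix j assume j: "j < n"
  let ?t = "\<Sum>k<n. anchor A z (S \<alpha> z) (\<xi> k) *\<^sub>R s k z"
  have "anchor A z ?t (\<xi> j) = (\<Sum>k<n. anchor A z (S \<alpha> z) (\<xi> k) * anchor A z (s k z) (\<xi> j))"
    by (rule anchor_lin_comb) (auto simp: s_fibre)
  also have "\<dots> = anchor A z (S \<alpha> z) (\<xi> j)"
    using j by (simp add: s(2)[OF assms(2)] if_distrib[of "\<lambda>x. _ * x"] cong: if_cong)
  finally have t: "anchor A z ?t (\<xi> j) = anchor A z (S \<alpha> z) (\<xi> j)" .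
  have "?t \<in> fibre A z" by (rule lin_comb_fibre) (auto simp: s_fibre)
  from anchor_add[OF A.section_fibre[OF u_section[OF assms(1)]] this]
  have "anchor A z (u \<alpha> z + ?t) (\<xi> j) = anchor A z (u \<alpha> z) (\<xi> j) + anchor A z ?t (\<xi> j)"
    by (rule fun_cong)
  moreover have "u \<alpha> z + ?t = S \<alpha> z" by (simp add: u_def)
  ultimately have "anchor A z (S \<alpha> z) (\<xi> j) = anchor A z (u \<alpha> z) (\<xi> j) + anchor A z ?t (\<xi> j)"
    by simp
  then show "anchor A z (u \<alpha> z) (\<xi> j) = 0" using t by simp
qed

lemma frame_split: "S \<alpha> z = u \<alpha> z + (\<Sum>k<n. anchor A z (S \<alpha> z) (\<xi> k) *\<^sub>R s k z)"
  by (simp add: u_def)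

text \<open>The parts of the \<open>S \<alpha>\<close> along the \<open>s k\<close> add up to the
  lift of the anchor of the combination, which is zero.\<close>

lemma kernel_expansion:
  assumes "z \<in> W" "anchor A z (\<Sum>\<alpha><rA. \<tau> \<alpha> *\<^sub>R S \<alpha> z) = (\<lambda>f. 0)"
  shows "(\<Sum>\<alpha><rA. \<tau> \<alpha> *\<^sub>R S \<alpha> z) = (\<Sum>\<alpha><rA. \<tau> \<alpha> *\<^sub>R u \<alpha> z)"
proof -
  have 0: "(\<Sum>\<alpha><rA. \<tau> \<alpha> * anchor A z (S \<alpha> z) f) = 0" for f
    using anchor_lin_comb[of "{..<rA}" "\<lambda>\<alpha>. S \<alpha> z" z \<tau> f] assms(2) A.section_fibre[OF S_frame(1)] by simp
  have "(\<Sum>\<alpha><rA. \<tau> \<alpha> *\<^sub>R S \<alpha> z) = (\<Sum>\<alpha><rA. \<tau> \<alpha> *\<^sub>R u \<alpha> z) +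
      (\<Sum>\<alpha><rA. \<Sum>k<n. (\<tau> \<alpha> * anchor A z (S \<alpha> z) (\<xi> k)) *\<^sub>R s k z)"
    by (subst frame_split) (simp add: scaleR_add_right sum.distrib scaleR_sum_right)
  also have "(\<Sum>\<alpha><rA. \<Sum>k<n. (\<tau> \<alpha> * anchor A z (S \<alpha> z) (\<xi> k)) *\<^sub>R s k z) =
      (\<Sum>k<n. (\<Sum>\<alpha><rA. \<tau> \<alpha> * anchor A z (S \<alpha> z) (\<xi> k)) *\<^sub>R s k z)"
    by (subst sum.swap) (simp add: scaleR_sum_left)
  finally show ?thesis by (simp add: 0)
qed

text \<open>The \<open>u \<alpha>\<close> span the adjoint bundle over \<open>W\<close> but are in
  general linearly dependent, so smooth coefficients are inherited from the honest frame
  \<open>S\<close>.\<close>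

lemma kernel_section:
  assumes "t \<in> sections M A" "\<And>z. z \<in> W \<Longrightarrow> anchor A z (t z) = (\<lambda>f. 0)"
  shows "\<exists>\<tau>. (\<forall>\<alpha><rA. \<tau> \<alpha> \<in> C_inf M) \<and> (\<forall>z\<in>W. t z = (\<Sum>\<alpha><rA. \<tau> \<alpha> z *\<^sub>R u \<alpha> z))"
proof -
  obtain \<tau> where \<tau>: "\<forall>\<alpha><rA. \<tau> \<alpha> \<in> C_inf M" "\<forall>z\<in>W. t z = (\<Sum>\<alpha><rA. \<tau> \<alpha> z *\<^sub>R S \<alpha> z)"
    using S_frame(4)[OF assms(1)] by blast
  have "t z = (\<Sum>\<alpha><rA. \<tau> \<alpha> z *\<^sub>R u \<alpha> z)" if z: "z \<in> W" for z
    using kernel_expansion[OF z, of "\<lambda>\<alpha>. \<tau> \<alpha> z"] assms(2)[OF z] \<tau>(2) z by simp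
  then show ?thesis using \<tau>(1) by blast
qed

text \<open>The anchor of a bracket is the commutator of the anchors, and vector fields with
  constant coordinates commute.\<close>

lemma anchor_bracket_constant:
  assumes t: "t \<in> sections M A" and k: "k < n"
    and c: "\<And>j z. j < n \<Longrightarrow> z \<in> W \<Longrightarrow> anchor A z (t z) (\<xi> j) = c j" and z: "z \<in> W"
  shows "anchor A z (bracket A (s k) t z) = (\<lambda>f. 0)"
proof (rule anchor_eq_0I[OF z A.section_fibre[OF bracket_section[OF s(1)[OF k] t]]])
  fix j assume j: "j < n"
  have 0: "anchor A z a h = 0" if "a \<in> fibre A z" "h \<in> C_inf M" "\<And>y. y \<in> W \<Longrightarrow> h y = d" for a h d
    using tangent_local[OF anchor_tangent[OF that(1)] that(2) C_inf_const W(1) z that(3)]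
      tangent_const[OF anchor_tangent[OF that(1)]] by simp
  have "anchor A z (s k z) (\<lambda>y. anchor A y (t y) (\<xi> j)) = 0"
    by (rule 0[OF s_fibre[OF k] anchor_smooth[OF t \<xi>(1)[OF j]] c[OF j]])
  moreover have "anchor A z (t z) (\<lambda>y. anchor A y (s k y) (\<xi> j)) = 0"
    by (rule 0[OF A.section_fibre[OF t] anchor_smooth[OF s(1)[OF k] \<xi>(1)[OF j]] s(2)[OF _ k j]])
  ultimately show "anchor A z (bracket A (s k) t z) (\<xi> j) = 0"
    using anchor_bracket[OF s(1)[OF k] t \<xi>(1)[OF j], of z] by simp
qed

text \<open>A lift over \<open>W\<close> of the Euler field centred at \<open>z0\<close>. The centre
  is a parameter, so that one adapted frame serves all centres in \<open>W\<close>.\<close>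

definition rad :: "'m \<Rightarrow> 'm \<Rightarrow> 'a" where
  "rad z0 z = (\<Sum>k<n. (\<xi> k z - \<xi> k z0) *\<^sub>R s k z)"

lemma rad_coeff: "k < n \<Longrightarrow> (\<lambda>z. \<xi> k z - \<xi> k z0) \<in> C_inf M"
  by (rule C_inf_diff[OF \<xi>(1) C_inf_const])

lemma rad_section: "rad z0 \<in> sections M A"
  unfolding rad_def[abs_def]
  by (rule A.section_sum, simp) (use A.section_scale[OF rad_coeff s(1)] in auto)

text \<open>Over \<open>W\<close> the last sum vanishes for sections of the adjoint bundle and
  equals \<open>s i\<close> for \<open>t = s i\<close>. This difference is the source of the two
  exponents in \<open>radial_vanish\<close>.\<close>

lemma bracket_rad:
  assumes t: "t \<in> sections M A"
  shows "bracket A (rad z0) t z =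
    (\<Sum>k<n. (\<xi> k z - \<xi> k z0) *\<^sub>R bracket A (s k) t z - anchor A z (t z) (\<xi> k) *\<^sub>R s k z)"
proof -
  have "bracket A (rad z0) t z = - bracket A t (rad z0) z"
    by (rule fun_cong[OF bracket_antisym[OF rad_section t]])
  also have "bracket A t (rad z0) z = (\<Sum>k<n. bracket A t (\<lambda>z. (\<xi> k z - \<xi> k z0) *\<^sub>R s k z) z)"
    unfolding rad_def[abs_def]
    by (rule bracket_sum_right[OF t], simp) (use A.section_scale[OF rad_coeff s(1)] in auto)
  also have "\<dots> = (\<Sum>k<n. - ((\<xi> k z - \<xi> k z0) *\<^sub>R bracket A (s k) t z) + anchor A z (t z) (\<xi> k) *\<^sub>R s k z)"
  proof (rule sum.cong)
    fix k assume "k \<in> {..<n}"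
    then have k: "k < n" by simp
    have "anchor A z (t z) (\<lambda>z. \<xi> k z - \<xi> k z0) = anchor A z (t z) (\<xi> k)"
      using tangent_diff[OF anchor_tangent[OF A.section_fibre[OF t]] \<xi>(1)[OF k] C_inf_const]
        tangent_const[OF anchor_tangent[OF A.section_fibre[OF t]]] by simp
    then show "bracket A t (\<lambda>z. (\<xi> k z - \<xi> k z0) *\<^sub>R s k z) z =
        - ((\<xi> k z - \<xi> k z0) *\<^sub>R bracket A (s k) t z) + anchor A z (t z) (\<xi> k) *\<^sub>R s k z"
      using bracket_leibniz[OF t s(1)[OF k] rad_coeff[OF k], of z0 z]
        fun_cong[OF bracket_antisym[OF t s(1)[OF k]], of z] by simp
  qed simp
  finally show ?thesis by (simp add: sum_subtractf sum_negf sum.distrib)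
qed

text \<open>Connection coefficients of \<open>F\<close> in the frame \<open>E\<close> along the
  lifts \<open>s k\<close>, chosen as global smooth functions; only their values over
  \<open>W\<close> are determined.\<close>

definition conn :: "nat \<Rightarrow> nat \<Rightarrow> nat \<Rightarrow> 'm \<Rightarrow> real" where
  "conn = (SOME \<Gamma>. \<forall>j<rF. \<forall>k<n. (\<forall>i<rF. \<Gamma> i j k \<in> C_inf M) \<and>
    (\<forall>z\<in>W. L z (s k z) (E j) = (\<Sum>i<rF. \<Gamma> i j k z *\<^sub>R E i z)))"

lemma conn:
  assumes "j < rF" "k < n"
  shows "i < rF \<Longrightarrow> conn i j k \<in> C_inf M"
    "z \<in> W \<Longrightarrow> L z (s k z) (E j) = (\<Sum>i<rF. conn i j k z *\<^sub>R E i z)"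
proof -
  have "\<exists>c. j < rF \<longrightarrow> k < n \<longrightarrow> (\<forall>i<rF. c i \<in> C_inf M) \<and>
      (\<forall>z\<in>W. L z (s k z) (E j) = (\<Sum>i<rF. c i z *\<^sub>R E i z))" for j k
    using E_frame(4)[OF L_section[OF s(1)[of k] E_frame(1)[of j]]] by blast
  then obtain c where "\<And>j k. j < rF \<Longrightarrow> k < n \<Longrightarrow> (\<forall>i<rF. c j k i \<in> C_inf M) \<and>
      (\<forall>z\<in>W. L z (s k z) (E j) = (\<Sum>i<rF. c j k i z *\<^sub>R E i z))" by metis
  then have "\<exists>\<Gamma>. \<forall>j<rF. \<forall>k<n. (\<forall>i<rF. \<Gamma> i j k \<in> C_inf M) \<and>
      (\<forall>z\<in>W. L z (s k z) (E j) = (\<Sum>i<rF. \<Gamma> i j k z *\<^sub>R E i z))"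
    by (intro exI[of _ "\<lambda>i j k. c j k i"]) simp
  from someI_ex[OF this, folded conn_def] assms
  show "i < rF \<Longrightarrow> conn i j k \<in> C_inf M"
    "z \<in> W \<Longrightarrow> L z (s k z) (E j) = (\<Sum>i<rF. conn i j k z *\<^sub>R E i z)"
    by simp_all
qed

lemma L_s:
  assumes z: "z \<in> V" and V: "open V" "V \<subseteq> W" and k: "k < n" and P: "P \<in> sections M F"
    and p: "\<And>i. i < rF \<Longrightarrow> p i \<in> C_inf M" "\<And>y. y \<in> V \<Longrightarrow> P y = (\<Sum>i<rF. p i y *\<^sub>R E i y)"
  shows "L z (s k z) P = (\<Sum>i<rF. (partial U \<phi> k (p i) z + (\<Sum>j<rF. conn i j k z * p j z)) *\<^sub>R E i z)"
proof -
  have zW: "z \<in> W" using z V by auto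
  have "L z (s k z) P = (\<Sum>i<rF. anchor A z (s k z) (p i) *\<^sub>R E i z + p i z *\<^sub>R L z (s k z) (E i))"
    by (rule cdo.D_frame[OF cdo_L[OF s_fibre[OF k]] V(1) z E_frame(1) P p])
  also have "\<dots> = (\<Sum>i<rF. partial U \<phi> k (p i) z *\<^sub>R E i z) +
      (\<Sum>j<rF. \<Sum>i<rF. (conn i j k z * p j z) *\<^sub>R E i z)"
    using anchor_s[OF zW k p(1)] conn(2)[OF _ k zW]
    by (simp add: sum.distrib scaleR_sum_right mult.commute)
  also have "(\<Sum>j<rF. \<Sum>i<rF. (conn i j k z * p j z) *\<^sub>R E i z) =
      (\<Sum>i<rF. (\<Sum>j<rF. conn i j k z * p j z) *\<^sub>R E i z)"
    by (subst sum.swap) (simp add: scaleR_sum_left)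
  finally show ?thesis by (simp add: sum.distrib scaleR_add_left)
qed

text \<open>In a frame the operator of the radial section is the Euler derivative of the
  coefficients plus connection terms, each with a factor that vanishes at the centre.\<close>

lemma L_rad:
  assumes z: "z \<in> V" and V: "open V" "V \<subseteq> W" and P: "P \<in> sections M F"
    and p: "\<And>i. i < rF \<Longrightarrow> p i \<in> C_inf M" "\<And>y. y \<in> V \<Longrightarrow> P y = (\<Sum>i<rF. p i y *\<^sub>R E i y)"
  shows "L z (rad z0 z) P = (\<Sum>i<rF. (\<Sum>k<n. (\<xi> k z - \<xi> k z0) *
    (partial U \<phi> k (p i) z + (\<Sum>j<rF. conn i j k z * p j z))) *\<^sub>R E i z)"
proof -
  have "L z (rad z0 z) P = (\<Sum>k<n. (\<xi> k z - \<xi> k z0) *\<^sub>R L z (s k z) P)"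
    unfolding rad_def by (rule L_lin_comb) (auto simp: s_fibre)
  also have "\<dots> = (\<Sum>k<n. \<Sum>i<rF. ((\<xi> k z - \<xi> k z0) *
      (partial U \<phi> k (p i) z + (\<Sum>j<rF. conn i j k z * p j z))) *\<^sub>R E i z)"
    using L_s[OF z V _ P p] by (simp add: scaleR_sum_right)
  finally show ?thesis by (subst (asm) sum.swap) (simp add: scaleR_sum_left)
qed

text \<open>Sections of \<open>F\<close> which satisfy a linear equation along the rays from \<open>z\<^sub>0\<close> vanish: with the
  weight \<open>t\<^sup>m\<close> the coefficients solve a homogeneous regular linear equation.\<close>

lemma radial_vanish:
  fixes q m :: nat
  assumes V: "open V" "V \<subseteq> W" "convex (\<phi> ` V)" and z0: "z0 \<in> V"
    and P: "\<And>\<beta>. \<beta> < q \<Longrightarrow> P \<beta> \<in> sections M F"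
    and eq: "\<And>\<beta> z. \<beta> < q \<Longrightarrow> z \<in> V \<Longrightarrow> L z (rad z0 z) (P \<beta>) =
      (- real m) *\<^sub>R P \<beta> z + (\<Sum>\<gamma><q. (\<Sum>k<n. (\<xi> k z - \<xi> k z0) * g k \<beta> \<gamma> z) *\<^sub>R P \<gamma> z)"
    and g: "\<And>k \<beta> \<gamma>. k < n \<Longrightarrow> \<beta> < q \<Longrightarrow> \<gamma> < q \<Longrightarrow> g k \<beta> \<gamma> \<in> C_inf M"
    and init: "m = 1 \<or> (m = 0 \<and> (\<forall>\<beta><q. P \<beta> z0 = 0))"
    and \<beta>: "\<beta> < q" and z: "z \<in> V"
  shows "P \<beta> z = 0"
proof -
  have "\<exists>c. \<beta> < q \<longrightarrow> (\<forall>i<rF. c i \<in> C_inf M) \<and> (\<forall>x\<in>W. P \<beta> x = (\<Sum>i<rF. c i x *\<^sub>R E i x))" for \<beta>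
    using E_frame(4)[OF P[of \<beta>]] by blast
  then obtain p where p: "\<And>\<beta> i. \<beta> < q \<Longrightarrow> i < rF \<Longrightarrow> p \<beta> i \<in> C_inf M"
    "\<And>\<beta> x. \<beta> < q \<Longrightarrow> x \<in> W \<Longrightarrow> P \<beta> x = (\<Sum>i<rF. p \<beta> i x *\<^sub>R E i x)" by metis
  let ?x = "\<phi> z" and ?c = "\<phi> z0"
  \<comment> \<open>The straight segment from \<open>z0\<close> to \<open>z\<close> in the chart, as
    a curve in the manifold.\<close>
  define pt where "pt t = inv_into U \<phi> (?c + t *\<^sub>R (?x - ?c))" for t
  have VU: "y \<in> U" if "y \<in> V" for y using that V(2) W(2) by auto
  have pt: "pt t \<in> V" "\<phi> (pt t) = ?c + t *\<^sub>R (?x - ?c)" if "t \<in> {0..1}" for t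
  proof -
    have "?c + t *\<^sub>R (?x - ?c) \<in> \<phi> ` V"
      using that z z0 by (intro ray_in_convex[OF V(3)]) auto
    then obtain y where y: "y \<in> V" "?c + t *\<^sub>R (?x - ?c) = \<phi> y" by auto
    then have "pt t = y" using chart(4)[OF U VU[OF y(1)]] by (simp add: pt_def)
    then show "pt t \<in> V" "\<phi> (pt t) = ?c + t *\<^sub>R (?x - ?c)" using y by auto
  qed
  have f: "\<xi> k (pt t) - \<xi> k z0 = t * ((?x - ?c) \<bullet> b k)" if "k < n" "t \<in> {0..1}" for k t
    using \<xi>(2)[OF that(1) subsetD[OF V(2) pt(1)[OF that(2)]]] \<xi>(2)[OF that(1) subsetD[OF V(2) z0]]
    by (simp add: pt(2)[OF that(2)] inner_add_left)
  have smooth: "smooth_on (\<phi> ` U) (h \<circ> inv_into U \<phi>)" if "h \<in> C_inf M" for h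
    by (rule C_infD[OF that U])
  have ray: "?c + t *\<^sub>R (?x - ?c) \<in> \<phi> ` U" if "t \<in> {0..1}" for t
    using pt[OF that] VU by (metis imageI)
  have cont: "continuous_on {0..1} (\<lambda>t. h (pt t))" if "h \<in> C_inf M" for h
  proof -
    have "continuous_on {0..1} (\<lambda>t. (h \<circ> inv_into U \<phi>) (?c + t *\<^sub>R (?x - ?c)))"
      by (rule continuous_on_compose2[OF smooth_on_continuous[OF smooth[OF that]]])
        (use ray in \<open>auto intro!: continuous_intros\<close>)
    then show ?thesis by (simp add: pt_def)
  qed
  \<comment> \<open>The derivative of \<open>h\<close> along that curve; the Euler derivative at
    \<open>pt t\<close> is \<open>t\<close> times it.\<close>
  define D where "D h t = (\<Sum>k<n. ((?x - ?c) \<bullet> b k) * partial U \<phi> k h (pt t))" for h t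
  have deriv: "((\<lambda>t. h (pt t)) has_real_derivative D h t) (at t)" if h: "h \<in> C_inf M" and t: "t \<in> {0<..<1}" for h t
  proof -
    let ?h = "h \<circ> inv_into U \<phi>"
    have t': "t \<in> {0..1}" using t by simp
    have fd: "(?h has_derivative frechet_derivative ?h (at (\<phi> (pt t)))) (at (?c + t *\<^sub>R (?x - ?c)))"
      using smooth_on_has_derivative[OF smooth[OF h] ray[OF t']] by (simp add: pt(2)[OF t'])
    have "((\<lambda>t. ?c + t *\<^sub>R (?x - ?c)) has_derivative (\<lambda>s. s *\<^sub>R (?x - ?c))) (at t)"
      by (auto intro!: derivative_eq_intros)
    from has_derivative_compose[OF this fd]
    have "((\<lambda>t. h (pt t)) has_derivative (\<lambda>s. frechet_derivative ?h (at (\<phi> (pt t))) (s *\<^sub>R (?x - ?c)))) (at t)"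
      by (simp add: pt_def)
    moreover have "frechet_derivative ?h (at (\<phi> (pt t))) (s *\<^sub>R (?x - ?c)) = D h t * s" for s
      using linear_scale[OF has_derivative_linear[OF fd]] linear_expand[OF has_derivative_linear[OF fd], of "?x - ?c"]
      by (simp add: D_def partial_def mult.commute)
    ultimately show ?thesis by (simp add: has_field_derivative_def)
  qed
  let ?G = "\<lambda>\<beta> \<gamma> t. \<Sum>k<n. ((?x - ?c) \<bullet> b k) * g k \<beta> \<gamma> (pt t)"
  let ?C = "\<lambda>i j t. \<Sum>k<n. ((?x - ?c) \<bullet> b k) * conn i j k (pt t)"
  \<comment> \<open>The hypothesis \<open>eq\<close> in components of the frame \<open>E\<close>.
    Every radial factor has contributed one \<open>t\<close>.\<close>
  have coeff: "t * D (p \<beta> i) t = - real m * p \<beta> i (pt t) +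
      t * ((\<Sum>\<gamma><q. ?G \<beta> \<gamma> t * p \<gamma> i (pt t)) - (\<Sum>j<rF. ?C i j t * p \<beta> j (pt t)))"
    if \<beta>: "\<beta> < q" and i: "i < rF" and t: "t \<in> {0..1}" for \<beta> i t
  proof -
    let ?z = "pt t"
    have zV: "?z \<in> V" and zW: "?z \<in> W" using pt[OF t] V(2) by auto
    let ?l = "\<lambda>i. \<Sum>k<n. (\<xi> k ?z - \<xi> k z0) * (partial U \<phi> k (p \<beta> i) ?z + (\<Sum>j<rF. conn i j k ?z * p \<beta> j ?z))"
    let ?r = "\<lambda>i. - real m * p \<beta> i ?z + (\<Sum>\<gamma><q. (\<Sum>k<n. (\<xi> k ?z - \<xi> k z0) * g k \<beta> \<gamma> ?z) * p \<gamma> i ?z)"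
    have "(\<Sum>i<rF. ?l i *\<^sub>R E i ?z) = L ?z (rad z0 ?z) (P \<beta>)"
      by (rule L_rad[OF zW W(1) order_refl P[OF \<beta>] p(1)[OF \<beta>] p(2)[OF \<beta>], symmetric])
    also have "\<dots> = (\<Sum>i<rF. ?r i *\<^sub>R E i ?z)"
    proof -
      have "(\<Sum>\<gamma><q. (\<Sum>k<n. (\<xi> k ?z - \<xi> k z0) * g k \<beta> \<gamma> ?z) *\<^sub>R P \<gamma> ?z) =
          (\<Sum>\<gamma><q. \<Sum>i<rF. ((\<Sum>k<n. (\<xi> k ?z - \<xi> k z0) * g k \<beta> \<gamma> ?z) * p \<gamma> i ?z) *\<^sub>R E i ?z)"
        using p(2)[OF _ zW] by (simp add: scaleR_sum_right)
      also have "\<dots> = (\<Sum>i<rF. (\<Sum>\<gamma><q. (\<Sum>k<n. (\<xi> k ?z - \<xi> k z0) * g k \<beta> \<gamma> ?z) * p \<gamma> i ?z) *\<^sub>R E i ?z)"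
        by (subst sum.swap) (simp add: scaleR_sum_left)
      moreover have "(- real m) *\<^sub>R P \<beta> ?z = (\<Sum>i<rF. (- real m * p \<beta> i ?z) *\<^sub>R E i ?z)"
        using p(2)[OF \<beta> zW] by (simp only: scaleR_sum_right scaleR_scaleR)
      ultimately show ?thesis
        unfolding eq[OF \<beta> zV] by (simp only: scaleR_add_left sum.distrib)
    qed
    finally have "(\<Sum>i<rF. (?l i - ?r i) *\<^sub>R E i ?z) = 0"
      by (simp only: scaleR_diff_left sum_subtractf) simp
    from E_frame(3)[OF zW this i] have "?l i = ?r i" by simp
    moreover have "?l i = t * D (p \<beta> i) t + t * (\<Sum>j<rF. ?C i j t * p \<beta> j ?z)"
    proof -
      have "?l i = (\<Sum>k<n. t * (((?x - ?c) \<bullet> b k) * partial U \<phi> k (p \<beta> i) ?z)) +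
          (\<Sum>k<n. \<Sum>j<rF. t * ((((?x - ?c) \<bullet> b k) * conn i j k ?z) * p \<beta> j ?z))"
        using f[OF _ t] by (simp add: distrib_left sum.distrib sum_distrib_left mult.assoc)
      also have "(\<Sum>k<n. \<Sum>j<rF. t * ((((?x - ?c) \<bullet> b k) * conn i j k ?z) * p \<beta> j ?z)) =
          t * (\<Sum>j<rF. ?C i j t * p \<beta> j ?z)"
        by (subst sum.swap) (simp add: sum_distrib_left sum_distrib_right)
      finally show ?thesis by (simp add: D_def sum_distrib_left)
    qed
    moreover have "?r i = - real m * p \<beta> i ?z + t * (\<Sum>\<gamma><q. ?G \<beta> \<gamma> t * p \<gamma> i ?z)"
      using f[OF _ t] by (simp add: sum_distrib_left sum_distrib_right mult.assoc)
    ultimately show ?thesis by (simp add: right_diff_distrib)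
  qed
  let ?I = "{..<q} \<times> {..<rF}"
  \<comment> \<open>The unknowns are indexed by pairs of a section and a frame component:
    \<open>g\<close> mixes the sections, the connection mixes the components.\<close>
  define a where "a = (\<lambda>(\<beta>, i) (\<gamma>, j) t. (if i = j then ?G \<beta> \<gamma> t else 0) - (if \<beta> = \<gamma> then ?C i j t else 0))"
  \<comment> \<open>The weight absorbs the singular term. For \<open>m = 1\<close> it also yields
    initial value 0 without any condition on \<open>P \<beta> z0\<close>.\<close>
  define w where "w = (\<lambda>(\<beta>, i) t. t ^ m * p \<beta> i (pt t))"
  have asum: "(\<Sum>\<delta>\<in>?I. a (\<beta>, i) \<delta> t * w \<delta> t) =
      t ^ m * ((\<Sum>\<gamma><q. ?G \<beta> \<gamma> t * p \<gamma> i (pt t)) - (\<Sum>j<rF. ?C i j t * p \<beta> j (pt t)))"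
    if "\<beta> < q" "i < rF" for \<beta> i t
  proof -
    have "(\<Sum>\<delta>\<in>?I. a (\<beta>, i) \<delta> t * w \<delta> t) =
        (\<Sum>\<gamma><q. \<Sum>j<rF. (if i = j then ?G \<beta> \<gamma> t * w (\<gamma>, j) t else 0) - (if \<beta> = \<gamma> then ?C i j t * w (\<gamma>, j) t else 0))"
      unfolding sum.cartesian_product by (rule sum.cong) (auto simp: a_def left_diff_distrib)
    also have "\<dots> = (\<Sum>\<gamma><q. ?G \<beta> \<gamma> t * w (\<gamma>, i) t) -
        (\<Sum>\<gamma><q. \<Sum>j<rF. if \<beta> = \<gamma> then ?C i j t * w (\<gamma>, j) t else 0)"
      using that(2) by (simp add: sum_subtractf)
    also have "(\<Sum>\<gamma><q. \<Sum>j<rF. if \<beta> = \<gamma> then ?C i j t * w (\<gamma>, j) t else 0) =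
        (\<Sum>j<rF. \<Sum>\<gamma><q. if \<beta> = \<gamma> then ?C i j t * w (\<gamma>, j) t else 0)" by (rule sum.swap)
    also have "\<dots> = (\<Sum>j<rF. ?C i j t * w (\<beta>, j) t)" using that(1) by simp
    finally show ?thesis by (simp add: w_def right_diff_distrib sum_distrib_left mult.left_commute)
  qed
  have acont: "continuous_on {0..1} (a \<delta> \<eta>)" if "\<delta> \<in> ?I" "\<eta> \<in> ?I" for \<delta> \<eta>
  proof -
    obtain \<beta> i \<gamma> j where \<delta>: "\<delta> = (\<beta>, i)" "\<eta> = (\<gamma>, j)" "\<beta> < q" "\<gamma> < q" "i < rF" "j < rF" using \<open>\<delta> \<in> ?I\<close> \<open>\<eta> \<in> ?I\<close> by auto
    have "continuous_on {0..1} (?G \<beta> \<gamma>)" using cont[OF g] \<delta> by (auto intro!: continuous_intros)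
    moreover have "continuous_on {0..1} (?C i j)" using cont[OF conn(1)] \<delta> by (auto intro!: continuous_intros)
    ultimately have "continuous_on {0..1} (\<lambda>t. (if i = j then ?G \<beta> \<gamma> t else 0) - (if \<beta> = \<gamma> then ?C i j t else 0))"
      by (cases "i = j"; cases "\<beta> = \<gamma>") (auto intro!: continuous_on_diff continuous_on_minus)
    then show ?thesis unfolding \<delta>(1,2) a_def by simp
  qed
  have "\<exists>B. \<forall>t\<in>{0..1}. \<bar>a \<delta> \<eta> t\<bar> \<le> B" if "\<delta> \<in> ?I" "\<eta> \<in> ?I" for \<delta> \<eta>
    using compact_imp_bounded[OF compact_continuous_image[OF acont[OF that] compact_Icc]]
    by (auto simp: bounded_iff)
  then obtain B where B: "\<And>\<delta> \<eta> t. \<delta> \<in> ?I \<Longrightarrow> \<eta> \<in> ?I \<Longrightarrow> t \<in> {0..1} \<Longrightarrow> \<bar>a \<delta> \<eta> t\<bar> \<le> B \<delta> \<eta>"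
    by metis
  let ?B = "\<Sum>\<delta>\<in>?I. \<Sum>\<eta>\<in>?I. \<bar>B \<delta> \<eta>\<bar>"
  have aB: "\<bar>a \<delta> \<eta> t\<bar> \<le> ?B" if "\<delta> \<in> ?I" "\<eta> \<in> ?I" "t \<in> {0..1}" for \<delta> \<eta> t
  proof -
    have "\<bar>B \<delta> \<eta>\<bar> \<le> (\<Sum>\<eta>\<in>?I. \<bar>B \<delta> \<eta>\<bar>)" by (rule member_le_sum) (use that in auto)
    also have "\<dots> \<le> ?B" by (rule member_le_sum[of \<delta> ?I "\<lambda>\<delta>. \<Sum>\<eta>\<in>?I. \<bar>B \<delta> \<eta>\<bar>"]) (use that in \<open>auto intro: sum_nonneg\<close>)
    finally show ?thesis using B[OF that] by simp
  qed
  have pt01: "pt 0 = z0" "pt 1 = z"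
    using chart(4)[OF U VU[OF z0]] chart(4)[OF U VU[OF z]] by (simp_all add: pt_def)
  have w0: "w (\<beta>, i) 1 = 0" if "\<beta> < q" "i < rF" for \<beta> i
  proof (rule linear_ode_zero[of ?I w a ?B])
    fix \<delta> t assume \<delta>: "\<delta> \<in> ?I" and t: "t \<in> {0<..<1::real}"
    then obtain \<beta> i where \<delta>: "\<delta> = (\<beta>, i)" and \<beta>: "\<beta> < q" and i: "i < rF" by auto
    let ?X = "(\<Sum>\<gamma><q. ?G \<beta> \<gamma> t * p \<gamma> i (pt t)) - (\<Sum>j<rF. ?C i j t * p \<beta> j (pt t))"
    have d: "((\<lambda>t. p \<beta> i (pt t)) has_real_derivative D (p \<beta> i) t) (at t)"
      by (rule deriv[OF p(1)[OF \<beta> i] t])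
    have c: "t * D (p \<beta> i) t = - real m * p \<beta> i (pt t) + t * ?X" using coeff[OF \<beta> i, of t] t by simp
    have "(w \<delta> has_real_derivative t ^ m * ?X) (at t)"
      using init
    proof
      \<comment> \<open>The summand \<open>p\<close> in the derivative of \<open>t * p\<close>
        cancels the term \<open>- p\<close> of \<open>c\<close>.\<close>
      assume m: "m = 1"
      from DERIV_mult[OF DERIV_ident d] show ?thesis using c m by (simp add: w_def \<delta> mult.commute)
    next
      \<comment> \<open>Here \<open>c\<close> is divided by \<open>t\<close>, which is positive in
        the open interval.\<close>
      assume "m = 0 \<and> (\<forall>\<beta><q. P \<beta> z0 = 0)"
      then show ?thesis using d c t by (simp add: w_def \<delta>)
    qed
    then show "(w \<delta> has_real_derivative (\<Sum>j\<in>?I. a \<delta> j t * w j t)) (at t)"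
      unfolding \<delta> asum[OF \<beta> i] .
  next
    fix \<delta> assume "\<delta> \<in> ?I"
    then obtain \<beta> i where \<delta>: "\<delta> = (\<beta>, i)" and \<beta>: "\<beta> < q" and i: "i < rF" by auto
    show "continuous_on {0..1} (w \<delta>)"
      using cont[OF p(1)[OF \<beta> i]] by (auto simp: w_def \<delta> intro!: continuous_intros)
    have "p \<beta> i z0 = 0" if "P \<beta> z0 = 0"
      using E_frame(3)[of z0 "\<lambda>i. p \<beta> i z0", OF _ _ i] p(2)[OF \<beta>, of z0] that z0 V(2) by auto
    then show "w \<delta> 0 = 0" using init \<beta> by (auto simp: w_def \<delta> pt01)
  qed (use that aB in auto)
  have "p \<beta> i z = 0" if "i < rF" for i using w0[OF \<beta> that] by (simp add: w_def pt01)
  then show ?thesis using p(2)[OF \<beta>, of z] z V(2) by auto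
qed

end

section \<open>Primitives of a cocycle: pointwise and on open sets\<close>

context algebroid_representation begin

definition solves :: "('m \<Rightarrow> 'a \<Rightarrow> 'f) \<Rightarrow> 'm set \<Rightarrow> ('m \<Rightarrow> 'f) \<Rightarrow> bool" where
  "solves \<Omega> V \<mu> \<longleftrightarrow> \<mu> \<in> sections M F \<and> (\<forall>z\<in>V. \<forall>a\<in>fibre A z. L z a \<mu> = \<Omega> z a)"

text \<open>\<open>m\<close> is a primitive of the restriction of \<open>\<Omega>\<close> to the isotropy Lie algebra at \<open>z\<close>.\<close>

definition fibre_primitive :: "('m \<Rightarrow> 'a \<Rightarrow> 'f) \<Rightarrow> 'm \<Rightarrow> 'f \<Rightarrow> bool" where
  "fibre_primitive \<Omega> z m \<longleftrightarrow> m \<in> fibre F z \<and>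
     (\<forall>a\<in>adjoint_fibre A z. \<forall>\<nu>\<in>sections M F. \<nu> z = m \<longrightarrow> L z a \<nu> = \<Omega> z a)"

text \<open>Elements of the adjoint fibre have zero symbol, so their operators see only the value of
  a section at \<open>z\<close>.\<close>

lemma solves_fibre_primitive:
  assumes "solves \<Omega> V \<mu>" "z \<in> V" shows "fibre_primitive \<Omega> z (\<mu> z)"
proof -
  have \<mu>: "\<mu> \<in> sections M F" using assms(1) by (simp add: solves_def)
  have "L z a \<nu> = \<Omega> z a" if a: "a \<in> adjoint_fibre A z" and \<nu>: "\<nu> \<in> sections M F" "\<nu> z = \<mu> z" for a \<nu>
  proof -
    have a': "a \<in> fibre A z" "anchor A z a = (\<lambda>f. 0)" using a by (auto simp: adjoint_fibre_def)
    have "L z a \<nu> = L z a \<mu>" by (rule cdo.D_tensorial[OF cdo_L[OF a'(1)] a'(2) \<nu>(1) \<mu> \<nu>(2)])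
    then show ?thesis using assms a'(1) by (simp add: solves_def)
  qed
  then show ?thesis using F.section_fibre[OF \<mu>] by (simp add: fibre_primitive_def)
qed

end

context adapted_frame begin

text \<open>The difference of the two sections is annihilated by the radial section and vanishes at
  \<open>z0\<close>: the case of \<open>radial_vanish\<close> with one section, weight 0 and no
  right-hand side.\<close>

lemma unique_solution:
  assumes V: "open V" "V \<subseteq> W" "convex (\<phi> ` V)" and z0: "z0 \<in> V"
    and \<mu>: "\<mu> \<in> sections M F" "\<mu>' \<in> sections M F"
    and eq: "\<And>z a. z \<in> V \<Longrightarrow> a \<in> fibre A z \<Longrightarrow> L z a \<mu> = L z a \<mu>'"
    and 0: "\<mu> z0 = \<mu>' z0" and z: "z \<in> V"
  shows "\<mu> z = \<mu>' z"
proof -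
  have "(\<lambda>_::nat. \<lambda>z. \<mu> z - \<mu>' z) 0 z = 0"
  proof (rule radial_vanish[OF V z0, where q = 1 and m = 0 and g = "\<lambda>_ _ _ _. 0"])
    fix x assume x: "x \<in> V"
    have "rad z0 x \<in> fibre A x" by (rule A.section_fibre[OF rad_section])
    then have "L x (rad z0 x) (\<lambda>z. \<mu> z - \<mu>' z) = 0"
      using cdo.D_diff[OF cdo_L \<mu>] eq[OF x] by simp
    then show "L x (rad z0 x) (\<lambda>z. \<mu> z - \<mu>' z) = - real 0 *\<^sub>R (\<mu> x - \<mu>' x) +
        (\<Sum>\<gamma><1::nat. (\<Sum>k<n. (\<xi> k x - \<xi> k z0) * 0) *\<^sub>R (\<mu> x - \<mu>' x))" by simp
  qed (use F.section_diff[OF \<mu>] C_inf_const 0 z in auto)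
  then show ?thesis by simp
qed

text \<open>The values \<open>\<Psi> (u \<alpha>)\<close> satisfy the equation of \<open>radial_vanish\<close> with \<open>m = 0\<close>. The values
  \<open>\<Psi> (s k)\<close> then satisfy it with \<open>m = 1\<close>, because \<open>[rad, s k] + s k\<close> takes values in the
  adjoint bundle.\<close>

lemma cocycle_vanish:
  assumes V: "open V" "V \<subseteq> W" "convex (\<phi> ` V)" and z0: "z0 \<in> V"
    and \<Psi>: "\<Psi> \<in> cocycles1 M A F L" and r: "\<And>z. z \<in> V \<Longrightarrow> \<Psi> z (rad z0 z) = 0"
    and 0: "\<And>a. a \<in> adjoint_fibre A z0 \<Longrightarrow> \<Psi> z0 a = 0" and z: "z \<in> V" and a: "a \<in> fibre A z"
  shows "\<Psi> z a = 0"
proof -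
  note \<Psi>c = cocycleD(1)[OF \<Psi>]
  \<comment> \<open>In the cocycle identity the other term applies an operator to
    \<open>\<Psi> (rad)\<close>, a section that vanishes near \<open>z\<close>; locality removes
    it.\<close>
  have L: "L z (rad z0 z) (\<lambda>y. \<Psi> y (t y)) = \<Psi> z (bracket A (rad z0) t z)"
    if t: "t \<in> sections M A" and z: "z \<in> V" for t z
  proof -
    have "L z (t z) (\<lambda>y. \<Psi> y (rad z0 y)) = L z (t z) (\<lambda>y. 0)"
      by (rule cdo.D_local[OF cdo_L[OF A.section_fibre[OF t]] cochainD(5)[OF \<Psi>c rad_section]
            F.section_zero V(1) z r])
    also have "\<dots> = 0" by (rule cdo.D_zero[OF cdo_L[OF A.section_fibre[OF t]]])
    finally show ?thesis using cocycleD(2)[OF \<Psi> rad_section t] by simp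
  qed
  have ufib: "u \<alpha> x \<in> fibre A x" if "\<alpha> < rA" for \<alpha> x by (rule A.section_fibre[OF u_section[OF that]])
  \<comment> \<open>The constants \<open>c\<close> cover two cases: all zero for
    \<open>u \<alpha>\<close>, and a Kronecker symbol for \<open>s i\<close>.\<close>
  have br: "\<exists>\<tau>. (\<forall>\<gamma><rA. \<tau> \<gamma> \<in> C_inf M) \<and> (\<forall>z\<in>W. bracket A (s k) t z = (\<Sum>\<gamma><rA. \<tau> \<gamma> z *\<^sub>R u \<gamma> z))"
    if "k < n" "t \<in> sections M A" "\<And>j z. j < n \<Longrightarrow> z \<in> W \<Longrightarrow> anchor A z (t z) (\<xi> j) = c j" for k t c
    by (rule kernel_section[OF bracket_section[OF s(1)[OF that(1)] that(2)]
          anchor_bracket_constant[OF that(2,1) that(3)]])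
  have "\<exists>\<tau>. k < n \<longrightarrow> \<alpha> < rA \<longrightarrow> (\<forall>\<gamma><rA. \<tau> \<gamma> \<in> C_inf M) \<and> (\<forall>z\<in>W. bracket A (s k) (u \<alpha>) z = (\<Sum>\<gamma><rA. \<tau> \<gamma> z *\<^sub>R u \<gamma> z))" for k \<alpha>
    using br[OF _ u_section, of k \<alpha> "\<lambda>_. 0"] anchor_u by auto
  then obtain G where G: "\<And>k \<alpha> \<gamma>. k < n \<Longrightarrow> \<alpha> < rA \<Longrightarrow> \<gamma> < rA \<Longrightarrow> G k \<alpha> \<gamma> \<in> C_inf M"
    "\<And>k \<alpha> z. k < n \<Longrightarrow> \<alpha> < rA \<Longrightarrow> z \<in> W \<Longrightarrow> bracket A (s k) (u \<alpha>) z = (\<Sum>\<gamma><rA. G k \<alpha> \<gamma> z *\<^sub>R u \<gamma> z)"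
    by metis
  have "\<exists>\<tau>. k < n \<longrightarrow> i < n \<longrightarrow> (\<forall>z\<in>W. bracket A (s k) (s i) z = (\<Sum>\<gamma><rA. \<tau> \<gamma> z *\<^sub>R u \<gamma> z))" for k i
    using br[OF _ s(1), of k i "\<lambda>j. if i = j then 1 else 0"] s(2) by auto
  then obtain H where H: "\<And>k i z. k < n \<Longrightarrow> i < n \<Longrightarrow> z \<in> W \<Longrightarrow> bracket A (s k) (s i) z = (\<Sum>\<gamma><rA. H k i \<gamma> z *\<^sub>R u \<gamma> z)"
    by metis
  have swap: "(\<Sum>k<n. f k *\<^sub>R (\<Sum>\<gamma><rA. T k \<gamma> *\<^sub>R v \<gamma>)) = (\<Sum>\<gamma><rA. (\<Sum>k<n. f k * T k \<gamma>) *\<^sub>R v \<gamma>)"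
    for f :: "nat \<Rightarrow> real" and T and v :: "nat \<Rightarrow> 'a"
    unfolding scaleR_sum_right scaleR_sum_left by (subst sum.swap) simp
  have \<Psi>u: "\<Psi> x (u \<alpha> x) = 0" if "\<alpha> < rA" "x \<in> V" for \<alpha> x
  proof (rule radial_vanish[OF V z0, where P = "\<lambda>\<alpha> z. \<Psi> z (u \<alpha> z)" and q = rA and m = 0 and g = G])
    fix \<alpha> x assume \<alpha>: "\<alpha> < rA" and x: "x \<in> V"
    have xW: "x \<in> W" using x V(2) by auto
    have "bracket A (rad z0) (u \<alpha>) x = (\<Sum>k<n. (\<xi> k x - \<xi> k z0) *\<^sub>R (\<Sum>\<gamma><rA. G k \<alpha> \<gamma> x *\<^sub>R u \<gamma> x))"
      using G(2)[OF _ \<alpha> xW] anchor_u[OF \<alpha> xW] by (simp add: bracket_rad[OF u_section[OF \<alpha>]])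
    then have "\<Psi> x (bracket A (rad z0) (u \<alpha>) x) = (\<Sum>\<gamma><rA. (\<Sum>k<n. (\<xi> k x - \<xi> k z0) * G k \<alpha> \<gamma> x) *\<^sub>R \<Psi> x (u \<gamma> x))"
      unfolding swap using cochain_lin_comb[OF \<Psi>c finite_lessThan, of rA "\<lambda>\<gamma>. u \<gamma> x" x] ufib by simp
    then show "L x (rad z0 x) (\<lambda>z. \<Psi> z (u \<alpha> z)) = - real 0 *\<^sub>R \<Psi> x (u \<alpha> x) +
        (\<Sum>\<gamma><rA. (\<Sum>k<n. (\<xi> k x - \<xi> k z0) * G k \<alpha> \<gamma> x) *\<^sub>R \<Psi> x (u \<gamma> x))"
      unfolding L[OF u_section[OF \<alpha>] x] by simp
  next
    have "\<Psi> z0 (u \<alpha> z0) = 0" if "\<alpha> < rA" for \<alpha>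
      using that z0 V(2) ufib[OF that] anchor_u[OF that] by (intro 0) (auto simp: adjoint_fibre_def)
    then show "(0::nat) = 1 \<or> (0::nat) = 0 \<and> (\<forall>\<beta><rA. \<Psi> z0 (u \<beta> z0) = 0)" by simp
  qed (use that G(1) cochainD(5)[OF \<Psi>c u_section] in auto)
  have \<Psi>s: "\<Psi> x (s i x) = 0" if "i < n" "x \<in> V" for i x
  proof (rule radial_vanish[OF V z0, where P = "\<lambda>i z. \<Psi> z (s i z)" and q = n and m = 1 and g = "\<lambda>_ _ _ _. 0"])
    fix i x assume i: "i < n" and x: "x \<in> V"
    have xW: "x \<in> W" using x V(2) by auto
    \<comment> \<open>Apart from \<open>- s i\<close> the bracket is a combination of the
      \<open>u \<gamma>\<close>, on which \<open>\<Psi>\<close> vanishes by \<open>\<Psi>u\<close>.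
      The equation for \<open>\<Psi> (s i)\<close> is therefore decoupled, with
      \<open>m = 1\<close>.\<close>
    have "bracket A (rad z0) (s i) x = (\<Sum>k<n. (\<xi> k x - \<xi> k z0) *\<^sub>R (\<Sum>\<gamma><rA. H k i \<gamma> x *\<^sub>R u \<gamma> x)) - s i x"
      using H[OF _ i xW] i by (simp add: bracket_rad[OF s(1)[OF i]] s(2)[OF xW i] sum_subtractf
          if_distrib[of "\<lambda>c. c *\<^sub>R _"] cong: if_cong)
    then have "bracket A (rad z0) (s i) x + s i x = (\<Sum>\<gamma><rA. (\<Sum>k<n. (\<xi> k x - \<xi> k z0) * H k i \<gamma> x) *\<^sub>R u \<gamma> x)"
      unfolding swap by simp
    then have "\<Psi> x (bracket A (rad z0) (s i) x + s i x) = 0"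
      using cochain_lin_comb[OF \<Psi>c finite_lessThan, of rA "\<lambda>\<gamma>. u \<gamma> x" x] ufib \<Psi>u[OF _ x] by simp
    moreover have "\<Psi> x (bracket A (rad z0) (s i) x + s i x) = \<Psi> x (bracket A (rad z0) (s i) x) + \<Psi> x (s i x)"
      by (rule cochainD(2)[OF \<Psi>c A.section_fibre[OF bracket_section[OF rad_section s(1)[OF i]]] s_fibre[OF i]])
    ultimately have "\<Psi> x (bracket A (rad z0) (s i) x) = - \<Psi> x (s i x)" by (simp add: eq_neg_iff_add_eq_0)
    then show "L x (rad z0 x) (\<lambda>z. \<Psi> z (s i z)) = - real 1 *\<^sub>R \<Psi> x (s i x) +
        (\<Sum>\<gamma><n. (\<Sum>k<n. (\<xi> k x - \<xi> k z0) * 0) *\<^sub>R \<Psi> x (s \<gamma> x))"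
      unfolding L[OF s(1)[OF i] x] by simp
  qed (use that C_inf_const cochainD(5)[OF \<Psi>c s(1)] in auto)
  have zW: "z \<in> W" using z V(2) by auto
  obtain c where c: "a = (\<Sum>\<alpha><rA. c \<alpha> *\<^sub>R S \<alpha> z)" using S_frame(2)[OF zW a] by blast
  have "\<Psi> z (S \<alpha> z) = 0" if \<alpha>: "\<alpha> < rA" for \<alpha>
  proof -
    let ?t = "\<Sum>k<n. anchor A z (S \<alpha> z) (\<xi> k) *\<^sub>R s k z"
    have "\<Psi> z (u \<alpha> z + ?t) = \<Psi> z (u \<alpha> z) + \<Psi> z ?t"
      by (rule cochainD(2)[OF \<Psi>c ufib[OF \<alpha>] lin_comb_fibre]) (auto simp: s_fibre)
    also have "\<Psi> z ?t = 0"
      using cochain_lin_comb[OF \<Psi>c finite_lessThan, of n "\<lambda>k. s k z" z] s_fibre \<Psi>s[OF _ z] by simp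
    finally show ?thesis using \<Psi>u[OF \<alpha> z] frame_split[of \<alpha> z] by simp
  qed
  then show ?thesis
    using cochain_lin_comb[OF \<Psi>c finite_lessThan, of rA "\<lambda>\<alpha>. S \<alpha> z" z c] A.section_fibre[OF S_frame(1)]
    by (simp add: c)
qed

text \<open>One neighbourhood must serve every centre \<open>z0\<close> in it. The radial equation
  is solved on a fixed small ball around \<open>\<phi> y\<close>, which is convex and hence
  star-shaped about each of its points, with bounds that hold for all these centres.\<close>

lemma local_solutions:
  assumes ball: "\<phi> ` W = ball (\<phi> y) \<epsilon>" and y: "y \<in> W" and \<Omega>: "\<Omega> \<in> cocycles1 M A F L"
  shows "\<exists>V. open V \<and> y \<in> V \<and>
    (\<forall>z\<in>V. \<forall>m. fibre_primitive \<Omega> z m \<longrightarrow> (\<exists>\<mu>. solves \<Omega> V \<mu> \<and> \<mu> z = m))"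
proof -
  note \<Omega>c = cocycleD(1)[OF \<Omega>]
  have yU: "y \<in> U" using y W(2) by auto
  define \<Gamma> where "\<Gamma> i j k = conn i j k \<circ> inv_into U \<phi>" for i j k
  have \<Gamma>s: "smooth_on (\<phi> ` U) (\<Gamma> i j k)" if "i < rF" "j < rF" "k < n" for i j k
    unfolding \<Gamma>_def by (rule C_infD[OF conn(1)[OF that(2,3,1)] U])
  define h where "h x = (\<Sum>i<rF. \<Sum>j<rF. \<Sum>k<n. \<bar>\<Gamma> i j k x\<bar>)" for x
  have hc: "continuous_on (\<phi> ` U) h"
    unfolding h_def using smooth_on_continuous[OF \<Gamma>s] by (auto intro!: continuous_intros)
  \<comment> \<open>The added 1 allows for the variation of \<open>h\<close> over the ball of radius
    \<open>d\<close> below, so \<open>B\<close> bounds each connection coefficient there.\<close>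
  define B where "B = h (\<phi> y) + 1"
  have B0: "0 \<le> B" unfolding B_def h_def by (auto intro!: add_nonneg_nonneg sum_nonneg)
  have "\<exists>d>0. \<forall>x\<in>\<phi> ` U. dist x (\<phi> y) < d \<longrightarrow> dist (h x) (h (\<phi> y)) < 1"
    using hc yU unfolding continuous_on_iff by (metis imageI zero_less_one)
  then obtain d where d: "d > 0" "\<And>x. x \<in> \<phi> ` U \<Longrightarrow> dist x (\<phi> y) < d \<Longrightarrow> dist (h x) (h (\<phi> y)) < 1" by blast
  have \<epsilon>: "\<epsilon> > 0" using ball y by (metis empty_iff imageI ball_empty not_le)
  let ?R = "real (rF * rF) * real n * B"
  have R0: "0 \<le> ?R" using B0 by simp
  \<comment> \<open>Two points of the ball are at distance at most \<open>2 * \<delta>\<close>, so a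
    matrix entry is at most \<open>n * 2 * \<delta> * B\<close>. Multiplied by
    \<open>rF * rF\<close> this is \<open>2 * \<delta> * ?R\<close>, which must not exceed one half;
    the 1 added to \<open>?R\<close> keeps the denominator positive.\<close>
  define \<delta> where "\<delta> = min (min d \<epsilon>) (1 / (4 * (?R + 1)))"
  have \<delta>: "\<delta> > 0" "\<delta> \<le> d" "\<delta> \<le> \<epsilon>" "\<delta> \<le> 1 / (4 * (?R + 1))" using d(1) \<epsilon> R0 by (auto simp: \<delta>_def)
  let ?S = "ball (\<phi> y) \<delta>"
  have SW: "?S \<subseteq> \<phi> ` W" using \<delta>(3) by (auto simp: ball)
  then have SU: "?S \<subseteq> \<phi> ` U" using W(2) by blast
  \<comment> \<open>The coordinate solution lives on \<open>V1\<close>. The smaller ball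
    \<open>V\<close>, with a cut-off supported in \<open>V1\<close>, is where it will be realised by
    a global section.\<close>
  define V1 where "V1 = W \<inter> (U \<inter> \<phi> -` ?S)"
  have V1: "open V1" "V1 \<subseteq> W" "V1 \<subseteq> U" "y \<in> V1"
    using W chart_open_preimage[OF U open_ball] y yU \<delta>(1) by (auto simp: V1_def)
  have imV1: "\<phi> ` V1 = ?S"
  proof
    show "?S \<subseteq> \<phi> ` V1"
    proof
      fix x assume x: "x \<in> ?S"
      then obtain w where "w \<in> W" "x = \<phi> w" using SW by auto
      then show "x \<in> \<phi> ` V1" using x W(2) by (auto simp: V1_def)
    qed
  qed (auto simp: V1_def)
  obtain V \<epsilon>' C and \<kappa> :: "'m \<Rightarrow> real" where V: "open V" "y \<in> V" "V \<subseteq> U" "\<phi> ` V = ball (\<phi> y) \<epsilon>'"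
    "V \<subseteq> C" "closed C" "C \<subseteq> V1" "\<kappa> \<in> C_inf M" "\<And>x. x \<in> V \<Longrightarrow> \<kappa> x = 1" "\<And>x. x \<notin> C \<Longrightarrow> \<kappa> x = 0"
    by (rule coordinate_ball_in_chart[OF U yU V1(1,4)]) blast
  have VV1: "x \<in> V1" if "x \<in> V" for x using that V by auto
  have VW: "V \<subseteq> W" using VV1 V1(2) by auto
  have cV: "convex (\<phi> ` V)" by (simp add: V(4))
  have "\<exists>\<mu>. solves \<Omega> V \<mu> \<and> \<mu> z0 = m" if z0: "z0 \<in> V" and prim: "fibre_primitive \<Omega> z0 m" for z0 m
  proof -
    have m: "m \<in> fibre F z0" using prim by (simp add: fibre_primitive_def)
    let ?c = "\<phi> z0"
    have z0W: "z0 \<in> W" and cS: "?c \<in> ?S" using z0 VW VV1[OF z0] imV1 by auto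
    obtain m' where m': "m = (\<Sum>i<rF. m' i *\<^sub>R E i z0)" using E_frame(2)[OF z0W m] by blast
    have "\<exists>c. k < n \<longrightarrow> (\<forall>i<rF. c i \<in> C_inf M) \<and> (\<forall>x\<in>W. \<Omega> x (s k x) = (\<Sum>i<rF. c i x *\<^sub>R E i x))" for k
      using E_frame(4)[OF cochainD(5)[OF \<Omega>c s(1)[of k]]] by blast
    then obtain \<omega> where \<omega>: "\<And>k i. k < n \<Longrightarrow> i < rF \<Longrightarrow> \<omega> k i \<in> C_inf M"
      "\<And>k x. k < n \<Longrightarrow> x \<in> W \<Longrightarrow> \<Omega> x (s k x) = (\<Sum>i<rF. \<omega> k i x *\<^sub>R E i x)" by metis
    have small: "\<bar>\<Sum>k<n. ((x - ?c) \<bullet> b k) * \<Gamma> i j k z\<bar> \<le> real n * (2 * \<delta> * B)"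
      if "i < rF" "j < rF" "x \<in> ?S" "z \<in> ?S" for i j x z
    proof -
      have "norm (x - ?c) \<le> 2 * \<delta>"
        using that(3) cS dist_triangle2[of x ?c "\<phi> y"] by (simp add: dist_norm norm_minus_commute)
      then have 1: "\<bar>(x - ?c) \<bullet> b k\<bar> \<le> 2 * \<delta>" if "k < n" for k using abs_coord_le[OF that, of "x - ?c"] by simp
      have "dist (h z) (h (\<phi> y)) < 1" using d(2)[of z] that(4) SU \<delta>(2) by (auto simp: dist_commute)
      then have hz: "h z \<le> B" by (simp add: B_def dist_real_def)
      have 2: "\<bar>\<Gamma> i j k z\<bar> \<le> B" if "k < n" for k
      proof -
        have "\<bar>\<Gamma> i j k z\<bar> \<le> (\<Sum>k<n. \<bar>\<Gamma> i j k z\<bar>)"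
          by (rule member_le_sum[of k "{..<n}" "\<lambda>k. \<bar>\<Gamma> i j k z\<bar>"]) (use that in auto)
        also have "\<dots> \<le> (\<Sum>j<rF. \<Sum>k<n. \<bar>\<Gamma> i j k z\<bar>)"
          by (rule member_le_sum[of j "{..<rF}" "\<lambda>j. \<Sum>k<n. \<bar>\<Gamma> i j k z\<bar>"])
            (use \<open>j < rF\<close> in \<open>auto intro: sum_nonneg\<close>)
        also have "\<dots> \<le> h z" unfolding h_def
          by (rule member_le_sum[of i "{..<rF}" "\<lambda>i. \<Sum>j<rF. \<Sum>k<n. \<bar>\<Gamma> i j k z\<bar>"])
            (use \<open>i < rF\<close> in \<open>auto intro!: sum_nonneg\<close>)
        finally show ?thesis using hz by simp
      qed
      have "\<bar>\<Sum>k<n. ((x - ?c) \<bullet> b k) * \<Gamma> i j k z\<bar> \<le> (\<Sum>k<n. \<bar>(x - ?c) \<bullet> b k\<bar> * \<bar>\<Gamma> i j k z\<bar>)"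
        using sum_abs[of "\<lambda>k. ((x - ?c) \<bullet> b k) * \<Gamma> i j k z" "{..<n}"] by (simp add: abs_mult)
      also have "\<dots> \<le> (\<Sum>k<n. 2 * \<delta> * B)" using 1 2 \<delta>(1) by (intro sum_mono mult_mono) auto
      finally show ?thesis by simp
    qed
    have "real (rF * rF) * (real n * (2 * \<delta> * B)) = 2 * \<delta> * ?R" by simp
    also have "\<dots> \<le> 2 * (1 / (4 * (?R + 1))) * ?R" using \<delta>(4) R0 by (intro mult_right_mono) auto
    also have "\<dots> \<le> 1 / 2" using R0 by (simp add: divide_simps)
    finally have small': "real (rF * rF) * (real n * (2 * \<delta> * B)) \<le> 1 / 2" .
    obtain \<mu> where \<mu>: "\<And>i. i < rF \<Longrightarrow> smooth_on ?S (\<mu> i)" "\<And>i. i < rF \<Longrightarrow> \<mu> i ?c = m' i"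
      "\<And>i x. i < rF \<Longrightarrow> x \<in> ?S \<Longrightarrow> frechet_derivative (\<mu> i) (at x) (x - ?c) =
        (\<Sum>k<n. ((x - ?c) \<bullet> b k) * ((\<omega> k i \<circ> inv_into U \<phi>) x - (\<Sum>j<rF. \<Gamma> i j k x * \<mu> j x)))"
      by (rule radial_linear_ode[OF open_ball convex_ball cS, of rF \<Gamma> "\<lambda>i k. \<omega> k i \<circ> inv_into U \<phi>" "real n * (2 * \<delta> * B)" m'])
        (use smooth_on_subset[OF \<Gamma>s SU] smooth_on_subset[OF C_infD[OF \<omega>(1) U] SU] small small' in blast)+
    define p where "p i = (\<lambda>z. if z \<in> V1 then \<kappa> z * \<mu> i (\<phi> z) else 0)" for i
    have pC: "p i \<in> C_inf M" if "i < rF" for i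
      unfolding p_def
      by (rule C_inf_extend[OF V1(1) V(6,7,8,10) smooth_fun_on_chart_comp[OF U V1(1,3)
              \<mu>(1)[OF that, folded imV1]]])
    have pV: "p i z = \<mu> i (\<phi> z)" if "z \<in> V" for i z using that VV1 V(9) by (simp add: p_def)
    define \<nu> where "\<nu> z = (\<Sum>i<rF. p i z *\<^sub>R E i z)" for z
    have \<nu>: "\<nu> \<in> sections M F"
      unfolding \<nu>_def[abs_def] by (rule F.section_sum, simp) (use F.section_scale[OF pC E_frame(1)] in auto)
    have \<nu>0: "\<nu> z0 = m" using pV[OF z0] \<mu>(2) by (simp add: \<nu>_def m')
    have f: "\<xi> k z - \<xi> k z0 = (\<phi> z - ?c) \<bullet> b k" if "k < n" "z \<in> V" for k z
      using \<xi>(2)[OF that(1)] that(2) VW z0W by (auto simp: inner_diff_left)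
    have rad: "L z (rad z0 z) \<nu> = \<Omega> z (rad z0 z)" if z: "z \<in> V" for z
    proof -
      have zW: "z \<in> W" and zS: "\<phi> z \<in> ?S" and zU: "z \<in> U" using z VW VV1[OF z] imV1 V(3) by auto
      have P: "(\<Sum>k<n. (\<xi> k z - \<xi> k z0) * partial U \<phi> k (p i) z) =
          (\<Sum>k<n. (\<xi> k z - \<xi> k z0) * (\<omega> k i z - (\<Sum>j<rF. conn i j k z * p j z)))" if i: "i < rF" for i
      proof -
        have "frechet_derivative (p i \<circ> inv_into U \<phi>) (at (\<phi> z)) = frechet_derivative (\<mu> i) (at (\<phi> z))"
          by (rule frechet_derivative_cong_open[OF chart_open_image[OF U V(1,3)] imageI[OF z]])
            (use pV chart(4)[OF U] V(3) in auto)
        then have "(\<Sum>k<n. (\<xi> k z - \<xi> k z0) * partial U \<phi> k (p i) z) =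
            (\<Sum>k<n. ((\<phi> z - ?c) \<bullet> b k) *\<^sub>R frechet_derivative (\<mu> i) (at (\<phi> z)) (b k))"
          using f[OF _ z] by (simp add: partial_def)
        also have "\<dots> = frechet_derivative (\<mu> i) (at (\<phi> z)) (\<phi> z - ?c)"
          by (rule linear_expand[symmetric, OF has_derivative_linear[OF smooth_on_has_derivative[OF \<mu>(1)[OF i] zS]]])
        also have "\<dots> = (\<Sum>k<n. (\<xi> k z - \<xi> k z0) * (\<omega> k i z - (\<Sum>j<rF. conn i j k z * p j z)))"
          unfolding \<mu>(3)[OF i zS] using f[OF _ z] chart(4)[OF U zU] pV[OF z] by (simp add: \<Gamma>_def)
        finally show ?thesis .
      qed
      have "L z (rad z0 z) \<nu> = (\<Sum>i<rF. (\<Sum>k<n. (\<xi> k z - \<xi> k z0) *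
          (partial U \<phi> k (p i) z + (\<Sum>j<rF. conn i j k z * p j z))) *\<^sub>R E i z)"
        by (rule L_rad[OF zW W(1) order_refl \<nu> pC]) (auto simp: \<nu>_def)
      also have "\<dots> = (\<Sum>i<rF. (\<Sum>k<n. (\<xi> k z - \<xi> k z0) * \<omega> k i z) *\<^sub>R E i z)"
        using P by (simp add: distrib_left right_diff_distrib sum.distrib sum_subtractf)
      also have "\<dots> = (\<Sum>k<n. \<Sum>i<rF. ((\<xi> k z - \<xi> k z0) * \<omega> k i z) *\<^sub>R E i z)"
        by (subst sum.swap) (simp add: scaleR_sum_left)
      also have "\<dots> = (\<Sum>k<n. (\<xi> k z - \<xi> k z0) *\<^sub>R \<Omega> z (s k z))"
        using \<omega>(2)[OF _ zW] by (simp add: scaleR_sum_right)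
      also have "\<dots> = \<Omega> z (rad z0 z)"
        unfolding rad_def by (rule cochain_lin_comb[OF \<Omega>c, symmetric]) (auto simp: s_fibre)
      finally show ?thesis .
    qed
    \<comment> \<open>The error of \<open>\<nu>\<close> as a primitive is itself a cocycle. It
      vanishes on the radial section by \<open>rad\<close>, and on the adjoint fibre at
      \<open>z0\<close> because \<open>m\<close> is a primitive there.\<close>
    let ?\<Psi> = "\<lambda>x a. coboundary \<nu> x a - \<Omega> x a"
    have "?\<Psi> z a = 0" if z: "z \<in> V" and a: "a \<in> fibre A z" for z a
    proof (rule cocycle_vanish[OF V(1) VW cV z0 cocycle_diff[OF coboundary_cocycle[OF \<nu>] \<Omega>] _ _ z a])
      show "?\<Psi> z (rad z0 z) = 0" if "z \<in> V" for z
        using rad[OF that] A.section_fibre[OF rad_section] by (simp add: coboundary_def)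
      show "?\<Psi> z0 a = 0" if "a \<in> adjoint_fibre A z0" for a
        using prim \<nu> \<nu>0 that by (simp add: fibre_primitive_def coboundary_def adjoint_fibre_def)
    qed
    then have "solves \<Omega> V \<nu>" using \<nu> by (simp add: solves_def coboundary_def)
    then show ?thesis using \<nu>0 by blast
  qed
  then show ?thesis using V(1,2) by blast
qed

end

context algebroid_representation begin

text \<open>The coordinate vectors at \<open>y\<close> are lifted and the lifts extended to
  sections, whose anchors are then correct at \<open>y\<close> only. The matrix of their coordinate
  components is the identity at \<open>y\<close>; multiplying by its inverse corrects them near
  \<open>y\<close>.\<close>

lemma adapted_frame_exists:
  obtains U \<phi> W \<xi> E S s \<epsilon> where "adapted_frame b n M A F L U \<phi> W \<xi> E S s" "y \<in> W" "\<phi> ` W = ball (\<phi> y) \<epsilon>"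
proof -
  obtain UF e where UF: "(UF, e) \<in> local_frames F" "y \<in> UF" by (rule F.frame_cover)
  obtain UA e' where UA: "(UA, e') \<in> local_frames A" "y \<in> UA" by (rule A.frame_cover)
  obtain U \<phi> where U: "(U, \<phi>) \<in> M" "y \<in> U" by (rule chart_cover)
  have "open (UF \<inter> UA)" using F.frame_open[OF UF(1)] A.frame_open[OF UA(1)] by blast
  moreover have "y \<in> UF \<inter> UA" using UF UA by simp
  ultimately obtain W0 C0 and \<kappa>0 :: "'m \<Rightarrow> real" where W0: "open W0" "y \<in> W0" "W0 \<subseteq> U" "W0 \<subseteq> C0" "closed C0"
    "C0 \<subseteq> UF \<inter> UA" "C0 \<subseteq> U" "\<kappa>0 \<in> C_inf M" "\<And>x. x \<in> W0 \<Longrightarrow> \<kappa>0 x = 1" "\<And>x. x \<notin> C0 \<Longrightarrow> \<kappa>0 x = 0"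
    by (rule coordinate_ball_in_chart[OF U]) blast
  define \<xi> where "\<xi> k = (\<lambda>z. if z \<in> U then \<kappa>0 z * (\<phi> z \<bullet> b k) else 0)" for k
  have \<xi>C: "\<xi> k \<in> C_inf M" for k
    unfolding \<xi>_def
  proof (rule C_inf_extend[OF chart(1)[OF U(1)] W0(5,7,8,10)])
    have "smooth_on (\<phi> ` U) (\<lambda>x. x \<bullet> b k)"
      using smooth_on_coord[OF chart(2)[OF U(1)], of 0] by simp
    then show "smooth_fun_on M U (\<lambda>z. \<phi> z \<bullet> b k)"
      by (rule smooth_fun_on_chart_comp[OF U(1) chart(1)[OF U(1)] order_refl])
  qed
  have \<xi>W: "\<xi> k z = \<phi> z \<bullet> b k" if "z \<in> W0" for k z using that W0(3,9) by (auto simp: \<xi>_def)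
  \<comment> \<open>This is where transitivity of the algebroid enters.\<close>
  have "\<exists>\<sigma>. \<sigma> \<in> sections M A \<and> anchor A y (\<sigma> y) = (\<lambda>f. if f \<in> C_inf M then partial U \<phi> k f y else 0)" for k
  proof -
    have "(\<lambda>f. if f \<in> C_inf M then partial U \<phi> k f y else 0) \<in> anchor A y ` fibre A y"
      using partial_tangent[OF U, of k] transitive by (simp add: transitive_def)
    then obtain a where a: "a \<in> fibre A y" "anchor A y a = (\<lambda>f. if f \<in> C_inf M then partial U \<phi> k f y else 0)" by force
    obtain \<sigma> where "\<sigma> \<in> sections M A" "\<sigma> y = a" by (rule A.section_through[OF a(1)])
    then show ?thesis using a(2) by auto
  qed
  then obtain \<sigma> where \<sigma>: "\<And>k. \<sigma> k \<in> sections M A"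
    "\<And>k. anchor A y (\<sigma> k y) = (\<lambda>f. if f \<in> C_inf M then partial U \<phi> k f y else 0)" by metis
  define G0 where "G0 k j z = anchor A z (\<sigma> k z) (\<xi> j)" for k j z
  have G0: "G0 k j \<in> C_inf M" for k j unfolding G0_def[abs_def] by (rule anchor_smooth[OF \<sigma>(1) \<xi>C])
  have G0y: "G0 k j y = (if k = j then 1 else 0)" if "k < n" "j < n" for k j
    using partial_coord[OF U(1) W0(1,3,2) that \<xi>W] by (simp add: G0_def \<sigma>(2) \<xi>C)
  define G where "G k j = G0 k j \<circ> inv_into U \<phi>" for k j
  have "smooth_on (\<phi> ` W0) (G k j)" for k j
    unfolding G_def by (rule smooth_on_subset[OF C_infD[OF G0 U(1)]]) (use W0(3) in auto)
  moreover have "G k j (\<phi> y) = (if k = j then 1 else 0)" if "k < n" "j < n" for k j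
    using G0y[OF that] chart(4)[OF U] by (simp add: G_def)
  ultimately obtain T H where T: "open T" "\<phi> y \<in> T" "T \<subseteq> \<phi> ` W0" and H: "\<And>k l. smooth_on T (H k l)"
    "\<And>x k j. x \<in> T \<Longrightarrow> k < n \<Longrightarrow> j < n \<Longrightarrow> (\<Sum>l<n. H k l x * G l j x) = (if k = j then 1 else 0)"
    by (rule smooth_matrix_inverse[OF chart_open_image[OF U(1) W0(1,3)] imageI[OF W0(2)], of n G]) blast+
  define O1 where "O1 = W0 \<inter> (U \<inter> \<phi> -` T)"
  have O1: "open O1" "y \<in> O1" "O1 \<subseteq> W0" "O1 \<subseteq> U" "\<phi> ` O1 \<subseteq> T"
    using W0 U(2) T(2) chart_open_preimage[OF U(1) T(1)] by (auto simp: O1_def)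
  obtain W \<epsilon> C and \<kappa> :: "'m \<Rightarrow> real" where W: "open W" "y \<in> W" "W \<subseteq> U" "\<phi> ` W = ball (\<phi> y) \<epsilon>"
    "W \<subseteq> C" "closed C" "C \<subseteq> O1" "\<kappa> \<in> C_inf M" "\<And>x. x \<in> W \<Longrightarrow> \<kappa> x = 1" "\<And>x. x \<notin> C \<Longrightarrow> \<kappa> x = 0"
    by (rule coordinate_ball_in_chart[OF U O1(1,2)]) blast
  have WO: "z \<in> O1" "z \<in> W0" if "z \<in> W" for z using that W O1 by auto
  define H' where "H' k l = (\<lambda>z. if z \<in> O1 then \<kappa> z * H k l (\<phi> z) else 0)" for k l
  have H'C: "H' k l \<in> C_inf M" for k l
    unfolding H'_def
    by (rule C_inf_extend[OF O1(1) W(6,7,8,10) smooth_fun_on_chart_comp[OF U(1) O1(1,4)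
            smooth_on_subset[OF H(1) O1(5)]]])
  \<comment> \<open>A left inverse of the matrix is what is required, as it acts on the index of the
    lifted fields.\<close>
  define s where "s k = (\<lambda>z. \<Sum>l<n. H' k l z *\<^sub>R \<sigma> l z)" for k
  have sS: "s k \<in> sections M A" for k
    unfolding s_def by (rule A.section_sum, simp) (rule A.section_scale[OF H'C \<sigma>(1)])
  have s\<xi>: "anchor A z (s k z) (\<xi> j) = (if k = j then 1 else 0)" if z: "z \<in> W" and k: "k < n" "j < n" for z k j
  proof -
    have "anchor A z (s k z) (\<xi> j) = (\<Sum>l<n. H' k l z * anchor A z (\<sigma> l z) (\<xi> j))"
      unfolding s_def by (rule anchor_lin_comb) (auto intro: A.section_fibre \<sigma>(1))
    also have "\<dots> = (\<Sum>l<n. H k l (\<phi> z) * G l j (\<phi> z))"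
      using WO(1)[OF z] W(9)[OF z] chart(4)[OF U(1), of z] z W(3) by (auto simp: H'_def G_def G0_def)
    also have "\<dots> = (if k = j then 1 else 0)" using H(2)[OF _ k] O1(5) WO(1)[OF z] by blast
    finally show ?thesis .
  qed
  have CU: "C \<subseteq> UF" "C \<subseteq> UA" using W(7) O1(3) W0(4,6) by blast+
  have "adapted_frame b n M A F L U \<phi> W \<xi> (\<lambda>i x. if x \<in> UF then \<kappa> x *\<^sub>R e i x else 0)
      (\<lambda>i x. if x \<in> UA then \<kappa> x *\<^sub>R e' i x else 0) s"
  proof unfold_locales
    show "convex (\<phi> ` W)" by (simp add: W(4))
    show "F.global_frame_on W (\<lambda>i x. if x \<in> UF then \<kappa> x *\<^sub>R e i x else 0)"
      by (rule F.global_frame[OF UF(1) W(6) CU(1) W(5,8,9,10)])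
    show "A.global_frame_on W (\<lambda>i x. if x \<in> UA then \<kappa> x *\<^sub>R e' i x else 0)"
      by (rule A.global_frame[OF UA(1) W(6) CU(2) W(5,8,9,10)])
  qed (use U(1) W(1,3) \<xi>C \<xi>W WO(2) sS s\<xi> in auto)
  then show thesis using that W(2,4) by blast
qed

text \<open>The neighbourhood is chosen before the cocycle and the solutions, and a single common
  value anywhere in it forces equality throughout. This is the alternative "equal everywhere or
  nowhere" demanded of a local system.\<close>

lemma unique_near:
  assumes "open O'" "y \<in> O'"
  shows "\<exists>V. open V \<and> y \<in> V \<and> V \<subseteq> O' \<and> (\<forall>\<Omega> \<mu> \<mu>'. solves \<Omega> V \<mu> \<longrightarrow> solves \<Omega> V \<mu>' \<longrightarrow>
    (\<forall>z0\<in>V. \<mu> z0 = \<mu>' z0 \<longrightarrow> (\<forall>z\<in>V. \<mu> z = \<mu>' z)))"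
proof -
  obtain U \<phi> W \<xi> E S s \<epsilon> where af: "adapted_frame b n M A F L U \<phi> W \<xi> E S s" and y: "y \<in> W"
    by (rule adapted_frame_exists)
  interpret adapted_frame b n M A F L U \<phi> W \<xi> E S s by (rule af)
  have o: "open (O' \<inter> W)" "y \<in> O' \<inter> W" "y \<in> U" using assms W y by auto
  obtain V \<epsilon> C where V: "open V" "y \<in> V" "\<phi> ` V = ball (\<phi> y) \<epsilon>" "V \<subseteq> C" "C \<subseteq> O' \<inter> W"
    by (rule coordinate_ball_in_chart[OF U o(3,1,2)]) blast
  have VW: "V \<subseteq> W" "V \<subseteq> O'" "convex (\<phi> ` V)" using V by auto
  show ?thesis
  proof (rule exI[of _ V], intro conjI V(1,2) VW(2) allI impI ballI)
    fix \<Omega> \<mu> \<mu>' z0 z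
    assume sol: "solves \<Omega> V \<mu>" "solves \<Omega> V \<mu>'" and z: "z0 \<in> V" "\<mu> z0 = \<mu>' z0" "z \<in> V"
    have sec: "\<mu> \<in> sections M F" "\<mu>' \<in> sections M F" using sol by (simp_all add: solves_def)
    have eq: "L x a \<mu> = L x a \<mu>'" if "x \<in> V" "a \<in> fibre A x" for x a
      using sol that by (simp add: solves_def)
    show "\<mu> z = \<mu>' z" by (rule unique_solution[OF V(1) VW(1,3) z(1) sec eq z(2,3)])
  qed
qed

lemma local_existence:
  assumes "\<Omega> \<in> cocycles1 M A F L"
  shows "\<exists>V. open V \<and> y \<in> V \<and>
    (\<forall>z\<in>V. \<forall>m. fibre_primitive \<Omega> z m \<longrightarrow> (\<exists>\<mu>. solves \<Omega> V \<mu> \<and> \<mu> z = m))"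
proof -
  obtain U \<phi> W \<xi> E S s \<epsilon> where af: "adapted_frame b n M A F L U \<phi> W \<xi> E S s" "y \<in> W" "\<phi> ` W = ball (\<phi> y) \<epsilon>"
    by (rule adapted_frame_exists)
  show ?thesis by (rule adapted_frame.local_solutions[OF af(1,3,2) assms])
qed

end

section \<open>Local systems on simply connected spaces\<close>

lemma continuous_on_preimage:
  "continuous_on T h \<Longrightarrow> open B \<Longrightarrow> \<exists>B'. open B' \<and> B' \<inter> T = h -` B \<inter> T"
  by (simp add: continuous_on_open_invariant)

text \<open>\<open>S V s\<close> says that \<open>s\<close> is a flat section over the open set \<open>V\<close>, and \<open>Sol z v\<close> that \<open>v\<close> is a value
  at \<open>z\<close> of flat sections.\<close>

locale local_system =
  fixes S :: "'x::topological_space set \<Rightarrow> ('x \<Rightarrow> 'v) \<Rightarrow> bool" and Sol :: "'x \<Rightarrow> 'v \<Rightarrow> bool"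
  assumes S_open: "S V s \<Longrightarrow> open V"
    and S_exists: "\<exists>V. z \<in> V \<and> open V \<and> (\<forall>y\<in>V. \<forall>v. Sol y v \<longrightarrow> (\<exists>s. S V s \<and> s y = v))"
    and S_Sol: "S V s \<Longrightarrow> y \<in> V \<Longrightarrow> Sol y (s y)"
    and S_coherent: "S V s \<Longrightarrow> S V' s' \<Longrightarrow> z \<in> V \<Longrightarrow> z \<in> V' \<Longrightarrow>
      \<exists>B. open B \<and> z \<in> B \<and> B \<subseteq> V \<inter> V' \<and> ((\<forall>y\<in>B. s y = s' y) \<or> (\<forall>y\<in>B. s y \<noteq> s' y))"
begin

text \<open>An evenly covered set in the language of coverings: every admissible value at any of its
  points extends over all of it.\<close>

definition full :: "'x set \<Rightarrow> bool" where
  "full V \<longleftrightarrow> (\<forall>y\<in>V. \<forall>v. Sol y v \<longrightarrow> (\<exists>s. S V s \<and> s y = v))"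

lemma full_exists: obtains V where "z \<in> V" "open V" "full V"
  using S_exists[of z] unfolding full_def[symmetric] by (elim exE conjE)

lemma full_through:
  assumes "full V" "y \<in> V" "Sol y v" obtains s where "S V s" "s y = v"
  using mp[OF spec[OF bspec[OF assms(1)[unfolded full_def] assms(2)]] assms(3)] by (elim exE conjE)

text \<open>A lift of \<open>h\<close> to the space of germs of flat sections, expressed without
  topologising that space. The parameter type is free because intervals and squares both
  occur.\<close>

definition lift :: "('p::topological_space \<Rightarrow> 'x) \<Rightarrow> 'p set \<Rightarrow> ('p \<Rightarrow> 'v) \<Rightarrow> bool" where
  "lift h T w \<longleftrightarrow> (\<forall>t\<in>T. \<exists>V s B. S V s \<and> open B \<and> t \<in> B \<and> (\<forall>t'\<in>B \<inter> T. h t' \<in> V \<and> w t' = s (h t')))"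

lemma liftD:
  assumes "lift h T w" "t \<in> T"
  obtains V s B where "S V s" "open B" "t \<in> B" "\<And>t'. t' \<in> B \<Longrightarrow> t' \<in> T \<Longrightarrow> h t' \<in> V"
    "\<And>t'. t' \<in> B \<Longrightarrow> t' \<in> T \<Longrightarrow> w t' = s (h t')"
proof -
  obtain V s B where "S V s" "open B" "t \<in> B" "\<forall>t'\<in>B \<inter> T. h t' \<in> V \<and> w t' = s (h t')"
    using bspec[OF assms(1)[unfolded lift_def] assms(2)] by blast
  then show thesis using that[of V s B] by simp
qed

lemma lift_Sol:
  assumes "lift h T w" "t \<in> T" shows "Sol (h t) (w t)"
proof -
  obtain V s B where "S V s" "t \<in> B" "\<And>t'. t' \<in> B \<Longrightarrow> t' \<in> T \<Longrightarrow> h t' \<in> V"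
    "\<And>t'. t' \<in> B \<Longrightarrow> t' \<in> T \<Longrightarrow> w t' = s (h t')"
    by (rule liftD[OF assms]) blast
  then show ?thesis using S_Sol assms(2) by metis
qed

lemma lift_subset:
  assumes "lift h T w" "T' \<subseteq> T" shows "lift h T' w"
  unfolding lift_def
proof
  fix t assume t: "t \<in> T'"
  with assms(2) have "t \<in> T" by auto
  from bspec[OF assms(1)[unfolded lift_def] this] obtain V s B where "S V s" "open B" "t \<in> B"
    "\<forall>t'\<in>B \<inter> T. h t' \<in> V \<and> w t' = s (h t')" by blast
  then show "\<exists>V s B. S V s \<and> open B \<and> t \<in> B \<and> (\<forall>t'\<in>B \<inter> T'. h t' \<in> V \<and> w t' = s (h t'))"
    using assms(2) by blast
qed

lemma lift_cong:
  assumes "\<And>t. t \<in> T \<Longrightarrow> h t = h' t" "\<And>t. t \<in> T \<Longrightarrow> w t = w' t"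
  shows "lift h T w \<longleftrightarrow> lift h' T w'"
  unfolding lift_def using assms by simp

lemma lift_flat:
  assumes "S V s" "\<And>t. t \<in> T \<Longrightarrow> h t \<in> V" shows "lift h T (\<lambda>t. s (h t))"
  unfolding lift_def using assms open_UNIV by blast

lemma lift_compose:
  assumes w: "lift h T w" and k: "continuous_on T' k" "k ` T' \<subseteq> T"
  shows "lift (\<lambda>t. h (k t)) T' (\<lambda>t. w (k t))"
  unfolding lift_def
proof
  fix t assume t: "t \<in> T'"
  then have "k t \<in> T" using k(2) by auto
  then obtain V s B where B: "S V s" "open B" "k t \<in> B" "\<And>t'. t' \<in> B \<Longrightarrow> t' \<in> T \<Longrightarrow> h t' \<in> V"
    "\<And>t'. t' \<in> B \<Longrightarrow> t' \<in> T \<Longrightarrow> w t' = s (h t')" by (rule liftD[OF w]) blast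
  obtain B' where B': "open B'" "B' \<inter> T' = k -` B \<inter> T'"
    using continuous_on_preimage[OF k(1) B(2)] by blast
  have "k t' \<in> B" "k t' \<in> T" if "t' \<in> B' \<inter> T'" for t' using that B'(2) k(2) by auto
  then have "\<forall>t'\<in>B' \<inter> T'. h (k t') \<in> V \<and> w (k t') = s (h (k t'))" using B(4,5) by blast
  moreover have "t \<in> B'" using B'(2) t B(3) by blast
  ultimately show "\<exists>V s B. S V s \<and> open B \<and> t \<in> B \<and> (\<forall>t'\<in>B \<inter> T'. h (k t') \<in> V \<and> w (k t') = s (h (k t')))"
    using B(1) B'(1) by blast
qed

lemma lift_agree_local:
  assumes h: "continuous_on T h" and w: "lift h T w" "lift h T w'" and t: "t \<in> T"
  obtains B where "open B" "t \<in> B" "\<And>t'. t' \<in> B \<Longrightarrow> t' \<in> T \<Longrightarrow> (w t' = w' t') = (w t = w' t)"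
proof -
  obtain V s B1 where 1: "S V s" "open B1" "t \<in> B1" "\<And>t'. t' \<in> B1 \<Longrightarrow> t' \<in> T \<Longrightarrow> h t' \<in> V"
    "\<And>t'. t' \<in> B1 \<Longrightarrow> t' \<in> T \<Longrightarrow> w t' = s (h t')" by (rule liftD[OF w(1) t]) blast
  obtain V' s' B2 where 2: "S V' s'" "open B2" "t \<in> B2" "\<And>t'. t' \<in> B2 \<Longrightarrow> t' \<in> T \<Longrightarrow> h t' \<in> V'"
    "\<And>t'. t' \<in> B2 \<Longrightarrow> t' \<in> T \<Longrightarrow> w' t' = s' (h t')" by (rule liftD[OF w(2) t]) blast
  obtain B3 where 3: "open B3" "h t \<in> B3" "(\<forall>y\<in>B3. s y = s' y) \<or> (\<forall>y\<in>B3. s y \<noteq> s' y)"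
    using S_coherent[OF 1(1) 2(1) 1(4)[OF 1(3) t] 2(4)[OF 2(3) t]] by auto
  obtain B4 where 4: "open B4" "B4 \<inter> T = h -` B3 \<inter> T"
    using continuous_on_preimage[OF h 3(1)] by blast
  have "(w t' = w' t') = (w t = w' t)" if t': "t' \<in> B1 \<inter> B2 \<inter> B4" "t' \<in> T" for t'
  proof -
    have "h t' \<in> B3" using 4(2) t' by blast
    then have "(s (h t') = s' (h t')) = (s (h t) = s' (h t))" using 3 by auto
    then show ?thesis using 1(5)[of t'] 2(5)[of t'] 1(5)[OF 1(3) t] 2(5)[OF 2(3) t] t' by simp
  qed
  moreover have "t \<in> B4" using 4(2) 3(2) t by blast
  moreover have "open (B1 \<inter> B2 \<inter> B4)" using 1(2) 2(2) 4(1) by (intro open_Int)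
  ultimately show thesis using that[of "B1 \<inter> B2 \<inter> B4"] 1(3) 2(3) by simp
qed

text \<open>Both agreement and disagreement of two lifts are open conditions by coherence, so on a
  connected parameter set one of them prevails.\<close>

lemma lift_unique:
  assumes T: "connected T" and h: "continuous_on T h" and w: "lift h T w" "lift h T w'"
    and t0: "t0 \<in> T" "w t0 = w' t0" and t: "t \<in> T"
  shows "w t = w' t"
proof -
  have "(w t0 = w' t0) = (w t = w' t)"
  proof (rule connected_local_const[OF T t0(1) t], rule ballI)
    fix a assume a: "a \<in> T"
    obtain B where "open B" "a \<in> B" "\<And>t'. t' \<in> B \<Longrightarrow> t' \<in> T \<Longrightarrow> (w t' = w' t') = (w a = w' a)"
      by (rule lift_agree_local[OF h w a]) blast
    then show "\<forall>\<^sub>F b in at a within T. (w a = w' a) = (w b = w' b)"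
      unfolding eventually_at_topological by blast
  qed
  then show ?thesis using t0(2) by simp
qed

text \<open>At the junction the flat sections of the two halves share a value, hence agree nearby by
  coherence, and the left one describes both sides.\<close>

lemma lift_join:
  fixes a b c :: real
  assumes g: "continuous_on {a..c} g" and abc: "a \<le> b" "b \<le> c"
    and w1: "lift g {a..b} w1" and w2: "lift g {b..c} w2" and eq: "w1 b = w2 b"
  shows "lift g {a..c} (\<lambda>t. if t \<le> b then w1 t else w2 t)"
  unfolding lift_def
proof
  let ?w = "\<lambda>t. if t \<le> b then w1 t else w2 t"
  fix t assume t: "t \<in> {a..c}"
  consider "t < b" | "t = b" | "t > b" by linarith
  then show "\<exists>V s B. S V s \<and> open B \<and> t \<in> B \<and> (\<forall>t'\<in>B \<inter> {a..c}. g t' \<in> V \<and> ?w t' = s (g t'))"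
  proof cases
    case 1
    then have "t \<in> {a..b}" using t by simp
    then obtain V s B where B: "S V s" "open B" "t \<in> B" "\<And>t'. t' \<in> B \<Longrightarrow> t' \<in> {a..b} \<Longrightarrow> g t' \<in> V"
      "\<And>t'. t' \<in> B \<Longrightarrow> t' \<in> {a..b} \<Longrightarrow> w1 t' = s (g t')" by (rule liftD[OF w1]) blast
    have "\<forall>t'\<in>(B \<inter> {..<b}) \<inter> {a..c}. g t' \<in> V \<and> ?w t' = s (g t')" using B(4,5) by auto
    moreover have "open (B \<inter> {..<b})" "t \<in> B \<inter> {..<b}" using B(2,3) 1 by auto
    ultimately show ?thesis using B(1) by blast
  next
    case 3
    then have "t \<in> {b..c}" using t by simp
    then obtain V s B where B: "S V s" "open B" "t \<in> B" "\<And>t'. t' \<in> B \<Longrightarrow> t' \<in> {b..c} \<Longrightarrow> g t' \<in> V"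
      "\<And>t'. t' \<in> B \<Longrightarrow> t' \<in> {b..c} \<Longrightarrow> w2 t' = s (g t')" by (rule liftD[OF w2]) blast
    have "\<forall>t'\<in>(B \<inter> {b<..}) \<inter> {a..c}. g t' \<in> V \<and> ?w t' = s (g t')" using B(4,5) by auto
    moreover have "open (B \<inter> {b<..})" "t \<in> B \<inter> {b<..}" using B(2,3) 3 by auto
    ultimately show ?thesis using B(1) by blast
  next
    case 2
    have b: "b \<in> {a..b}" "b \<in> {b..c}" using abc by auto
    obtain V s B where 1: "S V s" "open B" "b \<in> B" "\<And>t'. t' \<in> B \<Longrightarrow> t' \<in> {a..b} \<Longrightarrow> g t' \<in> V"
      "\<And>t'. t' \<in> B \<Longrightarrow> t' \<in> {a..b} \<Longrightarrow> w1 t' = s (g t')" by (rule liftD[OF w1 b(1)]) blast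
    obtain V' s' B' where two: "S V' s'" "open B'" "b \<in> B'" "\<And>t'. t' \<in> B' \<Longrightarrow> t' \<in> {b..c} \<Longrightarrow> g t' \<in> V'"
      "\<And>t'. t' \<in> B' \<Longrightarrow> t' \<in> {b..c} \<Longrightarrow> w2 t' = s' (g t')" by (rule liftD[OF w2 b(2)]) blast
    have gb: "s (g b) = s' (g b)" using 1(5)[OF 1(3) b(1)] two(5)[OF two(3) b(2)] eq by simp
    obtain B3 where 3: "open B3" "g b \<in> B3" "B3 \<subseteq> V \<inter> V'" "(\<forall>y\<in>B3. s y = s' y) \<or> (\<forall>y\<in>B3. s y \<noteq> s' y)"
      using S_coherent[OF 1(1) two(1) 1(4)[OF 1(3) b(1)] two(4)[OF two(3) b(2)]] by blast
    then have s: "s y = s' y" if "y \<in> B3" for y using gb that by auto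
    obtain B4 where 4: "open B4" "B4 \<inter> {a..c} = g -` B3 \<inter> {a..c}"
      using continuous_on_preimage[OF g 3(1)] by blast
    have "g t' \<in> V \<and> ?w t' = s (g t')" if t': "t' \<in> (B \<inter> B' \<inter> B4) \<inter> {a..c}" for t'
    proof -
      have g3: "g t' \<in> B3" using 4(2) t' by blast
      show ?thesis
      proof (cases "t' \<le> b")
        case True
        then show ?thesis using 1(4,5)[of t'] t' by simp
      next
        case False
        then show ?thesis using two(5)[of t'] s[OF g3] g3 3(3) t' by auto
      qed
    qed
    moreover have "b \<in> B4" using 4(2) 3(2) abc by auto
    ultimately show ?thesis using 1(1,2,3) two(2,3) 4(1) 2 by (intro exI[of _ V] exI[of _ s] exI[of _ "B \<inter> B' \<inter> B4"]) auto
  qed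
qed

text \<open>By bisection it suffices to lift over short intervals, which the path sends into a
  \<open>full\<close> set, and to join lifts. The statement is quantified over the initial value so
  that the second half can start where the first one ends.\<close>

lemma path_lift:
  fixes g :: "real \<Rightarrow> 'x"
  assumes g: "continuous_on {0..1} g" and v: "Sol (g 0) v"
  shows "\<exists>w. lift g {0..1} w \<and> w 0 = v"
proof -
  have "0 \<le> (0::real) \<and> (1::real) \<le> 1 \<longrightarrow> (\<forall>v. Sol (g 0) v \<longrightarrow> (\<exists>w. lift g {0..1} w \<and> w 0 = v))"
  proof (rule Bolzano[where P = "\<lambda>a b. 0 \<le> a \<and> b \<le> 1 \<longrightarrow> (\<forall>v. Sol (g a) v \<longrightarrow> (\<exists>w. lift g {a..b} w \<and> w a = v))"])
    fix a b c :: real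
    assume ab: "0 \<le> a \<and> b \<le> 1 \<longrightarrow> (\<forall>v. Sol (g a) v \<longrightarrow> (\<exists>w. lift g {a..b} w \<and> w a = v))"
      and bc: "0 \<le> b \<and> c \<le> 1 \<longrightarrow> (\<forall>v. Sol (g b) v \<longrightarrow> (\<exists>w. lift g {b..c} w \<and> w b = v))"
      and abc: "a \<le> b" "b \<le> c"
    show "0 \<le> a \<and> c \<le> 1 \<longrightarrow> (\<forall>v. Sol (g a) v \<longrightarrow> (\<exists>w. lift g {a..c} w \<and> w a = v))"
    proof (intro impI allI)
      fix v assume ac: "0 \<le> a \<and> c \<le> 1" and v: "Sol (g a) v"
      have b: "b \<le> 1" "0 \<le> b" using ac abc by auto
      obtain w1 where w1: "lift g {a..b} w1" "w1 a = v" using ab ac b v by blast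
      have "Sol (g b) (w1 b)" by (rule lift_Sol[OF w1(1)]) (use abc in auto)
      then obtain w2 where w2: "lift g {b..c} w2" "w2 b = w1 b" using bc ac b by blast
      have "continuous_on {a..c} g" by (rule continuous_on_subset[OF g]) (use ac in auto)
      from lift_join[OF this abc w1(1) w2(1)] w1(2) w2(2) abc
      show "\<exists>w. lift g {a..c} w \<and> w a = v" by (intro exI[of _ "\<lambda>t. if t \<le> b then w1 t else w2 t"]) simp
    qed
  next
    fix x :: real assume x: "0 \<le> x" "x \<le> 1"
    obtain V where V: "g x \<in> V" "open V" "full V" by (rule full_exists)
    obtain B where B: "open B" "B \<inter> {0..1} = g -` V \<inter> {0..1}"
      using continuous_on_preimage[OF g V(2)] by blast
    have "x \<in> g -` V \<inter> {0..1}" using V(1) x by simp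
    then have "x \<in> B" using B(2) by blast
    with B(1) obtain d where d: "d > 0" "ball x d \<subseteq> B" by (rule openE)
    have "\<exists>w. lift g {a..b} w \<and> w a = v"
      if ab: "a \<le> x" "x \<le> b" "b - a < d" "0 \<le> a" "b \<le> 1" and v: "Sol (g a) v" for a b v
    proof -
      have inV: "g t \<in> V" if "t \<in> {a..b}" for t
      proof -
        have "\<bar>x - t\<bar> < d" using that ab by (simp add: abs_less_iff)
        then have "t \<in> ball x d" by (simp add: dist_real_def)
        then have "t \<in> B \<inter> {0..1}" using d(2) that ab by auto
        then show ?thesis using B(2) by auto
      qed
      have "g a \<in> V" by (rule inV) (use ab in auto)
      then obtain s where s: "S V s" "s (g a) = v" by (rule full_through[OF V(3) _ v])
      have "lift g {a..b} (\<lambda>t. s (g t))" by (rule lift_flat[OF s(1) inV])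
      then show ?thesis using s(2) by blast
    qed
    then show "\<exists>d>0. \<forall>a b. a \<le> x \<and> x \<le> b \<and> b - a < d \<longrightarrow>
        0 \<le> a \<and> b \<le> 1 \<longrightarrow> (\<forall>v. Sol (g a) v \<longrightarrow> (\<exists>w. lift g {a..b} w \<and> w a = v))"
      using d(1) by blast
  qed simp
  then show ?thesis using v by simp
qed

text \<open>Homotopy lifting: lifts over the vertical segments whose initial values form a lift over
  the bottom edge fit together to a lift over the square. Being jointly flat near
  \<open>(s0, t)\<close> holds at height 0 and is a locally constant condition on
  \<open>t\<close>.\<close>

lemma square_lift:
  fixes h :: "real \<times> real \<Rightarrow> 'x"
  assumes h: "continuous_on ({0..1} \<times> {0..1}) h" and v: "lift (\<lambda>s. h (s, 0)) {0..1} (\<lambda>s. w s 0)"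
    and w: "\<And>s. s \<in> {0..1} \<Longrightarrow> lift (\<lambda>t. h (s, t)) {0..1} (w s)"
  shows "lift h ({0..1} \<times> {0..1}) (\<lambda>(s, t). w s t)"
proof -
  let ?Q = "{0..1::real} \<times> {0..1::real}"
  define R where "R s0 t \<longleftrightarrow> (\<exists>V \<sigma> B. S V \<sigma> \<and> open B \<and> (s0, t) \<in> B \<and>
    (\<forall>p\<in>B \<inter> ?Q. h p \<in> V \<and> w (fst p) (snd p) = \<sigma> (h p)))" for s0 t :: real
  have line: "continuous_on T (\<lambda>t. h (s, t))" if "s \<in> {0..1}" "T \<subseteq> {0..1}" for s T
  proof (rule continuous_on_compose2[OF h, of T "\<lambda>t. (s, t)"])
    show "continuous_on T (\<lambda>t. (s, t))" by (rule continuous_on_Pair[OF continuous_on_const continuous_on_id])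
    show "(\<lambda>t. (s, t)) ` T \<subseteq> ?Q" using that by blast
  qed
  \<comment> \<open>A named predicate for a square box that \<open>h\<close> maps into
    \<open>V\<close>.\<close>
  define inside where "inside V s0 t0 d \<longleftrightarrow>
    (\<forall>s\<in>{0..1}. \<forall>t\<in>{0..1}. dist s s0 < d \<longrightarrow> dist t t0 < d \<longrightarrow> h (s, t) \<in> V)" for V and s0 t0 d :: real
  have box: "\<exists>V d. d > 0 \<and> full V \<and> inside V s0 t0 d"
    if st: "s0 \<in> {0..1}" "t0 \<in> {0..1}" for s0 t0
  proof -
    obtain V where V: "h (s0, t0) \<in> V" "open V" "full V" by (rule full_exists)
    obtain B where B: "open B" "B \<inter> ?Q = h -` V \<inter> ?Q"
      using continuous_on_preimage[OF h V(2)] by blast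
    have "(s0, t0) \<in> h -` V \<inter> ?Q" using V(1) st by simp
    then have "(s0, t0) \<in> B" using B(2) by blast
    then obtain B1 B2 where B12: "open B1" "open B2" "s0 \<in> B1" "t0 \<in> B2" "B1 \<times> B2 \<subseteq> B"
      using open_prod_elim[OF B(1)] by (metis mem_Sigma_iff)
    obtain d1 where d1: "d1 > 0" "ball s0 d1 \<subseteq> B1" by (rule openE[OF B12(1,3)])
    obtain d2 where d2: "d2 > 0" "ball t0 d2 \<subseteq> B2" by (rule openE[OF B12(2,4)])
    have "h (s, t) \<in> V" if "s \<in> {0..1}" "t \<in> {0..1}" "dist s s0 < min d1 d2" "dist t t0 < min d1 d2" for s t
    proof -
      have "s \<in> ball s0 d1" "t \<in> ball t0 d2" using that by (simp_all add: dist_commute)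
      then have "(s, t) \<in> B1 \<times> B2" using d1(2) d2(2) by blast
      then have "(s, t) \<in> B \<inter> ?Q" using B12(5) that(1,2) by blast
      then show ?thesis using B(2) by blast
    qed
    then have "inside V s0 t0 (min d1 d2)" unfolding inside_def by blast
    then show ?thesis using V(3) d1(1) d2(1) by (intro exI[of _ V] exI[of _ "min d1 d2"]) simp
  qed
  \<comment> \<open>Inside a box, if one flat section \<open>\<sigma>\<close> describes the lifts at
    a single height \<open>t1\<close> for all \<open>s\<close> near \<open>s0\<close>, then
    uniqueness on the vertical segments makes it describe them at every height of the box.\<close>
  have spread: "R s0 t"
    if st: "s0 \<in> {0..1}" and d: "d > 0" and \<sigma>: "S V \<sigma>"
      and V: "inside V s0 t0 d"
      and t1: "t1 \<in> {0..1}" "dist t1 t0 < d" and B: "open B" "s0 \<in> B"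
      and eq: "\<And>s. s \<in> B \<Longrightarrow> s \<in> {0..1} \<Longrightarrow> w s t1 = \<sigma> (h (s, t1))"
      and t: "t \<in> {0..1}" "dist t t0 < d" for s0 t0 d V \<sigma> t1 B t
  proof -
    \<comment> \<open>The heights of the box, written as an intersection of intervals so that
      connectedness is immediate.\<close>
    let ?J = "{max 0 (t0 - d)..min 1 (t0 + d)} \<inter> {t0 - d<..<t0 + d}"
    have J: "u \<in> ?J \<longleftrightarrow> u \<in> {0..1} \<and> dist u t0 < d" for u by (auto simp: dist_real_def)
    have "is_interval ?J" by (intro is_interval_Int is_interval_cc is_interval_oo)
    then have conn: "connected ?J" by (rule is_interval_connected)
    have "w s u = \<sigma> (h (s, u))" if s: "s \<in> B \<inter> ball s0 d" "s \<in> {0..1}" and u: "u \<in> ?J" for s u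
    proof (rule lift_unique[OF conn line[OF s(2)]])
      show "?J \<subseteq> {0..1}" using J by blast
      then show "lift (\<lambda>t. h (s, t)) ?J (w s)" by (rule lift_subset[OF w[OF s(2)]])
      show "lift (\<lambda>t. h (s, t)) ?J (\<lambda>t. \<sigma> (h (s, t)))"
        by (rule lift_flat[OF \<sigma>]) (use s V J in \<open>auto simp: inside_def dist_commute\<close>)
      show "t1 \<in> ?J" using J t1 by blast
      show "w s t1 = \<sigma> (h (s, t1))" using eq s by auto
    qed (rule u)
    note wJ = this
    have "h p \<in> V \<and> w (fst p) (snd p) = \<sigma> (h p)" if p: "p \<in> ((B \<inter> ball s0 d) \<times> ball t0 d) \<inter> ?Q" for p
    proof -
      obtain s u where su: "p = (s, u)" "s \<in> B \<inter> ball s0 d" "s \<in> {0..1}" "dist u t0 < d" "u \<in> {0..1}"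
        using p by (cases p) (auto simp: dist_commute)
      have "u \<in> ?J" using su J by blast
      moreover have "h (s, u) \<in> V" using V su unfolding inside_def by (simp add: dist_commute)
      ultimately show ?thesis using wJ[OF su(2,3)] su(1) by simp
    qed
    moreover have "open ((B \<inter> ball s0 d) \<times> ball t0 d)" using B(1) by (intro open_Times) auto
    moreover have "(s0, t) \<in> (B \<inter> ball s0 d) \<times> ball t0 d" using B(2) d t by (auto simp: dist_commute)
    ultimately show ?thesis unfolding R_def using \<sigma>
      by (intro exI[of _ V] exI[of _ \<sigma>] exI[of _ "(B \<inter> ball s0 d) \<times> ball t0 d"]) blast
  qed
  have R0: "R s0 0" if s0: "s0 \<in> {0..1}" for s0
  proof -
    have 0: "(0::real) \<in> {0..1}" by simp
    obtain V d where V: "d > 0" "full V" "inside V s0 0 d"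
      using box[OF s0 0] by blast
    have hV: "h (s0, 0) \<in> V" using V(1,3) s0 by (simp add: inside_def)
    have "Sol (h (s0, 0)) (w s0 0)" using lift_Sol[OF v s0] by simp
    then obtain \<sigma> where \<sigma>: "S V \<sigma>" "\<sigma> (h (s0, 0)) = w s0 0" by (rule full_through[OF V(2) hV])
    let ?J = "{0..1} \<inter> {s0 - d<..<s0 + d}"
    have "is_interval ?J" by (intro is_interval_Int is_interval_cc is_interval_oo)
    then have conn: "connected ?J" by (rule is_interval_connected)
    \<comment> \<open>Along the bottom edge the hypothesis \<open>v\<close> makes the initial values
      a lift, and uniqueness along that edge identifies it with \<open>\<sigma>\<close>.\<close>
    have "w s 0 = \<sigma> (h (s, 0))" if s: "s \<in> ball s0 d" "s \<in> {0..1}" for s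
    proof (rule lift_unique[where w = "\<lambda>s. w s 0" and w' = "\<lambda>s. \<sigma> (h (s, 0))" and t = s and ?t0.0 = s0, OF conn])
      show "continuous_on ?J (\<lambda>s. h (s, 0))"
      proof (rule continuous_on_compose2[OF h, of ?J "\<lambda>s. (s, 0)"])
        show "continuous_on ?J (\<lambda>s. (s, 0::real))" by (rule continuous_on_Pair[OF continuous_on_id continuous_on_const])
      qed auto
      show "lift (\<lambda>s. h (s, 0)) ?J (\<lambda>s. w s 0)" by (rule lift_subset[OF v]) auto
      show "lift (\<lambda>s. h (s, 0)) ?J (\<lambda>s. \<sigma> (h (s, 0)))"
        by (rule lift_flat[OF \<sigma>(1)]) (use V(1,3) in \<open>auto simp: inside_def dist_real_def abs_less_iff\<close>)
    qed (use s s0 V(1) \<sigma>(2) in \<open>auto simp: dist_real_def abs_less_iff\<close>)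
    then show ?thesis
      using spread[OF s0 V(1) \<sigma>(1) V(3) 0 _ open_ball[of s0 d] _ _ 0] V(1) by simp
  qed
  have R: "R s0 t" if s0: "s0 \<in> {0..1}" and t: "t \<in> {0..1}" for s0 t
  proof -
    have "R s0 0 = R s0 t"
    proof (rule connected_local_const[of "{0..1}"])
      show "\<forall>a\<in>{0..1}. \<forall>\<^sub>F b in at a within {0..1}. R s0 a = R s0 b"
      proof
        fix t0 :: real assume t0: "t0 \<in> {0..1}"
        obtain V d where V: "d > 0" "full V" "inside V s0 t0 d"
      using box[OF s0 t0] by blast
        \<comment> \<open>The flat section known near \<open>(s0, t1)\<close> may live over a small
          set. Coherence replaces it by one over the \<open>full\<close> set \<open>V\<close> of the
          box, to which \<open>spread\<close> applies.\<close>
        have step: "R s0 t2" if t1: "t1 \<in> {0..1}" "dist t1 t0 < d" "R s0 t1" and t2: "t2 \<in> {0..1}" "dist t2 t0 < d" for t1 t2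
        proof -
          obtain V1 \<sigma>1 B1 where 1: "S V1 \<sigma>1" "open B1" "(s0, t1) \<in> B1"
            "\<And>p. p \<in> B1 \<inter> ?Q \<Longrightarrow> h p \<in> V1 \<and> w (fst p) (snd p) = \<sigma>1 (h p)"
            using t1(3) unfolding R_def by blast
          have hV: "h (s0, t1) \<in> V" using V(1,3) s0 t1 by (simp add: inside_def)
          obtain \<sigma> where \<sigma>: "S V \<sigma>" "\<sigma> (h (s0, t1)) = w s0 t1"
            by (rule full_through[OF V(2) hV lift_Sol[OF w[OF s0] t1(1)]])
          have at1: "h (s0, t1) \<in> V1" "w s0 t1 = \<sigma>1 (h (s0, t1))" using 1(4)[of "(s0, t1)"] 1(3) s0 t1(1) by auto
          obtain B where B: "open B" "h (s0, t1) \<in> B" "(\<forall>y\<in>B. \<sigma> y = \<sigma>1 y) \<or> (\<forall>y\<in>B. \<sigma> y \<noteq> \<sigma>1 y)"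
            using S_coherent[OF \<sigma>(1) 1(1) hV at1(1)] by blast
          then have eq: "\<sigma> y = \<sigma>1 y" if "y \<in> B" for y using that \<sigma>(2) at1(2) by auto
          obtain B' where B': "open B'" "B' \<inter> ?Q = h -` B \<inter> ?Q"
            using continuous_on_preimage[OF h B(1)] by blast
          have "(s0, t1) \<in> B1 \<inter> B'" using 1(3) B'(2) B(2) s0 t1(1) by auto
          moreover have "open (B1 \<inter> B')" using 1(2) B'(1) by blast
          ultimately obtain C1 C2 where C: "open C1" "s0 \<in> C1" "t1 \<in> C2" "C1 \<times> C2 \<subseteq> B1 \<inter> B'"
            using open_prod_elim by (metis mem_Sigma_iff)
          have "w s t1 = \<sigma> (h (s, t1))" if "s \<in> C1" "s \<in> {0..1}" for s
          proof -
            have p: "(s, t1) \<in> B1 \<inter> ?Q" "(s, t1) \<in> B' \<inter> ?Q" using that C(3,4) t1(1) by auto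
            then have "h (s, t1) \<in> B" using B'(2) by auto
            then show ?thesis using 1(4)[OF p(1)] eq by simp
          qed
          then show ?thesis by (rule spread[OF s0 V(1) \<sigma>(1) V(3) t1(1,2) C(1,2) _ t2])
        qed
        have "R s0 t0 = R s0 u" if "u \<in> ball t0 d" "u \<in> {0..1}" for u
          using step[of t0 u] step[of u t0] t0 V(1) that by (auto simp: dist_real_def abs_minus_commute)
        then show "\<forall>\<^sub>F b in at t0 within {0..1}. R s0 t0 = R s0 b"
          unfolding eventually_at_topological using V(1) by (intro exI[of _ "ball t0 d"]) auto
      qed
    qed (use t in auto)
    then show ?thesis using R0[OF s0] by simp
  qed
  show ?thesis
    unfolding lift_def
  proof
    fix p assume "p \<in> ?Q"
    then show "\<exists>V s B. S V s \<and> open B \<and> p \<in> B \<and> (\<forall>t'\<in>B \<inter> ?Q. h t' \<in> V \<and> (case t' of (s, t) \<Rightarrow> w s t) = s (h t'))"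
      using R[of "fst p" "snd p"] unfolding R_def by (auto simp: split_def)
  qed
qed

lemma lift_const:
  assumes "Sol z v" shows "lift (\<lambda>t. z) T (\<lambda>t. v)"
proof -
  obtain V where V: "z \<in> V" "full V" by (rule full_exists)
  obtain s where s: "S V s" "s z = v" by (rule full_through[OF V(2,1) assms])
  show ?thesis using lift_flat[OF s(1), of T "\<lambda>t. z"] V(1) s(2) by simp
qed

text \<open>A free homotopy contracts the loop, and its vertical lines are loops. The initial and
  final values of their lifts are two lifts of the same track of base points; they agree at the
  constant loop, hence also at \<open>g\<close>.\<close>

lemma loop_lift_closed:
  assumes sc: "simply_connected (UNIV :: 'x set)" and g: "path g" "pathfinish g = pathstart g"
    and w: "lift g {0..1} w"
  shows "w 0 = w 1"
proof -
  let ?I = "{0..1::real}"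
  have "homotopic_loops UNIV g (\<lambda>t. pathstart g)"
    using sc g unfolding simply_connected_def by (auto simp: path_def pathstart_def pathfinish_def)
  then obtain h where h: "continuous_on (?I \<times> ?I) h" "\<forall>x\<in>?I. h (0, x) = g x"
    "\<forall>x\<in>?I. h (1, x) = pathstart g" "\<forall>t\<in>?I. pathfinish (h \<circ> Pair t) = pathstart (h \<circ> Pair t)"
    unfolding homotopic_loops by blast
  have ends: "h (s, 1) = h (s, 0)" if "s \<in> ?I" for s
    using h(4) that by (simp add: pathstart_def pathfinish_def)
  have edge: "continuous_on ?I (\<lambda>s. (s, c))" for c :: real
    by (rule continuous_on_Pair[OF continuous_on_id continuous_on_const])
  have line: "continuous_on ?I (\<lambda>t. h (s, t))" if "s \<in> ?I" for s
    by (rule continuous_on_compose2[OF h(1) continuous_on_Pair[OF continuous_on_const continuous_on_id]])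
      (use that in auto)
  have bottom: "continuous_on ?I (\<lambda>s. h (s, 0))"
    by (rule continuous_on_compose2[OF h(1) edge]) auto
  have g0: "h (0, 0) = g 0" using h(2) by simp
  have "Sol (h (0, 0)) (w 0)" unfolding g0 by (rule lift_Sol[OF w]) simp
  from path_lift[OF bottom this] obtain v where v: "lift (\<lambda>s. h (s, 0)) ?I v" "v 0 = w 0"
    by (elim exE conjE)
  define W where "W s = (SOME W. lift (\<lambda>t. h (s, t)) ?I W \<and> W 0 = v s)" for s
  have "lift (\<lambda>t. h (s, t)) ?I (W s) \<and> W s 0 = v s" if "s \<in> ?I" for s
    unfolding W_def by (rule someI_ex[OF path_lift[OF line[OF that] lift_Sol[OF v(1) that]]])
  then have W: "\<And>s. s \<in> ?I \<Longrightarrow> lift (\<lambda>t. h (s, t)) ?I (W s)" "\<And>s. s \<in> ?I \<Longrightarrow> W s 0 = v s"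
    by simp_all
  have v': "lift (\<lambda>s. h (s, 0)) ?I (\<lambda>s. W s 0)"
    using v(1) by (subst lift_cong[where h' = "\<lambda>s. h (s, 0)" and w' = v]) (auto simp: W(2))
  have sq: "lift h (?I \<times> ?I) (\<lambda>(s, t). W s t)"
    by (rule square_lift[OF h(1) v' W(1)])
  have "lift (\<lambda>s. h (s, 1)) ?I (\<lambda>s. case (s, 1) of (s, t) \<Rightarrow> W s t)"
    by (rule lift_compose[OF sq edge]) auto
  then have top: "lift (\<lambda>s. h (s, 0)) ?I (\<lambda>s. W s 1)"
    by (subst lift_cong[where h' = "\<lambda>s. h (s, 1)" and w' = "\<lambda>s. case (s, 1) of (s, t) \<Rightarrow> W s t"]) (auto simp: ends)
  \<comment> \<open>At \<open>s = 1\<close> the loop is constant, so its lift is constant and starts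
    and ends at the same value.\<close>
  have "Sol (h (1, 0)) (W 1 0)" by (rule lift_Sol[OF W(1)]) auto
  then have "lift (\<lambda>t. pathstart g) ?I (\<lambda>t. W 1 0)" using h(3) by (intro lift_const) simp
  then have c: "lift (\<lambda>t. h (1, t)) ?I (\<lambda>t. W 1 0)"
    by (subst lift_cong[where h' = "\<lambda>t. pathstart g" and w' = "\<lambda>t. W 1 0"]) (use h(3) in auto)
  have "(\<lambda>t. W 1 0) 1 = W 1 1"
    by (rule lift_unique[OF connected_Icc line c W(1), of 0]) auto
  then have "W 1 0 = W 1 1" by simp
  from lift_unique[OF connected_Icc bottom v' top _ this, of 0] have "W 0 0 = W 0 1" by simp
  moreover have W0: "lift g ?I (W 0)"
    using W(1)[of 0] h(2) by (subst lift_cong[where h' = "\<lambda>t. h (0, t)" and w' = "W 0"]) auto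
  have "w 0 = W 0 0" using W(2)[of 0] v(2) by simp
  from lift_unique[OF connected_Icc _ w W0 _ this, of 1] have "w 1 = W 0 1"
    using g(1) by (simp add: path_def)
  ultimately show ?thesis using W(2)[of 0] v(2) by simp
qed

text \<open>Continue along the first path and back along the second. The resulting loop closes up,
  and reversing its second half gives a lift of the second path with the same initial value as
  \<open>w2\<close>.\<close>

lemma lift_independent:
  assumes sc: "simply_connected (UNIV :: 'x set)" and g1: "path g1" and g2: "path g2"
    and ends: "pathstart g1 = pathstart g2" "pathfinish g1 = pathfinish g2"
    and w1: "lift g1 {0..1} w1" and w2: "lift g2 {0..1} w2" and 0: "w1 0 = w2 0"
  shows "w1 1 = w2 1"
proof -
  let ?I = "{0..1::real}"
  have "path (reversepath g2)" using g2 by simp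
  then have rc: "continuous_on ?I (reversepath g2)" by (simp add: path_def)
  have r0: "reversepath g2 0 = g1 1" using ends by (simp add: reversepath_def pathfinish_def)
  have "Sol (reversepath g2 0) (w1 1)" unfolding r0 by (rule lift_Sol[OF w1]) simp
  from path_lift[OF rc this] obtain r where r: "lift (reversepath g2) ?I r" "r 0 = w1 1"
    by (elim exE conjE)
  let ?g = "g1 +++ reversepath g2"
  have pg: "path ?g" using g1 g2 ends by simp
  have "lift (\<lambda>t. g1 (2 * t)) {0..1/2} (\<lambda>t. w1 (2 * t))"
    by (rule lift_compose[OF w1]) (auto intro!: continuous_intros)
  then have l1: "lift ?g {0..1/2} (\<lambda>t. w1 (2 * t))"
    by (subst lift_cong[where h' = "\<lambda>t. g1 (2 * t)" and w' = "\<lambda>t. w1 (2 * t)"]) (auto simp: joinpaths_def)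
  have "lift (\<lambda>t. reversepath g2 (2 * t - 1)) {1/2..1} (\<lambda>t. r (2 * t - 1))"
    by (rule lift_compose[OF r(1)]) (auto intro!: continuous_intros)
  moreover have "?g t = reversepath g2 (2 * t - 1)" if "t \<in> {1/2..1}" for t
  proof (cases "t = 1/2")
    case True
    show ?thesis unfolding True using r0 by (simp add: joinpaths_def)
  qed (use that in \<open>auto simp: joinpaths_def\<close>)
  ultimately have l2: "lift ?g {1/2..1} (\<lambda>t. r (2 * t - 1))"
    by (subst lift_cong[where h' = "\<lambda>t. reversepath g2 (2 * t - 1)" and w' = "\<lambda>t. r (2 * t - 1)"]) auto
  have "lift ?g ?I (\<lambda>t. if t \<le> 1/2 then w1 (2 * t) else r (2 * t - 1))"
    using pg r(2) by (intro lift_join[OF _ _ _ l1 l2]) (auto simp: path_def)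
  from loop_lift_closed[OF sc pg _ this] have r1: "r 1 = w1 0" using ends by simp
  have "lift (\<lambda>t. reversepath g2 (1 - t)) ?I (\<lambda>t. r (1 - t))"
    by (rule lift_compose[OF r(1)]) (auto intro!: continuous_intros)
  then have "lift g2 ?I (\<lambda>t. r (1 - t))" by (simp add: reversepath_def)
  from lift_unique[OF connected_Icc _ w2 this, of 0 1] show ?thesis
    using g2 r1 r(2) 0 by (simp add: path_def)
qed

theorem global_section:
  assumes sc: "simply_connected (UNIV :: 'x set)"
    and lpc: "\<And>z V. open V \<Longrightarrow> z \<in> V \<Longrightarrow> \<exists>B. open B \<and> z \<in> B \<and> B \<subseteq> V \<and> path_connected (B :: 'x set)"
    and v: "Sol z0 v"
  shows "\<exists>g. g z0 = v \<and> (\<forall>z. \<exists>V s B. S V s \<and> open B \<and> z \<in> B \<and> B \<subseteq> V \<and> (\<forall>y\<in>B. g y = s y))"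
proof -
  let ?I = "{0..1::real}"
  \<comment> \<open>Here \<open>c\<close> is the result of continuing \<open>v\<close> along some
    path from \<open>z0\<close> to \<open>z\<close>; simple connectedness makes it a function of
    \<open>z\<close>.\<close>
  define E where "E z c \<longleftrightarrow> (\<exists>g w. path g \<and> pathstart g = z0 \<and> pathfinish g = z \<and>
    lift g {0..1} w \<and> w 0 = v \<and> w 1 = c)" for z c
  have EI: "E z c" if "path g" "pathstart g = z0" "pathfinish g = z" "lift g {0..1} w" "w 0 = v" "w 1 = c" for z c g w
    unfolding E_def using that by (intro exI[of _ g] exI[of _ w] conjI)
  have uniq: "c = c'" if E: "E z c" "E z c'" for z c c'
  proof -
    obtain g1 w1 where 1: "path g1" "pathstart g1 = z0" "pathfinish g1 = z" "lift g1 {0..1} w1" "w1 0 = v" "w1 1 = c"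
      using E(1) unfolding E_def by (elim exE conjE)
    obtain g2 w2 where 2: "path g2" "pathstart g2 = z0" "pathfinish g2 = z" "lift g2 {0..1} w2" "w2 0 = v" "w2 1 = c'"
      using E(2) unfolding E_def by (elim exE conjE)
    have "w1 1 = w2 1" by (rule lift_independent[OF sc 1(1) 2(1) _ _ 1(4) 2(4)]) (simp_all add: 1 2)
    then show ?thesis by (simp add: 1 2)
  qed
  have ex: "\<exists>c. E z c" for z
  proof -
    \<comment> \<open>A homotopy between two constant loops contains a path between the points: the
      track of the base point.\<close>
    have "homotopic_loops UNIV (\<lambda>t. z0) (\<lambda>t. z)"
      using sc unfolding simply_connected_def by (auto simp: path_def pathstart_def pathfinish_def)
    then obtain h where h: "continuous_on (?I \<times> ?I) h" "\<forall>x\<in>?I. h (0, x) = z0" "\<forall>x\<in>?I. h (1, x) = z"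
      unfolding homotopic_loops by blast
    let ?g = "\<lambda>s. h (s, 0)"
    have g: "continuous_on ?I ?g"
      by (rule continuous_on_compose2[OF h(1) continuous_on_Pair[OF continuous_on_id continuous_on_const]]) auto
    have ends: "?g 0 = z0" "?g 1 = z" using h(2,3) by auto
    then have "Sol (?g 0) v" using v by simp
    from path_lift[OF g this] obtain w where w: "lift ?g ?I w" "w 0 = v" by (elim exE conjE)
    have "E z (w 1)"
      by (rule EI[OF _ _ _ w]) (use g ends in \<open>auto simp: path_def pathstart_def pathfinish_def\<close>)
    then show ?thesis by blast
  qed
  define g where "g z = (THE c. E z c)" for z
  have g: "E z (g z)" for z
    unfolding g_def by (rule theI') (use ex uniq in blast)
  have g_eq: "g z = c" if "E z c" for z c by (rule uniq[OF g that])
  have "E z0 v"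
    by (rule EI[OF _ _ _ lift_const[OF v]]) (auto simp: path_def pathstart_def pathfinish_def)
  then have g0: "g z0 = v" by (rule g_eq)
  have "\<exists>V s B. S V s \<and> open B \<and> z \<in> B \<and> B \<subseteq> V \<and> (\<forall>y\<in>B. g y = s y)" for z
  proof -
    obtain V where V: "z \<in> V" "open V" "full V" by (rule full_exists)
    obtain B where B: "open B" "z \<in> B" "B \<subseteq> V" "path_connected B" using lpc[OF V(2,1)] by blast
    obtain k w where k: "path k" "pathstart k = z0" "pathfinish k = z" "lift k {0..1} w" "w 0 = v" "w 1 = g z"
      using g[of z] unfolding E_def by (elim exE conjE)
    have "k 1 = z" using k(3) by (simp add: pathfinish_def)
    then have "Sol z (g z)" using lift_Sol[OF k(4), of 1] k(6) by simp
    then obtain s where s: "S V s" "s z = g z" by (rule full_through[OF V(3,1)])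
    \<comment> \<open>A path to \<open>z\<close> is prolonged inside \<open>B\<close>, where
      continuation is given by the flat section \<open>s\<close>.\<close>
    have "g y = s y" if y: "y \<in> B" for y
    proof -
      obtain m where m: "path m" "path_image m \<subseteq> B" "pathstart m = z" "pathfinish m = y"
        using B(2,4) y unfolding path_connected_def by blast
      have mV: "m t \<in> V" if "t \<in> ?I" for t using subsetD[OF B(3) subsetD[OF m(2)[unfolded path_image_def] imageI[OF that]]] .
      let ?g = "k +++ m"
      have pg: "path ?g" using k m by simp
      have "lift (\<lambda>t. k (2 * t)) {0..1/2} (\<lambda>t. w (2 * t))"
        by (rule lift_compose[OF k(4)]) (auto intro!: continuous_intros)
      then have l1: "lift ?g {0..1/2} (\<lambda>t. w (2 * t))"
        by (subst lift_cong[where h' = "\<lambda>t. k (2 * t)" and w' = "\<lambda>t. w (2 * t)"]) (auto simp: joinpaths_def)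
      have "lift (\<lambda>t. m (2 * t - 1)) {1/2..1} (\<lambda>t. s (m (2 * t - 1)))"
        by (rule lift_flat[OF s(1)]) (use mV in auto)
      moreover have "?g t = m (2 * t - 1)" if "t \<in> {1/2..1}" for t
      proof (cases "t = 1/2")
        case True
        show ?thesis unfolding True using k(3) m(3) by (simp add: joinpaths_def pathstart_def pathfinish_def)
      qed (use that in \<open>auto simp: joinpaths_def\<close>)
      ultimately have l2: "lift ?g {1/2..1} (\<lambda>t. s (m (2 * t - 1)))"
        by (subst lift_cong[where h' = "\<lambda>t. m (2 * t - 1)" and w' = "\<lambda>t. s (m (2 * t - 1))"]) auto
      have m0: "m 0 = z" "m 1 = y" using m by (auto simp: pathstart_def pathfinish_def)
      have l: "lift ?g ?I (\<lambda>t. if t \<le> 1/2 then w (2 * t) else s (m (2 * t - 1)))"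
        using pg k(6) s(2) m0 by (intro lift_join[OF _ _ _ l1 l2]) (auto simp: path_def)
      have "E y (s y)" by (rule EI[OF pg _ _ l]) (simp_all add: k m m0)
      then show ?thesis by (rule g_eq)
    qed
    then show ?thesis using s(1) B(1,2,3) by (intro exI[of _ V] exI[of _ s] exI[of _ B] conjI ballI)
  qed
  then show ?thesis by (intro exI[of _ g] conjI allI g0)
qed

end

section \<open>Pull-back along a covering\<close>

lemma smooth_map_onI:
  assumes "continuous_on W f" "\<And>U \<phi> V \<psi>. (U, \<phi>) \<in> M \<Longrightarrow> (V, \<psi>) \<in> N \<Longrightarrow>
    smooth_on (\<phi> ` (U \<inter> W \<inter> f -` V)) (\<psi> \<circ> f \<circ> inv_into U \<phi>)"
  shows "smooth_map_on M N W f"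
  using assms by (auto simp: smooth_map_on_def)

lemma smooth_map_onD:
  assumes "smooth_map_on M N W f"
  shows "continuous_on W f" "(U, \<phi>) \<in> M \<Longrightarrow> (V, \<psi>) \<in> N \<Longrightarrow>
    smooth_on (\<phi> ` (U \<inter> W \<inter> f -` V)) (\<psi> \<circ> f \<circ> inv_into U \<phi>)"
  using assms by (auto simp: smooth_map_on_def)

lemma smooth_map_on_subset:
  assumes "smooth_map_on M N W f" "W' \<subseteq> W" shows "smooth_map_on M N W' f"
proof (rule smooth_map_onI)
  show "continuous_on W' f" by (rule continuous_on_subset[OF smooth_map_onD(1)[OF assms(1)] assms(2)])
  show "smooth_on (\<phi> ` (U \<inter> W' \<inter> f -` V)) (\<psi> \<circ> f \<circ> inv_into U \<phi>)"
    if "(U, \<phi>) \<in> M" "(V, \<psi>) \<in> N" for U \<phi> V \<psi>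
    by (rule smooth_on_subset[OF smooth_map_onD(2)[OF assms(1) that]]) (use assms(2) in auto)
qed

lemma is_vector_bundleI:
  assumes "\<And>x. subspace (fibre E x)" "\<And>x. \<exists>(U, e)\<in>local_frames E. x \<in> U"
    "\<And>U e. (U, e) \<in> local_frames E \<Longrightarrow> open U"
    "\<And>U e x. (U, e) \<in> local_frames E \<Longrightarrow> x \<in> U \<Longrightarrow> inj_on (\<lambda>i. e i x) {..<bundle_rank E} \<and>
      independent ((\<lambda>i. e i x) ` {..<bundle_rank E}) \<and> span ((\<lambda>i. e i x) ` {..<bundle_rank E}) = fibre E x"
    "\<And>U e V e'. (U, e) \<in> local_frames E \<Longrightarrow> (V, e') \<in> local_frames E \<Longrightarrow> \<exists>g.
      (\<forall>i<bundle_rank E. \<forall>j<bundle_rank E. smooth_fun_on M (U \<inter> V) (g i j)) \<and>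
      (\<forall>x\<in>U \<inter> V. \<forall>i<bundle_rank E. e' i x = (\<Sum>j<bundle_rank E. g i j x *\<^sub>R e j x))"
  shows "is_vector_bundle M E"
proof -
  have "x \<in> (\<Union>(U, e)\<in>local_frames E. U)" for x using assms(2)[of x] by auto
  then show ?thesis
    unfolding is_vector_bundle_def
    by (intro conjI allI ballI case_prodI2 assms(1)) (use assms(3-5) in auto)
qed

lemma smooth_fun_on_pullback:
  assumes M: "manifold b n M" and N: "manifold b n N" and W: "open W" and p: "smooth_map_on N M W p"
    and W': "open W'" "p ` W \<subseteq> W'" and f: "smooth_fun_on M W' f"
  shows "smooth_fun_on N W (\<lambda>z. f (p z))"
proof -
  interpret M: manifold b n M by (rule M)
  interpret N: manifold b n N by (rule N)
  have pc: "continuous_on W p" using p by (rule smooth_map_onD)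
  show ?thesis
  proof (rule N.smooth_fun_on_local[OF W])
    fix z assume z: "z \<in> W"
    obtain U \<phi> where U: "(U, \<phi>) \<in> N" "z \<in> U" by (rule N.chart_cover)
    obtain V \<psi> where V: "(V, \<psi>) \<in> M" "p z \<in> V" by (rule M.chart_cover)
    define B where "B = U \<inter> W \<inter> p -` V"
    have "open (W \<inter> p -` V)" by (rule continuous_open_preimage[OF pc W M.chart(1)[OF V(1)]])
    then have "open (U \<inter> (W \<inter> p -` V))" by (rule open_Int[OF N.chart(1)[OF U(1)]])
    then have B: "open B" unfolding B_def by (simp add: Int_assoc)
    have BU: "B \<subseteq> U" by (auto simp: B_def)
    have "smooth_on (\<phi> ` (U \<inter> W \<inter> p -` V)) (\<psi> \<circ> p \<circ> inv_into U \<phi>)"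
      by (rule smooth_map_onD(2)[OF p U(1) V(1)])
    then have s: "smooth_on (\<phi> ` B) (\<psi> \<circ> p \<circ> inv_into U \<phi>)" by (simp add: B_def)
    have oB: "open (\<phi> ` B)" by (rule N.chart_open_image[OF U(1) B BU])
    have "smooth_on (\<phi> ` B) (\<lambda>x. (f \<circ> inv_into V \<psi>) ((\<psi> \<circ> p \<circ> inv_into U \<phi>) x))"
    proof (rule M.smooth_on_compose[OF oB M.open_chart_image[OF W'(1) V(1)] _ s M.smooth_fun_onD[OF f V(1)]])
      show "(\<psi> \<circ> p \<circ> inv_into U \<phi>) ` \<phi> ` B \<subseteq> \<psi> ` (V \<inter> W')"
        using N.chart(4)[OF U(1)] W'(2) by (auto simp: B_def)
    qed
    moreover have "(f \<circ> inv_into V \<psi>) ((\<psi> \<circ> p \<circ> inv_into U \<phi>) x) = ((\<lambda>z. f (p z)) \<circ> inv_into U \<phi>) x"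
      if "x \<in> \<phi> ` B" for x
      using that N.chart(4)[OF U(1)] M.chart(4)[OF V(1)] by (auto simp: B_def)
    ultimately have "smooth_on (\<phi> ` B) ((\<lambda>z. f (p z)) \<circ> inv_into U \<phi>)"
      by (subst (asm) smooth_on_cong[OF oB])
    then have "smooth_fun_on N B (\<lambda>z. f (p z))" by (rule N.smooth_fun_on_chartI[OF U(1) B BU])
    then show "\<exists>V. open V \<and> z \<in> V \<and> smooth_fun_on N V (\<lambda>z. f (p z))"
      using B z U(2) V(2) by (intro exI[of _ B]) (simp add: B_def)
  qed
qed

section \<open>Pull-back of functions, bundles and sections under a local diffeomorphism\<close>

locale local_diffeo = M: manifold b n M + N: manifold b n N
  for b :: "nat \<Rightarrow> 'e::real_inner" and n :: nat
    and M :: "('m::{t2_space, second_countable_topology}, 'e) atlas"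
    and N :: "('n::{t2_space, second_countable_topology}, 'e) atlas" +
  fixes p :: "'n \<Rightarrow> 'm" and F :: "('m, 'f::real_vector) vector_bundle"
  assumes local_diffeomorphism: "local_diffeomorphism N M p" and vector_bundle: "is_vector_bundle M F"
begin

sublocale F: smooth_bundle b n M F by unfold_locales (rule vector_bundle)

lemma local_inverse:
  obtains W g where "z \<in> W" "open W" "open (p ` W)" "homeomorphism W (p ` W) p g"
    "smooth_map_on N M W p" "smooth_map_on M N (p ` W) g"
  using spec[OF local_diffeomorphism[unfolded local_diffeomorphism_def], of z] by (elim exE conjE)

lemma continuous_p: "continuous_on UNIV p"
proof (rule continuous_at_imp_continuous_on, rule ballI)
  fix z
  obtain W g where W: "z \<in> W" "open W" "homeomorphism W (p ` W) p g" by (rule local_inverse)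
  have "continuous_on W p" using W(3) by (simp add: homeomorphism_def)
  then show "isCont p z" using W(1,2) by (simp add: continuous_on_eq_continuous_at)
qed

lemma open_vimage_p: "open V \<Longrightarrow> open (p -` V)"
  using continuous_p by (rule open_vimage[rotated])

lemma smooth_fun_on_p:
  assumes "open V" "smooth_fun_on M V f" shows "smooth_fun_on N (p -` V) (\<lambda>z. f (p z))"
proof (rule N.smooth_fun_on_local[OF open_vimage_p[OF assms(1)]])
  fix z assume z: "z \<in> p -` V"
  obtain W g where W: "z \<in> W" "open W" "smooth_map_on N M W p" by (rule local_inverse)
  have o: "open (W \<inter> p -` V)" using W(2) open_vimage_p[OF assms(1)] by (rule open_Int)
  have "smooth_map_on N M (W \<inter> p -` V) p" using W(3) by (rule smooth_map_on_subset) auto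
  then have "smooth_fun_on N (W \<inter> p -` V) (\<lambda>z. f (p z))"
    by (rule smooth_fun_on_pullback[OF M.manifold_axioms N.manifold_axioms o _ assms(1) _ assms(2)]) auto
  then show "\<exists>B. open B \<and> z \<in> B \<and> smooth_fun_on N B (\<lambda>z. f (p z))"
    using o W(1) z by blast
qed

lemma C_inf_p: "f \<in> C_inf M \<Longrightarrow> (\<lambda>z. f (p z)) \<in> C_inf N"
  using smooth_fun_on_p[of UNIV f] by (simp add: C_inf_def)

lemma pullback_bundle_simps [simp]:
  "fibre (pullback_bundle p F) z = fibre F (p z)" "bundle_rank (pullback_bundle p F) = bundle_rank F"
  "local_frames (pullback_bundle p F) = (\<lambda>(U, e). (p -` U, \<lambda>i. e i \<circ> p)) ` local_frames F"
  by (simp_all add: pullback_bundle_def)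

lemma pullback_frame:
  assumes "(V, e) \<in> local_frames (pullback_bundle p F)"
  obtains U e' where "(U, e') \<in> local_frames F" "V = p -` U" "e = (\<lambda>i. e' i \<circ> p)"
  using assms by auto

lemma pullback_vector_bundle: "is_vector_bundle N (pullback_bundle p F)"
proof (rule is_vector_bundleI)
  show "subspace (fibre (pullback_bundle p F) z)" for z by (simp add: F.subspace_fibre)
  show "\<exists>(U, e)\<in>local_frames (pullback_bundle p F). z \<in> U" for z
  proof -
    obtain U e where "(U, e) \<in> local_frames F" "p z \<in> U" by (rule F.frame_cover)
    then show ?thesis by force
  qed
next
  fix V e assume "(V, e) \<in> local_frames (pullback_bundle p F)"
  then obtain U e' where U: "(U, e') \<in> local_frames F" "V = p -` U" "e = (\<lambda>i. e' i \<circ> p)"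
    by (rule pullback_frame)
  show "open V" unfolding U(2) by (rule open_vimage_p[OF F.frame_open[OF U(1)]])
  show "inj_on (\<lambda>i. e i x) {..<bundle_rank (pullback_bundle p F)} \<and>
      independent ((\<lambda>i. e i x) ` {..<bundle_rank (pullback_bundle p F)}) \<and>
      span ((\<lambda>i. e i x) ` {..<bundle_rank (pullback_bundle p F)}) = fibre (pullback_bundle p F) x" if "x \<in> V" for x
    using F.frame_basis[OF U(1)] that by (simp add: U(2,3))
  fix V' f assume "(V', f) \<in> local_frames (pullback_bundle p F)"
  then obtain U' f' where U': "(U', f') \<in> local_frames F" "V' = p -` U'" "f = (\<lambda>i. f' i \<circ> p)"
    by (rule pullback_frame)
  obtain g where g: "\<And>i j. i < bundle_rank F \<Longrightarrow> j < bundle_rank F \<Longrightarrow> smooth_fun_on M (U \<inter> U') (g i j)"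
    "\<And>x i. x \<in> U \<inter> U' \<Longrightarrow> i < bundle_rank F \<Longrightarrow> f' i x = (\<Sum>j<bundle_rank F. g i j x *\<^sub>R e' j x)"
    by (rule F.frame_transition[OF U(1) U'(1)]) blast
  have o: "open (U \<inter> U')" using F.frame_open[OF U(1)] F.frame_open[OF U'(1)] by (rule open_Int)
  have "smooth_fun_on N (p -` U \<inter> p -` U') (\<lambda>z. g i j (p z))" if "i < bundle_rank F" "j < bundle_rank F" for i j
    using smooth_fun_on_p[OF o g(1)[OF that]] by simp
  then show "\<exists>g. (\<forall>i<bundle_rank (pullback_bundle p F). \<forall>j<bundle_rank (pullback_bundle p F).
        smooth_fun_on N (V \<inter> V') (g i j)) \<and>
      (\<forall>x\<in>V \<inter> V'. \<forall>i<bundle_rank (pullback_bundle p F).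
        f i x = (\<Sum>j<bundle_rank (pullback_bundle p F). g i j x *\<^sub>R e j x))"
    unfolding U(2,3) U'(2,3) pullback_bundle_simps
    by (intro exI[of _ "\<lambda>i j z. g i j (p z)"]) (simp add: g(2))
qed

sublocale PF: smooth_bundle b n N "pullback_bundle p F"
  by unfold_locales (rule pullback_vector_bundle)

lemma pullback_section:
  assumes "\<mu> \<in> sections M F" shows "\<mu> \<circ> p \<in> sections N (pullback_bundle p F)"
proof (rule PF.sectionI)
  show "(\<mu> \<circ> p) z \<in> fibre (pullback_bundle p F) z" for z by (simp add: F.section_fibre[OF assms])
  fix V e assume "(V, e) \<in> local_frames (pullback_bundle p F)"
  then obtain U e' where U: "(U, e') \<in> local_frames F" "V = p -` U" "e = (\<lambda>i. e' i \<circ> p)"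
    by (rule pullback_frame)
  obtain c where c: "\<And>i. i < bundle_rank F \<Longrightarrow> smooth_fun_on M U (c i)"
    "\<And>x. x \<in> U \<Longrightarrow> \<mu> x = (\<Sum>i<bundle_rank F. c i x *\<^sub>R e' i x)"
    by (rule F.section_coeff[OF assms U(1)]) blast
  then show "\<exists>c. (\<forall>i<bundle_rank (pullback_bundle p F). smooth_fun_on N V (c i)) \<and>
      (\<forall>x\<in>V. (\<mu> \<circ> p) x = (\<Sum>i<bundle_rank (pullback_bundle p F). c i x *\<^sub>R e i x))"
    unfolding U(2,3) using smooth_fun_on_p[OF F.frame_open[OF U(1)] c(1)]
    by (intro exI[of _ "\<lambda>i z. c i (p z)"]) simp
qed

end

text \<open>Near a point \<open>z\<close> of the covering, functions and sections descend to the base after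
  multiplication by a cut-off function.\<close>

locale patch = local_diffeo b n M N p F
  for b :: "nat \<Rightarrow> 'e::real_inner" and n :: nat
    and M :: "('m::{t2_space, second_countable_topology}, 'e) atlas"
    and N :: "('n::{t2_space, second_countable_topology}, 'e) atlas"
    and p :: "'n \<Rightarrow> 'm" and F :: "('m, 'f::real_vector) vector_bundle" +
  fixes z :: 'n and W :: "'n set" and g :: "'m \<Rightarrow> 'n" and V C :: "'m set" and \<kappa> :: "'m \<Rightarrow> real"
  assumes W: "z \<in> W" "open W" "open (p ` W)" "homeomorphism W (p ` W) p g" "smooth_map_on M N (p ` W) g"
    and V: "open V" "p z \<in> V" "V \<subseteq> C" "closed C" "C \<subseteq> p ` W"
    and \<kappa>: "\<kappa> \<in> C_inf M" "\<And>x. x \<in> V \<Longrightarrow> \<kappa> x = 1" "\<And>x. x \<notin> C \<Longrightarrow> \<kappa> x = 0"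
begin

lemma gp: "w \<in> W \<Longrightarrow> g (p w) = w" and pg: "y \<in> p ` W \<Longrightarrow> p (g y) = y" and gW: "y \<in> p ` W \<Longrightarrow> g y \<in> W"
  using W(4) by (auto simp: homeomorphism_def)

definition down :: "('n \<Rightarrow> 'f) \<Rightarrow> 'm \<Rightarrow> 'f" where
  "down \<mu> = (\<lambda>y. if y \<in> p ` W then \<kappa> y *\<^sub>R \<mu> (g y) else 0)"

definition down_fun :: "('n \<Rightarrow> real) \<Rightarrow> 'm \<Rightarrow> real" where
  "down_fun f = (\<lambda>y. if y \<in> p ` W then \<kappa> y * f (g y) else 0)"

definition nbhd :: "'n set" where "nbhd = W \<inter> p -` V"

lemma nbhd: "open nbhd" "z \<in> nbhd"
  using W(1,2) V(1,2) open_vimage_p by (auto simp: nbhd_def)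

lemma down_near: "w \<in> nbhd \<Longrightarrow> down \<mu> (p w) = \<mu> w" "w \<in> nbhd \<Longrightarrow> down_fun f (p w) = f w"
  using gp \<kappa>(2) by (auto simp: down_def down_fun_def nbhd_def)

lemma down_pullback: "y \<in> V \<Longrightarrow> down (\<mu> \<circ> p) y = \<mu> y" "y \<in> V \<Longrightarrow> down_fun (\<lambda>z. f (p z)) y = f y"
  using V(3,5) \<kappa>(2) pg by (auto simp: down_def down_fun_def)

lemma smooth_fun_on_g:
  assumes "smooth_fun_on N V' f" "open V'" "open B" "B \<subseteq> p ` W" "g ` B \<subseteq> V'"
  shows "smooth_fun_on M B (\<lambda>y. f (g y))"
proof (rule smooth_fun_on_pullback[OF N.manifold_axioms M.manifold_axioms assms(3) _ assms(2,5,1)])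
  show "smooth_map_on M N B g" by (rule smooth_map_on_subset[OF W(5) assms(4)])
qed

lemma down_fun_C_inf: assumes "f \<in> C_inf N" shows "down_fun f \<in> C_inf M"
proof -
  have "smooth_fun_on M (p ` W) (\<lambda>y. f (g y))"
    by (rule smooth_fun_on_g[of UNIV]) (use assms W(3) in \<open>auto simp: C_inf_def\<close>)
  from M.C_inf_extend[OF W(3) V(4,5) \<kappa>(1,3) this] show ?thesis unfolding down_fun_def .
qed

lemma down_section:
  assumes "\<mu> \<in> sections N (pullback_bundle p F)" shows "down \<mu> \<in> sections M F"
proof (rule F.sectionI)
  have "\<mu> (g y) \<in> fibre F y" if "y \<in> p ` W" for y
    using PF.section_fibre[OF assms, of "g y"] pg[OF that] by simp
  then show "down \<mu> y \<in> fibre F y" for y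
    using subspace_scale[OF F.subspace_fibre] subspace_0[OF F.subspace_fibre] by (simp add: down_def)
  fix U e assume f: "(U, e) \<in> local_frames F"
  have f': "(p -` U, \<lambda>i. e i \<circ> p) \<in> local_frames (pullback_bundle p F)" using f by force
  obtain c where c: "\<And>i. i < bundle_rank F \<Longrightarrow> smooth_fun_on N (p -` U) (c i)"
    "\<And>x. x \<in> p -` U \<Longrightarrow> \<mu> x = (\<Sum>i<bundle_rank F. c i x *\<^sub>R (e i \<circ> p) x)"
    by (rule PF.section_coeff[OF assms f', unfolded pullback_bundle_simps]) blast
  let ?c = "\<lambda>i y. if y \<in> p ` W then \<kappa> y * c i (g y) else 0"
  have "smooth_fun_on M U (?c i)" if i: "i < bundle_rank F" for i
  proof (rule M.smooth_fun_on_local[OF F.frame_open[OF f]])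
    fix y assume y: "y \<in> U"
    show "\<exists>B. open B \<and> y \<in> B \<and> smooth_fun_on M B (?c i)"
    proof (cases "y \<in> p ` W")
      case True
      have o: "open (U \<inter> p ` W)" using F.frame_open[OF f] W(3) by (rule open_Int)
      have "smooth_fun_on M (U \<inter> p ` W) (\<lambda>y. c i (g y))"
        by (rule smooth_fun_on_g[OF c(1)[OF i] open_vimage_p[OF F.frame_open[OF f]] o]) (auto simp: gp)
      from M.smooth_fun_on_mult[OF o M.C_inf_smooth_on[OF \<kappa>(1)] this]
      have "smooth_fun_on M (U \<inter> p ` W) (?c i)"
        by (subst M.smooth_fun_on_cong[OF o, of _ "\<lambda>y. \<kappa> y * c i (g y)"]) auto
      then show ?thesis using o y True by blast
    next
      case False
      have "smooth_fun_on M (- C) (?c i)"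
        using V(4) \<kappa>(3) by (subst M.smooth_fun_on_cong[where g = "\<lambda>_. 0"]) (auto intro: M.smooth_fun_on_const)
      then show ?thesis using False V(4,5) by blast
    qed
  qed
  moreover have "down \<mu> y = (\<Sum>i<bundle_rank F. ?c i y *\<^sub>R e i y)" if y: "y \<in> U" for y
    using c(2)[of "g y"] pg[of y] y by (simp add: down_def scaleR_sum_right)
  ultimately show "\<exists>c. (\<forall>i<bundle_rank F. smooth_fun_on M U (c i)) \<and>
      (\<forall>y\<in>U. down \<mu> y = (\<Sum>i<bundle_rank F. c i y *\<^sub>R e i y))" by (intro exI[of _ ?c]) simp
qed

text \<open>The inverse of \<open>push_forward\<close> at \<open>z\<close>. Locality of derivations
  makes the effect of the cut-off invisible.\<close>

definition up :: "(('m \<Rightarrow> real) \<Rightarrow> real) \<Rightarrow> ('n \<Rightarrow> real) \<Rightarrow> real" where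
  "up X = (\<lambda>f. if f \<in> C_inf N then X (down_fun f) else 0)"

lemma up_tangent:
  assumes X: "X \<in> tangent_space M (p z)" shows "up X \<in> tangent_space N z"
proof -
  have at: "down_fun f (p z) = f z" for f by (rule down_near(2)[OF nbhd(2)])
  have mult: "X (down_fun (\<lambda>y. f y * h y)) = X (down_fun f) * h z + f z * X (down_fun h)"
    if f: "f \<in> C_inf N" and h: "h \<in> C_inf N" for f h
  proof -
    have "X (down_fun (\<lambda>y. f y * h y)) = X (\<lambda>y. down_fun f y * down_fun h y)"
      by (rule M.tangent_local[OF X down_fun_C_inf[OF N.C_inf_mult[OF f h]]
            M.C_inf_mult[OF down_fun_C_inf[OF f] down_fun_C_inf[OF h]] V(1,2)])
        (auto simp: down_fun_def \<kappa>(2))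
    then show ?thesis using M.tangent_spaceD(3)[OF X down_fun_C_inf[OF f] down_fun_C_inf[OF h]] by (simp add: at)
  qed
  have add: "X (down_fun (\<lambda>y. f y + h y)) = X (down_fun f) + X (down_fun h)"
    if f: "f \<in> C_inf N" and h: "h \<in> C_inf N" for f h
  proof -
    have "down_fun (\<lambda>y. f y + h y) = (\<lambda>y. down_fun f y + down_fun h y)" by (auto simp: down_fun_def distrib_left)
    then show ?thesis using M.tangent_spaceD(1)[OF X down_fun_C_inf[OF f] down_fun_C_inf[OF h]] by simp
  qed
  have scale: "X (down_fun (\<lambda>y. a * f y)) = a * X (down_fun f)" if f: "f \<in> C_inf N" for a f
  proof -
    have "down_fun (\<lambda>y. a * f y) = (\<lambda>y. a * down_fun f y)" by (auto simp: down_fun_def)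
    then show ?thesis using M.tangent_spaceD(2)[OF X down_fun_C_inf[OF f]] by simp
  qed
  show ?thesis
    unfolding tangent_space_def up_def
    by (simp add: N.C_inf_add N.C_inf_cmult N.C_inf_mult add scale mult)
qed

lemma push_forward_up:
  assumes X: "X \<in> tangent_space M (p z)" shows "push_forward M p (up X) = X"
proof
  fix f show "push_forward M p (up X) f = X f"
  proof (cases "f \<in> C_inf M")
    case True
    have "X (down_fun (\<lambda>z. f (p z))) = X f"
      by (rule M.tangent_local[OF X down_fun_C_inf[OF C_inf_p[OF True]] True V(1,2) down_pullback(2)])
    then show ?thesis using True C_inf_p[OF True] by (simp add: push_forward_def up_def o_def)
  next
    case False
    then show ?thesis using X by (simp add: push_forward_def tangent_space_def)
  qed
qed

text \<open>Near \<open>z\<close> every function is the pull-back of its descended version, so a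
  tangent vector is determined by its push-forward. This settles the unique choice in
  \<open>pullback_anchor\<close>.\<close>

lemma push_forward_inject:
  assumes Z: "Z \<in> tangent_space N z" and "push_forward M p Z = X" shows "Z = up X"
proof
  fix f show "Z f = up X f"
  proof (cases "f \<in> C_inf N")
    case True
    have "Z f = Z (\<lambda>w. down_fun f (p w))"
      by (rule N.tangent_local[OF Z True C_inf_p[OF down_fun_C_inf[OF True]] nbhd])
        (rule down_near(2)[symmetric])
    also have "\<dots> = push_forward M p Z (down_fun f)"
      using down_fun_C_inf[OF True] by (simp add: push_forward_def o_def)
    finally show ?thesis using assms(2) True by (simp add: up_def)
  next
    case False
    then show ?thesis using Z by (simp add: up_def tangent_space_def)
  qed
qed

definition up_op :: "(('m \<Rightarrow> 'f) \<Rightarrow> 'f) \<Rightarrow> ('n \<Rightarrow> 'f) \<Rightarrow> 'f" where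
  "up_op D = (\<lambda>\<mu>. if \<mu> \<in> sections N (pullback_bundle p F) then D (down \<mu>) else 0)"

lemma up_op:
  assumes "cdo b n M F (p z) D X"
  shows "up_op D \<in> CDO N (pullback_bundle p F) z" "has_symbol N (pullback_bundle p F) z (up_op D) (up X)"
    "\<And>\<mu>. \<mu> \<in> sections M F \<Longrightarrow> up_op D (\<mu> \<circ> p) = D \<mu>"
proof -
  interpret D: cdo b n M F "p z" D X by (rule assms)
  have leibniz: "D (down (\<lambda>y. f y *\<^sub>R \<mu> y)) = X (down_fun f) *\<^sub>R \<mu> z + f z *\<^sub>R D (down \<mu>)"
    if f: "f \<in> C_inf N" and \<mu>: "\<mu> \<in> sections N (pullback_bundle p F)" for f \<mu>
  proof -
    have "D (down (\<lambda>y. f y *\<^sub>R \<mu> y)) = D (\<lambda>y. down_fun f y *\<^sub>R down \<mu> y)"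
      by (rule D.D_local[OF down_section[OF PF.section_scale[OF f \<mu>]]
            F.section_scale[OF down_fun_C_inf[OF f] down_section[OF \<mu>]] V(1,2)])
        (auto simp: down_fun_def down_def \<kappa>(2))
    then show ?thesis
      using D.leibniz[OF down_fun_C_inf[OF f] down_section[OF \<mu>]] by (simp add: down_near[OF nbhd(2)])
  qed
  have add: "D (down (\<lambda>y. \<mu> y + \<nu> y)) = D (down \<mu>) + D (down \<nu>)"
    if \<mu>: "\<mu> \<in> sections N (pullback_bundle p F)" and \<nu>: "\<nu> \<in> sections N (pullback_bundle p F)" for \<mu> \<nu>
  proof -
    have "down (\<lambda>y. \<mu> y + \<nu> y) = (\<lambda>y. down \<mu> y + down \<nu> y)" by (auto simp: down_def scaleR_add_right)
    then show ?thesis using D.D_add[OF down_section[OF \<mu>] down_section[OF \<nu>]] by simp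
  qed
  have scale: "D (down (\<lambda>y. a *\<^sub>R \<mu> y)) = a *\<^sub>R D (down \<mu>)"
    if \<mu>: "\<mu> \<in> sections N (pullback_bundle p F)" for a \<mu>
  proof -
    have "down (\<lambda>y. a *\<^sub>R \<mu> y) = (\<lambda>y. a *\<^sub>R down \<mu> y)" by (auto simp: down_def)
    then show ?thesis using D.D_scale[OF down_section[OF \<mu>]] by simp
  qed
  show sym: "has_symbol N (pullback_bundle p F) z (up_op D) (up X)"
    unfolding has_symbol_def
    using up_tangent[OF D.X] leibniz by (simp add: up_op_def PF.section_scale) (simp add: up_def)
  show "up_op D \<in> CDO N (pullback_bundle p F) z"
    unfolding CDO_def mem_Collect_eq
  proof (intro conjI)
    show "\<exists>X. has_symbol N (pullback_bundle p F) z (up_op D) X" using sym by blast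
  qed (use D.D_fibre[OF down_section] add scale in
      \<open>simp_all add: up_op_def PF.section_add PF.section_cmult\<close>)
  show "up_op D (\<mu> \<circ> p) = D \<mu>" if \<mu>: "\<mu> \<in> sections M F" for \<mu>
    using D.D_local[OF down_section[OF pullback_section[OF \<mu>]] \<mu> V(1,2) down_pullback(1)] pullback_section[OF \<mu>]
    by (simp add: up_op_def)
qed

text \<open>Near \<open>z\<close> every section is a pull-back, and operators are local, so the
  values on pull-back sections determine the operator.\<close>

lemma up_op_unique:
  assumes D': "cdo b n N (pullback_bundle p F) z D' X'" and ext: "\<And>\<mu>. \<mu> \<in> sections M F \<Longrightarrow> D' (\<mu> \<circ> p) = D \<mu>"
  shows "D' = up_op D"
proof
  interpret D': cdo b n N "pullback_bundle p F" z D' X' by (rule D')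
  fix \<mu> show "D' \<mu> = up_op D \<mu>"
  proof (cases "\<mu> \<in> sections N (pullback_bundle p F)")
    case True
    have "D' \<mu> = D' (down \<mu> \<circ> p)"
      by (rule D'.D_local[OF True pullback_section[OF down_section[OF True]] nbhd]) (simp add: down_near)
    then show ?thesis using ext[OF down_section[OF True]] True by (simp add: up_op_def)
  next
    case False
    then show ?thesis using D'.D by (simp add: up_op_def CDO_def)
  qed
qed

end

lemma (in local_diffeo) patch_exists: "\<exists>W g V C \<kappa>. patch b n M N p F z W g V C \<kappa>"
proof -
  obtain W g where W: "z \<in> W" "open W" "open (p ` W)" "homeomorphism W (p ` W) p g" "smooth_map_on M N (p ` W) g"
    by (rule local_inverse)
  obtain V C and \<kappa> :: "'m \<Rightarrow> real" where "open V" "p z \<in> V" "V \<subseteq> C" "closed C" "C \<subseteq> p ` W" "\<kappa> \<in> C_inf M"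
    "\<And>x. x \<in> V \<Longrightarrow> \<kappa> x = 1" "\<And>x. x \<notin> C \<Longrightarrow> \<kappa> x = 0"
    by (rule M.coordinate_ball[OF W(3) imageI[OF W(1)]]) blast
  then have "patch b n M N p F z W g V C \<kappa>" using W by unfold_locales
  then show ?thesis by (intro exI)
qed

section \<open>The kernels of localization and pull-back\<close>

locale covered_representation = algebroid_representation b n M A F L + local_diffeo b n M N p F
  for b :: "nat \<Rightarrow> 'e::real_inner" and n :: nat
    and M :: "('m::{t2_space, second_countable_topology}, 'e) atlas"
    and A :: "('m, 'a::real_vector) lie_algebroid" and F :: "('m, 'f::real_vector) vector_bundle"
    and L :: "'m \<Rightarrow> 'a \<Rightarrow> ('m \<Rightarrow> 'f) \<Rightarrow> 'f"
    and N :: "('n::{t2_space, second_countable_topology}, 'e) atlas" and p :: "'n \<Rightarrow> 'm" +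
  assumes simply_connected: "simply_connected (UNIV :: 'n set)" and surj: "surj p"
begin

abbreviation "PL \<equiv> pullback_representation N M p A F L"

text \<open>Existence and uniqueness in a patch evaluate the definite descriptions for the anchor
  and for the representation; from here on only these properties of \<open>PL\<close> are
  used.\<close>

lemma pullback_representation:
  assumes a: "a \<in> fibre A (p z)"
  shows "PL z a \<in> CDO N (pullback_bundle p F) z"
    "has_symbol N (pullback_bundle p F) z (PL z a) (pullback_anchor N M p A z a)"
    "\<mu> \<in> sections M F \<Longrightarrow> PL z a (\<mu> \<circ> p) = L (p z) a \<mu>"
    "anchor A (p z) a = (\<lambda>f. 0) \<Longrightarrow> pullback_anchor N M p A z a = (\<lambda>f. 0)"
proof -
  obtain W g V C \<kappa> where "patch b n M N p F z W g V C \<kappa>" using patch_exists by blast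
  then interpret P: patch b n M N p F z W g V C \<kappa> .
  note X = anchor_tangent[OF a]
  have anchor: "pullback_anchor N M p A z a = P.up (anchor A (p z) a)"
    unfolding pullback_anchor_def
    by (rule the_equality) (use P.up_tangent[OF X] P.push_forward_up[OF X] P.push_forward_inject in blast)+
  let ?P = "\<lambda>D. D \<in> CDO N (pullback_bundle p F) z \<and>
     has_symbol N (pullback_bundle p F) z D (pullback_anchor N M p A z a) \<and>
     (\<forall>\<mu>\<in>sections M F. D (\<mu> \<circ> p) = L (p z) a \<mu>)"
  have ex: "?P (P.up_op (L (p z) a))" unfolding anchor using P.up_op[OF cdo_L[OF a]] by simp
  have uniq: "D = P.up_op (L (p z) a)" if "?P D" for D
  proof (rule P.up_op_unique)
    show "cdo b n N (pullback_bundle p F) z D (pullback_anchor N M p A z a)"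
      by unfold_locales (use that in auto)
  qed (use that in simp)
  have "PL z a = P.up_op (L (p z) a)"
    unfolding pullback_representation_def
  proof (rule the_equality)
    show "?P (P.up_op (L (p z) a))" by (rule ex)
    show "D = P.up_op (L (p z) a)" if "?P D" for D by (rule uniq[OF that])
  qed
  with ex show "PL z a \<in> CDO N (pullback_bundle p F) z"
    "has_symbol N (pullback_bundle p F) z (PL z a) (pullback_anchor N M p A z a)"
    "\<mu> \<in> sections M F \<Longrightarrow> PL z a (\<mu> \<circ> p) = L (p z) a \<mu>" by simp_all
  show "pullback_anchor N M p A z a = (\<lambda>f. 0)" if "anchor A (p z) a = (\<lambda>f. 0)"
    unfolding anchor that P.up_def by simp
qed

lemma cdo_PL: "a \<in> fibre A (p z) \<Longrightarrow> cdo b n N (pullback_bundle p F) z (PL z a) (pullback_anchor N M p A z a)"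
  by unfold_locales (use pullback_representation in auto)

definition pullback_primitive :: "('m \<Rightarrow> 'a \<Rightarrow> 'f) \<Rightarrow> ('n \<Rightarrow> 'f) \<Rightarrow> bool" where
  "pullback_primitive \<Omega> \<mu> \<longleftrightarrow> \<mu> \<in> sections N (pullback_bundle p F) \<and>
     (\<forall>z. \<forall>a\<in>fibre A (p z). PL z a \<mu> = \<Omega> (p z) a)"

text \<open>Over an element of the adjoint fibre the operator \<open>PL z a\<close> has zero symbol,
  so \<open>\<mu>\<close> may be replaced by the pull-back of any section with the same value at
  \<open>z\<close>.\<close>

lemma fibre_primitive_of_pullback_primitive:
  assumes "pullback_primitive \<Omega> \<mu>" shows "fibre_primitive \<Omega> (p z) (\<mu> z)"
proof -
  have \<mu>: "\<mu> \<in> sections N (pullback_bundle p F)" using assms by (simp add: pullback_primitive_def)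
  have "L (p z) a \<nu> = \<Omega> (p z) a" if a: "a \<in> adjoint_fibre A (p z)" and \<nu>: "\<nu> \<in> sections M F" "\<nu> (p z) = \<mu> z" for a \<nu>
  proof -
    have a': "a \<in> fibre A (p z)" "anchor A (p z) a = (\<lambda>f. 0)" using a by (auto simp: adjoint_fibre_def)
    have "PL z a \<mu> = PL z a (\<nu> \<circ> p)"
      by (rule cdo.D_tensorial[OF cdo_PL[OF a'(1)] pullback_representation(4)[OF a'] \<mu> pullback_section[OF \<nu>(1)]])
        (simp add: \<nu>(2))
    then show ?thesis using pullback_representation(3)[OF a'(1) \<nu>(1)] assms a'(1)
      by (simp add: pullback_primitive_def)
  qed
  then show ?thesis using PF.section_fibre[OF \<mu>, of z] by (simp add: fibre_primitive_def)
qed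

lemma solves_subset: "solves \<Omega> V \<mu> \<Longrightarrow> V' \<subseteq> V \<Longrightarrow> solves \<Omega> V' \<mu>"
  unfolding solves_def by blast

lemma locally_path_connected:
  assumes "open V" "z \<in> V" shows "\<exists>B. open B \<and> z \<in> B \<and> B \<subseteq> V \<and> path_connected (B :: 'n set)"
proof -
  obtain U \<phi> W \<epsilon> C where W: "(U, \<phi>) \<in> N" "open W" "z \<in> W" "W \<subseteq> U" "\<phi> ` W = ball (\<phi> z) \<epsilon>" "W \<subseteq> C" "C \<subseteq> V"
    by (rule N.coordinate_ball[OF assms]) blast
  have "inv_into U \<phi> ` \<phi> ` W = W" using N.chart(4)[OF W(1)] W(4) by force
  moreover have "path_connected (\<phi> ` W)" by (simp add: W(5) convex_imp_path_connected)
  moreover have "continuous_on (\<phi> ` W) (inv_into U \<phi>)"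
    by (rule continuous_on_subset[OF N.chart(6)[OF W(1)] image_mono[OF W(4)]])
  ultimately have "path_connected W" using path_connected_continuous_image by metis
  then show ?thesis using W(2,3,6,7) by (intro exI[of _ W]) auto
qed

text \<open>A primitive at one point of the base starts the continuation upstairs; the continued
  values form a primitive everywhere.\<close>

lemma pullback_primitive_exists:
  assumes \<Omega>: "\<Omega> \<in> cocycles1 M A F L" and m: "fibre_primitive \<Omega> x m"
  shows "\<exists>\<mu>. pullback_primitive \<Omega> \<mu>"
proof -
  \<comment> \<open>Flat sections upstairs are pull-backs of solutions on the base, so existence and
    coherence are inherited from there.\<close>
  define S where "S V s \<longleftrightarrow> (\<exists>W \<mu>. open W \<and> V = p -` W \<and> s = \<mu> \<circ> p \<and> solves \<Omega> W \<mu>)" for V s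
  have "local_system S (\<lambda>z. fibre_primitive \<Omega> (p z))"
  proof
    show "open V" if "S V s" for V s using that open_vimage_p by (auto simp: S_def)
    show "\<exists>V. z \<in> V \<and> open V \<and> (\<forall>y\<in>V. \<forall>v. fibre_primitive \<Omega> (p y) v \<longrightarrow> (\<exists>s. S V s \<and> s y = v))" for z
    proof -
      obtain W where W: "open W" "p z \<in> W"
        "\<forall>z\<in>W. \<forall>m. fibre_primitive \<Omega> z m \<longrightarrow> (\<exists>\<mu>. solves \<Omega> W \<mu> \<and> \<mu> z = m)"
        using local_existence[OF \<Omega>, of "p z"] by (elim exE conjE)
      have "\<exists>s. S (p -` W) s \<and> s y = v" if "y \<in> p -` W" "fibre_primitive \<Omega> (p y) v" for y v
      proof -
        have "p y \<in> W" using that(1) by simp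
        from mp[OF spec[OF bspec[OF W(3) this]] that(2)]
        obtain \<mu> where "solves \<Omega> W \<mu>" "\<mu> (p y) = v" by (elim exE conjE)
        then show ?thesis unfolding S_def using W(1) by (intro exI[of _ "\<mu> \<circ> p"]) auto
      qed
      then show ?thesis using W(1,2) open_vimage_p by (intro exI[of _ "p -` W"]) auto
    qed
    show "fibre_primitive \<Omega> (p y) (s y)" if "S V s" "y \<in> V" for V s y
      using that solves_fibre_primitive by (auto simp: S_def)
    show "\<exists>B. open B \<and> z \<in> B \<and> B \<subseteq> V \<inter> V' \<and> ((\<forall>y\<in>B. s y = s' y) \<or> (\<forall>y\<in>B. s y \<noteq> s' y))"
      if S: "S V s" "S V' s'" and z: "z \<in> V" "z \<in> V'" for V s V' s' z
    proof -
      obtain W \<mu> where W: "open W" "V = p -` W" "s = \<mu> \<circ> p" "solves \<Omega> W \<mu>"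
        using S(1) unfolding S_def by (elim exE conjE)
      obtain W' \<mu>' where W': "open W'" "V' = p -` W'" "s' = \<mu>' \<circ> p" "solves \<Omega> W' \<mu>'"
        using S(2) unfolding S_def by (elim exE conjE)
      have "open (W \<inter> W')" "p z \<in> W \<inter> W'" using W W' z by auto
      from unique_near[OF this] obtain B where B: "open B" "p z \<in> B" "B \<subseteq> W \<inter> W'"
        "\<forall>\<Omega> \<mu> \<mu>'. solves \<Omega> B \<mu> \<longrightarrow> solves \<Omega> B \<mu>' \<longrightarrow> (\<forall>z0\<in>B. \<mu> z0 = \<mu>' z0 \<longrightarrow> (\<forall>z\<in>B. \<mu> z = \<mu>' z))"
        by (elim exE conjE)
      have "solves \<Omega> B \<mu>" "solves \<Omega> B \<mu>'" using W(4) W'(4) B(3) solves_subset by auto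
      then have "\<forall>z0\<in>B. \<mu> z0 = \<mu>' z0 \<longrightarrow> (\<forall>z\<in>B. \<mu> z = \<mu>' z)" using B(4) by simp
      then have "(\<forall>y\<in>p -` B. s y = s' y) \<or> (\<forall>y\<in>p -` B. s y \<noteq> s' y)" by (auto simp: W(3) W'(3))
      then show ?thesis using B(1-3) open_vimage_p W(2) W'(2) by (intro exI[of _ "p -` B"]) auto
    qed
  qed
  then interpret local_system S "\<lambda>z. fibre_primitive \<Omega> (p z)" .
  obtain z0 where z0: "p z0 = x" using surj by (metis surj_def)
  have "fibre_primitive \<Omega> (p z0) m" using m z0 by simp
  then have "\<exists>g. g z0 = m \<and> (\<forall>z. \<exists>V s B. S V s \<and> open B \<and> z \<in> B \<and> B \<subseteq> V \<and> (\<forall>y\<in>B. g y = s y))"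
    by (intro global_section[OF simply_connected] locally_path_connected)
  then obtain g where g: "\<forall>z. \<exists>V s B. S V s \<and> open B \<and> z \<in> B \<and> B \<subseteq> V \<and> (\<forall>y\<in>B. g y = s y)"
    by (elim exE conjE)
  have loc: "\<exists>W \<mu> B. solves \<Omega> W \<mu> \<and> open B \<and> z \<in> B \<and> B \<subseteq> p -` W \<and> (\<forall>y\<in>B. g y = (\<mu> \<circ> p) y)" for z
    using spec[OF g, of z] unfolding S_def by blast
  have gs: "g \<in> sections N (pullback_bundle p F)"
  proof (rule PF.section_local)
    fix z
    obtain W \<mu> B where B: "solves \<Omega> W \<mu>" "open B" "z \<in> B" "\<forall>y\<in>B. g y = (\<mu> \<circ> p) y"
      using loc[of z] by (elim exE conjE)
    then have "\<mu> \<circ> p \<in> sections N (pullback_bundle p F)" by (intro pullback_section) (simp add: solves_def)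
    then show "\<exists>W t. open W \<and> z \<in> W \<and> t \<in> sections N (pullback_bundle p F) \<and> (\<forall>y\<in>W. g y = t y)"
      using B(2,3,4) by (intro exI[of _ B] exI[of _ "\<mu> \<circ> p"]) simp
  qed
  have "PL z a g = \<Omega> (p z) a" if a: "a \<in> fibre A (p z)" for z a
  proof -
    obtain W \<mu> B where B: "solves \<Omega> W \<mu>" "open B" "z \<in> B" "B \<subseteq> p -` W" "\<forall>y\<in>B. g y = (\<mu> \<circ> p) y"
      using loc[of z] by (elim exE conjE)
    have \<mu>: "\<mu> \<in> sections M F" using B(1) by (simp add: solves_def)
    have "PL z a g = PL z a (\<mu> \<circ> p)"
      by (rule cdo.D_local[OF cdo_PL[OF a] gs pullback_section[OF \<mu>] B(2,3)]) (use B(5) in blast)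
    also have "\<dots> = L (p z) a \<mu>" by (rule pullback_representation(3)[OF a \<mu>])
    also have "\<dots> = \<Omega> (p z) a" using B(1,3,4) a by (auto simp: solves_def)
    finally show ?thesis .
  qed
  then show ?thesis using gs unfolding pullback_primitive_def by blast
qed

subsection \<open>Passage to cohomology\<close>

text \<open>Zero symbol makes the operator independent of the extension of \<open>m\<close>, so the
  definite description has a value.\<close>

lemma adjoint_action_eq:
  assumes a: "a \<in> adjoint_fibre A x" and \<nu>: "\<nu> \<in> sections M F" "\<nu> x = m"
  shows "adjoint_action M F L x a m = L x a \<nu>"
  unfolding adjoint_action_def
proof (rule the_equality)
  show "\<exists>\<mu>\<in>sections M F. \<mu> x = m \<and> L x a \<nu> = L x a \<mu>" using \<nu> by blast
  fix w assume "\<exists>\<mu>\<in>sections M F. \<mu> x = m \<and> w = L x a \<mu>"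
  then obtain \<mu> where \<mu>: "\<mu> \<in> sections M F" "\<mu> x = m" "w = L x a \<mu>" by blast
  have a': "a \<in> fibre A x" "anchor A x a = (\<lambda>f. 0)" using a by (auto simp: adjoint_fibre_def)
  show "w = L x a \<nu>"
    unfolding \<mu>(3) by (rule cdo.D_tensorial[OF cdo_L[OF a'(1)] a'(2) \<mu>(1) \<nu>(1)]) (simp add: \<mu>(2) \<nu>(2))
qed

abbreviation "adjoint_coboundaries x \<equiv>
  lie_coboundaries1 (adjoint_fibre A x) (fibre F x) (adjoint_action M F L x)"

lemma restriction_coboundary_iff:
  "restrict_cochain A x \<Omega> \<in> adjoint_coboundaries x \<longleftrightarrow> (\<exists>m. fibre_primitive \<Omega> x m)"
proof
  assume "restrict_cochain A x \<Omega> \<in> adjoint_coboundaries x"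
  then obtain m where m: "m \<in> fibre F x"
    "restrict_cochain A x \<Omega> = (\<lambda>u. if u \<in> adjoint_fibre A x then adjoint_action M F L x u m else 0)"
    unfolding lie_coboundaries1_def by blast
  have "L x a \<nu> = \<Omega> x a" if "a \<in> adjoint_fibre A x" "\<nu> \<in> sections M F" "\<nu> x = m" for a \<nu>
    using fun_cong[OF m(2), of a] adjoint_action_eq[OF that] that(1) by (simp add: restrict_cochain_def)
  then show "\<exists>m. fibre_primitive \<Omega> x m" using m(1) unfolding fibre_primitive_def by blast
next
  assume "\<exists>m. fibre_primitive \<Omega> x m"
  then obtain m where m: "fibre_primitive \<Omega> x m" ..
  then have mF: "m \<in> fibre F x" by (simp add: fibre_primitive_def)
  obtain \<nu> where \<nu>: "\<nu> \<in> sections M F" "\<nu> x = m" by (rule F.section_through[OF mF])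
  have "restrict_cochain A x \<Omega> = (\<lambda>u. if u \<in> adjoint_fibre A x then adjoint_action M F L x u m else 0)"
    using m \<nu> adjoint_action_eq[OF _ \<nu>] by (auto simp: restrict_cochain_def fibre_primitive_def)
  then show "restrict_cochain A x \<Omega> \<in> adjoint_coboundaries x"
    unfolding lie_coboundaries1_def using mF by blast
qed

abbreviation "pullback_coboundaries \<equiv>
  coboundaries1 N (pullback_algebroid N M p A) (pullback_bundle p F) PL"

lemma fibre_pullback_algebroid [simp]: "fibre (pullback_algebroid N M p A) z = fibre A (p z)"
  by (simp add: pullback_algebroid_def pullback_with_bracket_def pullback_bundle_def
      vector_bundle.extend_def vector_bundle.truncate_def)

text \<open>Equality of cochains is equality of functions on the whole type; off the fibres both
  sides are zero by the normalisation of \<open>\<Omega>\<close>.\<close>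

lemma pullback_coboundary_iff:
  assumes "\<Omega> \<in> cochains1 M A F"
  shows "pullback_cochain p \<Omega> \<in> pullback_coboundaries \<longleftrightarrow> (\<exists>\<mu>. pullback_primitive \<Omega> \<mu>)"
proof
  assume "pullback_cochain p \<Omega> \<in> pullback_coboundaries"
  then obtain \<mu> where \<mu>: "\<mu> \<in> sections N (pullback_bundle p F)"
    "pullback_cochain p \<Omega> = (\<lambda>z a. if a \<in> fibre A (p z) then PL z a \<mu> else 0)"
    unfolding coboundaries1_def fibre_pullback_algebroid by blast
  have "PL z a \<mu> = \<Omega> (p z) a" if "a \<in> fibre A (p z)" for z a
    using fun_cong[OF fun_cong[OF \<mu>(2)], of z a] that by (simp add: pullback_cochain_def)
  then show "\<exists>\<mu>. pullback_primitive \<Omega> \<mu>" using \<mu>(1) unfolding pullback_primitive_def by blast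
next
  assume "\<exists>\<mu>. pullback_primitive \<Omega> \<mu>"
  then obtain \<mu> where \<mu>: "pullback_primitive \<Omega> \<mu>" ..
  then have "pullback_cochain p \<Omega> = (\<lambda>z a. if a \<in> fibre A (p z) then PL z a \<mu> else 0)"
    using cochainD(4)[OF assms] by (auto simp: pullback_cochain_def pullback_primitive_def intro!: ext)
  then show "pullback_cochain p \<Omega> \<in> pullback_coboundaries"
    unfolding coboundaries1_def fibre_pullback_algebroid using \<mu> unfolding pullback_primitive_def by blast
qed

end

text \<open>The maps on cohomology are unions of cosets over representatives, and the kernel asks
  when such a union is the trivial coset \<open>D\<close>. Addition and subtraction are parameters
  because cochains of two different function types occur.\<close>

lemma Union_cosets_eq:
  assumes "z \<in> D" "\<And>w. add z w = w" "\<And>d w. sub (add d w) d = w" "\<And>d w. add (sub d w) w = d"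
    and D: "\<And>d e. d \<in> D \<Longrightarrow> e \<in> D \<Longrightarrow> add d e \<in> D" "\<And>d e. d \<in> D \<Longrightarrow> e \<in> D \<Longrightarrow> sub d e \<in> D"
    and "C \<noteq> {}"
  shows "(\<Union>w\<in>C. \<Union>d\<in>D. {add d w}) = D \<longleftrightarrow> C \<subseteq> D"
proof
  assume eq: "(\<Union>w\<in>C. \<Union>d\<in>D. {add d w}) = D"
  show "C \<subseteq> D"
  proof
    fix w assume "w \<in> C"
    then have "add z w \<in> (\<Union>w\<in>C. \<Union>d\<in>D. {add d w})" using assms(1) by blast
    then show "w \<in> D" using assms(2) eq by simp
  qed
next
  assume C: "C \<subseteq> D"
  show "(\<Union>w\<in>C. \<Union>d\<in>D. {add d w}) = D"
  proof
    show "(\<Union>w\<in>C. \<Union>d\<in>D. {add d w}) \<subseteq> D" using C D(1) by blast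
    show "D \<subseteq> (\<Union>w\<in>C. \<Union>d\<in>D. {add d w})"
    proof
      fix d assume d: "d \<in> D"
      obtain w where w: "w \<in> C" using \<open>C \<noteq> {}\<close> by blast
      then have "sub d w \<in> D" using C D(2) d by blast
      then have "add (sub d w) w \<in> (\<Union>d\<in>D. {add d w})" by blast
      then show "d \<in> (\<Union>w\<in>C. \<Union>d\<in>D. {add d w})" using assms(4) w by auto
    qed
  qed
qed

context covered_representation begin

lemma localization_trivial_iff:
  assumes "c \<noteq> {}"
  shows "localization1 M A F L x c = adjoint_coboundaries x \<longleftrightarrow>
    (\<forall>\<Omega>\<in>c. restrict_cochain A x \<Omega> \<in> adjoint_coboundaries x)"
proof -
  let ?T = "\<lambda>m u. if u \<in> adjoint_fibre A x then adjoint_action M F L x u m else 0"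
  have T: "?T (m + m') = (\<lambda>u. ?T m u + ?T m' u)" "?T (m - m') = (\<lambda>u. ?T m u - ?T m' u)" "?T 0 = (\<lambda>u. 0)"
    if m: "m \<in> fibre F x" and m': "m' \<in> fibre F x" for m m'
  proof -
    obtain \<nu> where \<nu>: "\<nu> \<in> sections M F" "\<nu> x = m" by (rule F.section_through[OF m])
    obtain \<nu>' where \<nu>': "\<nu>' \<in> sections M F" "\<nu>' x = m'" by (rule F.section_through[OF m'])
    have cdo: "cdo b n M F x (L x u) (anchor A x u)" if "u \<in> adjoint_fibre A x" for u
      by (rule cdo_L) (use that in \<open>simp add: adjoint_fibre_def\<close>)
    show "?T (m + m') = (\<lambda>u. ?T m u + ?T m' u)"
      using adjoint_action_eq[OF _ F.section_add[OF \<nu>(1) \<nu>'(1)]] cdo.D_add[OF cdo \<nu>(1) \<nu>'(1)]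
        adjoint_action_eq[OF _ \<nu>] adjoint_action_eq[OF _ \<nu>'] by (auto simp: \<nu>(2) \<nu>'(2))
    show "?T (m - m') = (\<lambda>u. ?T m u - ?T m' u)"
      using adjoint_action_eq[OF _ F.section_diff[OF \<nu>(1) \<nu>'(1)]] cdo.D_diff[OF cdo \<nu>(1) \<nu>'(1)]
        adjoint_action_eq[OF _ \<nu>] adjoint_action_eq[OF _ \<nu>'] by (auto simp: \<nu>(2) \<nu>'(2))
    show "?T 0 = (\<lambda>u. 0)"
      using adjoint_action_eq[OF _ F.section_zero] cdo.D_zero[OF cdo] by auto
  qed
  have 0: "0 \<in> fibre F x" by (rule subspace_0[OF F.subspace_fibre])
  have "(\<Union>w\<in>restrict_cochain A x ` c. \<Union>d\<in>adjoint_coboundaries x. {\<lambda>u. d u + w u}) = adjoint_coboundaries x \<longleftrightarrow>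
      restrict_cochain A x ` c \<subseteq> adjoint_coboundaries x"
  proof (rule Union_cosets_eq[where z = "\<lambda>u. 0" and sub = "\<lambda>d w u. d u - w u"])
    show "(\<lambda>u. 0) \<in> adjoint_coboundaries x"
      unfolding lie_coboundaries1_def by (rule image_eqI[of _ ?T 0, OF T(3)[OF 0 0, symmetric] 0])
    fix d e assume "d \<in> adjoint_coboundaries x" "e \<in> adjoint_coboundaries x"
    then obtain m m' where m: "m \<in> fibre F x" "d = ?T m" "m' \<in> fibre F x" "e = ?T m'"
      unfolding lie_coboundaries1_def by blast
    show "(\<lambda>u. d u + e u) \<in> adjoint_coboundaries x"
      unfolding lie_coboundaries1_def m(2,4)
      by (rule image_eqI[of _ ?T "m + m'", OF T(1)[OF m(1,3), symmetric] subspace_add[OF F.subspace_fibre m(1,3)]])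
    show "(\<lambda>u. d u - e u) \<in> adjoint_coboundaries x"
      unfolding lie_coboundaries1_def m(2,4)
      by (rule image_eqI[of _ ?T "m - m'", OF T(2)[OF m(1,3), symmetric] subspace_diff[OF F.subspace_fibre m(1,3)]])
  qed (use assms in auto)
  then show ?thesis
    by (simp add: localization1_def lie_cohomology_class_def r_coset_def lie_cocycle_group_def image_subset_iff)
qed

lemma pullback_trivial_iff:
  assumes "c \<noteq> {}"
  shows "pullback_cohomology1 N M p A F L c = pullback_coboundaries \<longleftrightarrow>
    (\<forall>\<Omega>\<in>c. pullback_cochain p \<Omega> \<in> pullback_coboundaries)"
proof -
  let ?T = "\<lambda>\<mu> z a. if a \<in> fibre A (p z) then PL z a \<mu> else 0"
  let ?S = "sections N (pullback_bundle p F)"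
  have D: "pullback_coboundaries = ?T ` ?S" by (simp add: coboundaries1_def)
  have T: "?T (\<lambda>z. \<mu> z + \<nu> z) = (\<lambda>z a. ?T \<mu> z a + ?T \<nu> z a)" "?T (\<lambda>z. \<mu> z - \<nu> z) = (\<lambda>z a. ?T \<mu> z a - ?T \<nu> z a)"
    if \<mu>: "\<mu> \<in> ?S" and \<nu>: "\<nu> \<in> ?S" for \<mu> \<nu>
    using cdo.D_add[OF cdo_PL \<mu> \<nu>] cdo.D_diff[OF cdo_PL \<mu> \<nu>] by (auto intro!: ext)
  have T0: "?T (\<lambda>z. 0) = (\<lambda>z a. 0)" using cdo.D_zero[OF cdo_PL] by (auto intro!: ext)
  have "(\<Union>w\<in>pullback_cochain p ` c. \<Union>d\<in>?T ` ?S. {\<lambda>z a. d z a + w z a}) = ?T ` ?S \<longleftrightarrow>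
      pullback_cochain p ` c \<subseteq> ?T ` ?S"
  proof (rule Union_cosets_eq[where z = "\<lambda>z a. 0" and sub = "\<lambda>d w z a. d z a - w z a"])
    show "(\<lambda>z a. 0) \<in> ?T ` ?S" by (rule image_eqI[of _ ?T "\<lambda>z. 0", OF T0[symmetric] PF.section_zero])
    fix d e assume "d \<in> ?T ` ?S" "e \<in> ?T ` ?S"
    then obtain \<mu> \<nu> where m: "\<mu> \<in> ?S" "d = ?T \<mu>" "\<nu> \<in> ?S" "e = ?T \<nu>" by blast
    show "(\<lambda>z a. d z a + e z a) \<in> ?T ` ?S"
      unfolding m(2,4) by (rule image_eqI[of _ ?T "\<lambda>z. \<mu> z + \<nu> z", OF T(1)[OF m(1,3), symmetric] PF.section_add[OF m(1,3)]])
    show "(\<lambda>z a. d z a - e z a) \<in> ?T ` ?S"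
      unfolding m(2,4) by (rule image_eqI[of _ ?T "\<lambda>z. \<mu> z - \<nu> z", OF T(2)[OF m(1,3), symmetric] PF.section_diff[OF m(1,3)]])
  qed (use assms in auto)
  then show ?thesis
    by (simp add: pullback_cohomology1_def cohomology_class_def r_coset_def cocycle_group_def image_subset_iff D)
qed

text \<open>A class is a coset of coboundaries through a cocycle. The sum of the two is rewritten as
  a difference, with the negated section as primitive, so that \<open>cocycle_diff\<close>
  applies.\<close>

lemma cohomology_class_cocycles:
  assumes "c \<in> carrier (cohomology1 M A F L)" shows "c \<noteq> {}" "c \<subseteq> cocycles1 M A F L"
proof -
  obtain \<Omega> where \<Omega>: "\<Omega> \<in> cocycles1 M A F L"
    and c: "c = (\<Union>d\<in>coboundaries1 M A F L. {\<lambda>x a. d x a + \<Omega> x a})"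
    using assms by (auto simp: cohomology1_def FactGroup_def RCOSETS_def r_coset_def cocycle_group_def)
  show "c \<noteq> {}" using F.section_zero by (auto simp: c coboundaries1_eq)
  show "c \<subseteq> cocycles1 M A F L"
  proof
    fix w assume "w \<in> c"
    then obtain \<mu> where \<mu>: "\<mu> \<in> sections M F" "w = (\<lambda>x a. coboundary \<mu> x a + \<Omega> x a)"
      by (auto simp: c coboundaries1_eq)
    let ?\<nu> = "\<lambda>x. 0 - \<mu> x"
    have \<nu>: "?\<nu> \<in> sections M F" by (rule F.section_diff[OF F.section_zero \<mu>(1)])
    have "coboundary ?\<nu> x a = - coboundary \<mu> x a" for x a
      using cdo.D_diff[OF cdo_L F.section_zero \<mu>(1), of a x] cdo.D_zero[OF cdo_L, of a x]
      by (simp add: coboundary_def)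
    then have "w = (\<lambda>x a. \<Omega> x a - coboundary ?\<nu> x a)" by (simp add: \<mu>(2) add.commute)
    then show "w \<in> cocycles1 M A F L" using cocycle_diff[OF \<Omega> coboundary_cocycle[OF \<nu>]] by simp
  qed
qed

text \<open>Either kernel is tested on the representatives of a class, where it becomes the
  existence of a primitive: at \<open>x\<close> on one side, on the whole covering on the other.
  Surjectivity of \<open>p\<close> provides a point over \<open>x\<close> to compare them.\<close>

theorem kernels_eq:
  "kernel (cohomology1 M A F L) (adjoint_cohomology1 M A F L x) (localization1 M A F L x) =
   kernel (cohomology1 M A F L)
     (cohomology1 N (pullback_algebroid N M p A) (pullback_bundle p F) PL) (pullback_cohomology1 N M p A F L)"
proof -
  have "localization1 M A F L x c = adjoint_coboundaries x \<longleftrightarrow>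
      pullback_cohomology1 N M p A F L c = pullback_coboundaries"
    if c: "c \<in> carrier (cohomology1 M A F L)" for c
  proof -
    note c' = cohomology_class_cocycles[OF c]
    have "restrict_cochain A x \<Omega> \<in> adjoint_coboundaries x \<longleftrightarrow> pullback_cochain p \<Omega> \<in> pullback_coboundaries"
      if "\<Omega> \<in> c" for \<Omega>
    proof -
      have \<Omega>: "\<Omega> \<in> cocycles1 M A F L" using that c'(2) by blast
      obtain z where z: "p z = x" using surj by (metis surj_def)
      have "(\<exists>m. fibre_primitive \<Omega> x m) \<longleftrightarrow> (\<exists>\<mu>. pullback_primitive \<Omega> \<mu>)"
        using pullback_primitive_exists[OF \<Omega>] fibre_primitive_of_pullback_primitive[of \<Omega> _ z] z by blast
      then show ?thesis
        unfolding restriction_coboundary_iff pullback_coboundary_iff[OF cocycleD(1)[OF \<Omega>]] .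
    qed
    then show ?thesis unfolding localization_trivial_iff[OF c'(1)] pullback_trivial_iff[OF c'(1)] by blast
  qed
  then show ?thesis
    unfolding kernel_def
    by (auto simp: adjoint_cohomology1_def lie_cohomology1_def cohomology1_def[of N] FactGroup_def)
qed

end

theorem corollary3p5:
  fixes M :: "('m::{t2_space, second_countable_topology}, 'e::real_inner) atlas"
    and A :: "('m, 'a::real_vector) lie_algebroid"
    and F :: "('m, 'f::real_vector) vector_bundle"
    and L :: "'m \<Rightarrow> 'a \<Rightarrow> ('m \<Rightarrow> 'f) \<Rightarrow> 'f"
    and N :: "('n::{t2_space, second_countable_topology}, 'e) atlas"
    and p :: "'n \<Rightarrow> 'm"
    and x :: 'm
  assumes "smooth_manifold M" and "connected (UNIV :: 'm set)"
    and "is_lie_algebroid M A" and "transitive M A"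
    and "is_vector_bundle M F" and "is_representation M A F L"
    and "smooth_manifold N" and "universal_covering N M p"
  shows "kernel (cohomology1 M A F L) (adjoint_cohomology1 M A F L x) (localization1 M A F L x) =
         kernel (cohomology1 M A F L)
           (cohomology1 N (pullback_algebroid N M p A) (pullback_bundle p F)
              (pullback_representation N M p A F L))
           (pullback_cohomology1 N M p A F L)"
proof -
  obtain B :: "'e set" where B: "finite B" "span B = UNIV"
    using assms(1) unfolding smooth_manifold_def by blast
  \<comment> \<open>Both manifolds are modelled on the type \<open>'e\<close>, so one frame serves
    for \<open>M\<close> and \<open>N\<close>.\<close>
  obtain b :: "nat \<Rightarrow> 'e" and n where "orthonormal_frame b n" by (rule orthonormal_frame_exists[OF B])
  then interpret orthonormal_frame b n .
  have "covering_space UNIV p (UNIV :: 'm set)" "local_diffeomorphism N M p" "simply_connected (UNIV :: 'n set)"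
    using assms(8) by (simp_all add: universal_covering_def)
  moreover from this(1) have "surj p" by (rule covering_space_imp_surjective)
  ultimately interpret covered_representation b n M A F L N p
    by unfold_locales (use assms in simp_all)
  show ?thesis by (rule kernels_eq)
qed

end
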